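(* Let $L^{w}_\infty$ and $L^{y}_\infty$ be the fractals generated by a globally blocked $m$-triangular labyrinth patterns system with global path matrix $M$, and let $\theta$ be the largest eigenvalue of $M$. Then the following assertions hold: (a) Between any two distinct points in $L^{w}_\infty$ there is a unique arc $a\subset L^{w}_\infty$ that connects them. (b) The length of the arc $a$ is infinite. (c) $\dim_H(a)=\frac{\log\theta}{\log m}>1$. (d) The set of points of the arc $a$ at which there exists no tangent to the arc is dense in $a$. The analogous assertions hold for the yellow fractal $L^{y}_\infty$.
   Context: **Triangles.** Let $H=\{(\alpha_1,\alpha_2,\alpha_3)\in[0,1]^3:\alpha_1+\alpha_2+\alpha_3=1\}$, $\mathbb N=\{0,1,2,\dots\}$, $\mathbf P_1=(0,0)$, $\mathbf P_2=(1,0)$, $\mathbf P_3=(1/2,\sqrt3/2)$. $\Delta(\mathbf A_1,\mathbf A_2,\mathbf A_3)$ denotes the full closed triangle with (ordered) vertices $\mathbf A_1,\mathbf A_2,\mathbf A_3$, and $T_1=\Delta(\mathbf P_1,\mathbf P_2,\mathbf P_3)$. For $\Delta=\Delta(\mathbf A_1,\mathbf A_2,\mathbf A_3)\subset T_1$ let $P_\Delta:T_1\to T_1$, $\sum\alpha_i\mathbf P_i\mapsto\sum\alpha_i\mathbf A_i$ for $(\alpha_1,\alpha_2,\alpha_3)\in H$. For $m\ge2$ and $(k_1,k_2,k_3)\in\mathbb Z^3$, $T_m(k_1,k_2,k_3)$ is the triangle with ordered vertices $\mathbf A_i=\frac1m\big(k_1\mathbf P_1+k_2\mathbf P_2+k_3\mathbf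 P_3+\mathbf P_i\big)$ and $T'_m(k_1,k_2,k_3)$ is the triangle with ordered vertices $\mathbf A_i=\frac1m\big(k_1\mathbf P_1+k_2\mathbf P_2+k_3\mathbf P_3+\mathbf P_1+\mathbf P_2+\mathbf P_3-\mathbf P_i\big)$, $i=1,2,3$. Put $\mathcal T_m=\{T_m(k_1,k_2,k_3):k_i\in\mathbb N,\ k_1+k_2+k_3=m-1\}$ and $\mathcal T'_m=\{T'_m(k_1,k_2,k_3):k_i\in\mathbb N,\ k_1+k_2+k_3=m-2\}$. $T_m(k_1,k_2,k_3)$ and $T'_m(k'_1,k'_2,k'_3)$ are $j$-neighbours if $k_j=k'_j+1$ and $k_i=k'_i$ for $i\ne j$ (they then share a side). For $i\in\{1,2,3\}$ and $K\in\{0,\dots,m-1\}$, the set of all $T_m(k_1,k_2,k_3)\in\mathcal T_m$ and $T'_m(k_1,k_2,k_3)\in\mathcal T'_m$ with $k_i=K$ is called a strip of type $i$. **Patterns systems.** An $m$-triangular patterns system is a pair $(\mathcal W\cup\mathcal W',\mathcal Y\cup\mathcal Y')$ with $\mathcal W,\mathcal Y\subset\mathcal T_m$ and $\mathcal W',\mathcal Y'\subset\mathcal T'_m$. Put $\mathcal W_1=\mathcal W$, $\mathcal W'_1=\mathcal W'$, $\mathcal Y_1=\mathcal Y$, $\mathcal Y'_1=\mathcal Y'$, and for $n\ge2$ $\mathcal W_n=\{P_{U}(V):U\in\mathcal W_{n-1},V\in\mathcal W_1\}\cup\{P_{U}(V):U\in\mathcal W'_{n-1},V\in\mathcal Y'_1\}$,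 $\mathcal W'_n=\{P_{U}(V):U\in\mathcal W_{n-1},V\in\mathcal W'_1\}\cup\{P_{U}(V):U\in\mathcal W'_{n-1},V\in\mathcal Y_1\}$, $\mathcal Y_n=\{P_{U}(V):U\in\mathcal Y_{n-1},V\in\mathcal Y_1\}\cup\{P_{U}(V):U\in\mathcal Y'_{n-1},V\in\mathcal W'_1\}$, $\mathcal Y'_n=\{P_{U}(V):U\in\mathcal Y_{n-1},V\in\mathcal Y'_1\}\cup\{P_{U}(V):U\in\mathcal Y'_{n-1},V\in\mathcal W_1\}$. $\mathcal G(\mathcal W\cup\mathcal W')$ is the undirected graph with vertex set $\mathcal W\cup\mathcal W'$ in which two vertices are joined by an edge labelled $j$ iff they are $j$-neighbours; $\mathcal G(\mathcal Y\cup\mathcal Y')$ is defined analogously. **Labyrinth patterns systems.** The system is an $m$-triangular labyrinth patterns system if: (1) (tree property) $\mathcal G(\mathcal W\cup\mathcal W')$ and $\mathcal G(\mathcal Y\cup\mathcal Y')$ are trees; (2) (exits property) there is exactly one triple $(k_1,k_2,k_3)$ of integers in $\{0,\dots,m-1\}$ with $T_m(0,k_1,m-1-k_1)\in\mathcal W$, $T_m(0,m-1-k_1,k_1)\in\mathcal Y$, $T_m(k_2,0,m-1-k_2)\in\mathcal W$, $T_m(m-1-k_2,0,k_2)\in\mathcal Y$, $T_m(k_3,m-1-k_3,0)\in\mathcal W$, $T_m(m-1-k_3,k_3,0)\in\mathcal Y$; (3) (corners property) the sets $\mathcal C(\mathcal W)$, $\mathcal C(\mathcal Y)$ of elements of $\mathcal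 W$, resp. $\mathcal Y$, that contain one of $\mathbf P_1,\mathbf P_2,\mathbf P_3$ are disjoint and each has at most one element. The exits of the patterns are $e^w_1=T_m(0,k_1,m-1-k_1)$, $e^w_2=T_m(k_2,0,m-1-k_2)$, $e^w_3=T_m(k_3,m-1-k_3,0)$ and $e^y_1=T_m(0,m-1-k_1,k_1)$, $e^y_2=T_m(m-1-k_2,0,k_2)$, $e^y_3=T_m(m-1-k_3,k_3,0)$. **Fractals.** $L^{w}_n$ (resp. $L^{y}_n$) is the union of all triangles in $\mathcal W_n\cup\mathcal W'_n$ (resp. $\mathcal Y_n\cup\mathcal Y'_n$). The white and yellow triangular labyrinth fractals generated by the system are $L^{w}_\infty=\bigcap_{n\ge1}L^{w}_n$ and $L^{y}_\infty=\bigcap_{n\ge1}L^{y}_n$. **Paths and path matrices.** Let $\mathcal P=\{\{1,2\},\{1,3\},\{2,3\}\}$. For $\{i,j\}\in\mathcal P$ the white (yellow) path of type $\{i,j\}$ is the unique path in the tree $\mathcal G(\mathcal W\cup\mathcal W')$ (resp. $\mathcal G(\mathcal Y\cup\mathcal Y')$) from $e^w_i$ to $e^w_j$ (resp. $e^y_i$ to $e^y_j$). If $V_1,\dots,V_r$ is this path and $l_h$ is the label of the edge between $V_h$ and $V_{h+1}$, then (with respect to the path) $V_h$ has type $\{l_{h-1},l_h\}$ for $1<h<r$, $V_1$ has type $\{i,l_1\}$ and $V_r$ has type $\{l_{r-1},j\}$. Define $3\times3$ matrices with rows and columns indexed by $\{1,2\},\{1,3\},\{2,3\}$ in this order: the $(\pi,\gamma)$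 entry of $M_w$ (resp. $\tilde M_w$) is the number of triangles from $\mathcal W$ (resp. $\mathcal W'$) of type $\gamma$ in the white path of type $\pi$; the $(\pi,\gamma)$ entry of $M_y$ (resp. $\tilde M_y$) is the number of triangles from $\mathcal Y$ (resp. $\mathcal Y'$) of type $\gamma$ in the yellow path of type $\pi$. The global path matrix is the $6\times 6$ matrix $M=\begin{pmatrix}M_w&\tilde M_w\\ \tilde M_y&M_y\end{pmatrix}$; one has $\tilde M_w=M_w-I_3$, $\tilde M_y=M_y-I_3$. **Blocked.** For $\{i,j\}\in\mathcal P$ and $\{k\}=\{1,2,3\}\setminus\{i,j\}$, the white (yellow) path of type $\{i,j\}$ is blocked if it contains two triangles that are not contained in the same strip of type $k$. The system is $\pi$-blocked ($\pi\in\mathcal P$) if the white or the yellow path of type $\pi$ is blocked, and globally blocked if it is $\pi$-blocked for all $\pi\in\mathcal P$. **Length and tangents.** The length of an arc is its one-dimensional (Lebesgue) measure. There exists a tangent $\tau$ (a straight line) at a point $\mathbf X_0$ to an arc $a$ if for every angle $\phi>0$ there is $\varepsilon>0$ such that for all $\mathbf X\in a$ with $\mathbf X\neq\mathbf X_0$, $|\mathbf X_0-\mathbf X|<\varepsilon$, the angle between $\tau$ and the straight line through $\mathbf X$ and $\mathbf X_0$ is not greater than $\phi$. *)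

theory Defs
  imports "HOL-Analysis.Analysis" "Jordan_Normal_Form.Char_Poly"
begin

section \<open>Triangles\<close>

text \<open>
  The indices 1, 2, 3 of the paper are the elements of the numeral type \<^typ>\<open>3\<close> (in which
  3 = 0; these exhaust the type by \<open>exhaust_3\<close>).  A triangle is
  the ordered family of its vertices, since the maps \<open>P_\<Delta>\<close> depend on the order.
\<close>

type_synonym triangle = "3 \<Rightarrow> real^2"

definition triple :: "'a \<Rightarrow> 'a \<Rightarrow> 'a \<Rightarrow> 3 \<Rightarrow> 'a" where
  "triple a b c i = (if i = 1 then a else if i = 2 then b else c)"

definition base_triangle :: triangle where
  "base_triangle = triple (vector [0, 0]) (vector [1, 0]) (vector [1/2, sqrt 3 / 2])"

definition full_triangle :: "triangle \<Rightarrow> (real^2) set" where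
  "full_triangle A = convex hull (range A)"

definition bary_coords :: "(3 \<Rightarrow> real) set" where
  "bary_coords = {\<alpha>. (\<forall>i. \<alpha> i \<in> {0..1}) \<and> (\<Sum>i\<in>UNIV. \<alpha> i) = 1}"

text \<open>Only meaningful for arguments in the full base triangle, where \<open>\<alpha>\<close> is unique.\<close>

definition triangle_map :: "triangle \<Rightarrow> real^2 \<Rightarrow> real^2" where
  "triangle_map A x = (THE y. \<exists>\<alpha>\<in>bary_coords.
     x = (\<Sum>i\<in>UNIV. \<alpha> i *\<^sub>R base_triangle i) \<and> y = (\<Sum>i\<in>UNIV. \<alpha> i *\<^sub>R A i))"

definition subtriangle :: "triangle \<Rightarrow> triangle \<Rightarrow> triangle" where
  "subtriangle U V = (\<lambda>i. triangle_map U (V i))"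

definition up_triangle :: "nat \<Rightarrow> (3 \<Rightarrow> int) \<Rightarrow> triangle" where
  "up_triangle m k = (\<lambda>i. (1 / real m) *\<^sub>R
     ((\<Sum>j\<in>UNIV. of_int (k j) *\<^sub>R base_triangle j) + base_triangle i))"

definition down_triangle :: "nat \<Rightarrow> (3 \<Rightarrow> int) \<Rightarrow> triangle" where
  "down_triangle m k = (\<lambda>i. (1 / real m) *\<^sub>R
     ((\<Sum>j\<in>UNIV. of_int (k j) *\<^sub>R base_triangle j) + (\<Sum>j\<in>UNIV. base_triangle j) - base_triangle i))"

definition up_index :: "nat \<Rightarrow> (3 \<Rightarrow> int) set" where
  "up_index m = {k. (\<forall>i. 0 \<le> k i) \<and> (\<Sum>i\<in>UNIV. k i) = int m - 1}"

definition down_index :: "nat \<Rightarrow> (3 \<Rightarrow> int) set" where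
  "down_index m = {k. (\<forall>i. 0 \<le> k i) \<and> (\<Sum>i\<in>UNIV. k i) = int m - 2}"

definition up_triangles :: "nat \<Rightarrow> triangle set" where
  "up_triangles m = up_triangle m ` up_index m"

definition down_triangles :: "nat \<Rightarrow> triangle set" where
  "down_triangles m = down_triangle m ` down_index m"

text \<open>
  The base triangle has a vertex at the origin, so a triangle determines its index triple only
  through the prescribed sum; hence the index sets in the next definitions.
\<close>

definition up_down_neighbours :: "nat \<Rightarrow> 3 \<Rightarrow> triangle \<Rightarrow> triangle \<Rightarrow> bool" where
  "up_down_neighbours m j U V \<longleftrightarrow> (\<exists>k\<in>up_index m. \<exists>k'\<in>down_index m.
     U = up_triangle m k \<and> V = down_triangle m k' \<and> k j = k' j + 1 \<and> (\<forall>i. i \<noteq> j \<longrightarrow> k i = k' i))"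

definition neighbours :: "nat \<Rightarrow> 3 \<Rightarrow> triangle \<Rightarrow> triangle \<Rightarrow> bool" where
  "neighbours m j U V \<longleftrightarrow> up_down_neighbours m j U V \<or> up_down_neighbours m j V U"

definition strip :: "nat \<Rightarrow> 3 \<Rightarrow> int \<Rightarrow> triangle set" where
  "strip m i K = up_triangle m ` {k \<in> up_index m. k i = K} \<union> down_triangle m ` {k \<in> down_index m. k i = K}"


section \<open>Patterns systems\<close>

record patterns =
  white_up :: "triangle set"
  white_down :: "triangle set"
  yellow_up :: "triangle set"
  yellow_down :: "triangle set"

definition patterns_system :: "nat \<Rightarrow> patterns \<Rightarrow> bool" where
  "patterns_system m S \<longleftrightarrow> 2 \<le> m \<and>
     white_up S \<subseteq> up_triangles m \<and> white_down S \<subseteq> down_triangles m \<and>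
     yellow_up S \<subseteq> up_triangles m \<and> yellow_down S \<subseteq> down_triangles m"

text \<open>The levels start at 1; the value at level 0 is a dummy.\<close>

fun white_up_level white_down_level yellow_up_level yellow_down_level ::
    "patterns \<Rightarrow> nat \<Rightarrow> triangle set" where
  "white_up_level S 0 = {}"
| "white_up_level S (Suc 0) = white_up S"
| "white_up_level S (Suc (Suc n)) =
     {subtriangle U V | U V. U \<in> white_up_level S (Suc n) \<and> V \<in> white_up S} \<union>
     {subtriangle U V | U V. U \<in> white_down_level S (Suc n) \<and> V \<in> yellow_down S}"
| "white_down_level S 0 = {}"
| "white_down_level S (Suc 0) = white_down S"
| "white_down_level S (Suc (Suc n)) =
     {subtriangle U V | U V. U \<in> white_up_level S (Suc n) \<and> V \<in> white_down S} \<union>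
     {subtriangle U V | U V. U \<in> white_down_level S (Suc n) \<and> V \<in> yellow_up S}"
| "yellow_up_level S 0 = {}"
| "yellow_up_level S (Suc 0) = yellow_up S"
| "yellow_up_level S (Suc (Suc n)) =
     {subtriangle U V | U V. U \<in> yellow_up_level S (Suc n) \<and> V \<in> yellow_up S} \<union>
     {subtriangle U V | U V. U \<in> yellow_down_level S (Suc n) \<and> V \<in> white_down S}"
| "yellow_down_level S 0 = {}"
| "yellow_down_level S (Suc 0) = yellow_down S"
| "yellow_down_level S (Suc (Suc n)) =
     {subtriangle U V | U V. U \<in> yellow_up_level S (Suc n) \<and> V \<in> yellow_down S} \<union>
     {subtriangle U V | U V. U \<in> yellow_down_level S (Suc n) \<and> V \<in> white_up S}"

definition white_fractal :: "patterns \<Rightarrow> (real^2) set" where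
  "white_fractal S = (\<Inter>n\<in>{1..}. \<Union>U \<in> white_up_level S n \<union> white_down_level S n. full_triangle U)"

definition yellow_fractal :: "patterns \<Rightarrow> (real^2) set" where
  "yellow_fractal S = (\<Inter>n\<in>{1..}. \<Union>U \<in> yellow_up_level S n \<union> yellow_down_level S n. full_triangle U)"


section \<open>Labyrinth patterns systems\<close>

text \<open>
  Paths, cycles and trees in the undirected graph with vertex set \<open>X\<close> and symmetric, irreflexive
  adjacency relation \<open>E\<close>.  (The predicate \<open>tree\<close> of the Graph Theory entry of the AFP excludes
  directed cycles, hence also pairs of opposite arcs, and so does not describe undirected trees.)
\<close>

definition graph_path :: "'a set \<Rightarrow> ('a \<Rightarrow> 'a \<Rightarrow> bool) \<Rightarrow> 'a \<Rightarrow> 'a list \<Rightarrow> 'a \<Rightarrow> bool" where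
  "graph_path X E u p v \<longleftrightarrow>
     p \<noteq> [] \<and> hd p = u \<and> last p = v \<and> set p \<subseteq> X \<and> distinct p \<and> successively E p"

definition graph_cycle :: "'a set \<Rightarrow> ('a \<Rightarrow> 'a \<Rightarrow> bool) \<Rightarrow> 'a list \<Rightarrow> bool" where
  "graph_cycle X E p \<longleftrightarrow>
     3 \<le> length p \<and> set p \<subseteq> X \<and> distinct p \<and> successively E p \<and> E (last p) (hd p)"

definition tree_graph :: "'a set \<Rightarrow> ('a \<Rightarrow> 'a \<Rightarrow> bool) \<Rightarrow> bool" where
  "tree_graph X E \<longleftrightarrow>
     X \<noteq> {} \<and> (\<forall>u\<in>X. \<forall>v\<in>X. \<exists>p. graph_path X E u p v) \<and> \<not> (\<exists>p. graph_cycle X E p)"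

definition adjacent :: "nat \<Rightarrow> triangle \<Rightarrow> triangle \<Rightarrow> bool" where
  "adjacent m U V \<longleftrightarrow> (\<exists>j. neighbours m j U V)"

definition edge_label :: "nat \<Rightarrow> triangle \<Rightarrow> triangle \<Rightarrow> 3" where
  "edge_label m U V = (THE j. neighbours m j U V)"

definition exits_triple :: "nat \<Rightarrow> patterns \<Rightarrow> (3 \<Rightarrow> int) \<Rightarrow> bool" where
  "exits_triple m S k \<longleftrightarrow> (\<forall>i. k i \<in> {0..int m - 1}) \<and>
     up_triangle m (triple 0 (k 1) (int m - 1 - k 1)) \<in> white_up S \<and>
     up_triangle m (triple 0 (int m - 1 - k 1) (k 1)) \<in> yellow_up S \<and>
     up_triangle m (triple (k 2) 0 (int m - 1 - k 2)) \<in> white_up S \<and>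
     up_triangle m (triple (int m - 1 - k 2) 0 (k 2)) \<in> yellow_up S \<and>
     up_triangle m (triple (k 3) (int m - 1 - k 3) 0) \<in> white_up S \<and>
     up_triangle m (triple (int m - 1 - k 3) (k 3) 0) \<in> yellow_up S"

definition corners :: "triangle set \<Rightarrow> triangle set" where
  "corners X = {U \<in> X. \<exists>i. base_triangle i \<in> full_triangle U}"

definition labyrinth_patterns_system :: "nat \<Rightarrow> patterns \<Rightarrow> bool" where
  "labyrinth_patterns_system m S \<longleftrightarrow> patterns_system m S \<and>
     tree_graph (white_up S \<union> white_down S) (adjacent m) \<and>
     tree_graph (yellow_up S \<union> yellow_down S) (adjacent m) \<and>
     (\<exists>!k. exits_triple m S k) \<and>
     corners (white_up S) \<inter> corners (yellow_up S) = {} \<and>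
     card (corners (white_up S)) \<le> 1 \<and> card (corners (yellow_up S)) \<le> 1"


section \<open>Paths, blocking and the global path matrix\<close>

definition white_exit :: "nat \<Rightarrow> patterns \<Rightarrow> 3 \<Rightarrow> triangle" where
  "white_exit m S = (let k = (THE k. exits_triple m S k) in
     triple (up_triangle m (triple 0 (k 1) (int m - 1 - k 1)))
            (up_triangle m (triple (k 2) 0 (int m - 1 - k 2)))
            (up_triangle m (triple (k 3) (int m - 1 - k 3) 0)))"

definition yellow_exit :: "nat \<Rightarrow> patterns \<Rightarrow> 3 \<Rightarrow> triangle" where
  "yellow_exit m S = (let k = (THE k. exits_triple m S k) in
     triple (up_triangle m (triple 0 (int m - 1 - k 1) (k 1)))
            (up_triangle m (triple (int m - 1 - k 2) 0 (k 2)))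
            (up_triangle m (triple (int m - 1 - k 3) (k 3) 0)))"

definition white_path :: "nat \<Rightarrow> patterns \<Rightarrow> 3 \<Rightarrow> 3 \<Rightarrow> triangle list" where
  "white_path m S i j = (THE p. graph_path (white_up S \<union> white_down S) (adjacent m)
     (white_exit m S i) p (white_exit m S j))"

definition yellow_path :: "nat \<Rightarrow> patterns \<Rightarrow> 3 \<Rightarrow> 3 \<Rightarrow> triangle list" where
  "yellow_path m S i j = (THE p. graph_path (yellow_up S \<union> yellow_down S) (adjacent m)
     (yellow_exit m S i) p (yellow_exit m S j))"

text \<open>
  The labels of the consecutive edges of a path from exit \<open>i\<close> to exit \<open>j\<close>, extended by \<open>i\<close> in front
  and \<open>j\<close> at the end: the type of the \<open>h\<close>-th triangle consists of the labels on its two sides.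
  A path consisting of a single triangle (two exits coincide) gives it the type \<open>{i, j}\<close>.
\<close>

definition path_labels :: "nat \<Rightarrow> 3 \<Rightarrow> 3 \<Rightarrow> triangle list \<Rightarrow> 3 list" where
  "path_labels m i j p = i # map2 (edge_label m) p (tl p) @ [j]"

definition type_in_path :: "nat \<Rightarrow> 3 \<Rightarrow> 3 \<Rightarrow> triangle list \<Rightarrow> nat \<Rightarrow> 3 set" where
  "type_in_path m i j p h = {path_labels m i j p ! h, path_labels m i j p ! Suc h}"

definition type_count :: "nat \<Rightarrow> 3 \<Rightarrow> 3 \<Rightarrow> triangle list \<Rightarrow> triangle set \<Rightarrow> 3 set \<Rightarrow> nat" where
  "type_count m i j p X \<gamma> = card {h. h < length p \<and> p ! h \<in> X \<and> type_in_path m i j p h = \<gamma>}"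

text \<open>The order of rows and columns of the path matrices.\<close>

definition type_pair :: "nat \<Rightarrow> 3 \<times> 3" where
  "type_pair a = [(1, 2), (1, 3), (2, 3)] ! a"

definition path_matrix :: "nat \<Rightarrow> (3 \<Rightarrow> 3 \<Rightarrow> triangle list) \<Rightarrow> triangle set \<Rightarrow> real mat" where
  "path_matrix m q X = Matrix.mat 3 3 (\<lambda>(r, c).
     let (i, j) = type_pair r; (i', j') = type_pair c
     in real (type_count m i j (q i j) X {i', j'}))"

definition global_path_matrix :: "nat \<Rightarrow> patterns \<Rightarrow> real mat" where
  "global_path_matrix m S = four_block_mat
     (path_matrix m (white_path m S) (white_up S)) (path_matrix m (white_path m S) (white_down S))
     (path_matrix m (yellow_path m S) (yellow_down S)) (path_matrix m (yellow_path m S) (yellow_up S))"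

definition blocked_path :: "nat \<Rightarrow> 3 \<Rightarrow> 3 \<Rightarrow> triangle list \<Rightarrow> bool" where
  "blocked_path m i j p \<longleftrightarrow> (\<exists>k. {k} = UNIV - {i, j} \<and>
     (\<exists>U\<in>set p. \<exists>V\<in>set p. \<not> (\<exists>K\<in>{0..int m - 1}. U \<in> strip m k K \<and> V \<in> strip m k K)))"

definition blocked :: "nat \<Rightarrow> patterns \<Rightarrow> 3 \<Rightarrow> 3 \<Rightarrow> bool" where
  "blocked m S i j \<longleftrightarrow>
     blocked_path m i j (white_path m S i j) \<or> blocked_path m i j (yellow_path m S i j)"

definition globally_blocked :: "nat \<Rightarrow> patterns \<Rightarrow> bool" where
  "globally_blocked m S \<longleftrightarrow> (\<forall>i j. i \<noteq> j \<longrightarrow> blocked m S i j)"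


section \<open>Arcs, Hausdorff measure and tangents\<close>

definition arc_between :: "'a::topological_space set \<Rightarrow> 'a \<Rightarrow> 'a \<Rightarrow> bool" where
  "arc_between a x y \<longleftrightarrow> (\<exists>g. arc g \<and> path_image g = a \<and> pathstart g = x \<and> pathfinish g = y)"

text \<open>
  The \<open>s\<close>-th power of the diameter, with the usual conventions that the empty set contributes 0 and
  that the 0-th power of the diameter of a nonempty set is 1 (whereas \<^term>\<open>0 powr 0 = (0::real)\<close>).
\<close>

definition diameter_power :: "real \<Rightarrow> 'a::metric_space set \<Rightarrow> real" where
  "diameter_power s U = (if U = {} then 0 else if s = 0 then 1 else diameter U powr s)"

text \<open>Boundedness is required because \<^const>\<open>diameter\<close> is only meaningful for bounded sets.\<close>

definition hausdorff_premeasure :: "real \<Rightarrow> real \<Rightarrow> 'a::metric_space set \<Rightarrow> ennreal" where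
  "hausdorff_premeasure s \<delta> A =
     (INF U \<in> {U :: nat \<Rightarrow> 'a set. A \<subseteq> (\<Union>n. U n) \<and> (\<forall>n. bounded (U n) \<and> diameter (U n) \<le> \<delta>)}.
        \<Sum>n. ennreal (diameter_power s (U n)))"

definition hausdorff_measure :: "real \<Rightarrow> 'a::metric_space set \<Rightarrow> ennreal" where
  "hausdorff_measure s A = (SUP \<delta>\<in>{0<..}. hausdorff_premeasure s \<delta> A)"

definition hausdorff_dim :: "'a::metric_space set \<Rightarrow> ereal" where
  "hausdorff_dim A = Inf (ereal ` {s. 0 \<le> s \<and> hausdorff_measure s A = 0})"

text \<open>One-dimensional Hausdorff measure, which extends Lebesgue measure from lines to arcs.\<close>

definition arc_length :: "'a::metric_space set \<Rightarrow> ennreal" where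
  "arc_length a = hausdorff_measure 1 a"

text \<open>The angle, between 0 and \<open>pi / 2\<close>, of two lines with nonzero direction vectors \<open>u\<close> and \<open>v\<close>.\<close>

definition line_angle :: "'a::real_inner \<Rightarrow> 'a \<Rightarrow> real" where
  "line_angle u v = arccos (\<bar>u \<bullet> v\<bar> / (norm u * norm v))"

text \<open>The tangent is given by its direction \<open>v\<close>.\<close>

definition has_tangent_at :: "'a::real_inner set \<Rightarrow> 'a \<Rightarrow> bool" where
  "has_tangent_at a x0 \<longleftrightarrow> (\<exists>v. v \<noteq> 0 \<and> (\<forall>\<phi>>0. \<exists>\<epsilon>>0. \<forall>x\<in>a.
     x \<noteq> x0 \<and> dist x0 x < \<epsilon> \<longrightarrow> line_angle v (x - x0) \<le> \<phi>))"

end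

theory Submission
  imports Defs
begin

text \<open>
  Reading the substitution from the outside in, the two fractals form a finite system of self-similar
  compact sets: each fractal is the union, over the cells of its pattern, of scaled copies of one of
  the two fractals.  The corners and exits properties force copies in two cells to meet only if the
  cells are neighbours, and then in a single point, the image of a common exit point of the fractals.
  Since the cells form a tree, the copies are glued along a tree.  Chains of cells give path
  connectedness, and a loop would have to lie in arbitrarily small copies; hence arcs exist and are
  unique.

  The arcs between exit points split into scaled copies of such arcs, counted by the path matrix \<open>M\<close>.
  By \<open>M\<^sub>w - M'\<^sub>w = M\<^sub>y - M'\<^sub>y = I\<close>, where \<open>M'\<close> denotes the blocks of downward triangles, adding up the
  two colours reduces the eigenvector equation for \<open>M\<close> to one for the matrix
  \<open>M\<^sub>w + M\<^sub>y - I\<close> of size 3.  Blockedness makes its row sums at least \<open>m + 1\<close>, which yields a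
  positive eigenvector with an eigenvalue of at least \<open>m + 1\<close>, and a positive eigenvector of \<open>M\<close> can
  belong only to the largest eigenvalue \<open>\<theta>\<close>.  Distributing mass along this eigenvector shows that the
  Hausdorff measure of dimension \<open>log \<theta> / log m > 1\<close> of the exit arcs is positive, while all higher ones
  vanish.  Every arc contains a copy of an exit arc and is, up to its end points, a countable union of
  such copies, which gives its dimension and its infinite length.  Finally, an exit arc is not contained
  in a line, so at every scale the directions seen from a point of a copy spread by a fixed angle.
\<close>

section \<open>Bridges and paths in trees\<close>

text \<open>The obstacle is that copies might touch in unexpected places. Cell maps act on
  barycentric coordinates by integers and division by \<open>m\<close>, so a contact of two cells is
  an equation between integers and numbers in [0, 1]. Apart from contacts across a common side, its
  solutions put vertices of the base triangle into the fractals against the corners property. Across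
  a common side, the exits property makes the contact recur inside the exit cells at all scales, so
  it is their fixed point.

  Irreducibility of \<open>M\<close> is not assumed, so the positivity of the eigenvector cannot
  come from Perron-Frobenius theory alone. A vanishing coordinate is excluded by the geometry of
  trees: a type that occurs in the path of no other type is carried by at most one cell of its own
  path.

  The bound \<open>m + 1\<close> has its origin in the mirrored exits. The indices of the white and
  the yellow exit of a side add up to \<open>m - 1\<close>, two steps of a path change an index by
  at most one in the required direction, and a blocked path loses at least one step.\<close>

lemma tree_bridge:
  assumes tree: "tree_graph X E" and sym: "\<And>a b. E a b \<Longrightarrow> E b a" and irr: "\<And>a. \<not> E a a"
    and u: "u \<in> X" and w: "w \<in> X" and uw: "E u w"
  obtains A B where "A \<union> B = X" "A \<inter> B = {}" "u \<in> A" "w \<in> B"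
    "\<And>a b. a \<in> A \<Longrightarrow> b \<in> B \<Longrightarrow> E a b \<Longrightarrow> a = u \<and> b = w"
proof -
  \<comment> \<open>\<open>E'\<close> is the graph without the edge between \<open>u\<close> and
    \<open>w\<close>, in both orientations; one side of the bridge is what remains reachable from
    \<open>u\<close>.\<close>
  define E' where "E' a b \<longleftrightarrow> E a b \<and> \<not> (a = u \<and> b = w) \<and> \<not> (a = w \<and> b = u)" for a b
  define A where "A = {v. \<exists>p. graph_path X E' u p v}"
  define B where "B = X - A"
  have uA: "u \<in> A"
    unfolding A_def graph_path_def using u by (auto intro!: exI[of _ "[u]"])
  have AX: "A \<subseteq> X" by (auto simp: A_def graph_path_def)
  \<comment> \<open>A path from \<open>u\<close> to \<open>w\<close> in \<open>E'\<close> has at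
    least three vertices, since \<open>E' u w\<close> fails, and the removed edge closes it to a
    cycle.\<close>
  have wB: "w \<notin> A"
  proof
    assume "w \<in> A"
    then obtain p where p: "graph_path X E' u p w" by (auto simp: A_def)
    have ne: "u \<noteq> w" using irr uw by auto
    have "successively E' p" using p by (simp add: graph_path_def)
    then have "successively E p" by (rule successively_mono) (simp add: E'_def)
    moreover have "3 \<le> length p"
    proof (rule ccontr)
      assume "\<not> 3 \<le> length p"
      then have "length p = 0 \<or> length p = 1 \<or> length p = 2" by linarith
      then consider "p = []" | x where "p = [x]" | x y where "p = [x, y]"
        by (auto simp: length_Suc_conv eval_nat_numeral)
      then show False
        using p ne by cases (auto simp: graph_path_def E'_def)
    qed
    ultimately have "graph_cycle X E p"
      using p sym uw by (auto simp: graph_cycle_def graph_path_def)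
    then show False using tree by (auto simp: tree_graph_def)
  qed
  have cross: "a = u \<and> b = w" if aA: "a \<in> A" and bB: "b \<in> B" and ab: "E a b" for a b
  proof -
    obtain p where p: "graph_path X E' u p a" using aA by (auto simp: A_def)
    have "\<not> E' a b"
    proof
      assume "E' a b"
      have "b \<notin> set p"
      proof
        assume "b \<in> set p"
        then obtain ys zs where pd: "p = (ys @ [b]) @ zs" by (auto simp: in_set_conv_decomp)
        have "successively E' ((ys @ [b]) @ zs)"
          using p unfolding pd by (simp only: graph_path_def)
        then have "successively E' (ys @ [b])"
          unfolding successively_append_iff by blast
        then have "graph_path X E' u (ys @ [b]) b"
          using p pd by (cases ys) (auto simp: graph_path_def)
        then show False using bB by (auto simp: B_def A_def)
      qed
      then have "graph_path X E' u (p @ [b]) b"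
        using p bB \<open>E' a b\<close> by (auto simp: graph_path_def successively_append_iff B_def)
      then show False using bB by (auto simp: B_def A_def)
    qed
    then have "(a = u \<and> b = w) \<or> (a = w \<and> b = u)" using ab by (auto simp: E'_def)
    then show ?thesis using wB aA bB uA by (auto simp: B_def)
  qed
  show thesis
  proof (rule that[OF _ _ uA _ cross])
    show "A \<union> B = X" "A \<inter> B = {}" "w \<in> B" using AX wB w by (auto simp: B_def)
  qed
qed

text \<open>The step from \<open>u\<close> to \<open>w\<close> is the only way from \<open>A\<close>
  into \<open>B\<close>, so a walk that avoids \<open>w\<close> cannot leave
  \<open>A\<close>.\<close>

lemma walk_avoiding_bridge:
  assumes cross: "\<And>a b. a \<in> A \<Longrightarrow> b \<in> B \<Longrightarrow> E a b \<Longrightarrow> a = u \<and> b = w"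
    and "successively E p" "set p \<subseteq> A \<union> B" "p \<noteq> []" "hd p \<in> A" "w \<notin> set p"
  shows "set p \<subseteq> A"
  using assms(2-)
proof (induction p)
  case (Cons x p)
  show ?case
  proof (cases p)
    case (Cons y ys)
    then have "y \<in> A" using Cons.prems cross by auto
    then show ?thesis using Cons.IH Cons.prems Cons by auto
  qed (use Cons.prems in auto)
qed auto

text \<open>A path visits \<open>u\<close> and \<open>w\<close> only once, so its part before the
  bridge avoids \<open>w\<close> and its part after it avoids \<open>u\<close>. The sides
  \<open>A\<close> and \<open>B\<close> later separate the copies that are glued along the
  tree.\<close>

lemma path_bridge:
  assumes tree: "tree_graph X E" and sym: "\<And>a b. E a b \<Longrightarrow> E b a" and irr: "\<And>a. \<not> E a a"
    and p: "graph_path X E x (xs @ u # w # ys) y"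
  obtains A B where "A \<union> B = X" "A \<inter> B = {}" "set (xs @ [u]) \<subseteq> A" "set (w # ys) \<subseteq> B"
    "\<And>a b. a \<in> A \<Longrightarrow> b \<in> B \<Longrightarrow> E a b \<Longrightarrow> a = u \<and> b = w"
proof -
  have suc: "successively E (xs @ [u])" "successively E (w # ys)" "E u w" "u \<in> X" "w \<in> X"
    and dis: "distinct (xs @ u # w # ys)" and sub: "set (xs @ u # w # ys) \<subseteq> X"
    using p by (auto simp: graph_path_def successively_append_iff successively_Cons)
  obtain A B where AB: "A \<union> B = X" "A \<inter> B = {}" "u \<in> A" "w \<in> B"
    and cross: "\<And>a b. a \<in> A \<Longrightarrow> b \<in> B \<Longrightarrow> E a b \<Longrightarrow> a = u \<and> b = w"
    using tree_bridge[OF tree sym irr \<open>u \<in> X\<close> \<open>w \<in> X\<close> \<open>E u w\<close>] by metis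
  have "successively (\<lambda>x y. E y x) (xs @ [u])"
    using suc(1) by (rule successively_mono) (rule sym)
  then have "successively E (rev (xs @ [u]))" by (simp only: successively_rev)
  have "set (rev (xs @ [u])) \<subseteq> A"
  proof (rule walk_avoiding_bridge[OF cross])
    show "successively E (rev (xs @ [u]))" by fact
  qed (use AB dis sub in auto)
  moreover have "a = w \<and> b = u" if "a \<in> B" "b \<in> A" "E a b" for a b
    using cross[OF that(2,1) sym[OF that(3)]] by simp
  then have "set (w # ys) \<subseteq> B"
    using suc(2) by (rule walk_avoiding_bridge) (use AB dis sub in auto)
  ultimately show thesis using that[OF AB(1,2) _ _ cross] by auto
qed

text \<open>The first edge of \<open>p\<close> is a bridge with the target beyond it. So
  \<open>q\<close> crosses it too, and has to do so at once, because it cannot return to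
  \<open>x\<close> later.\<close>

lemma tree_path_unique:
  assumes tree: "tree_graph X E" and sym: "\<And>a b. E a b \<Longrightarrow> E b a" and irr: "\<And>a. \<not> E a a"
  shows "graph_path X E x p y \<Longrightarrow> graph_path X E x q y \<Longrightarrow> p = q"
proof (induction p arbitrary: x q)
  case (Cons u p)
  have u: "u = x" using Cons.prems by (auto simp: graph_path_def)
  obtain q' where q: "q = x # q'" using Cons.prems by (cases q) (auto simp: graph_path_def)
  show ?case
  proof (cases p)
    case Nil
    then have "y = x" using Cons.prems u by (auto simp: graph_path_def)
    then have "q' = []" using Cons.prems(2) q last_in_set[of q'] by (cases "q' = []") (auto simp: graph_path_def)
    then show ?thesis using q u Nil by simp
  next
    case p: (Cons w p')
    have q'ne: "q' \<noteq> []"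
    proof
      assume "q' = []"
      then have "x = y" using Cons.prems(2) q by (auto simp: graph_path_def)
      then show False using Cons.prems(1) p u last_in_set[of p] by (auto simp: graph_path_def)
    qed
    then obtain w2 q'' where q': "q' = w2 # q''" by (cases q') auto
    have "graph_path X E x ([] @ x # w # p') y" using Cons.prems(1) p u by simp
    from path_bridge[OF tree sym irr this] obtain A B
      where AB: "A \<union> B = X" "A \<inter> B = {}" "set ([] @ [x]) \<subseteq> A" "set (w # p') \<subseteq> B"
      and cross: "\<And>a b. a \<in> A \<Longrightarrow> b \<in> B \<Longrightarrow> E a b \<Longrightarrow> a = x \<and> b = w"
      by blast
    have "y \<in> B" using AB(4) Cons.prems(1) p last_in_set[of "w # p'"] by (auto simp: graph_path_def)
    have ws: "w \<in> set q'"
    proof (rule ccontr)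
      assume wq: "w \<notin> set q'"
      have "successively E (x # q')" "set (x # q') \<subseteq> X" using Cons.prems(2) q
        by (simp_all add: graph_path_def)
      moreover have "x \<noteq> w" using AB by auto
      ultimately have "set (x # q') \<subseteq> A"
        by (rule_tac walk_avoiding_bridge[OF cross]) (use AB wq in auto)
      then show False using \<open>y \<in> B\<close> AB(2) Cons.prems(2) q q'ne last_in_set[of q'] by (auto simp: graph_path_def)
    qed
    have "w2 = w"
    proof (rule ccontr)
      assume ne: "w2 \<noteq> w"
      have w2: "E x w2" "w2 \<in> X" "w2 \<noteq> x" using Cons.prems(2) q q' by (auto simp: graph_path_def)
      then have "w2 \<in> A" using cross[of x w2] AB ne by auto
      obtain r s where rs: "q' = r @ w # s" using ws by (auto simp: in_set_conv_decomp)
      then obtain r' where r': "r = w2 # r'" using q' ne by (cases r) auto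
      have dq: "distinct (x # q')" "successively E (x # q')" "set (x # q') \<subseteq> X"
        using Cons.prems(2) q by (auto simp: graph_path_def)
      then have sr: "successively E r" "E (last r) w" "w \<notin> set r" "x \<notin> set r" "set r \<subseteq> X"
        using rs r' by (auto simp: successively_append_iff successively_Cons)
      have "set r \<subseteq> A"
        by (rule walk_avoiding_bridge[OF cross]) (use AB sr r' \<open>w2 \<in> A\<close> in auto)
      then have "last r \<in> A" using r' last_in_set[of r] by auto
      then have "last r = x" using cross sr AB(4) by auto
      then show False using sr(4) r' last_in_set[of r] by auto
    qed
    moreover have "graph_path X E w p y" using Cons.prems(1) p by (auto simp: graph_path_def)
    moreover have "graph_path X E w2 q' y" using Cons.prems(2) q q' by (auto simp: graph_path_def)
    ultimately have "p = q'" using Cons.IH by simp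
    then show ?thesis using u q by simp
  qed
qed (auto simp: graph_path_def)

section \<open>Hausdorff measure\<close>

lemma premeasure_less:
  assumes "hausdorff_premeasure s \<delta> A < c"
  obtains U where "A \<subseteq> (\<Union>n. U n)" "\<And>n::nat. bounded (U n)" "\<And>n. diameter (U n) \<le> \<delta>"
    "(\<Sum>n. ennreal (diameter_power s (U n))) < c"
  using assms unfolding hausdorff_premeasure_def INF_less_iff by blast

lemma premeasure_le:
  assumes "A \<subseteq> (\<Union>n. U n)" "\<And>n::nat. bounded (U n)" "\<And>n. diameter (U n) \<le> \<delta>"
  shows "hausdorff_premeasure s \<delta> A \<le> (\<Sum>n. ennreal (diameter_power s (U n)))"
  unfolding hausdorff_premeasure_def using assms by (intro INF_lower) auto

lemma hausdorff_measure_eq_0_iff: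
  "hausdorff_measure s A = 0 \<longleftrightarrow> (\<forall>\<delta>>0. hausdorff_premeasure s \<delta> A = 0)"
  unfolding hausdorff_measure_def by (auto simp: SUP_bot_conv simp flip: bot_ennreal)

lemma hausdorff_measure_eq_0I:
  assumes "\<And>\<delta> \<epsilon>::real. 0 < \<delta> \<Longrightarrow> 0 < \<epsilon> \<Longrightarrow> hausdorff_premeasure s \<delta> A \<le> ennreal \<epsilon>"
  shows "hausdorff_measure s A = 0"
  unfolding hausdorff_measure_eq_0_iff
proof (intro allI impI)
  fix \<delta> :: real assume "0 < \<delta>"
  then have "hausdorff_premeasure s \<delta> A \<le> 0 + ennreal \<epsilon>" if "0 < \<epsilon>" for \<epsilon> using assms that by simp
  then have "hausdorff_premeasure s \<delta> A \<le> 0" by (rule ennreal_le_epsilon)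
  then show "hausdorff_premeasure s \<delta> A = 0" by simp
qed

lemma hausdorff_measure_eq_0D:
  assumes "hausdorff_measure s A = 0" "0 < \<delta>" "0 < \<epsilon>"
  obtains U where "A \<subseteq> (\<Union>n. U n)" "\<And>n::nat. bounded (U n)" "\<And>n. diameter (U n) \<le> \<delta>"
    "(\<Sum>n. ennreal (diameter_power s (U n))) < ennreal \<epsilon>"
proof -
  have "hausdorff_premeasure s \<delta> A < ennreal \<epsilon>"
    using assms by (simp add: hausdorff_measure_eq_0_iff ennreal_zero_less_one)
  then show thesis by (rule premeasure_less) (rule that)
qed

lemma premeasure_mono: "A \<subseteq> B \<Longrightarrow> hausdorff_premeasure s \<delta> A \<le> hausdorff_premeasure s \<delta> B"
  unfolding hausdorff_premeasure_def by (rule INF_superset_mono) auto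

lemma hausdorff_measure_mono: "A \<subseteq> B \<Longrightarrow> hausdorff_measure s A \<le> hausdorff_measure s B"
  unfolding hausdorff_measure_def by (rule SUP_mono) (auto intro: premeasure_mono)

lemma hausdorff_null_subset: "hausdorff_measure s B = 0 \<Longrightarrow> A \<subseteq> B \<Longrightarrow> hausdorff_measure s A = 0"
  using hausdorff_measure_mono[of A B s] by simp

lemma diameter_power_eq: "0 < s \<Longrightarrow> diameter_power s U = diameter U powr s"
  by (simp add: diameter_power_def)

lemma hausdorff_null_UN:
  assumes "\<And>i::nat. hausdorff_measure s (A i) = 0"
  shows "hausdorff_measure s (\<Union>i. A i) = 0"
proof (rule hausdorff_measure_eq_0I)
  fix \<delta> \<epsilon> :: real assume \<delta>: "0 < \<delta>" and \<epsilon>: "0 < \<epsilon>"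
  have "\<exists>U. A i \<subseteq> (\<Union>n. U n) \<and> (\<forall>n::nat. bounded (U n) \<and> diameter (U n) \<le> \<delta>) \<and>
    (\<Sum>n. ennreal (diameter_power s (U n))) < ennreal (\<epsilon> * (1/2)^Suc i)" for i
  proof -
    have "0 < \<epsilon> * (1/2)^Suc i" using \<epsilon> by simp
    from hausdorff_measure_eq_0D[OF assms[of i] \<delta> this] show ?thesis by metis
  qed
  then obtain U where U: "\<And>i. A i \<subseteq> (\<Union>n. U i n)" "\<And>i n::nat. bounded (U i n)" "\<And>i n. diameter (U i n) \<le> \<delta>"
    "\<And>i. (\<Sum>n. ennreal (diameter_power s (U i n))) < ennreal (\<epsilon> * (1/2)^Suc i)" by metis
  define V where "V j = (case prod_decode j of (i, n) \<Rightarrow> U i n)" for j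
  have V: "V (prod_encode (i, n)) = U i n" for i n by (simp add: V_def)
  have "(\<Sum>j. ennreal (diameter_power s (V j))) \<le> ennreal \<epsilon>"
    unfolding suminf_eq_SUP
  proof (rule SUP_least)
    fix N :: nat
    \<comment> \<open>A finite part of the enumeration lies in a rectangle of index pairs; on it the
      double sum is finite and can be taken row by row.\<close>
    define P where "P = prod_decode ` {..<N}"
    define K where "K = Suc (Max (insert 0 (fst ` P)))"
    define J where "J = Suc (Max (insert 0 (snd ` P)))"
    have fP: "finite P" by (simp add: P_def)
    have "i < K \<and> n < J" if "(i, n) \<in> P" for i n
    proof
      have "i \<in> fst ` P" "n \<in> snd ` P" using that by (force simp: image_iff)+
      then show "i < K" "n < J" unfolding K_def J_def less_Suc_eq_le
        using fP by (auto intro!: Max_ge simp del: Max_insert)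
    qed
    then have sub: "P \<subseteq> {..<K} \<times> {..<J}" by auto
    have "(\<Sum>j<N. ennreal (diameter_power s (V j))) = (\<Sum>(i,n)\<in>P. ennreal (diameter_power s (U i n)))"
      unfolding P_def by (subst sum.reindex) (auto simp: V_def inj_prod_decode intro!: sum.cong inj_prod_decode split: prod.splits)
    also have "\<dots> \<le> (\<Sum>(i,n)\<in>{..<K} \<times> {..<J}. ennreal (diameter_power s (U i n)))"
      by (rule sum_mono2) (use sub in auto)
    also have "\<dots> = (\<Sum>i<K. \<Sum>n<J. ennreal (diameter_power s (U i n)))"
      by (simp add: sum.cartesian_product)
    also have "\<dots> \<le> (\<Sum>i<K. ennreal (\<epsilon> * (1/2)^Suc i))"
    proof (rule sum_mono)
      fix i
      have "(\<Sum>n<J. ennreal (diameter_power s (U i n))) \<le> (\<Sum>n. ennreal (diameter_power s (U i n)))"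
        by (rule sum_le_suminf) auto
      also have "\<dots> \<le> ennreal (\<epsilon> * (1/2)^Suc i)" using U(4)[of i] by simp
      finally show "(\<Sum>n<J. ennreal (diameter_power s (U i n))) \<le> ennreal (\<epsilon> * (1/2)^Suc i)" .
    qed
    also have "\<dots> = ennreal (\<epsilon> * (\<Sum>i<K. (1/2)^Suc i))"
      using \<epsilon> by (simp add: sum_ennreal sum_distrib_left)
    also have "\<dots> \<le> ennreal \<epsilon>"
    proof (rule ennreal_leI)
      have "(\<Sum>i<K. (1/2)^Suc i) \<le> (1::real)"
        using sum_le_suminf[of "\<lambda>i. (1/2)^Suc i :: real" "{..<K}"] power_half_series
        by (simp add: sums_iff)
      then show "\<epsilon> * (\<Sum>i<K. (1/2)^Suc i) \<le> \<epsilon>" using \<epsilon> mult_left_le[of "(\<Sum>i<K. (1/2)^Suc i)" \<epsilon>] by simp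
    qed
    finally show "(\<Sum>j<N. ennreal (diameter_power s (V j))) \<le> ennreal \<epsilon>" .
  qed
  moreover have "(\<Union>i. A i) \<subseteq> (\<Union>j. V j)"
  proof safe
    fix x i assume "x \<in> A i"
    then obtain n where "x \<in> U i n" using U(1) by blast
    then show "x \<in> (\<Union>j. V j)" using V by (metis UNIV_I UN_iff)
  qed
  then have "hausdorff_premeasure s \<delta> (\<Union>i. A i) \<le> (\<Sum>j. ennreal (diameter_power s (V j)))"
    by (rule premeasure_le) (auto simp: V_def U split: prod.splits)
  ultimately show "hausdorff_premeasure s \<delta> (\<Union>i. A i) \<le> ennreal \<epsilon>" by (rule order_trans[rotated])
qed

lemma hausdorff_null_countable_UN:
  fixes A :: "'b \<Rightarrow> 'a::metric_space set"
  assumes "countable I" "\<And>i. i \<in> I \<Longrightarrow> hausdorff_measure s (A i) = 0"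
  shows "hausdorff_measure s (\<Union>i\<in>I. A i) = 0"
proof (cases "I = {}")
  case True
  have "hausdorff_measure s ({}::'a set) = 0"
  proof (rule hausdorff_measure_eq_0I)
    fix \<delta> \<epsilon> :: real assume "0 < \<delta>" "0 < \<epsilon>"
    then have "hausdorff_premeasure s \<delta> ({}::'a set) \<le> (\<Sum>n. ennreal (diameter_power s ({}::'a set)))"
      by (intro premeasure_le) auto
    also have "\<dots> = 0" by (simp add: diameter_power_def)
    finally show "hausdorff_premeasure s \<delta> ({}::'a set) \<le> ennreal \<epsilon>" by simp
  qed
  then show ?thesis using True by simp
next
  case False
  then have "(\<Union>i\<in>I. A i) = (\<Union>n. A (from_nat_into I n))"
    using range_from_nat_into[OF False assms(1)] by (metis image_image)
  then show ?thesis using assms(2) from_nat_into[OF False] hausdorff_null_UN by metis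
qed

lemma hausdorff_null_singleton: "0 < s \<Longrightarrow> hausdorff_measure s {x} = 0"
proof (rule hausdorff_measure_eq_0I)
  fix \<delta> \<epsilon> :: real assume s: "0 < s" and "0 < \<delta>" "0 < \<epsilon>"
  then have "hausdorff_premeasure s \<delta> {x} \<le> (\<Sum>n::nat. ennreal (diameter_power s {x}))"
    by (intro premeasure_le) auto
  also have "\<dots> = 0" using s by (simp add: diameter_power_eq)
  finally show "hausdorff_premeasure s \<delta> {x} \<le> ennreal \<epsilon>" by simp
qed

section \<open>Dependence of the measure on the exponent\<close>

lemma premeasure_change_exponent:
  assumes "0 \<le> s" "s \<le> t" "0 < \<delta>"
  shows "hausdorff_premeasure t \<delta> A \<le> ennreal (\<delta> powr (t - s)) * hausdorff_premeasure s \<delta> A"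
proof (cases "hausdorff_premeasure s \<delta> A")
  case (real r)
  let ?C = "\<delta> powr (t - s)"
  have Cpos: "0 < ?C" using assms(3) by simp
  \<comment> \<open>A factor of exponent \<open>t - s\<close> is split off and bounded by the mesh;
    \<open>s = 0\<close> is a case of its own because \<open>diameter_power\<close> is then 1
    instead of a power.\<close>
  have key: "diameter_power t U \<le> \<delta> powr (t - s) * diameter_power s U"
    if "bounded U" "diameter U \<le> \<delta>" for U :: "'a set"
  proof -
    have d0: "0 \<le> diameter U" using that(1) by (rule diameter_ge_0)
    show ?thesis
    proof (cases "U = {} \<or> s = t")
      case True
      then show ?thesis using assms by (auto simp: diameter_power_def)
    next
      case False
      then have st: "s < t" "0 < t" "U \<noteq> {}" using assms by auto
      show ?thesis
      proof (cases "s = 0")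
        case True
        then show ?thesis using st d0 that(2) by (auto simp: diameter_power_def powr_mono2)
      next
        case s: False
        have "diameter U powr t = diameter U powr (t - s) * diameter U powr s"
          by (simp flip: powr_add)
        also have "\<dots> \<le> \<delta> powr (t - s) * diameter U powr s"
          using st d0 that(2) by (intro mult_right_mono powr_mono2) auto
        finally show ?thesis using st s by (auto simp: diameter_power_def)
      qed
    qed
  qed
  have "hausdorff_premeasure t \<delta> A \<le> ennreal ?C * hausdorff_premeasure s \<delta> A + ennreal e" if e: "0 < e" for e
  proof -
    have "hausdorff_premeasure s \<delta> A < ennreal (r + e / ?C)"
      using real e Cpos by (simp add: ennreal_less_iff)
    then obtain U where U: "A \<subseteq> (\<Union>n. U n)" "\<And>n::nat. bounded (U n)" "\<And>n. diameter (U n) \<le> \<delta>"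
      "(\<Sum>n. ennreal (diameter_power s (U n))) < ennreal (r + e / ?C)"
      by (rule premeasure_less) blast
    have "hausdorff_premeasure t \<delta> A \<le> (\<Sum>n. ennreal (diameter_power t (U n)))"
      using U by (intro premeasure_le)
    also have "\<dots> \<le> (\<Sum>n. ennreal ?C * ennreal (diameter_power s (U n)))"
      using key U by (intro suminf_le) (auto simp flip: ennreal_mult' simp: diameter_power_def intro!: ennreal_leI)
    also have "\<dots> = ennreal ?C * (\<Sum>n. ennreal (diameter_power s (U n)))" by (rule ennreal_suminf_cmult)
    also have "\<dots> \<le> ennreal ?C * ennreal (r + e / ?C)" using U(4) by (intro mult_left_mono) auto
    also have "\<dots> = ennreal (?C * (r + e / ?C))" using e real by (intro ennreal_mult[symmetric]) auto
    also have "?C * (r + e / ?C) = ?C * r + e" using Cpos by (simp only: distrib_left) simp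
    also have "ennreal \<dots> = ennreal ?C * hausdorff_premeasure s \<delta> A + ennreal e"
      using e real by (simp add: ennreal_mult)
    finally show ?thesis .
  qed
  then show ?thesis by (rule ennreal_le_epsilon)
qed (use assms in \<open>auto simp: ennreal_mult_top\<close>)

lemma hausdorff_measure_finite_imp_null:
  assumes "0 \<le> s" "s < t" "hausdorff_measure s A \<noteq> \<infinity>"
  shows "hausdorff_measure t A = 0"
proof -
  obtain r where r: "hausdorff_measure s A = ennreal r" "0 \<le> r"
    using assms(3) by (cases "hausdorff_measure s A") auto
  have bnd: "hausdorff_premeasure t \<delta> A \<le> ennreal (\<delta> powr (t - s) * r)" if "0 < \<delta>" for \<delta>
  proof -
    have "hausdorff_premeasure t \<delta> A \<le> ennreal (\<delta> powr (t - s)) * hausdorff_premeasure s \<delta> A"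
      using premeasure_change_exponent assms that by (metis less_imp_le)
    also have "\<dots> \<le> ennreal (\<delta> powr (t - s)) * hausdorff_measure s A"
      unfolding hausdorff_measure_def using that by (intro mult_left_mono SUP_upper) auto
    finally show ?thesis by (simp add: r ennreal_mult')
  qed
  show ?thesis
  proof (rule hausdorff_measure_eq_0I)
    fix \<delta> \<epsilon> :: real assume \<delta>: "0 < \<delta>" and \<epsilon>: "0 < \<epsilon>"
    \<comment> \<open>Makes \<open>\<eta> powr (t - s) * r\<close> at most \<epsilon>;
      \<open>r + 1\<close> avoids a division by zero. Shrinking the mesh from \<delta> to \<eta> can
      only increase the premeasure.\<close>
    define \<eta> where "\<eta> = min \<delta> ((\<epsilon> / (r + 1)) powr (1 / (t - s)))"
    have \<eta>: "0 < \<eta>" "\<eta> \<le> \<delta>" using \<delta> \<epsilon> r by (auto simp: \<eta>_def)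
    have "\<eta> powr (t - s) \<le> ((\<epsilon> / (r + 1)) powr (1 / (t - s))) powr (t - s)"
      using \<eta> assms by (intro powr_mono2) (auto simp: \<eta>_def)
    also have "\<dots> = \<epsilon> / (r + 1)" using assms \<epsilon> r by (simp add: powr_powr)
    finally have "\<eta> powr (t - s) * r \<le> \<epsilon> / (r + 1) * r" using r by (intro mult_right_mono)
    also have "\<dots> \<le> \<epsilon>" using \<epsilon> r by (simp add: field_simps)
    finally have "hausdorff_premeasure t \<eta> A \<le> ennreal \<epsilon>" using bnd[OF \<eta>(1)] by (meson ennreal_leI order_trans)
    moreover have "hausdorff_premeasure t \<delta> A \<le> hausdorff_premeasure t \<eta> A"
      unfolding hausdorff_premeasure_def using \<eta>(2) by (intro INF_superset_mono) (auto intro: order_trans)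
    ultimately show "hausdorff_premeasure t \<delta> A \<le> ennreal \<epsilon>" by simp
  qed
qed

text \<open>Length is the measure of exponent 1; were it finite, all measures of larger exponent
  would vanish.\<close>

lemma arc_length_infinite:
  assumes "1 < s" "hausdorff_measure s A \<noteq> 0"
  shows "arc_length A = \<infinity>"
  using hausdorff_measure_finite_imp_null[of 1 s A] assms unfolding arc_length_def by auto

lemma hausdorff_dim_eqI:
  assumes "0 \<le> s" "hausdorff_measure s A \<noteq> 0" "\<And>t. s < t \<Longrightarrow> hausdorff_measure t A = 0"
  shows "hausdorff_dim A = ereal s"
proof (rule antisym)
  show "ereal s \<le> hausdorff_dim A" unfolding hausdorff_dim_def
  proof (rule Inf_greatest, safe)
    fix t :: real assume "0 \<le> t" "hausdorff_measure t A = 0"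
    then have "\<not> t < s" using hausdorff_measure_finite_imp_null[of t s A] assms(2) by auto
    then show "ereal s \<le> ereal t" by simp
  qed
  show "hausdorff_dim A \<le> ereal s"
  proof (rule ereal_le_epsilon2)
    fix e :: real assume "0 < e"
    then have "hausdorff_dim A \<le> ereal (s + e)"
      unfolding hausdorff_dim_def using assms by (intro Inf_lower) auto
    then show "hausdorff_dim A \<le> ereal s + ereal e" by simp
  qed
qed

lemma hausdorff_null_lipschitz_image:
  fixes A :: "'a::metric_space set" and f :: "'a \<Rightarrow> 'b::real_normed_vector"
  assumes "0 < s" "0 < C" and lip: "\<And>x y. x \<in> A \<Longrightarrow> y \<in> A \<Longrightarrow> dist (f x) (f y) \<le> C * dist x y"
    and null: "hausdorff_measure s A = 0"
  shows "hausdorff_measure s (f ` A) = 0"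
proof (rule hausdorff_measure_eq_0I)
  fix \<delta> \<epsilon> :: real assume \<delta>: "0 < \<delta>" and \<epsilon>: "0 < \<epsilon>"
  have "0 < \<delta> / C" "0 < \<epsilon> / (C powr s)" using \<delta> \<epsilon> assms by auto
  from hausdorff_measure_eq_0D[OF null this]
  obtain U where U: "A \<subseteq> (\<Union>n. U n)" "\<And>n::nat. bounded (U n)" "\<And>n. diameter (U n) \<le> \<delta> / C"
    "(\<Sum>n. ennreal (diameter_power s (U n))) < ennreal (\<epsilon> / (C powr s))" by metis
  \<comment> \<open>The Lipschitz bound is known on \<open>A\<close> only, so the cover is cut down
    to \<open>A\<close> before it is mapped.\<close>
  define V where "V n = f ` (U n \<inter> A)" for n
  have VU: "dist x y \<le> C * diameter (U n)" if "x \<in> V n" "y \<in> V n" for x y n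
  proof -
    obtain x' y' where "x' \<in> U n \<inter> A" "y' \<in> U n \<inter> A" "x = f x'" "y = f y'" using \<open>x \<in> V n\<close> \<open>y \<in> V n\<close> by (auto simp: V_def)
    then have "dist x y \<le> C * dist x' y'" using lip by auto
    also have "\<dots> \<le> C * diameter (U n)"
      using diameter_bounded_bound[OF U(2)] \<open>x' \<in> _\<close> \<open>y' \<in> _\<close> assms by (intro mult_left_mono) auto
    finally show ?thesis .
  qed
  have bV: "bounded (V n)" for n using VU[of _ n] by (rule bounded_two_points[THEN iffD2, OF exI, rule_format])
  have dV: "diameter (V n) \<le> C * diameter (U n)" for n
    using VU[of _ n] diameter_ge_0[OF U(2)[of n]] assms by (intro diameter_le) (auto simp: dist_norm)
  have "hausdorff_premeasure s \<delta> (f ` A) \<le> (\<Sum>n. ennreal (diameter_power s (V n)))"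
  proof (rule premeasure_le)
    show "f ` A \<subseteq> (\<Union>n. V n)" using U(1) by (force simp: V_def)
    show "diameter (V n) \<le> \<delta>" for n
      using dV[of n] U(3)[of n] assms by (simp add: field_simps)
  qed (rule bV)
  also have "\<dots> \<le> (\<Sum>n. ennreal (C powr s) * ennreal (diameter_power s (U n)))"
  proof (intro suminf_le)
    fix n
    have "diameter (V n) powr s \<le> (C * diameter (U n)) powr s"
      using dV assms diameter_ge_0[OF bV] by (intro powr_mono2) auto
    then show "ennreal (diameter_power s (V n)) \<le> ennreal (C powr s) * ennreal (diameter_power s (U n))"
      using assms diameter_ge_0[OF U(2)] by (simp add: diameter_power_eq powr_mult flip: ennreal_mult)
  qed auto
  also have "\<dots> = ennreal (C powr s) * (\<Sum>n. ennreal (diameter_power s (U n)))" by (rule ennreal_suminf_cmult)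
  also have "\<dots> \<le> ennreal (C powr s) * ennreal (\<epsilon> / (C powr s))"
    using U(4) by (intro mult_left_mono) auto
  also have "\<dots> = ennreal \<epsilon>" using assms \<epsilon> by (simp flip: ennreal_mult)
  finally show "hausdorff_premeasure s \<delta> (f ` A) \<le> ennreal \<epsilon>" .
qed

section \<open>Bounds for the measure from covers\<close>

lemma premeasure_finite_cover:
  assumes "finite F" "A \<subseteq> \<Union>F" "\<And>U. U \<in> F \<Longrightarrow> bounded U \<and> diameter U \<le> \<delta>" "0 \<le> \<delta>"
  shows "hausdorff_premeasure s \<delta> A \<le> (\<Sum>U\<in>F. ennreal (diameter_power s U))"
proof -
  obtain h where h: "bij_betw h {0..<card F} F" using ex_bij_betw_nat_finite[OF assms(1)] by blast
  \<comment> \<open>The finite cover is padded with empty sets, which contribute 0 for every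
    exponent, including 0.\<close>
  define V where "V n = (if n < card F then h n else {})" for n
  have "h ` {0..<card F} = F" using h by (simp add: bij_betw_def)
  then have hF: "h n \<in> F" if "n < card F" for n using that by auto
  have "hausdorff_premeasure s \<delta> A \<le> (\<Sum>n. ennreal (diameter_power s (V n)))"
  proof (rule premeasure_le)
    show "A \<subseteq> (\<Union>n. V n)"
    proof
      fix x assume "x \<in> A"
      then obtain U where "U \<in> F" "x \<in> U" using assms(2) by auto
      then obtain n where "n < card F" "h n = U" using \<open>h ` _ = F\<close> by (metis atLeastLessThan_iff imageE)
      then show "x \<in> (\<Union>n. V n)" using \<open>x \<in> U\<close> by (auto simp: V_def intro!: exI[of _ n])
    qed
  qed (use assms hF in \<open>auto simp: V_def\<close>)
  also have "\<dots> = (\<Sum>n<card F. ennreal (diameter_power s (V n)))"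
    by (rule suminf_finite) (auto simp: V_def diameter_power_def)
  also have "\<dots> = (\<Sum>n\<in>{0..<card F}. ennreal (diameter_power s (h n)))"
    by (rule sum.cong) (auto simp: V_def)
  also have "\<dots> = (\<Sum>U\<in>F. ennreal (diameter_power s U))"
    using h by (rule sum.reindex_bij_betw)
  finally show ?thesis .
qed

text \<open>Level \<open>n\<close> contributes at most \<open>C * D powr s\<close> times the
  \<open>n\<close>-th power of \<open>\<theta> / M powr s\<close>, which is less than 1.\<close>

lemma hausdorff_null_of_finite_covers:
  fixes A :: "'a::real_normed_vector set"
  assumes M: "1 < M" and s: "0 < s" and \<theta>: "0 < \<theta>" "\<theta> < M powr s" and "0 \<le> C" "0 \<le> D"
    and cov: "\<And>n::nat. \<exists>F. finite F \<and> A \<subseteq> \<Union>F \<and> real (card F) \<le> C * \<theta> ^ n \<and>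
       (\<forall>U\<in>F. \<forall>x\<in>U. \<forall>y\<in>U. dist x y \<le> D / M ^ n)"
  shows "hausdorff_measure s A = 0"
proof (rule hausdorff_measure_eq_0I)
  fix \<delta> \<epsilon> :: real assume \<delta>: "0 < \<delta>" and \<epsilon>: "0 < \<epsilon>"
  have "(\<lambda>n. D * (1 / M) ^ n) \<longlonglongrightarrow> D * 0"
    using M by (intro tendsto_mult tendsto_const LIMSEQ_realpow_zero) auto
  then have e1: "\<forall>\<^sub>F n in sequentially. D * (1 / M) ^ n < \<delta>" using \<delta> by (intro order_tendstoD) auto
  have q: "0 \<le> \<theta> / M powr s" "\<theta> / M powr s < 1" using \<theta> M by auto
  have "(\<lambda>n. (C * D powr s) * (\<theta> / M powr s) ^ n) \<longlonglongrightarrow> (C * D powr s) * 0"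
    using q by (intro tendsto_mult tendsto_const LIMSEQ_realpow_zero) auto
  then have "\<forall>\<^sub>F n in sequentially. (C * D powr s) * (\<theta> / M powr s) ^ n < \<epsilon>"
    using \<epsilon> by (intro order_tendstoD) auto
  with e1 obtain n where n: "D * (1 / M) ^ n < \<delta>" "(C * D powr s) * (\<theta> / M powr s) ^ n < \<epsilon>"
    using eventually_conj eventually_happens'[OF sequentially_bot] by (metis (mono_tags, lifting))
  obtain F where F: "finite F" "A \<subseteq> \<Union>F" "real (card F) \<le> C * \<theta> ^ n"
    "\<And>U x y. U \<in> F \<Longrightarrow> x \<in> U \<Longrightarrow> y \<in> U \<Longrightarrow> dist x y \<le> D / M ^ n" using cov[of n] by blast
  have Dn: "0 \<le> D / M ^ n" using \<open>0 \<le> D\<close> M by simp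
  have bF: "bounded U" if "U \<in> F" for U using F(4)[OF that] by (auto simp: bounded_two_points)
  have dF: "diameter U \<le> D / M ^ n" if "U \<in> F" for U
    using F(4)[OF that] Dn by (intro diameter_le) (auto simp: dist_norm)
  have "hausdorff_premeasure s \<delta> A \<le> (\<Sum>U\<in>F. ennreal (diameter_power s U))"
    using F \<delta> dF bF n(1) by (intro premeasure_finite_cover) (force simp: power_divide)+
  also have "\<dots> \<le> (\<Sum>U\<in>F. ennreal ((D / M ^ n) powr s))"
    using dF bF s by (intro sum_mono ennreal_leI) (auto simp: diameter_power_eq intro!: powr_mono2 diameter_ge_0)
  also have "\<dots> = ennreal (real (card F) * (D / M ^ n) powr s)" by (simp add: ennreal_mult ennreal_of_nat_eq_real_of_nat)
  also have "\<dots> \<le> ennreal (C * \<theta> ^ n * (D / M ^ n) powr s)"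
    using F(3) by (intro ennreal_leI mult_right_mono) auto
  also have "C * \<theta> ^ n * (D / M ^ n) powr s = (C * D powr s) * (\<theta> / M powr s) ^ n"
  proof -
    have "(M ^ n) powr s = (M powr s) ^ n"
      using M by (simp add: powr_powr powr_realpow[symmetric] mult.commute)
    then show ?thesis using M \<open>0 \<le> D\<close> by (simp add: powr_divide power_divide)
  qed
  also have "ennreal \<dots> \<le> ennreal \<epsilon>" using n(2) by (intro ennreal_leI) simp
  finally show "hausdorff_premeasure s \<delta> A \<le> ennreal \<epsilon>" .
qed

text \<open>Serves to find three points off a common line in every bounded set of positive measure
  for an exponent above 1.\<close>

lemma hausdorff_null_of_subset_line:
  fixes A :: "'a::real_normed_vector set"
  assumes s: "1 < s" and "bounded A" and line: "A \<subseteq> range (\<lambda>t. p + t *\<^sub>R v)" and v: "v \<noteq> 0"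
  shows "hausdorff_measure s A = 0"
proof -
  obtain B where B: "0 < B" "\<And>x. x \<in> A \<Longrightarrow> norm (x - p) \<le> B"
  proof -
    have "bounded ((\<lambda>x. x - p) ` A)" using \<open>bounded A\<close> bounded_translation_minus by blast
    then show ?thesis using that unfolding bounded_pos by auto
  qed
  define R where "R = B / norm v"
  have R: "0 < R" using B v by (simp add: R_def)
  have AR: "\<exists>t. x = p + t *\<^sub>R v \<and> \<bar>t\<bar> \<le> R" if xA: "x \<in> A" for x
  proof -
    obtain t where "x = p + t *\<^sub>R v" using line xA by auto
    then show ?thesis using B(2)[OF xA] v by (intro exI[of _ t]) (auto simp: R_def field_simps)
  qed
  show ?thesis
  proof (rule hausdorff_null_of_finite_covers[where M = 2 and \<theta> = 2 and C = 3 and D = B])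
    have "2 powr 1 < 2 powr s" using s by (intro powr_less_mono) auto
    then show "2 < 2 powr s" by simp
    fix n :: nat
    \<comment> \<open>The parameters from \<open>-R\<close> to \<open>R\<close> are covered by
      intervals of length \<open>R / 2 ^ n\<close>. Their indices run from \<open>-(2 ^ n)\<close>
      to \<open>2 ^ n\<close>, hence the factor 3, and each image has diameter at most
      \<open>B / 2 ^ n\<close>.\<close>
    define I where "I k = (\<lambda>t. p + t *\<^sub>R v) ` {R * of_int k / 2 ^ n .. R * (of_int k + 1) / 2 ^ n}" for k :: int
    define F where "F = I ` {- (2 ^ n) .. 2 ^ n}"
    have "A \<subseteq> \<Union>F"
    proof
      fix x assume "x \<in> A"
      then obtain t where t: "x = p + t *\<^sub>R v" "\<bar>t\<bar> \<le> R" using AR by blast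
      define k where "k = \<lfloor>t * 2 ^ n / R\<rfloor>"
      have k: "of_int k \<le> t * 2 ^ n / R" "t * 2 ^ n / R < of_int k + 1" unfolding k_def by linarith+
      have "t * 2 ^ n \<le> R * 2 ^ n" "- R * 2 ^ n \<le> t * 2 ^ n"
        using t(2) mult_right_mono[of t R "2 ^ n"] mult_right_mono[of "- R" t "2 ^ n"] by auto
      then have "t * 2 ^ n / R \<le> 1 * 2 ^ n" "(-1) * 2 ^ n \<le> t * 2 ^ n / R"
        using R by (simp_all add: divide_le_eq le_divide_eq mult.commute)
      then have "of_int k \<le> (2 ^ n :: real)" "- (2 ^ n) < real_of_int k + 1" using k by linarith+
      then have "real_of_int k \<le> real_of_int (2 ^ n)" "real_of_int (- (2 ^ n)) < real_of_int (k + 1)" by simp_all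
      then have "k \<in> {- (2 ^ n) .. 2 ^ n}" unfolding of_int_le_iff of_int_less_iff by simp
      moreover have "R * of_int k \<le> t * 2 ^ n" "t * 2 ^ n \<le> R * (of_int k + 1)"
        using k R by (simp_all add: pos_le_divide_eq pos_divide_less_eq mult.commute)
      then have "x \<in> I k" unfolding I_def t(1) by (intro imageI) (simp add: divide_le_eq le_divide_eq)
      ultimately show "x \<in> \<Union>F" by (auto simp: F_def)
    qed
    moreover have "real (card F) \<le> 3 * 2 ^ n"
    proof -
      have "card F \<le> card {- (2 ^ n) .. 2 ^ n :: int}" unfolding F_def by (intro card_image_le finite_atLeastAtMost_int)
      also have "\<dots> = 2 * 2 ^ n + 1" by (simp add: nat_add_distrib nat_mult_distrib nat_power_eq)
      finally have "card F \<le> 3 * 2 ^ n" using one_le_power[of "2::nat" n] by linarith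
      then have "real (card F) \<le> real (3 * 2 ^ n)" by (rule of_nat_mono)
      then show ?thesis by simp
    qed
    moreover have "dist x y \<le> B / 2 ^ n" if xy: "x \<in> I k" "y \<in> I k" for x y k
    proof -
      obtain t u where tu: "x = p + t *\<^sub>R v" "y = p + u *\<^sub>R v"
        "t \<in> {R * of_int k / 2 ^ n .. R * (of_int k + 1) / 2 ^ n}" "u \<in> {R * of_int k / 2 ^ n .. R * (of_int k + 1) / 2 ^ n}"
        using xy unfolding I_def by (elim imageE)
      have "\<bar>t - u\<bar> \<le> R * (of_int k + 1) / 2 ^ n - R * of_int k / 2 ^ n" using tu(3,4) by auto
      also have "\<dots> = R / 2 ^ n" by (simp add: field_simps)
      finally have "\<bar>t - u\<bar> * norm v \<le> R / 2 ^ n * norm v" by (rule mult_right_mono) simp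
      also have "\<dots> = B / 2 ^ n" using v by (simp add: R_def)
      finally have "norm ((t - u) *\<^sub>R v) \<le> B / 2 ^ n" by simp
      then show ?thesis by (simp add: tu dist_norm scaleR_left_diff_distrib)
    qed
    ultimately show "\<exists>F. finite F \<and> A \<subseteq> \<Union>F \<and> real (card F) \<le> 3 * 2 ^ n \<and>
       (\<forall>U\<in>F. \<forall>x\<in>U. \<forall>y\<in>U. dist x y \<le> B / 2 ^ n)"
      by (intro exI[of _ F]) (auto simp: F_def)
  qed (use s B in auto)
qed

text \<open>Compactness reduces positivity to finite covers by sets with positive diameter bounds
  below 1, to which the mass distribution argument applies. The price is a slight fattening of the
  covering sets to open ones.\<close>

lemma hausdorff_measure_pos_of_covers:
  fixes A :: "'a::real_normed_vector set"
  assumes "compact A" and s: "0 < s" and c: "0 < c"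
    and cov: "\<And>(I :: nat set) U d. finite I \<Longrightarrow> A \<subseteq> (\<Union>i\<in>I. U i) \<Longrightarrow>
        (\<And>i. i \<in> I \<Longrightarrow> 0 < d i \<and> d i < 1 \<and> (\<forall>x\<in>U i. \<forall>y\<in>U i. dist x y \<le> d i)) \<Longrightarrow>
        c \<le> (\<Sum>i\<in>I. d i powr s)"
  shows "hausdorff_measure s A \<noteq> 0"
proof
  assume "hausdorff_measure s A = 0"
  then obtain U where U: "A \<subseteq> (\<Union>n. U n)" "\<And>n::nat. bounded (U n)" "\<And>n. diameter (U n) \<le> 1/4"
    "(\<Sum>n. ennreal (diameter_power s (U n))) < ennreal (c/2)"
    using hausdorff_measure_eq_0D[of s A "1/4" "c/2"] c by (metis half_gt_zero zero_less_divide_1_iff zero_less_numeral)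
  let ?D = "\<lambda>n. diameter (U n)"
  \<comment> \<open>Continuity of the power allows a fattening at total cost \<open>c/4\<close>,
    which added to a sum below \<open>c/2\<close> stays below \<open>c\<close>. With
    \<open>e n\<close> at most 1/8 the fattened diameters are bounded by 1/2.\<close>
  have "\<exists>e>0. e \<le> 1/8 \<and> (?D n + 2 * e) powr s \<le> ?D n powr s + c/4 * (1/2)^Suc n" for n
  proof -
    have "((\<lambda>e. (?D n + 2 * e) powr s) \<longlongrightarrow> (?D n + 2 * 0) powr s) (at_right 0)"
      using s diameter_ge_0[OF U(2)[of n]]
      by (intro tendsto_powr' tendsto_intros) (auto simp: eventually_at_right_less intro!: eventually_at_rightI[of 0 1])
    then have "\<forall>\<^sub>F e in at_right 0. (?D n + 2 * e) powr s < ?D n powr s + c/4 * (1/2)^Suc n"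
      using c by (intro order_tendstoD) auto
    moreover have "\<forall>\<^sub>F e in at_right (0::real). e \<le> 1/8 \<and> 0 < e"
      by (intro eventually_at_rightI[of 0 "1/8"]) auto
    ultimately have "\<forall>\<^sub>F e in at_right (0::real). (?D n + 2 * e) powr s < ?D n powr s + c/4 * (1/2)^Suc n \<and> e \<le> 1/8 \<and> 0 < e"
      by (rule eventually_conj)
    then show ?thesis using eventually_happens'[OF trivial_limit_at_right_real] by (metis (no_types, lifting) less_imp_le)
  qed
  then obtain e where e: "\<And>n. 0 < e n" "\<And>n. e n \<le> 1/8"
    "\<And>n. (?D n + 2 * e n) powr s \<le> ?D n powr s + c/4 * (1/2)^Suc n" by metis
  define V where "V n = (\<Union>u\<in>U n. ball u (e n))" for n
  have "U n \<subseteq> V n" for n using e(1) by (auto simp: V_def)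
  then have "A \<subseteq> (\<Union>n. V n)" using U(1) by (meson SUP_mono' order_trans)
  moreover have "\<And>n. open (V n)" by (auto simp: V_def)
  ultimately obtain I where I: "finite I" "A \<subseteq> (\<Union>n\<in>I. V n)"
    using compactE_image[OF \<open>compact A\<close>, of UNIV V] by auto
  have "c \<le> (\<Sum>i\<in>I. (?D i + 2 * e i) powr s)"
  proof (rule cov[OF I])
    fix i assume "i \<in> I"
    have "dist x y \<le> ?D i + 2 * e i" if xy: "x \<in> V i" "y \<in> V i" for x y
    proof -
      obtain u w where uw: "u \<in> U i" "w \<in> U i" "dist u x < e i" "dist w y < e i" using xy by (auto simp: V_def)
      have "dist x y \<le> dist x u + dist u w + dist w y" using dist_triangle[of x y u] dist_triangle[of u y w] by linarith
      then show ?thesis using uw diameter_bounded_bound[OF U(2) uw(1,2)] by (simp add: dist_commute)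
    qed
    then show "0 < ?D i + 2 * e i \<and> ?D i + 2 * e i < 1 \<and> (\<forall>x\<in>V i. \<forall>y\<in>V i. dist x y \<le> ?D i + 2 * e i)"
      using e(1,2)[of i] U(3)[of i] diameter_ge_0[OF U(2)[of i]] by auto
  qed
  also have "\<dots> \<le> (\<Sum>i\<in>I. ?D i powr s + c/4 * (1/2)^Suc i)" by (intro sum_mono e(3))
  also have "\<dots> = (\<Sum>i\<in>I. ?D i powr s) + c/4 * (\<Sum>i\<in>I. (1/2)^Suc i)"
    by (simp add: sum.distrib sum_distrib_left)
  also have "(\<Sum>i\<in>I. (1/2)^Suc i) \<le> (1::real)"
    using sum_le_suminf[of "\<lambda>i. (1/2)^Suc i :: real" I] power_half_series I(1) by (simp add: sums_iff)
  then have "(\<Sum>i\<in>I. ?D i powr s) + c/4 * (\<Sum>i\<in>I. (1/2)^Suc i) \<le> (\<Sum>i\<in>I. ?D i powr s) + c/4"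
    using c by simp
  also have "(\<Sum>i\<in>I. ?D i powr s) < c/2"
  proof -
    have "ennreal (\<Sum>i\<in>I. ?D i powr s) = (\<Sum>i\<in>I. ennreal (diameter_power s (U i)))"
      using s by (simp add: diameter_power_eq sum_ennreal)
    also have "\<dots> \<le> (\<Sum>n. ennreal (diameter_power s (U n)))" using I(1) by (intro sum_le_suminf) auto
    also have "\<dots> < ennreal (c/2)" by (rule U(4))
    finally show ?thesis using c by (simp add: ennreal_less_iff sum_nonneg)
  qed
  finally show False using c by simp
qed

section \<open>Paths and loops in self-similar families\<close>

text \<open>How nested \<open>+++\<close> divides the unit interval depends only on the number of
  paths. Two concatenations of equally many paths therefore run in step and can be compared at each
  parameter.\<close>

fun catpaths :: "(real \<Rightarrow> 'a::topological_space) list \<Rightarrow> real \<Rightarrow> 'a" where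
  "catpaths [] = undefined"
| "catpaths [g] = g"
| "catpaths (g # h # gs) = g +++ catpaths (h # gs)"

lemma catpaths_path:
  assumes "gs \<noteq> []" "\<forall>g\<in>set gs. path g" "successively (\<lambda>g h. pathfinish g = pathstart h) gs"
  shows "path (catpaths gs) \<and> pathstart (catpaths gs) = pathstart (hd gs) \<and> pathfinish (catpaths gs) = pathfinish (last gs)"
  using assms by (induction gs rule: catpaths.induct) auto

lemma catpaths_dist:
  assumes "list_all2 (\<lambda>g h. \<forall>t\<in>{0..1}. dist (g t) (h t) \<le> e) gs hs" "gs \<noteq> []" "t \<in> {0..1}"
  shows "dist (catpaths gs t) (catpaths hs t :: 'a::metric_space) \<le> e"
  using assms
proof (induction gs arbitrary: hs t rule: catpaths.induct)
  case (2 g)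
  then show ?case by (auto simp: list_all2_Cons1)
next
  case (3 g g' gs)
  then obtain h h' hs' where hs: "hs = h # h' # hs'" by (auto simp: list_all2_Cons1)
  show ?case using 3 by (auto simp: hs joinpaths_def)
qed auto

lemma catpaths_all:
  assumes "\<forall>g\<in>set gs. \<forall>t\<in>{0..1}. P (g t)" "gs \<noteq> []" "t \<in> {0..1}"
  shows "P (catpaths gs t)"
  using assms by (induction gs arbitrary: t rule: catpaths.induct) (auto simp: joinpaths_def)

text \<open>An entry \<open>(v, a, b)\<close> is a copy that is entered at \<open>f v a\<close> and
  left at \<open>f v b\<close>; \<open>a\<close> and \<open>b\<close> are local coordinates in
  \<open>K v\<close>.\<close>

definition chain_in ::
  "('v \<Rightarrow> 'a \<Rightarrow> 'a) \<Rightarrow> 'v set \<Rightarrow> ('v \<Rightarrow> 'a set) \<Rightarrow> 'a \<Rightarrow> 'a \<Rightarrow> ('v \<times> 'a \<times> 'a) list \<Rightarrow> bool" where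
  "chain_in f V K p q xs \<longleftrightarrow> xs \<noteq> [] \<and> (\<forall>(v, a, b) \<in> set xs. v \<in> V \<and> a \<in> K v \<and> b \<in> K v) \<and>
     (case hd xs of (v, a, b) \<Rightarrow> f v a = p) \<and> (case last xs of (v, a, b) \<Rightarrow> f v b = q) \<and>
     successively (\<lambda>(v, a, b) (v', a', b'). f v b = f v' a') xs"

text \<open>A path from \<open>p\<close> to \<open>q\<close> is the uniform limit of the polygonal paths obtained by repeatedly
  replacing a segment by the segments of a chain.\<close>

lemma self_similar_path_connected:
  fixes L :: "'c \<Rightarrow> 'a::euclidean_space set"
  assumes r: "0 \<le> r" "r < 1"
    and lip: "\<And>c v x y. v \<in> V c \<Longrightarrow> dist (f v x) (f v y) \<le> r * dist x y"
    and T: "convex T" "bounded T" "\<And>c. L c \<subseteq> T" "\<And>c v. v \<in> V c \<Longrightarrow> f v ` T \<subseteq> T"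
    and L: "\<And>c. closed (L c)" "\<And>c v. v \<in> V c \<Longrightarrow> f v ` L (nxt c v) \<subseteq> L c"
    and chain: "\<And>c p q. p \<in> L c \<Longrightarrow> q \<in> L c \<Longrightarrow> \<exists>xs. chain_in f (V c) (\<lambda>v. L (nxt c v)) p q xs"
  shows "path_connected (L c0)"
proof -
  define X where "X c p q = (SOME xs. chain_in f (V c) (\<lambda>v. L (nxt c v)) p q xs)" for c p q
  have X: "chain_in f (V c) (\<lambda>v. L (nxt c v)) p q (X c p q)" if "p \<in> L c" "q \<in> L c" for c p q
    unfolding X_def using chain[OF that] by (rule someI_ex)
  obtain D where D: "0 \<le> D" "\<And>x y. x \<in> T \<Longrightarrow> y \<in> T \<Longrightarrow> dist x y \<le> D"
    using that[of "diameter T"] diameter_ge_0[OF T(2)] diameter_bounded_bound[OF T(2)] by blast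
  \<comment> \<open>The chain chosen for \<open>p\<close> and \<open>q\<close> is the same at all
    stages. Consecutive stages thus differ only inside the copies, where one more contraction is
    gained.\<close>
  define G where "G = rec_nat (\<lambda>c p q. linepath p q)
     (\<lambda>n Gn c p q. catpaths (map (\<lambda>(v, a, b). f v \<circ> Gn (nxt c v) a b) (X c p q)))"
  have G0: "G 0 c p q = linepath p q" for c p q by (simp add: G_def)
  have GS: "G (Suc n) c p q = catpaths (map (\<lambda>(v, a, b). f v \<circ> G n (nxt c v) a b) (X c p q))" for n c p q
    by (simp add: G_def)
  have contf: "continuous_on UNIV (f v)" if "v \<in> V c" for c v
  proof (rule lipschitz_on_continuous_on[of r])
    show "r-lipschitz_on UNIV (f v)" using lip[OF that] r by (intro lipschitz_onI) auto
  qed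
  have inT: "\<forall>t\<in>{0..1}. G n c p q t \<in> T" if "p \<in> L c" "q \<in> L c" for n c p q
    using that
  proof (induction n arbitrary: c p q)
    case 0
    have "closed_segment p q \<subseteq> T" using T(1,3) 0 by (meson closed_segment_subset subsetD)
    then show ?case unfolding G0 using linepath_in_path by blast
  next
    case (Suc n)
    have ch: "chain_in f (V c) (\<lambda>v. L (nxt c v)) p q (X c p q)" using X Suc.prems by blast
    have el: "f v (G n (nxt c v) a b t) \<in> T" if "(v, a, b) \<in> set (X c p q)" "t \<in> {0..1}" for v a b t
      using Suc.IH[of a "nxt c v" b] ch T(4)[of v c] that by (fastforce simp: chain_in_def)
    have ne: "X c p q \<noteq> []" using ch by (simp add: chain_in_def)
    show ?case unfolding GS
      by (intro ballI catpaths_all[where P = "\<lambda>x. x \<in> T"]) (use el ne in auto)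
  qed
  have pathG: "path (G n c p q) \<and> pathstart (G n c p q) = p \<and> pathfinish (G n c p q) = q"
    if "p \<in> L c" "q \<in> L c" for n c p q
    using that
  proof (induction n arbitrary: c p q)
    case (Suc n)
    have ch: "chain_in f (V c) (\<lambda>v. L (nxt c v)) p q (X c p q)" using X Suc.prems by blast
    let ?g = "\<lambda>(v, a, b). f v \<circ> G n (nxt c v) a b"
    have el: "path (?g y) \<and> pathstart (?g y) = f (fst y) (fst (snd y)) \<and> pathfinish (?g y) = f (fst y) (snd (snd y))"
      if "y \<in> set (X c p q)" for y
    proof -
      obtain v a b where y: "y = (v, a, b)" by (cases y)
      then have "v \<in> V c" "a \<in> L (nxt c v)" "b \<in> L (nxt c v)" using ch that by (auto simp: chain_in_def)
      then show ?thesis using Suc.IH[of a "nxt c v" b] contf[of v c]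
        by (auto simp: y pathstart_compose pathfinish_compose intro!: path_continuous_image intro: continuous_on_subset)
    qed
    have ne: "X c p q \<noteq> []" using ch by (simp add: chain_in_def)
    have suc: "successively (\<lambda>g h. pathfinish g = pathstart h) (map ?g (X c p q))"
      unfolding successively_map
      by (rule successively_mono[where P = "\<lambda>(v, a, b) (v', a', b'). f v b = f v' a'"])
        (use ch el in \<open>auto simp: chain_in_def\<close>)
    have "path (catpaths (map ?g (X c p q))) \<and> pathstart (catpaths (map ?g (X c p q))) = pathstart (hd (map ?g (X c p q)))
      \<and> pathfinish (catpaths (map ?g (X c p q))) = pathfinish (last (map ?g (X c p q)))"
      using catpaths_path[OF _ _ suc] ne el by auto
    moreover have "pathstart (hd (map ?g (X c p q))) = p" "pathfinish (last (map ?g (X c p q))) = q"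
      using el[of "hd (X c p q)"] el[of "last (X c p q)"] ch ne
      by (auto simp: chain_in_def hd_map last_map split: prod.splits)
    ultimately show ?case by (simp add: GS)
  qed (simp add: G0)
  have distG: "\<forall>t\<in>{0..1}. dist (G (Suc n) c p q t) (G n c p q t) \<le> D * r ^ n"
    if "p \<in> L c" "q \<in> L c" for n c p q
    using that
  proof (induction n arbitrary: c p q)
    case 0
    then show ?case using D(2) inT[of p c q] by simp
  next
    case (Suc n)
    have ch: "chain_in f (V c) (\<lambda>v. L (nxt c v)) p q (X c p q)" using X Suc.prems by blast
    have "dist (f v (G (Suc n) (nxt c v) a b t)) (f v (G n (nxt c v) a b t)) \<le> D * r ^ Suc n"
      if y: "(v, a, b) \<in> set (X c p q)" and t: "t \<in> {0..1}" for v a b t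
    proof -
      have v: "v \<in> V c" "a \<in> L (nxt c v)" "b \<in> L (nxt c v)" using ch y by (auto simp: chain_in_def)
      have "dist (f v (G (Suc n) (nxt c v) a b t)) (f v (G n (nxt c v) a b t))
         \<le> r * dist (G (Suc n) (nxt c v) a b t) (G n (nxt c v) a b t)" by (rule lip[OF v(1)])
      also have "\<dots> \<le> r * (D * r ^ n)" using Suc.IH[OF v(2,3)] t r by (intro mult_left_mono) auto
      finally show ?thesis by (simp add: mult_ac)
    qed
    then show ?case unfolding GS[of "Suc n"] GS[of n c]
      by (intro ballI catpaths_dist)
        (use ch in \<open>auto simp: chain_in_def list_all2_map1 list_all2_map2 list_all2_same\<close>)
  qed
  \<comment> \<open>The approximations may leave \<open>L c\<close>, but by at most
    \<open>D * r ^ n\<close>; closedness brings the limit back.\<close>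
  have nearL: "\<forall>t\<in>{0..1}. \<exists>z\<in>L c. dist (G n c p q t) z \<le> D * r ^ n" if "p \<in> L c" "q \<in> L c" for n c p q
    using that
  proof (induction n arbitrary: c p q)
    case 0
    then show ?case using D(2) inT[of p c q] T(3) by (metis mult.right_neutral power_0 subsetD)
  next
    case (Suc n)
    have ch: "chain_in f (V c) (\<lambda>v. L (nxt c v)) p q (X c p q)" using X Suc.prems by blast
    have "\<exists>z\<in>L c. dist (f v (G n (nxt c v) a b t)) z \<le> D * r ^ Suc n"
      if y: "(v, a, b) \<in> set (X c p q)" and t: "t \<in> {0..1}" for v a b t
    proof -
      have v: "v \<in> V c" "a \<in> L (nxt c v)" "b \<in> L (nxt c v)" using ch y by (auto simp: chain_in_def)
      obtain z where z: "z \<in> L (nxt c v)" "dist (G n (nxt c v) a b t) z \<le> D * r ^ n"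
        using Suc.IH[OF v(2,3)] t by blast
      have "dist (f v (G n (nxt c v) a b t)) (f v z) \<le> r * dist (G n (nxt c v) a b t) z" by (rule lip[OF v(1)])
      also have "\<dots> \<le> r * (D * r ^ n)" using z r by (intro mult_left_mono) auto
      finally show ?thesis using L(2)[OF v(1)] z(1) by (intro bexI[of _ "f v z"]) (auto simp: mult_ac)
    qed
    then show ?case unfolding GS
      by (intro ballI catpaths_all[where P = "\<lambda>x. \<exists>z\<in>L c. dist x z \<le> D * r ^ Suc n"])
        (use ch in \<open>auto simp: chain_in_def\<close>)
  qed
  have "\<exists>g. path g \<and> path_image g \<subseteq> L c0 \<and> pathstart g = p \<and> pathfinish g = q" if pq: "p \<in> L c0" "q \<in> L c0" for p q
  proof -
    let ?g = "\<lambda>n. G n c0 p q"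
    have "uniform_limit {0..1} (\<lambda>n t. \<Sum>i<n. ?g (Suc i) t - ?g i t) (\<lambda>t. \<Sum>i. ?g (Suc i) t - ?g i t) sequentially"
    proof (rule Weierstrass_m_test)
      show "norm (?g (Suc n) t - ?g n t) \<le> D * r ^ n" if "t \<in> {0..1}" for n t
        using distG[OF pq] that by (auto simp: dist_norm)
      show "summable (\<lambda>n. D * r ^ n)" using r by (intro summable_mult summable_geometric) auto
    qed
    moreover have "(\<Sum>i<n. ?g (Suc i) t - ?g i t) = ?g n t - ?g 0 t" for n t
      using sum_lessThan_telescope[of "\<lambda>i. ?g i t" n] by simp
    ultimately obtain h where h: "uniform_limit {0..1} (\<lambda>n t. ?g n t - ?g 0 t) h sequentially"
      by auto
    have "uniform_limit {0..1} (\<lambda>n t. (?g n t - ?g 0 t) + ?g 0 t) (\<lambda>t. h t + ?g 0 t) sequentially"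
      by (intro uniform_limit_add h uniform_limit_const)
    then have lim: "uniform_limit {0..1} ?g (\<lambda>t. h t + ?g 0 t) sequentially" by simp
    let ?h = "\<lambda>t. h t + ?g 0 t"
    have pw: "(\<lambda>n. ?g n t) \<longlonglongrightarrow> ?h t" if "t \<in> {0..1}" for t
      using tendsto_uniform_limitI[OF lim that] .
    have "path ?h" unfolding path_def
      using pathG[OF pq] by (intro uniform_limit_theorem[OF _ lim]) (auto simp: path_def)
    moreover have "?g n 0 = p" "?g n 1 = q" for n
      using pathG[OF pq] by (simp_all add: pathstart_def pathfinish_def)
    then have "pathstart ?h = p" "pathfinish ?h = q"
      using pw[of 0] pw[of 1] by (simp_all add: LIMSEQ_const_iff pathstart_def pathfinish_def)
    moreover have "?h t \<in> L c0" if t: "t \<in> {0..1}" for t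
    proof -
      have "\<exists>z. z \<in> L c0 \<and> dist (?g n t) z \<le> D * r ^ n" for n using nearL[OF pq] t by blast
      then obtain z where z: "\<And>n. z n \<in> L c0" "\<And>n. dist (?g n t) (z n) \<le> D * r ^ n" by metis
      have D0: "(\<lambda>n. D * r ^ n) \<longlonglongrightarrow> D * 0" using r by (intro tendsto_mult tendsto_const LIMSEQ_realpow_zero) auto
      have "(\<lambda>n. dist (?g n t) (z n)) \<longlonglongrightarrow> 0"
        by (rule tendsto_sandwich[OF _ _ tendsto_const, of _ _ _ "\<lambda>n. D * r ^ n"]) (use z D0 in auto)
      then have "(\<lambda>n. ?g n t - z n) \<longlonglongrightarrow> 0" by (simp add: dist_norm tendsto_norm_zero_iff)
      then have "(\<lambda>n. ?g n t - (?g n t - z n)) \<longlonglongrightarrow> ?h t - 0" by (intro tendsto_diff pw t)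
      then have "z \<longlonglongrightarrow> ?h t" by simp
      then show ?thesis using L(1)[of c0] z(1) closed_sequential_limits by blast
    qed
    ultimately show ?thesis by (intro exI[of _ ?h]) (auto simp: path_image_def)
  qed
  then show ?thesis by (auto simp: path_connected_def)
qed

section \<open>Simple loops and uniqueness of arcs\<close>

lemma simple_path_half:
  assumes "simple_path g"
  shows "g 0 \<noteq> g (1/2)"
proof
  assume "g 0 = g (1/2)"
  moreover have "(0::real) \<in> {0..1}" "(1/2::real) \<in> {0..1}" by auto
  ultimately have "(0::real) = 1/2 \<or> (0::real) = 0 \<and> (1/2::real) = 1 \<or> (0::real) = 1 \<and> (1/2::real) = 0"
    using assms unfolding simple_path_def loop_free_def by blast
  then show False by simp
qed

text \<open>Without the point \<open>p\<close> a simple loop is still connected, and there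
  \<open>A\<close> and \<open>B\<close> no longer meet. So the rest lies on one side, and
  \<open>p\<close> is a limit of the rest.\<close>

lemma loop_in_side:
  fixes g :: "real \<Rightarrow> 'a::euclidean_space"
  assumes g: "simple_path g" "pathfinish g = pathstart g"
    and "path_image g \<subseteq> A \<union> B" "closed A" "closed B" "A \<inter> B \<subseteq> {p}"
  shows "path_image g \<subseteq> A \<or> path_image g \<subseteq> B"
proof -
  let ?J = "path_image g"
  have conJ: "connected ?J" using g(1) by (rule connected_simple_path_image)
  have con: "connected (?J - {p})"
  proof (cases "p \<in> ?J")
    case True
    then obtain t where t: "t \<in> {0..1}" "p = g t" by (auto simp: path_image_def)
    \<comment> \<open>The loop is made to start at \<open>p\<close>, so that removing
      \<open>p\<close> removes only its end points.\<close>
    let ?s = "shiftpath t g"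
    have "simple_path ?s" "path_image ?s = ?J" "pathstart ?s = p" "pathfinish ?s = p"
      using g t by (auto simp: simple_path_shiftpath path_image_shiftpath pathstart_shiftpath pathfinish_shiftpath)
    then show ?thesis using connected_simple_path_endless[of ?s] by simp
  qed (use conJ in simp)
  have "A \<inter> (?J - {p}) = {} \<or> B \<inter> (?J - {p}) = {}"
    using con assms(3-6) unfolding connected_closed by blast
  then have "?J - {p} \<subseteq> B \<or> ?J - {p} \<subseteq> A" using assms(3) by blast
  moreover have "?J \<subseteq> closure (?J - {p})"
  proof (cases "p \<in> ?J")
    case True
    have "?J \<noteq> {p}"
    proof
      assume "?J = {p}"
      then have "g 0 = p" "g (1/2) = p" by (auto simp: path_image_def)
      then show False using simple_path_half[OF g(1)] by simp
    qed
    then have "p islimpt ?J" using conJ True by (intro connected_imp_perfect) auto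
    then have "p \<in> closure (?J - {p})" by (simp only: islimpt_in_closure)
    moreover have "?J - {p} \<subseteq> closure (?J - {p})" by (rule closure_subset)
    ultimately show ?thesis by blast
  qed (auto intro: closure_subset[THEN subsetD])
  ultimately show ?thesis
    using closure_minimal[of "?J - {p}" A] closure_minimal[of "?J - {p}" B] assms(4,5) by (meson order_trans)
qed

text \<open>A smallest subfamily that covers the loop has one member: two members could be
  separated, and the side containing the loop would need fewer.\<close>

lemma loop_in_piece:
  fixes g :: "real \<Rightarrow> 'a::euclidean_space" and K :: "'v \<Rightarrow> 'a set"
  assumes g: "simple_path g" "pathfinish g = pathstart g" and X: "finite X" "path_image g \<subseteq> (\<Union>v\<in>X. K v)"
    and K: "\<And>v. v \<in> X \<Longrightarrow> closed (K v)"
    and sep: "\<And>u w. u \<in> X \<Longrightarrow> w \<in> X \<Longrightarrow> u \<noteq> w \<Longrightarrow> \<exists>A B p. A \<union> B = X \<and> u \<in> A \<and> w \<in> B \<and>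
       u \<notin> B \<and> w \<notin> A \<and> (\<Union>v\<in>A. K v) \<inter> (\<Union>v\<in>B. K v) \<subseteq> {p}"
  shows "\<exists>v\<in>X. path_image g \<subseteq> K v"
proof -
  let ?P = "\<lambda>F. F \<subseteq> X \<and> path_image g \<subseteq> (\<Union>v\<in>F. K v)"
  have "?P X" using X by simp
  then obtain F where F: "?P F" and min: "\<And>F'. ?P F' \<Longrightarrow> card F \<le> card F'"
    using ex_has_least_nat[of ?P X card] by blast
  have finF: "finite F" using F X(1) finite_subset by blast
  have "\<not> (u \<in> F \<and> w \<in> F \<and> u \<noteq> w)" for u w
  proof
    assume uw: "u \<in> F \<and> w \<in> F \<and> u \<noteq> w"
    then obtain A B p where AB: "A \<union> B = X" "u \<in> A" "w \<in> B" "u \<notin> B" "w \<notin> A"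
      "(\<Union>v\<in>A. K v) \<inter> (\<Union>v\<in>B. K v) \<subseteq> {p}" using sep[of u w] F by blast
    have "path_image g \<subseteq> (\<Union>v\<in>A \<inter> F. K v) \<or> path_image g \<subseteq> (\<Union>v\<in>B \<inter> F. K v)"
    proof (rule loop_in_side[OF g])
      show "path_image g \<subseteq> (\<Union>v\<in>A \<inter> F. K v) \<union> (\<Union>v\<in>B \<inter> F. K v)" using F AB(1) by blast
      show "closed (\<Union>v\<in>A \<inter> F. K v)" "closed (\<Union>v\<in>B \<inter> F. K v)"
        using finF K F by (auto intro!: closed_UN)
      show "(\<Union>v\<in>A \<inter> F. K v) \<inter> (\<Union>v\<in>B \<inter> F. K v) \<subseteq> {p}" using AB(6) by blast
    qed
    then have "card F \<le> card (A \<inter> F) \<or> card F \<le> card (B \<inter> F)" using min F by (meson le_infI2)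
    moreover have "card (A \<inter> F) < card F" "card (B \<inter> F) < card F"
      using uw AB finF by (auto intro!: psubset_card_mono)
    ultimately show False by simp
  qed
  moreover have "F \<noteq> {}" using F by (auto simp: path_image_nonempty)
  ultimately obtain v where "F = {v}" by (metis is_singletonI' is_singleton_the_elem)
  then show ?thesis using F by auto
qed

text \<open>A loop lies in one copy, pulling it back by \<open>h v\<close> gives a loop again, and
  so on. Hence its diameter is at most \<open>D * r ^ n\<close> for all \<open>n\<close>, whereas a
  simple loop has two distinct points.\<close>

lemma self_similar_no_loop:
  fixes L :: "'c \<Rightarrow> 'a::euclidean_space set"
  assumes r: "0 < r" "r < 1"
    and hom: "\<And>c v x y. v \<in> V c \<Longrightarrow> dist (f v x) (f v y) = r * dist x y"
    and inv: "\<And>c v. v \<in> V c \<Longrightarrow> continuous_on UNIV (h v) \<and> (\<forall>x. h v (f v x) = x)"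
    and L: "\<And>c. compact (L c)" "\<And>c. L c = (\<Union>v\<in>V c. f v ` L (nxt c v))" "\<And>c. finite (V c)"
    and sep: "\<And>c u w. u \<in> V c \<Longrightarrow> w \<in> V c \<Longrightarrow> u \<noteq> w \<Longrightarrow> \<exists>A B p. A \<union> B = V c \<and> u \<in> A \<and> w \<in> B \<and>
       u \<notin> B \<and> w \<notin> A \<and> (\<Union>v\<in>A. f v ` L (nxt c v)) \<inter> (\<Union>v\<in>B. f v ` L (nxt c v)) \<subseteq> {p}"
    and bnd: "bounded (\<Union>c. L c)"
    and g: "simple_path g" "pathfinish g = pathstart g"
  shows "\<not> path_image g \<subseteq> L c"
proof
  assume sub: "path_image g \<subseteq> L c"
  obtain D where D: "0 \<le> D" "\<And>x y c. x \<in> L c \<Longrightarrow> y \<in> L c \<Longrightarrow> dist x y \<le> D"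
    using that[of "diameter (\<Union>c. L c)"] diameter_ge_0[OF bnd] diameter_bounded_bound[OF bnd] by blast
  have "\<forall>s\<in>{0..1}. \<forall>t\<in>{0..1}. dist (g s) (g t) \<le> D * r ^ n"
    if "simple_path g" "pathfinish g = pathstart g" "path_image g \<subseteq> L c" for n g c
    using that
  proof (induction n arbitrary: g c)
    case 0
    have "dist (g s) (g t) \<le> D" if "s \<in> {0..1}" "t \<in> {0..1}" for s t
      using 0(3) that by (intro D(2)[of _ c]) (auto simp: path_image_def)
    then show ?case by simp
  next
    case (Suc n)
    have closedK: "closed (f v ` L (nxt c v))" if "v \<in> V c" for v
    proof -
      have "r-lipschitz_on UNIV (f v)" using hom[OF that] r by (intro lipschitz_onI) auto
      then have "continuous_on (L (nxt c v)) (f v)"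
        using lipschitz_on_continuous_on lipschitz_on_subset by blast
      then show ?thesis using L(1) compact_continuous_image compact_imp_closed by blast
    qed
    have "path_image g \<subseteq> (\<Union>v\<in>V c. f v ` L (nxt c v))" using Suc.prems(3) L(2) by blast
    from loop_in_piece[OF Suc.prems(1,2) L(3) this closedK sep]
    obtain v where v: "v \<in> V c" "path_image g \<subseteq> f v ` L (nxt c v)" by blast
    define g' where "g' = h v \<circ> g"
    have fh: "f v (g' t) = g t \<and> g' t \<in> L (nxt c v)" if "t \<in> {0..1}" for t
    proof -
      have "g t \<in> f v ` L (nxt c v)" using v(2) that by (auto simp: path_image_def)
      then show ?thesis using inv[OF v(1)] by (auto simp: g'_def)
    qed
    have "simple_path g'" unfolding simple_path_def loop_free_def
    proof (intro conjI ballI impI)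
      show "path g'" using Suc.prems(1) inv[OF v(1)] unfolding g'_def
        by (intro path_continuous_image) (auto simp: simple_path_def intro: continuous_on_subset)
      fix s t :: real assume st: "s \<in> {0..1}" "t \<in> {0..1}" "g' s = g' t"
      then have "g s = g t" using fh by metis
      then show "s = t \<or> s = 0 \<and> t = 1 \<or> s = 1 \<and> t = 0"
        using st Suc.prems(1) by (auto simp: simple_path_def loop_free_def)
    qed
    moreover have "pathfinish g' = pathstart g'"
      using Suc.prems(2) by (simp add: g'_def pathstart_def pathfinish_def)
    moreover have "path_image g' \<subseteq> L (nxt c v)" using fh by (auto simp: path_image_def)
    ultimately have IH: "\<forall>s\<in>{0..1}. \<forall>t\<in>{0..1}. dist (g' s) (g' t) \<le> D * r ^ n" by (rule Suc.IH)
    show ?case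
    proof (intro ballI)
      fix s t :: real assume st: "s \<in> {0..1}" "t \<in> {0..1}"
      have "dist (g s) (g t) = r * dist (g' s) (g' t)" using fh st hom[OF v(1)] by metis
      also have "\<dots> \<le> r * (D * r ^ n)" using IH st r by (intro mult_left_mono) auto
      finally show "dist (g s) (g t) \<le> D * r ^ Suc n" by (simp add: mult_ac)
    qed
  qed
  from this[OF g sub] have "dist (g 0) (g (1/2)) \<le> D * r ^ n" for n by auto
  moreover have "(\<lambda>n. D * r ^ n) \<longlonglongrightarrow> D * 0" using r by (intro tendsto_mult tendsto_const LIMSEQ_realpow_zero) auto
  ultimately have "dist (g 0) (g (1/2)) \<le> D * 0" by (intro LIMSEQ_le_const) auto
  then have "g 0 = g (1/2)" by simp
  then show False using simple_path_half[OF g(1)] by simp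
qed

text \<open>A point of \<open>a\<close> off \<open>b\<close> lies on an excursion of
  \<open>a\<close> that leaves \<open>b\<close> and returns to it. Together with the part of
  \<open>b\<close> between its ends it forms a simple loop.\<close>

lemma arc_subset_of_no_loop:
  fixes L :: "'a::euclidean_space set"
  assumes noloop: "\<And>g. simple_path g \<Longrightarrow> pathfinish g = pathstart g \<Longrightarrow> \<not> path_image g \<subseteq> L"
    and a: "arc_between a x y" "a \<subseteq> L" and b: "arc_between b x y" "b \<subseteq> L"
  shows "a \<subseteq> b"
proof
  fix z assume "z \<in> a"
  obtain g where g: "arc g" "path_image g = a" "pathstart g = x" "pathfinish g = y"
    using a by (auto simp: arc_between_def)
  obtain h where h: "arc h" "path_image h = b" "pathstart h = x" "pathfinish h = y"
    using b by (auto simp: arc_between_def)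
  show "z \<in> b"
  proof (rule ccontr)
    assume zb: "z \<notin> b"
    obtain t0 where t0: "t0 \<in> {0..1}" "g t0 = z" using \<open>z \<in> a\<close> g(2) by (auto simp: path_image_def)
    have cg: "continuous_on {0..1} g" using g(1) by (simp add: arc_def path_def)
    have cb: "closed b" using h(1,2) closed_arc_image by blast
    have cl: "closed ({0..1} \<inter> g -` b)" using continuous_closed_preimage[OF cg _ cb] by (simp add: Int_commute)
    have ends: "g 0 \<in> b" "g 1 \<in> b"
      using h g by (metis pathstart_def pathstart_in_path_image, metis pathfinish_def pathfinish_in_path_image)
    have "compact ({0..t0} \<inter> ({0..1} \<inter> g -` b))" using cl by (intro compact_Int_closed compact_Icc)
    moreover have "{0..t0} \<inter> ({0..1} \<inter> g -` b) \<noteq> {}" using ends t0 by auto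
    \<comment> \<open>The last parameter before \<open>t0\<close> and, below, the first one after it
      at which \<open>g\<close> is on \<open>b\<close>; only the ends of the excursion meet
      \<open>b\<close>.\<close>
    ultimately obtain u where u: "u \<in> {0..t0} \<inter> ({0..1} \<inter> g -` b)"
      "\<And>t. t \<in> {0..t0} \<inter> ({0..1} \<inter> g -` b) \<Longrightarrow> t \<le> u"
      using compact_attains_sup by metis
    have "compact ({t0..1} \<inter> ({0..1} \<inter> g -` b))" using cl by (intro compact_Int_closed compact_Icc)
    moreover have "{t0..1} \<inter> ({0..1} \<inter> g -` b) \<noteq> {}" using ends t0 by auto
    ultimately obtain w where w: "w \<in> {t0..1} \<inter> ({0..1} \<inter> g -` b)"
      "\<And>t. t \<in> {t0..1} \<inter> ({0..1} \<inter> g -` b) \<Longrightarrow> w \<le> t"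
      using compact_attains_inf by metis
    have "u \<noteq> t0" "w \<noteq> t0" using u w t0 zb by auto
    then have uw: "u < w" "u \<in> {0..1}" "w \<in> {0..1}" using u(1) w(1) by auto
    have between: "g t \<notin> b" if "u < t" "t < w" for t
    proof
      assume "g t \<in> b"
      then show False using u(2)[of t] w(2)[of t] that uw by (cases "t \<le> t0") auto
    qed
    obtain su sw where s: "su \<in> {0..1}" "h su = g u" "sw \<in> {0..1}" "h sw = g w"
      using u(1) w(1) h(2) by (auto simp: path_image_def image_iff)
    have inj: "inj_on g {0..1}" using g(1) by (simp add: arc_def)
    then have "g u \<noteq> g w" using uw by (auto dest: inj_onD)
    then have "su \<noteq> sw" using s by auto
    define \<gamma> where "\<gamma> = subpath u w g +++ subpath sw su h"
    have sub1: "path_image (subpath u w g) = g ` {u..w}" using uw by (simp add: path_image_subpath)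
    have sub2: "path_image (subpath sw su h) \<subseteq> b"
      using path_image_subpath_subset[of sw su h] s h by auto
    have "simple_path \<gamma>" unfolding \<gamma>_def
    proof (rule simple_path_join_loop)
      show "arc (subpath u w g)" using g(1) uw by (intro arc_subpath_arc) auto
      show "arc (subpath sw su h)" using h(1) s \<open>su \<noteq> sw\<close> by (intro arc_subpath_arc) auto
      show "path_image (subpath u w g) \<inter> path_image (subpath sw su h) \<subseteq> {pathstart (subpath u w g), pathstart (subpath sw su h)}"
      proof
        fix x assume "x \<in> path_image (subpath u w g) \<inter> path_image (subpath sw su h)"
        then obtain t where "t \<in> {u..w}" "x = g t" "x \<in> b" using sub1 sub2 by auto
        then have "t = u \<or> t = w" using between[of t] by force
        then show "x \<in> {pathstart (subpath u w g), pathstart (subpath sw su h)}" using \<open>x = g t\<close> s by auto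
      qed
    qed (use s in auto)
    moreover have "pathfinish \<gamma> = pathstart \<gamma>" using s by (simp add: \<gamma>_def)
    moreover have "path_image \<gamma> \<subseteq> L"
    proof -
      have "path_image \<gamma> \<subseteq> path_image (subpath u w g) \<union> path_image (subpath sw su h)"
        unfolding \<gamma>_def by (rule path_image_join_subset)
      moreover have "path_image (subpath u w g) \<subseteq> a" using path_image_subpath_subset[of u w g] uw g by auto
      ultimately show ?thesis using sub2 a(2) b(2) by blast
    qed
    ultimately show False using noloop by blast
  qed
qed

lemma arc_unique_of_no_loop:
  fixes L :: "'a::euclidean_space set"
  assumes noloop: "\<And>g. simple_path g \<Longrightarrow> pathfinish g = pathstart g \<Longrightarrow> \<not> path_image g \<subseteq> L"
    and "arc_between a x y" "a \<subseteq> L" "arc_between b x y" "b \<subseteq> L"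
  shows "a = b"
  using arc_subset_of_no_loop[OF noloop] assms(2-) by (metis subset_antisym)

section \<open>Barycentric coordinates\<close>

text \<open>The solution of the linear equations for the coordinates, hence affine and defined in
  the whole plane; outside the triangle some coordinate is negative.\<close>

definition bary :: "real^2 \<Rightarrow> 3 \<Rightarrow> real" where
  "bary x = triple (1 - x $ 1 - x $ 2 / sqrt 3) (x $ 1 - x $ 2 / sqrt 3) (2 * x $ 2 / sqrt 3)"

text \<open>The affine extension of \<open>triangle_map A\<close> to the whole plane, which composes
  without side conditions.\<close>

definition affine_map :: "triangle \<Rightarrow> real^2 \<Rightarrow> real^2" where
  "affine_map A x = (\<Sum>i\<in>UNIV. bary x i *\<^sub>R A i)"

abbreviation base_region :: "(real^2) set" where
  "base_region \<equiv> full_triangle base_triangle"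

lemma triple_simps [simp]: "triple a b c 1 = a" "triple a b c 2 = b" "triple a b c 3 = c"
  by (simp_all add: triple_def)

lemma all_3_iff: "(\<forall>i::3. P i) \<longleftrightarrow> P 1 \<and> P 2 \<and> P 3" by (metis exhaust_3)

lemma base_triangle_nth: "base_triangle 1 $ 1 = 0" "base_triangle 1 $ 2 = 0" "base_triangle 2 $ 1 = 1"
  "base_triangle 2 $ 2 = 0" "base_triangle 3 $ 1 = 1/2" "base_triangle 3 $ 2 = sqrt 3 / 2"
  by (simp_all add: base_triangle_def vector_2)

lemma bary_sum [simp]: "(\<Sum>i\<in>UNIV. bary x i) = 1"
  by (simp add: sum_3 bary_def)

lemma bary_sum3: "bary x 1 + bary x 2 + bary x 3 = 1"
  using bary_sum[of x] by (simp only: sum_3)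

lemma bary_reconstruct: "(\<Sum>i\<in>UNIV. bary x i *\<^sub>R base_triangle i) = x"
  unfolding Finite_Cartesian_Product.vec_eq_iff forall_2
proof
  show "(\<Sum>i\<in>UNIV. bary x i *\<^sub>R base_triangle i) $ 1 = x $ 1"
    "(\<Sum>i\<in>UNIV. bary x i *\<^sub>R base_triangle i) $ 2 = x $ 2"
    by (simp_all add: sum_3 base_triangle_nth bary_def)
qed

lemma bary_eqI: "(\<And>i. bary x i = bary y i) \<Longrightarrow> x = y"
  by (metis bary_reconstruct ext)

lemma bary_affine:
  assumes "(\<Sum>j\<in>UNIV. \<beta> j) = 1"
  shows "bary (\<Sum>j\<in>UNIV. \<beta> j *\<^sub>R y j) i = (\<Sum>j\<in>(UNIV::3 set). \<beta> j * bary (y j) i)"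
proof -
  \<comment> \<open>Every coordinate is an affine function of the Cartesian ones; weights with sum 1
    preserve the constant term.\<close>
  have "\<exists>a b c. \<forall>x. bary x i = a + b * x $ 1 + c * x $ 2"
  proof -
    consider "i = 1" | "i = 2" | "i = 3" using exhaust_3 by blast
    then show ?thesis
    proof cases
      case 1
      show ?thesis by (rule exI[of _ 1], rule exI[of _ "-1"], rule exI[of _ "- 1 / sqrt 3"]) (simp add: 1 bary_def)
    next
      case 2
      show ?thesis by (rule exI[of _ 0], rule exI[of _ 1], rule exI[of _ "- 1 / sqrt 3"]) (simp add: 2 bary_def)
    next
      case 3
      show ?thesis by (rule exI[of _ 0], rule exI[of _ 0], rule exI[of _ "2 / sqrt 3"]) (simp add: 3 bary_def)
    qed
  qed
  then obtain a b c where abc: "\<And>x. bary x i = a + b * x $ 1 + c * x $ 2" by blast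
  have "a = a * (\<beta> 1 + \<beta> 2 + \<beta> 3)" using assms by (simp add: sum_3)
  then show ?thesis by (simp add: sum_3 abc algebra_simps)
qed

lemma bary_base: "bary (base_triangle j) i = (if i = j then 1 else 0)"
  using exhaust_3[of i] exhaust_3[of j] by (auto simp: bary_def base_triangle_nth)

lemma bary_combination:
  "(\<Sum>j\<in>UNIV. \<beta> j) = 1 \<Longrightarrow> bary (\<Sum>j\<in>UNIV. \<beta> j *\<^sub>R base_triangle j) i = \<beta> i"
  using exhaust_3[of i] by (subst bary_affine) (auto simp: bary_base sum_3)

lemma bary_affine_map: "bary (affine_map A x) i = (\<Sum>j\<in>UNIV. bary x j * bary (A j) i)"
  unfolding affine_map_def by (rule bary_affine) simp

lemma affine_map_affine_map: "affine_map (\<lambda>i. affine_map U (V i)) x = affine_map U (affine_map V x)"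
proof -
  have "affine_map (\<lambda>i. affine_map U (V i)) x = (\<Sum>j\<in>UNIV. \<Sum>i\<in>UNIV. (bary x i * bary (V i) j) *\<^sub>R U j)"
    unfolding affine_map_def by (subst sum.swap) (simp add: scaleR_sum_right)
  also have "\<dots> = affine_map U (affine_map V x)"
    by (simp add: affine_map_def[of U] bary_affine_map scaleR_sum_left)
  finally show ?thesis .
qed

lemma affine_map_vertex [simp]: "affine_map A (base_triangle i) = A i"
  using exhaust_3[of i] by (auto simp: affine_map_def bary_base sum_3)

lemma base_region_iff: "x \<in> base_region \<longleftrightarrow> (\<forall>i. 0 \<le> bary x i)"
proof -
  have "range base_triangle = base_triangle ` {1, 2, 3}" by (auto simp: UNIV_3)
  then have hull: "base_region = {u *\<^sub>R base_triangle 1 + v *\<^sub>R base_triangle 2 + w *\<^sub>R base_triangle 3 | u v w.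
     0 \<le> u \<and> 0 \<le> v \<and> 0 \<le> w \<and> u + v + w = 1}"
    by (simp add: full_triangle_def convex_hull_3)
  show ?thesis
  proof
    assume "x \<in> base_region"
    then obtain u v w where x: "x = u *\<^sub>R base_triangle 1 + v *\<^sub>R base_triangle 2 + w *\<^sub>R base_triangle 3"
      "0 \<le> u" "0 \<le> v" "0 \<le> w" "u + v + w = 1" using hull by auto
    then have "bary x i = triple u v w i" for i
      using bary_combination[of "triple u v w" i] by (simp add: sum_3)
    then show "\<forall>i. 0 \<le> bary x i" using x by (auto simp: all_3_iff)
  next
    assume "\<forall>i. 0 \<le> bary x i"
    moreover have "x = bary x 1 *\<^sub>R base_triangle 1 + bary x 2 *\<^sub>R base_triangle 2 + bary x 3 *\<^sub>R base_triangle 3"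
      using bary_reconstruct[of x] by (simp add: sum_3)
    ultimately show "x \<in> base_region" unfolding hull using bary_sum3[of x] by blast
  qed
qed

lemma base_region_le_1: "x \<in> base_region \<Longrightarrow> bary x i \<le> 1"
  using bary_sum3[of x] exhaust_3[of i] unfolding base_region_iff all_3_iff by auto

lemma triangle_map_eq: "x \<in> base_region \<Longrightarrow> triangle_map A x = affine_map A x"
proof -
  assume x: "x \<in> base_region"
  show ?thesis unfolding triangle_map_def
  proof (rule the_equality)
    have "bary x \<in> bary_coords"
      using x base_region_le_1[OF x] by (auto simp: bary_coords_def base_region_iff)
    then show "\<exists>\<alpha>\<in>bary_coords. x = (\<Sum>i\<in>UNIV. \<alpha> i *\<^sub>R base_triangle i) \<and> affine_map A x = (\<Sum>i\<in>UNIV. \<alpha> i *\<^sub>R A i)"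
      by (intro bexI[of _ "bary x"]) (simp_all add: bary_reconstruct affine_map_def)
  next
    fix y assume "\<exists>\<alpha>\<in>bary_coords. x = (\<Sum>i\<in>UNIV. \<alpha> i *\<^sub>R base_triangle i) \<and> y = (\<Sum>i\<in>UNIV. \<alpha> i *\<^sub>R A i)"
    then obtain \<alpha> where \<alpha>: "\<alpha> \<in> bary_coords" "x = (\<Sum>i\<in>UNIV. \<alpha> i *\<^sub>R base_triangle i)" "y = (\<Sum>i\<in>UNIV. \<alpha> i *\<^sub>R A i)"
      by blast
    then have "bary x = \<alpha>" using bary_combination[of \<alpha>] by (auto simp: bary_coords_def)
    then show "y = affine_map A x" using \<alpha>(3) by (simp add: affine_map_def)
  qed
qed

lemma full_triangle_eq: "full_triangle A = affine_map A ` base_region"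
proof -
  have hull: "full_triangle A = {u *\<^sub>R A 1 + v *\<^sub>R A 2 + w *\<^sub>R A 3 | u v w.
     0 \<le> u \<and> 0 \<le> v \<and> 0 \<le> w \<and> u + v + w = 1}"
  proof -
    have "range A = A ` {1, 2, 3}" by (auto simp: UNIV_3)
    then show ?thesis by (simp add: full_triangle_def convex_hull_3)
  qed
  show ?thesis
  proof safe
    fix x assume "x \<in> full_triangle A"
    then obtain u v w where x: "x = u *\<^sub>R A 1 + v *\<^sub>R A 2 + w *\<^sub>R A 3"
      "0 \<le> u" "0 \<le> v" "0 \<le> w" "u + v + w = 1" using hull by auto
    let ?z = "\<Sum>i\<in>UNIV. triple u v w i *\<^sub>R base_triangle i"
    have b: "bary ?z i = triple u v w i" for i using x by (intro bary_combination) (simp add: sum_3)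
    have "?z \<in> base_region" using x unfolding base_region_iff b by (simp add: all_3_iff)
    moreover have "affine_map A ?z = x" unfolding affine_map_def b by (simp add: sum_3 x)
    ultimately show "x \<in> affine_map A ` base_region" by blast
  next
    fix x assume "x \<in> base_region"
    then show "affine_map A x \<in> full_triangle A"
      unfolding hull affine_map_def base_region_iff using bary_sum3[of x] by (force simp: sum_3)
  qed
qed

lemma convex_base_region: "convex base_region" by (simp add: full_triangle_def)

lemma compact_base_region: "compact base_region"
  by (simp add: full_triangle_def finite_imp_compact_convex_hull)

lemma vertex_in_base_region [simp]: "base_triangle i \<in> base_region"
  by (simp add: base_region_iff bary_base)

lemma subtriangle_eq:
  assumes "range V \<subseteq> base_region"
  shows "subtriangle U V = (\<lambda>i. affine_map U (V i))"
  using assms unfolding subtriangle_def by (intro ext triangle_map_eq) auto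

lemma affine_map_subtriangle:
  "range V \<subseteq> base_region \<Longrightarrow> affine_map (subtriangle U V) x = affine_map U (affine_map V x)"
  by (simp add: subtriangle_eq affine_map_affine_map)

lemma affine_map_in_base_region:
  assumes "range V \<subseteq> base_region" "x \<in> base_region"
  shows "affine_map V x \<in> base_region"
proof -
  have "full_triangle V \<subseteq> base_region"
    using assms(1) convex_base_region by (simp add: full_triangle_def hull_minimal)
  then show ?thesis using assms(2) by (auto simp: full_triangle_eq[of V])
qed

lemma range_subtriangle:
  assumes "range U \<subseteq> base_region" "range V \<subseteq> base_region"
  shows "range (subtriangle U V) \<subseteq> base_region"
  using assms by (auto simp: subtriangle_eq intro!: affine_map_in_base_region)

lemma subtriangle_assoc:
  assumes V: "range V \<subseteq> base_region" and W: "range W \<subseteq> base_region"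
  shows "subtriangle (subtriangle U V) W = subtriangle U (subtriangle V W)"
proof
  fix i
  have "subtriangle (subtriangle U V) W i = affine_map U (affine_map V (W i))"
    by (simp only: subtriangle_eq[OF W] affine_map_subtriangle[OF V])
  also have "\<dots> = affine_map U (subtriangle V W i)" by (simp only: subtriangle_eq[OF W])
  also have "\<dots> = subtriangle U (subtriangle V W) i"
    by (simp only: subtriangle_eq[OF range_subtriangle[OF V W]])
  finally show "subtriangle (subtriangle U V) W i = subtriangle U (subtriangle V W) i" .
qed

lemma full_subtriangle:
  "range V \<subseteq> base_region \<Longrightarrow> full_triangle (subtriangle U V) = affine_map U ` full_triangle V"
  by (simp add: full_triangle_eq[of V] full_triangle_eq[of "subtriangle U V"] image_image affine_map_subtriangle)

section \<open>Cell maps in barycentric coordinates\<close>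

lemma affine_map_up:
  "affine_map (up_triangle m k) x = (1 / real m) *\<^sub>R ((\<Sum>j\<in>UNIV. of_int (k j) *\<^sub>R base_triangle j) + x)"
proof -
  let ?K = "\<Sum>j\<in>UNIV. of_int (k j) *\<^sub>R base_triangle j"
  have "affine_map (up_triangle m k) x = (1 / real m) *\<^sub>R (\<Sum>i\<in>UNIV. bary x i *\<^sub>R (?K + base_triangle i))"
    unfolding affine_map_def up_triangle_def by (simp add: scaleR_sum_right mult.commute)
  also have "(\<Sum>i\<in>UNIV. bary x i *\<^sub>R (?K + base_triangle i)) = ?K + x"
    by (simp add: scaleR_right_distrib sum.distrib bary_reconstruct flip: scaleR_sum_left)
  finally show ?thesis .
qed

lemma affine_map_down:
  "affine_map (down_triangle m k) x =
     (1 / real m) *\<^sub>R ((\<Sum>j\<in>UNIV. of_int (k j) *\<^sub>R base_triangle j) + (\<Sum>j\<in>UNIV. base_triangle j) - x)"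
proof -
  let ?K = "(\<Sum>j\<in>UNIV. of_int (k j) *\<^sub>R base_triangle j) + (\<Sum>j\<in>UNIV. base_triangle j)"
  have "affine_map (down_triangle m k) x = (1 / real m) *\<^sub>R (\<Sum>i\<in>UNIV. bary x i *\<^sub>R (?K - base_triangle i))"
    unfolding affine_map_def down_triangle_def by (simp add: scaleR_sum_right mult.commute)
  also have "(\<Sum>i\<in>UNIV. bary x i *\<^sub>R (?K - base_triangle i)) = ?K - x"
    by (simp add: scaleR_right_diff_distrib sum_subtractf bary_reconstruct flip: scaleR_sum_left)
  finally show ?thesis .
qed

text \<open>The source of the contact arguments: a coincidence of points in two cells turns into
  equations between integers and coordinates in [0, 1]. For downward cells the coordinate enters
  with a minus sign.\<close>

lemma bary_up:
  assumes "k \<in> up_index m" "2 \<le> m"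
  shows "bary (affine_map (up_triangle m k) x) i = (of_int (k i) + bary x i) / real m"
proof -
  let ?\<beta> = "\<lambda>i. (of_int (k i) + bary x i) / real m"
  have "(\<Sum>i\<in>UNIV. ?\<beta> i) = 1"
  proof -
    have "k 1 + k 2 + k 3 = int m - 1" using assms by (simp add: up_index_def sum_3)
    then have "of_int (k 1) + of_int (k 2) + of_int (k 3) = real m - 1" by linarith
    then show ?thesis using assms(2) bary_sum3[of x] by (simp add: sum_3 flip: add_divide_distrib)
  qed
  moreover have "affine_map (up_triangle m k) x = (\<Sum>i\<in>UNIV. ?\<beta> i *\<^sub>R base_triangle i)"
  proof -
    have "(\<Sum>i\<in>UNIV. ?\<beta> i *\<^sub>R base_triangle i) = (1 / real m) *\<^sub>R (\<Sum>i\<in>UNIV. of_int (k i) *\<^sub>R base_triangle i + bary x i *\<^sub>R base_triangle i)"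
      by (simp add: scaleR_sum_right scaleR_left_distrib[symmetric])
    also have "\<dots> = affine_map (up_triangle m k) x"
      by (simp only: affine_map_up sum.distrib bary_reconstruct)
    finally show ?thesis by simp
  qed
  ultimately show ?thesis by (simp only: bary_combination)
qed

lemma bary_down:
  assumes "k \<in> down_index m" "2 \<le> m"
  shows "bary (affine_map (down_triangle m k) x) i = (of_int (k i) + 1 - bary x i) / real m"
proof -
  let ?\<beta> = "\<lambda>i. (of_int (k i) + 1 - bary x i) / real m"
  have "(\<Sum>i\<in>UNIV. ?\<beta> i) = 1"
  proof -
    have "k 1 + k 2 + k 3 = int m - 2" using assms by (simp add: down_index_def sum_3)
    then have "of_int (k 1) + of_int (k 2) + of_int (k 3) = real m - 2" by linarith
    then show ?thesis using assms(2) bary_sum3[of x] by (simp add: sum_3 flip: add_divide_distrib)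
  qed
  moreover have "affine_map (down_triangle m k) x = (\<Sum>i\<in>UNIV. ?\<beta> i *\<^sub>R base_triangle i)"
  proof -
    have "(\<Sum>i\<in>UNIV. ?\<beta> i *\<^sub>R base_triangle i) = (1 / real m) *\<^sub>R (\<Sum>i\<in>UNIV. of_int (k i) *\<^sub>R base_triangle i + base_triangle i - bary x i *\<^sub>R base_triangle i)"
      unfolding scaleR_sum_right
      by (rule sum.cong[OF refl]) (simp add: algebra_simps add_divide_distrib diff_divide_distrib)
    also have "\<dots> = affine_map (down_triangle m k) x"
      by (simp only: affine_map_down sum.distrib sum_subtractf bary_reconstruct)
    finally show ?thesis by simp
  qed
  ultimately show ?thesis by (simp only: bary_combination)
qed

lemma range_up: "k \<in> up_index m \<Longrightarrow> 2 \<le> m \<Longrightarrow> range (up_triangle m k) \<subseteq> base_region"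
proof safe
  fix i assume k: "k \<in> up_index m" "2 \<le> m"
  have "0 \<le> bary (affine_map (up_triangle m k) (base_triangle i)) j" for j
    unfolding bary_up[OF k] using k by (simp add: up_index_def bary_base)
  then show "up_triangle m k i \<in> base_region" by (simp add: base_region_iff)
qed

lemma range_down: "k \<in> down_index m \<Longrightarrow> 2 \<le> m \<Longrightarrow> range (down_triangle m k) \<subseteq> base_region"
proof safe
  fix i assume k: "k \<in> down_index m" "2 \<le> m"
  have "0 \<le> bary (affine_map (down_triangle m k) (base_triangle i)) j" for j
    unfolding bary_down[OF k] using k by (simp add: down_index_def bary_base)
  then show "down_triangle m k i \<in> base_region" by (simp add: base_region_iff)
qed

lemma up_triangle_inject:
  assumes "k \<in> up_index m" "k' \<in> up_index m" "2 \<le> m" "up_triangle m k = up_triangle m k'"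
  shows "k = k'"
proof
  fix i
  have "(of_int (k i) + bary 0 i) / real m = (of_int (k' i) + bary 0 i) / real m"
    using bary_up[OF assms(1,3), of 0 i] bary_up[OF assms(2,3), of 0 i] assms(4) by metis
  then show "k i = k' i" using assms(3) by (simp add: divide_cancel_right)
qed

lemma down_triangle_inject:
  assumes "k \<in> down_index m" "k' \<in> down_index m" "2 \<le> m" "down_triangle m k = down_triangle m k'"
  shows "k = k'"
proof
  fix i
  have "(of_int (k i) + 1 - bary 0 i) / real m = (of_int (k' i) + 1 - bary 0 i) / real m"
    using bary_down[OF assms(1,3), of 0 i] bary_down[OF assms(2,3), of 0 i] assms(4) by metis
  then show "k i = k' i" using assms(3) by (simp add: divide_cancel_right)
qed

lemma up_down_disjoint:
  assumes "2 \<le> m" shows "up_triangles m \<inter> down_triangles m = {}"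
proof -
  have False if "k \<in> up_index m" "k' \<in> down_index m" "up_triangle m k = down_triangle m k'" for k k'
  proof -
    \<comment> \<open>The left side increases with the first coordinate and the right side
      decreases, so two vertices refute the equation.\<close>
    have "(of_int (k 1) + bary x 1) = (of_int (k' 1) + 1 - bary x 1)" for x
      using bary_up[OF that(1) assms, of x 1] bary_down[OF that(2) assms, of x 1] that(3) assms by simp
    from this[of "base_triangle 1"] this[of "base_triangle 2"] show False by (simp add: bary_base)
  qed
  then show ?thesis by (auto simp: up_triangles_def down_triangles_def)
qed

lemma finite_up_index: "finite (up_index m)"
proof (rule finite_subset)
  show "up_index m \<subseteq> PiE UNIV (\<lambda>_. {0..int m})"
  proof
    fix k assume "k \<in> up_index m"
    then have "k 1 + k 2 + k 3 = int m - 1" "\<And>i. 0 \<le> k i" by (auto simp: up_index_def sum_3)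
    then have "k i \<le> int m" for i using exhaust_3[of i] by (smt (verit))
    then show "k \<in> PiE UNIV (\<lambda>_. {0..int m})" using \<open>\<And>i. 0 \<le> k i\<close> by auto
  qed
qed (auto intro: finite_PiE)

lemma finite_down_index: "finite (down_index m)"
proof (rule finite_subset)
  show "down_index m \<subseteq> PiE UNIV (\<lambda>_. {0..int m})"
  proof
    fix k assume "k \<in> down_index m"
    then have "k 1 + k 2 + k 3 = int m - 2" "\<And>i. 0 \<le> k i" by (auto simp: down_index_def sum_3)
    then have "k i \<le> int m" for i using exhaust_3[of i] by (smt (verit))
    then show "k \<in> PiE UNIV (\<lambda>_. {0..int m})" using \<open>\<And>i. 0 \<le> k i\<close> by auto
  qed
qed (auto intro: finite_PiE)

lemma affine_map_homothety:
  assumes "V \<in> up_triangles m \<union> down_triangles m"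
  shows "dist (affine_map V x) (affine_map V y) = (1 / real m) * dist x y"
  using assms by (auto simp: up_triangles_def down_triangles_def affine_map_up affine_map_down dist_norm
      simp flip: scaleR_diff_right intro: norm_minus_commute)

lemma affine_map_left_inverse:
  assumes "V \<in> up_triangles m \<union> down_triangles m" "2 \<le> m"
  obtains h where "continuous_on UNIV h" "\<And>x. h (affine_map V x) = x"
proof -
  consider k where "V = up_triangle m k" | k where "V = down_triangle m k"
    using assms(1) by (auto simp: up_triangles_def down_triangles_def)
  then show thesis
  proof cases
    case (1 k)
    show ?thesis
      by (rule that[of "\<lambda>y. real m *\<^sub>R y - (\<Sum>j\<in>UNIV. of_int (k j) *\<^sub>R base_triangle j)"])
        (use assms(2) in \<open>auto simp: 1 affine_map_up intro!: continuous_intros\<close>)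
  next
    case (2 k)
    show ?thesis
      by (rule that[of "\<lambda>y. (\<Sum>j\<in>UNIV. of_int (k j) *\<^sub>R base_triangle j) + (\<Sum>j\<in>UNIV. base_triangle j) - real m *\<^sub>R y"])
        (use assms(2) in \<open>auto simp: 2 affine_map_down intro!: continuous_intros\<close>)
  qed
qed

section \<open>Self-similarity of the fractals\<close>

text \<open>The colours are encoded as booleans, with \<^const>\<open>True\<close> for white; likewise the directions, with
  \<^const>\<open>True\<close> for up.  Passing through a downward triangle exchanges both colours and both directions.\<close>

definition pattern_part :: "patterns \<Rightarrow> bool \<Rightarrow> bool \<Rightarrow> triangle set" where
  "pattern_part S c u = (if c then (if u then white_up S else white_down S) else (if u then yellow_up S else yellow_down S))"

definition level_part :: "patterns \<Rightarrow> bool \<Rightarrow> bool \<Rightarrow> nat \<Rightarrow> triangle set" where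
  "level_part S c u n = (if c then (if u then white_up_level S n else white_down_level S n)
     else (if u then yellow_up_level S n else yellow_down_level S n))"

definition fractal :: "patterns \<Rightarrow> bool \<Rightarrow> (real^2) set" where
  "fractal S c = (if c then white_fractal S else yellow_fractal S)"

definition level_region :: "patterns \<Rightarrow> bool \<Rightarrow> nat \<Rightarrow> (real^2) set" where
  "level_region S c n = (\<Union>U \<in> level_part S c True (Suc n) \<union> level_part S c False (Suc n). full_triangle U)"

lemma fractal_eq: "fractal S c = (\<Inter>n. level_region S c n)"
proof -
  have "{1::nat..} = range Suc" by (auto simp: image_iff dest: Suc_le_D)
  then show ?thesis
    by (simp add: fractal_def white_fractal_def yellow_fractal_def level_region_def level_part_def)
qed

lemma level_part_1: "level_part S c u (Suc 0) = pattern_part S c u"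
  by (simp add: level_part_def pattern_part_def)

text \<open>For upward \<open>u'\<close> the booleans \<open>c = u'\<close> and
  \<open>u = u'\<close> are \<open>c\<close> and \<open>u\<close>, for downward \<open>u'\<close>
  their negations. So one equation covers the four recursions.\<close>

lemma level_part_Suc:
  "level_part S c u (Suc (Suc n)) =
     {subtriangle U V | U V u'. U \<in> level_part S c u' (Suc n) \<and> V \<in> pattern_part S (c = u') (u = u')}"
  by (cases c; cases u) (auto simp: level_part_def pattern_part_def)

locale triangular_patterns =
  fixes m :: nat and S :: patterns
  assumes patterns: "patterns_system m S"
begin

lemma m_ge_2: "2 \<le> m"
  using patterns by (simp add: patterns_system_def)

lemma pattern_part_subset: "pattern_part S c True \<subseteq> up_triangles m" "pattern_part S c False \<subseteq> down_triangles m"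
  using patterns by (auto simp: patterns_system_def pattern_part_def)

definition cells :: "bool \<Rightarrow> triangle set" where
  "cells c = pattern_part S c True \<union> pattern_part S c False"

text \<open>The colour of the fractal that is copied into the cell \<open>V\<close> of the fractal
  of colour \<open>c\<close>.\<close>

definition child :: "bool \<Rightarrow> triangle \<Rightarrow> bool" where
  "child c V \<longleftrightarrow> c = (V \<in> up_triangles m)"

lemma cells_subset: "cells c \<subseteq> up_triangles m \<union> down_triangles m"
  using pattern_part_subset by (auto simp: cells_def)

lemma pattern_part_range: "V \<in> pattern_part S c u \<Longrightarrow> range V \<subseteq> base_region"
  using pattern_part_subset[of c] m_ge_2
  by (cases u) (auto simp: up_triangles_def down_triangles_def dest!: subsetD range_up range_down)

lemma cells_range: "V \<in> cells c \<Longrightarrow> range V \<subseteq> base_region"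
  unfolding cells_def using pattern_part_range by blast

lemma child_eq: "V \<in> pattern_part S c u \<Longrightarrow> child c' V = (c' = u)"
  using pattern_part_subset[of c] up_down_disjoint[OF m_ge_2] by (cases u) (auto simp: child_def)

lemma cells_iff: "V \<in> cells c \<longleftrightarrow> (\<exists>u. V \<in> pattern_part S c u)"
  by (auto simp: cells_def) (metis (full_types))

lemma finite_cells: "finite (cells c)"
  using cells_subset by (rule finite_subset) (simp add: up_triangles_def down_triangles_def finite_up_index finite_down_index)

lemma level_part_range: "U \<in> level_part S c u (Suc n) \<Longrightarrow> range U \<subseteq> base_region"
proof (induction n arbitrary: c u U)
  case (Suc n)
  then obtain U' V u' where "U = subtriangle U' V" "U' \<in> level_part S c u' (Suc n)" "V \<in> pattern_part S (c = u') (u = u')"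
    unfolding level_part_Suc by blast
  then show ?case using range_subtriangle[OF Suc.IH pattern_part_range] by simp
qed (simp add: level_part_1 pattern_part_range)

text \<open>The levels are defined by refining the innermost triangle, but self-similarity splits
  off the outermost one. Both agree because composition of triangles and equality of booleans are
  associative.\<close>

lemma level_part_Suc':
  "level_part S c u (Suc (Suc n)) =
     {subtriangle V U | V U u'. V \<in> pattern_part S c u' \<and> U \<in> level_part S (c = u') (u = u') (Suc n)}"
proof (induction n arbitrary: c u)
  case 0
  show ?case by (simp add: level_part_Suc level_part_1)
next
  case (Suc n)
  show ?case (is "?l = ?r")
  proof safe
    fix X assume "X \<in> ?l"
    then obtain U W u' where X: "X = subtriangle U W" "U \<in> level_part S c u' (Suc (Suc n))"
      "W \<in> pattern_part S (c = u') (u = u')" unfolding level_part_Suc[of S c u "Suc n"] by blast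
    obtain V U' u'' where U: "U = subtriangle V U'" "V \<in> pattern_part S c u''"
      "U' \<in> level_part S (c = u'') (u' = u'') (Suc n)" using X(2) unfolding Suc.IH by blast
    have eqs: "((c = u'') = (u' = u'')) = (c = u')" "((u = u'') = (u' = u'')) = (u = u')" by auto
    have "subtriangle U' W \<in> level_part S (c = u'') (u = u'') (Suc (Suc n))"
      unfolding level_part_Suc[of S "c = u''"]
      by (rule CollectI, rule exI[of _ U'], rule exI[of _ W], rule exI[of _ "u' = u''"])
        (simp add: eqs U(3) X(3))
    moreover have "X = subtriangle V (subtriangle U' W)"
      using subtriangle_assoc level_part_range[OF U(3)] pattern_part_range[OF X(3)] X(1) U(1) by simp
    ultimately show "\<exists>V U u'. X = subtriangle V U \<and> V \<in> pattern_part S c u' \<and> U \<in> level_part S (c = u') (u = u') (Suc (Suc n))"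
      using U(2) by blast
  next
    fix V Y u'' assume V: "V \<in> pattern_part S c u''" and "Y \<in> level_part S (c = u'') (u = u'') (Suc (Suc n))"
    then obtain U' W u3 where Y: "Y = subtriangle U' W" "U' \<in> level_part S (c = u'') u3 (Suc n)"
      "W \<in> pattern_part S ((c = u'') = u3) ((u = u'') = u3)" unfolding level_part_Suc[of S "c = u''"] by blast
    define u' where "u' = (u3 = u'')"
    have eq: "u3 = (u' = u'')" "((c = u'') = (u' = u'')) = (c = u')" "((u = u'') = (u' = u'')) = (u = u')"
      by (auto simp: u'_def)
    have "subtriangle V U' \<in> level_part S c u' (Suc (Suc n))"
      unfolding Suc.IH using V Y(2) eq(1) by blast
    moreover have "W \<in> pattern_part S (c = u') (u = u')" using Y(3) unfolding eq .
    moreover have "subtriangle V Y = subtriangle (subtriangle V U') W"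
      using subtriangle_assoc level_part_range[OF Y(2)] pattern_part_range[OF Y(3)] Y(1) by simp
    ultimately show "subtriangle V Y \<in> level_part S c u (Suc (Suc (Suc n)))"
      unfolding level_part_Suc[of S c u "Suc n"] by blast
  qed
qed

lemma level_region_0: "level_region S c 0 = (\<Union>V\<in>cells c. affine_map V ` base_region)"
  by (simp add: level_region_def level_part_1 cells_def full_triangle_eq[symmetric])

lemma level_region_Suc:
  "level_region S c (Suc n) = (\<Union>V\<in>cells c. affine_map V ` level_region S (child c V) n)"
proof -
  have full: "full_triangle (subtriangle V U) = affine_map V ` full_triangle U"
    if "U \<in> level_part S c' u (Suc n)" for V U c' u
    using level_part_range[OF that] by (rule full_subtriangle)
  show ?thesis
  proof (rule Set.set_eqI)
    fix x
    have "x \<in> level_region S c (Suc n) \<longleftrightarrow> (\<exists>u. \<exists>U\<in>level_part S c u (Suc (Suc n)). x \<in> full_triangle U)"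
      by (auto simp: level_region_def) (metis (full_types))
    also have "\<dots> \<longleftrightarrow> (\<exists>u u' V U. V \<in> pattern_part S c u' \<and> U \<in> level_part S (c = u') (u = u') (Suc n) \<and>
        x \<in> affine_map V ` full_triangle U)"
      unfolding level_part_Suc' using full by blast
    also have "\<dots> \<longleftrightarrow> (\<exists>u' V. V \<in> pattern_part S c u' \<and> (\<exists>w U. U \<in> level_part S (c = u') w (Suc n) \<and>
        x \<in> affine_map V ` full_triangle U))" (is "?A \<longleftrightarrow> ?B")
    proof
      assume ?B
      then obtain u' V w U where *: "V \<in> pattern_part S c u'" "U \<in> level_part S (c = u') w (Suc n)"
        "x \<in> affine_map V ` full_triangle U" by blast
      have e: "((w = u') = u') = w" by auto
      show ?A
        by (rule exI[of _ "w = u'"], rule exI[of _ u'], rule exI[of _ V], rule exI[of _ U]) (simp add: * e)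
    qed blast
    also have "\<dots> \<longleftrightarrow> (\<exists>u' V. V \<in> pattern_part S c u' \<and> x \<in> affine_map V ` level_region S (c = u') n)"
    proof -
      have "(\<exists>w U. U \<in> level_part S c' w (Suc n) \<and> x \<in> affine_map V ` full_triangle U) \<longleftrightarrow>
        x \<in> affine_map V ` level_region S c' n" for c' V
      proof -
        have "level_region S c' n = (\<Union>w. \<Union>U\<in>level_part S c' w (Suc n). full_triangle U)"
          by (auto simp: level_region_def UNIV_bool)
        then show ?thesis by (simp only: image_UN) blast
      qed
      then show ?thesis by simp
    qed
    also have "\<dots> \<longleftrightarrow> x \<in> (\<Union>V\<in>cells c. affine_map V ` level_region S (child c V) n)"
    proof -
      have "(V \<in> pattern_part S c u' \<and> x \<in> affine_map V ` level_region S (c = u') n) \<longleftrightarrow>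
          (V \<in> pattern_part S c u' \<and> x \<in> affine_map V ` level_region S (child c V) n)" for u' V
        by (cases "V \<in> pattern_part S c u'") (simp_all add: child_eq)
      then show ?thesis unfolding UN_iff Bex_def cells_iff by blast
    qed
    finally show "x \<in> level_region S c (Suc n) \<longleftrightarrow> x \<in> (\<Union>V\<in>cells c. affine_map V ` level_region S (child c V) n)" .
  qed
qed

lemma cell_maps_base: "V \<in> cells c \<Longrightarrow> affine_map V ` base_region \<subseteq> base_region"
  using affine_map_in_base_region cells_range by blast

lemma level_region_subset: "level_region S c n \<subseteq> base_region"
  using cell_maps_base by (induction n arbitrary: c) (fastforce simp: level_region_0 level_region_Suc)+

lemma level_region_decreasing: "level_region S c (Suc n) \<subseteq> level_region S c n"
proof (induction n arbitrary: c)
  case 0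
  show ?case unfolding level_region_Suc level_region_0[of c] using level_region_subset by blast
next
  case (Suc n)
  show ?case unfolding level_region_Suc[of c "Suc n"] level_region_Suc[of c n] using Suc by blast
qed

lemma cell_homothety: "V \<in> cells c \<Longrightarrow> dist (affine_map V x) (affine_map V y) = (1 / real m) * dist x y"
  using affine_map_homothety cells_subset by blast

lemma cell_inj: "V \<in> cells c \<Longrightarrow> inj (affine_map V)"
  using cell_homothety m_ge_2 by (intro injI) (metis dist_eq_0_iff divide_eq_0_iff mult_eq_0_iff of_nat_eq_0_iff not_numeral_le_zero zero_neq_one)

lemma fractal_subset: "fractal S c \<subseteq> base_region"
  unfolding fractal_eq using level_region_subset by blast

lemma fractal_self_similar: "fractal S c = (\<Union>V\<in>cells c. affine_map V ` fractal S (child c V))"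
proof safe
  fix x assume x: "x \<in> fractal S c"
  \<comment> \<open>One cell serves for all levels: there are finitely many cells and the regions
    decrease, so if every cell failed at some level, all would fail at the largest of these
    levels.\<close>
  have "\<exists>V\<in>cells c. \<forall>n. x \<in> affine_map V ` level_region S (child c V) n"
  proof (rule ccontr)
    assume "\<not> ?thesis"
    then obtain N where N: "\<And>V. V \<in> cells c \<Longrightarrow> x \<notin> affine_map V ` level_region S (child c V) (N V)" by metis
    define M where "M = Max (N ` cells c)"
    have "x \<in> level_region S c (Suc M)" using x by (auto simp: fractal_eq)
    then obtain V where V: "V \<in> cells c" "x \<in> affine_map V ` level_region S (child c V) M"
      by (auto simp: level_region_Suc)
    have "N V \<le> M" using V(1) finite_cells by (auto simp: M_def)
    then have "level_region S (child c V) M \<subseteq> level_region S (child c V) (N V)"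
      using lift_Suc_antimono_le[of "level_region S (child c V)"] level_region_decreasing by blast
    then show False using N V by blast
  qed
  then obtain V where V: "V \<in> cells c" "\<And>n. x \<in> affine_map V ` level_region S (child c V) n" by blast
  obtain y where y: "x = affine_map V y" "y \<in> level_region S (child c V) 0" using V(2) by blast
  have "y \<in> level_region S (child c V) n" for n
    using V(2)[of n] y(1) cell_inj[OF V(1)] by (auto dest: injD)
  then show "x \<in> (\<Union>V\<in>cells c. affine_map V ` fractal S (child c V))"
    using V(1) y(1) by (auto simp: fractal_eq)
next
  fix V y assume V: "V \<in> cells c" and y: "y \<in> fractal S (child c V)"
  have "affine_map V y \<in> level_region S c n" for n
  proof (cases n)
    case 0
    then show ?thesis using V y fractal_subset by (auto simp: level_region_0)
  next
    case (Suc n')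
    then show ?thesis using V y by (auto simp: level_region_Suc fractal_eq)
  qed
  then show "affine_map V y \<in> fractal S c" by (simp add: fractal_eq)
qed

lemma compact_fractal: "compact (fractal S c)"
proof -
  have "compact (affine_map V ` K)" if "V \<in> cells c" "compact K" for V c K
  proof -
    have "(1 / real m)-lipschitz_on UNIV (affine_map V)"
      using cell_homothety[OF that(1)] by (intro lipschitz_onI) auto
    then have "continuous_on UNIV (affine_map V)" by (rule lipschitz_on_continuous_on)
    then show ?thesis using that(2) by (meson compact_continuous_image continuous_on_subset subset_UNIV)
  qed
  then have "compact (level_region S c n)" for n
    by (induction n arbitrary: c)
      (auto simp: level_region_0 level_region_Suc finite_cells compact_base_region intro!: compact_UN)
  then show ?thesis unfolding fractal_eq by (intro compact_Inter) auto
qed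

text \<open>Upward cells keep the colour, so their fixed points survive at every level. Exit points
  and corners are found in the fractals this way.\<close>

lemma fixed_point_in_fractal:
  assumes "V \<in> pattern_part S c True" "affine_map V x = x" "x \<in> base_region"
  shows "x \<in> fractal S c"
proof -
  have V: "V \<in> cells c" "child c V = c" using assms(1) child_eq by (auto simp: cells_iff)
  have "x \<in> level_region S c n" for n
  proof (induction n)
    case 0
    show ?case using V assms by (force simp: level_region_0)
  next
    case (Suc n)
    then show ?case using V assms by (force simp: level_region_Suc)
  qed
  then show ?thesis by (simp add: fractal_eq)
qed

end

section \<open>Exits and corners\<close>

lemma other_indices:
  fixes j :: 3
  obtains i l where "i \<noteq> j" "l \<noteq> j" "i \<noteq> l" "\<And>h. h = j \<or> h = i \<or> h = l"
proof -
  consider "j = 1" | "j = 2" | "j = 3" using exhaust_3 by blast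
  then show thesis
  proof cases
    case 1 then show ?thesis using that[of 2 3] exhaust_3 by auto
  next
    case 2 then show ?thesis using that[of 1 3] exhaust_3 by auto
  next
    case 3 then show ?thesis using that[of 1 2] exhaust_3 by auto
  qed
qed

lemma sum_distinct_3:
  fixes i j l :: 3
  assumes "i \<noteq> j" "l \<noteq> j" "i \<noteq> l"
  shows "(\<Sum>h\<in>UNIV. f h) = f j + f i + (f l :: 'a::comm_monoid_add)"
proof -
  have U: "UNIV = {j, i, l}" using exhaust_3[of i] exhaust_3[of j] exhaust_3[of l] assms by (auto simp: UNIV_3)
  have "sum f UNIV = sum f {j, i, l}" by (simp only: U)
  also have "\<dots> = f j + f i + f l" using assms by (simp add: add.assoc)
  finally show ?thesis .
qed

lemma base_region_vertex:
  assumes "x \<in> base_region" "bary x i = 1"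
  shows "x = base_triangle i"
proof (rule bary_eqI)
  fix h
  obtain a b where ab: "a \<noteq> i" "b \<noteq> i" "a \<noteq> b" "\<And>h. h = i \<or> h = a \<or> h = b" by (rule other_indices[of i]) blast
  have "bary x i + bary x a + bary x b = 1" using sum_distinct_3[OF ab(1-3), of "bary x"] by simp
  moreover have "0 \<le> bary x a" "0 \<le> bary x b" using assms(1) by (simp_all add: base_region_iff)
  ultimately show "bary x h = bary (base_triangle i) h" using ab assms(2) by (auto simp: bary_base) (metis add_nonneg_eq_0_iff add_cancel_right_right add.assoc)+
qed

lemma base_region_edge_vertex:
  assumes "x \<in> base_region" "bary x j = 0" "i \<noteq> j" "bary x i \<in> \<int>"
  shows "\<exists>h. h \<noteq> j \<and> x = base_triangle h"
proof -
  obtain n where n: "bary x i = of_int n" using assms(4) by (elim Ints_cases)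
  have "0 \<le> bary x i" "bary x i \<le> 1" using assms(1) base_region_le_1 by (auto simp: base_region_iff)
  then have "n = 0 \<or> n = 1" using n by auto
  then show ?thesis
  proof
    assume "n = 1"
    then show ?thesis using n base_region_vertex[OF assms(1), of i] assms(3) by auto
  next
    assume "n = 0"
    obtain a b where ab: "a \<noteq> j" "b \<noteq> j" "a \<noteq> b" "\<And>h. h = j \<or> h = a \<or> h = b" by (rule other_indices[of j]) blast
    have "bary x j + bary x a + bary x b = 1" using sum_distinct_3[OF ab(1-3), of "bary x"] by simp
    then have "bary x a = 1 \<or> bary x b = 1" using \<open>n = 0\<close> n assms(2) ab(4)[of i] assms(3) by auto
    then show ?thesis using base_region_vertex[OF assms(1)] ab by blast
  qed
qed

text \<open>The integer is 0, 1 or 2. The value 1 means that the points are mirror images on side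
  \<open>j\<close>; the other values mean a common vertex.\<close>

lemma base_region_edge_pair:
  assumes "x \<in> base_region" "y \<in> base_region" "bary x j = 0" "bary y j = 0"
    and "i \<noteq> j" "bary x i + bary y i \<in> \<int>"
  shows "(\<forall>h. h \<noteq> j \<longrightarrow> bary x h + bary y h = 1) \<or> (\<exists>h. h \<noteq> j \<and> x = base_triangle h \<and> y = base_triangle h)"
proof -
  obtain n where n: "bary x i + bary y i = of_int n" using assms(6) by (elim Ints_cases)
  have b: "0 \<le> bary x h" "bary x h \<le> 1" "0 \<le> bary y h" "bary y h \<le> 1" for h
    using assms(1,2) base_region_le_1 by (auto simp: base_region_iff)
  have "n = 0 \<or> n = 1 \<or> n = 2" using n b[of i] by linarith
  obtain a' b' where ab': "a' \<noteq> j" "b' \<noteq> j" "a' \<noteq> b'" "\<And>h. h = j \<or> h = a' \<or> h = b'" by (rule other_indices[of j]) blast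
  obtain l where l: "l \<noteq> j" "i \<noteq> l" "\<And>h. h = j \<or> h = i \<or> h = l" using ab' assms(5) by metis
  have sx: "bary x j + bary x i + bary x l = 1" using sum_distinct_3[OF assms(5) l(1,2), of "bary x"] by simp
  have sy: "bary y j + bary y i + bary y l = 1" using sum_distinct_3[OF assms(5) l(1,2), of "bary y"] by simp
  show ?thesis using \<open>n = 0 \<or> n = 1 \<or> n = 2\<close>
  proof (elim disjE)
    assume "n = 0"
    then have "bary x l = 1" "bary y l = 1" using n b[of i] sx sy assms(3,4) by auto
    then show ?thesis using base_region_vertex assms(1,2) l(1) by blast
  next
    assume "n = 1"
    then have "bary x l + bary y l = 1" "bary x i + bary y i = 1" using n sx sy assms(3,4) by auto
    then show ?thesis using l(3) by metis
  next
    assume "n = 2"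
    then have "bary x i = 1" "bary y i = 1" using n b[of i] by auto
    then show ?thesis using base_region_vertex assms(1,2,5) by blast
  qed
qed

lemma neighbours_sym: "neighbours m j U V \<Longrightarrow> neighbours m j V U"
  by (auto simp: neighbours_def)

lemma adjacent_sym: "adjacent m U V \<Longrightarrow> adjacent m V U"
  unfolding adjacent_def using neighbours_sym by blast

lemma up_down_neighboursE:
  assumes "up_down_neighbours m j U V"
  obtains k k' where "k \<in> up_index m" "k' \<in> down_index m" "U = up_triangle m k" "V = down_triangle m k'"
    "\<And>i. k i = k' i + (if i = j then 1 else 0)"
proof -
  obtain k k' where k: "k \<in> up_index m" "k' \<in> down_index m" "U = up_triangle m k" "V = down_triangle m k'"
    "k j = k' j + 1" "\<And>i. i \<noteq> j \<Longrightarrow> k i = k' i"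
    using assms unfolding up_down_neighbours_def by blast
  show thesis by (rule that[OF k(1-4)]) (use k(5,6) in auto)
qed

context triangular_patterns
begin

lemma adjacent_irrefl: "\<not> adjacent m V V"
  using up_down_disjoint[OF m_ge_2]
  by (auto simp: adjacent_def neighbours_def up_triangles_def down_triangles_def elim!: up_down_neighboursE)

lemma up_down_neighbours_label:
  assumes "up_down_neighbours m j U V" "up_down_neighbours m j' U V"
  shows "j = j'"
proof -
  obtain k k' where k: "k \<in> up_index m" "k' \<in> down_index m" "U = up_triangle m k" "V = down_triangle m k'"
    "\<And>i. k i = k' i + (if i = j then 1 else 0)" using assms(1) by (rule up_down_neighboursE) blast
  obtain l l' where l: "l \<in> up_index m" "l' \<in> down_index m" "U = up_triangle m l" "V = down_triangle m l'"
    "\<And>i. l i = l' i + (if i = j' then 1 else 0)" using assms(2) by (rule up_down_neighboursE) blast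
  have "k = l" "k' = l'" using up_triangle_inject down_triangle_inject k l m_ge_2 by metis+
  then show ?thesis using k(5)[of j] l(5)[of j] by (auto split: if_splits)
qed

lemma up_down_neighbours_asym: "up_down_neighbours m j U V \<Longrightarrow> \<not> up_down_neighbours m j' V U"
  using up_down_disjoint[OF m_ge_2]
  by (auto simp: up_triangles_def down_triangles_def elim!: up_down_neighboursE)

lemma neighbours_label: "neighbours m j U V \<Longrightarrow> neighbours m j' U V \<Longrightarrow> j = j'"
  using up_down_neighbours_label up_down_neighbours_asym unfolding neighbours_def by blast

lemma edge_label_eq: "neighbours m j U V \<Longrightarrow> edge_label m U V = j"
  unfolding edge_label_def using neighbours_label by blast

lemma edge_label_neighbours: "adjacent m U V \<Longrightarrow> neighbours m (edge_label m U V) U V"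
  using edge_label_eq by (auto simp: adjacent_def)

lemma neighbours_child:
  assumes "neighbours m j U V"
  shows "child c V = (\<not> child c U)"
proof -
  have "(U \<in> up_triangles m) = (V \<notin> up_triangles m)"
    using assms up_down_disjoint[OF m_ge_2]
    by (auto simp: neighbours_def up_triangles_def down_triangles_def elim!: up_down_neighboursE)
  then show ?thesis by (auto simp: child_def)
qed

lemma up_cellE:
  assumes "V \<in> pattern_part S c True"
  obtains k where "k \<in> up_index m" "V = up_triangle m k"
    "\<And>x i. real m * bary (affine_map V x) i = of_int (k i) + bary x i" "\<And>i. 0 \<le> k i"
proof -
  obtain k where "k \<in> up_index m" "V = up_triangle m k"
    using assms pattern_part_subset[of c] by (auto simp: up_triangles_def)
  then show thesis using that[of k] bary_up[OF _ m_ge_2] m_ge_2 by (auto simp: up_index_def)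
qed

lemma down_cellE:
  assumes "V \<in> pattern_part S c False"
  obtains k where "k \<in> down_index m" "V = down_triangle m k"
    "\<And>x i. real m * bary (affine_map V x) i = of_int (k i) + 1 - bary x i" "\<And>i. 0 \<le> k i"
proof -
  obtain k where "k \<in> down_index m" "V = down_triangle m k"
    using assms pattern_part_subset[of c] by (auto simp: down_triangles_def)
  then show thesis using that[of k] bary_down[OF _ m_ge_2] m_ge_2 by (auto simp: down_index_def)
qed

end

locale labyrinth =
  fixes m :: nat and S :: patterns
  assumes labyrinth: "labyrinth_patterns_system m S"

sublocale labyrinth \<subseteq> triangular_patterns
  using labyrinth by unfold_locales (simp add: labyrinth_patterns_system_def)

context labyrinth
begin

lemma tree: "tree_graph (cells c) (adjacent m)"
  using labyrinth by (cases c) (auto simp: labyrinth_patterns_system_def cells_def pattern_part_def)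

definition exit_pos :: "3 \<Rightarrow> int" where
  "exit_pos = (THE k. exits_triple m S k)"

lemma exits_triple_iff: "exits_triple m S k \<longleftrightarrow> k = exit_pos"
  using labyrinth unfolding labyrinth_patterns_system_def exit_pos_def by (metis the_equality)

definition exit_index :: "bool \<Rightarrow> 3 \<Rightarrow> 3 \<Rightarrow> int" where
  "exit_index c = (if c
     then triple (triple 0 (exit_pos 1) (int m - 1 - exit_pos 1))
                 (triple (exit_pos 2) 0 (int m - 1 - exit_pos 2))
                 (triple (exit_pos 3) (int m - 1 - exit_pos 3) 0)
     else triple (triple 0 (int m - 1 - exit_pos 1) (exit_pos 1))
                 (triple (int m - 1 - exit_pos 2) 0 (exit_pos 2))
                 (triple (int m - 1 - exit_pos 3) (exit_pos 3) 0))"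

definition exit_cell :: "bool \<Rightarrow> 3 \<Rightarrow> triangle" where
  "exit_cell c j = up_triangle m (exit_index c j)"

lemma exits: "exits_triple m S exit_pos" by (simp add: exits_triple_iff)

lemma exit_index_self [simp]: "exit_index c j j = 0"
  using exhaust_3[of j] by (auto simp: exit_index_def)

lemma exit_index_mirror: "i \<noteq> j \<Longrightarrow> exit_index c j i + exit_index (\<not> c) j i = int m - 1"
  using exhaust_3[of j] exhaust_3[of i] by (auto simp: exit_index_def)

lemma exit_index_up: "exit_index c j \<in> up_index m"
  using exhaust_3[of j] exits
  by (auto simp: exit_index_def up_index_def all_3_iff sum_3 exits_triple_def)

lemma exit_cell_in: "exit_cell c j \<in> pattern_part S c True"
  using exhaust_3[of j] exits
  by (auto simp: exit_index_def exit_cell_def exits_triple_def pattern_part_def)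

lemma white_exit_eq: "white_exit m S = exit_cell True"
  by (rule ext) (auto simp: white_exit_def exit_cell_def exit_index_def exit_pos_def Let_def triple_def)

lemma yellow_exit_eq: "yellow_exit m S = exit_cell False"
  by (rule ext) (auto simp: yellow_exit_def exit_cell_def exit_index_def exit_pos_def Let_def triple_def)

lemma triple_eta: "triple (f 1) (f 2) (f 3) = f"
  using exhaust_3 by (auto simp: triple_def fun_eq_iff)

text \<open>Uniqueness of the triple amounts to uniqueness on each side: another candidate on side
  \<open>j\<close> could replace the entry \<open>j\<close> of \<open>exit_pos\<close>.\<close>

lemma exit_unique_white:
  assumes k: "k \<in> up_index m" "k' \<in> up_index m" "k j = 0" "k' j = 0" "\<And>i. i \<noteq> j \<Longrightarrow> k i + k' i = int m - 1"
    and "up_triangle m k \<in> pattern_part S True True" "up_triangle m k' \<in> pattern_part S False True"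
  shows "k = exit_index True j \<and> k' = exit_index False j"
proof -
  have white: "up_triangle m (triple (k 1) (k 2) (k 3)) \<in> white_up S"
    and yellow: "up_triangle m (triple (k' 1) (k' 2) (k' 3)) \<in> yellow_up S"
    using assms(6,7) by (simp_all add: triple_eta pattern_part_def)
  have nn: "0 \<le> k i" "0 \<le> k' i" for i using k(1,2) by (auto simp: up_index_def)
  have sk: "k 1 + k 2 + k 3 = int m - 1" "k' 1 + k' 2 + k' 3 = int m - 1"
    using k(1,2) by (auto simp: up_index_def sum_3)
  consider "j = 1" | "j = 2" | "j = 3" using exhaust_3 by blast
  then show ?thesis
  proof cases
    case 1
    have e: "k 1 = 0" "k' 1 = 0" "k 3 = int m - 1 - k 2" "k' 2 = int m - 1 - k 2" "k' 3 = k 2"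
      using k(3,4) k(5)[of 2] k(5)[of 3] sk 1 by auto
    have "exits_triple m S (exit_pos(1 := k 2))"
      using exits white yellow nn[of 2] nn[of 3] unfolding exits_triple_def e all_3_iff by auto
    then have "exit_pos 1 = k 2" by (metis exits_triple_iff fun_upd_same)
    then show ?thesis using e 1 by (auto simp: fun_eq_iff exit_index_def all_3_iff)
  next
    case 2
    have e: "k 2 = 0" "k' 2 = 0" "k 3 = int m - 1 - k 1" "k' 1 = int m - 1 - k 1" "k' 3 = k 1"
      using k(3,4) k(5)[of 1] k(5)[of 3] sk 2 by auto
    have "exits_triple m S (exit_pos(2 := k 1))"
      using exits white yellow nn[of 1] nn[of 3] unfolding exits_triple_def e all_3_iff by auto
    then have "exit_pos 2 = k 1" by (metis exits_triple_iff fun_upd_same)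
    then show ?thesis using e 2 by (auto simp: fun_eq_iff exit_index_def all_3_iff)
  next
    case 3
    have e: "k 3 = 0" "k' 3 = 0" "k 2 = int m - 1 - k 1" "k' 1 = int m - 1 - k 1" "k' 2 = k 1"
      using k(3,4) k(5)[of 1] k(5)[of 2] sk 3 by auto
    have "exits_triple m S (exit_pos(3 := k 1))"
      using exits white yellow nn[of 1] nn[of 2] unfolding exits_triple_def e all_3_iff by auto
    then have "exit_pos 3 = k 1" by (metis exits_triple_iff fun_upd_same)
    then show ?thesis using e 3 by (auto simp: fun_eq_iff exit_index_def all_3_iff)
  qed
qed

lemma exit_unique:
  assumes k: "k \<in> up_index m" "k' \<in> up_index m" "k j = 0" "k' j = 0" "\<And>i. i \<noteq> j \<Longrightarrow> k i + k' i = int m - 1"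
    and "up_triangle m k \<in> pattern_part S c True" "up_triangle m k' \<in> pattern_part S (\<not> c) True"
  shows "k = exit_index c j \<and> k' = exit_index (\<not> c) j"
proof (cases c)
  case True
  then show ?thesis using exit_unique_white[OF k] assms(6,7) by simp
next
  case False
  have "k' i + k i = int m - 1" if "i \<noteq> j" for i using k(5)[OF that] by simp
  then show ?thesis using exit_unique_white[OF k(2,1,4,3)] assms(6,7) False by simp
qed

text \<open>Only the corner cell reaches coordinate 1; in a downward cell, \<open>m\<close> times a
  coordinate is at most \<open>m - 1\<close>.\<close>

lemma corner_cell:
  assumes "base_triangle i \<in> fractal S c"
  shows "up_triangle m (\<lambda>j. if j = i then int m - 1 else 0) \<in> corners (pattern_part S c True)"
proof -
  obtain V x where V: "V \<in> cells c" "x \<in> fractal S (child c V)" "base_triangle i = affine_map V x"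
    using assms fractal_self_similar[of c] by blast
  have x: "x \<in> base_region" using V(2) fractal_subset by blast
  have x1: "0 \<le> bary x i" "bary x i \<le> 1" using x base_region_le_1 by (auto simp: base_region_iff)
  have "V \<notin> pattern_part S c False"
  proof
    assume "V \<in> pattern_part S c False"
    then obtain k where k: "k \<in> down_index m" "V = down_triangle m k"
      "\<And>x i. real m * bary (affine_map V x) i = of_int (k i) + 1 - bary x i" "\<And>i. 0 \<le> k i"
      by (rule down_cellE) blast
    have "k i \<le> (\<Sum>h\<in>UNIV. k h)" using k(4) by (intro member_le_sum) auto
    then have "k i \<le> int m - 2" using k(1) by (simp add: down_index_def)
    moreover have "real m = of_int (k i) + 1 - bary x i" using k(3)[of x i] V(3)[symmetric] by (simp add: bary_base)
    ultimately show False using x1 by linarith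
  qed
  then have up: "V \<in> pattern_part S c True" using V(1) by (simp add: cells_def)
  then obtain k where k: "k \<in> up_index m" "V = up_triangle m k"
      "\<And>x i. real m * bary (affine_map V x) i = of_int (k i) + bary x i" "\<And>i. 0 \<le> k i"
      by (rule up_cellE) blast
  have "real m = of_int (k i) + bary x i" using k(3)[of x i] V(3)[symmetric] by (simp add: bary_base)
  then have ki: "k i \<ge> int m - 1" using x1 by linarith
  obtain a b where ab: "a \<noteq> i" "b \<noteq> i" "a \<noteq> b" "\<And>h. h = i \<or> h = a \<or> h = b" by (rule other_indices[of i]) blast
  have "k i + k a + k b = int m - 1" using sum_distinct_3[OF ab(1-3), of k] k(1) by (simp add: up_index_def)
  then have "k = (\<lambda>j. if j = i then int m - 1 else 0)" using ki k(4)[of a] k(4)[of b] ab(4) by (intro ext) (smt (verit))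
  then have "up_triangle m (\<lambda>j. if j = i then int m - 1 else 0) = V" using k(2) by simp
  moreover have "base_triangle i \<in> full_triangle V" using V(3) x by (simp add: full_triangle_eq[of V])
  ultimately show ?thesis using up by (auto simp: corners_def)
qed

text \<open>The corners property, stated for patterns, carries over to the fractals: here for one
  colour, in the next lemma for the two colours together.\<close>

lemma corner_eq: "base_triangle i \<in> fractal S c \<Longrightarrow> base_triangle j \<in> fractal S c \<Longrightarrow> i = j"
proof -
  assume "base_triangle i \<in> fractal S c" "base_triangle j \<in> fractal S c"
  note c = this[THEN corner_cell]
  let ?C = "corners (pattern_part S c True)"
  have "finite ?C" using finite_cells[of c] by (rule rev_finite_subset) (auto simp: corners_def cells_def)
  moreover have "card ?C \<le> 1"
    using labyrinth by (auto simp: labyrinth_patterns_system_def pattern_part_def)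
  ultimately have e: "up_triangle m (\<lambda>h. if h = i then int m - 1 else 0) = up_triangle m (\<lambda>h. if h = j then int m - 1 else 0)"
    using c card_le_Suc0_iff_eq by (metis One_nat_def)
  have idx: "(\<lambda>h. if h = l then int m - 1 else 0) \<in> up_index m" for l :: 3
    using m_ge_2 exhaust_3[of l] by (auto simp: up_index_def sum_3)
  have "(\<lambda>h. if h = i then int m - 1 else 0) = (\<lambda>h. if h = j then int m - 1 else 0)"
    using up_triangle_inject[OF idx idx m_ge_2 e] .
  from fun_cong[OF this, of i] show "i = j" using m_ge_2 by (auto split: if_splits)
qed

lemma corner_neq: "base_triangle i \<in> fractal S c \<Longrightarrow> base_triangle i \<notin> fractal S (\<not> c)"
  using corner_cell[of i c] corner_cell[of i "\<not> c"] labyrinth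
  by (cases c) (auto simp: labyrinth_patterns_system_def pattern_part_def)

text \<open>The fixed point of the exit cell, which maps \<open>x\<close> to
  \<open>(k + x) / m\<close> in coordinates; hence the denominator \<open>m - 1\<close>.\<close>

definition exit_point :: "bool \<Rightarrow> 3 \<Rightarrow> real^2" where
  "exit_point c j = (\<Sum>i\<in>UNIV. (of_int (exit_index c j i) / (real m - 1)) *\<^sub>R base_triangle i)"

lemma bary_exit_point: "bary (exit_point c j) i = of_int (exit_index c j i) / (real m - 1)"
  unfolding exit_point_def
proof (rule bary_combination)
  have "exit_index c j 1 + exit_index c j 2 + exit_index c j 3 = int m - 1"
    using exit_index_up[of c j] by (simp add: up_index_def sum_3)
  then have "real_of_int (exit_index c j 1) + of_int (exit_index c j 2) + of_int (exit_index c j 3) = real m - 1" by linarith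
  then show "(\<Sum>i\<in>UNIV. of_int (exit_index c j i) / (real m - 1)) = 1"
    using m_ge_2 by (simp add: sum_3 flip: add_divide_distrib)
qed

lemma exit_point_base_region: "exit_point c j \<in> base_region"
  using exit_index_up[of c j] m_ge_2 by (auto simp: base_region_iff bary_exit_point up_index_def)

lemma affine_map_exit_cell: "affine_map (exit_cell c j) (exit_point c j) = exit_point c j"
proof (rule bary_eqI)
  fix i
  have "bary (affine_map (exit_cell c j) (exit_point c j)) i
     = (of_int (exit_index c j i) + of_int (exit_index c j i) / (real m - 1)) / real m"
    unfolding exit_cell_def by (simp add: bary_up[OF exit_index_up m_ge_2] bary_exit_point)
  also have "\<dots> = of_int (exit_index c j i) / (real m - 1)" using m_ge_2 by (simp add: field_simps)
  finally show "bary (affine_map (exit_cell c j) (exit_point c j)) i = bary (exit_point c j) i"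
    by (simp add: bary_exit_point)
qed

lemma exit_point_in_fractal: "exit_point c j \<in> fractal S c"
  using exit_cell_in affine_map_exit_cell exit_point_base_region by (rule fixed_point_in_fractal)

lemma exit_point_self [simp]: "bary (exit_point c j) j = 0"
  by (simp add: bary_exit_point)

lemma exit_point_mirror: "i \<noteq> j \<Longrightarrow> bary (exit_point c j) i + bary (exit_point (\<not> c) j) i = 1"
proof -
  assume "i \<noteq> j"
  then have "real_of_int (exit_index c j i) + of_int (exit_index (\<not> c) j i) = real m - 1"
    using exit_index_mirror[of i j c] by linarith
  then show ?thesis using m_ge_2 by (simp add: bary_exit_point flip: add_divide_distrib)
qed

end

section \<open>Contact points of neighbouring cells\<close>

context labyrinth
begin

text \<open>A pair of points of the two fractals on side \<open>j\<close> that coincide when an upward and a downward cell are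
  joined along this side.\<close>

definition side_pair :: "bool \<Rightarrow> 3 \<Rightarrow> real^2 \<Rightarrow> real^2 \<Rightarrow> bool" where
  "side_pair c j x y \<longleftrightarrow> x \<in> fractal S c \<and> y \<in> fractal S (\<not> c) \<and> bary x j = 0 \<and> bary y j = 0 \<and>
     (\<forall>i. i \<noteq> j \<longrightarrow> bary x i + bary y i = 1)"

lemma side_pair_sym: "side_pair c j x y \<Longrightarrow> side_pair (\<not> c) j y x"
  by (auto simp: side_pair_def add.commute)

lemma fractalE:
  assumes "x \<in> fractal S c"
  obtains V y u where "V \<in> pattern_part S c u" "y \<in> fractal S (c = u)" "x = affine_map V y" "y \<in> base_region"
  using assms fractal_self_similar[of c] child_eq fractal_subset
  by (auto simp: cells_iff) (metis subsetD)

text \<open>A downward cell reaches side \<open>j\<close> only with its vertex \<open>j\<close>, so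
  \<open>y'\<close> is this vertex. The sum condition then makes \<open>x'\<close> another vertex,
  and one fractal would contain both.\<close>

lemma side_pair_up_down:
  assumes xy: "side_pair c j x y" and V: "V \<in> pattern_part S c True" "x' \<in> fractal S c" "x = affine_map V x'"
    and W: "W \<in> pattern_part S (\<not> c) False" "y' \<in> fractal S c" "y = affine_map W y'"
  shows False
proof -
  obtain k where k: "\<And>x i. real m * bary (affine_map V x) i = of_int (k i) + bary x i" "\<And>i. 0 \<le> k i"
    using V(1) by (rule up_cellE) blast
  obtain l where l: "\<And>x i. real m * bary (affine_map W x) i = of_int (l i) + 1 - bary x i" "\<And>i. 0 \<le> l i"
    using W(1) by (rule down_cellE) blast
  have b: "x' \<in> base_region" "y' \<in> base_region" using V(2) W(2) fractal_subset by auto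
  have b': "0 \<le> bary x' i" "bary y' i \<le> 1" for i using b base_region_le_1 by (auto simp: base_region_iff)
  have "of_int (k j) + bary x' j = 0" "of_int (l j) + 1 - bary y' j = 0"
    using k(1)[of x' j] l(1)[of y' j] V(3) W(3) xy by (simp_all add: side_pair_def)
  moreover have "0 \<le> real_of_int (k j)" "0 \<le> real_of_int (l j)" using k(2) l(2) by simp_all
  ultimately have "bary x' j = 0" "bary y' j = 1" using b'[of j] by linarith+
  then have y': "y' = base_triangle j" using base_region_vertex b by blast
  obtain i i' where i: "i \<noteq> j" "i' \<noteq> j" "i \<noteq> i'" "\<And>h. h = j \<or> h = i \<or> h = i'" by (rule other_indices[of j]) blast
  have "bary y' i = 0" using y' i(1) by (simp add: bary_base)
  have "real m * (bary x i + bary y i) = real m" using xy i by (simp add: side_pair_def)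
  then have "of_int (k i) + bary x' i + (of_int (l i) + 1) = real m"
    using k(1)[of x' i] l(1)[of y' i] V(3) W(3) \<open>bary y' i = 0\<close> by (simp add: distrib_left)
  then have "bary x' i = of_int (int m - k i - l i - 1)" by simp
  then have "bary x' i \<in> \<int>" by (metis Ints_of_int)
  then obtain h where "h \<noteq> j" "x' = base_triangle h"
    using base_region_edge_vertex[OF b(1) \<open>bary x' j = 0\<close> i(1)] by blast
  then show False using V(2) W(2) y' corner_eq by blast
qed

text \<open>Two upward cells that hold the pair are mirrored on side \<open>j\<close>, hence are the
  exit cells by uniqueness. The other combinations of directions lead to vertices that the corners
  property forbids.\<close>

lemma side_pair_step:
  assumes xy: "side_pair c j x y"
  obtains x' y' where "side_pair c j x' y'" "x = affine_map (exit_cell c j) x'" "y = affine_map (exit_cell (\<not> c) j) y'"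
proof -
  have "x \<in> fractal S c" "y \<in> fractal S (\<not> c)" using xy by (auto simp: side_pair_def)
  note mem = this
  obtain V x' u where V: "V \<in> pattern_part S c u" "x' \<in> fractal S (c = u)" "x = affine_map V x'" "x' \<in> base_region"
    using mem(1) by (rule fractalE)
  obtain W y' w where W: "W \<in> pattern_part S (\<not> c) w" "y' \<in> fractal S ((\<not> c) = w)" "y = affine_map W y'" "y' \<in> base_region"
    using mem(2) by (rule fractalE)
  have b: "0 \<le> bary x' i" "bary x' i \<le> 1" "0 \<le> bary y' i" "bary y' i \<le> 1" for i
    using V(4) W(4) base_region_le_1 by (auto simp: base_region_iff)
  consider "u" "w" | "u" "\<not> w" | "\<not> u" "w" | "\<not> u" "\<not> w" by blast
  then show thesis
  proof cases
    case 1
    obtain k where k: "k \<in> up_index m" "V = up_triangle m k"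
      "\<And>x i. real m * bary (affine_map V x) i = of_int (k i) + bary x i" "\<And>i. 0 \<le> k i"
      using V(1) 1 by (auto elim: up_cellE)
    obtain l where l: "l \<in> up_index m" "W = up_triangle m l"
      "\<And>x i. real m * bary (affine_map W x) i = of_int (l i) + bary x i" "\<And>i. 0 \<le> l i"
      using W(1) 1 by (auto elim: up_cellE)
    have "of_int (k j) + bary x' j = 0" "of_int (l j) + bary y' j = 0"
      using k(3)[of x' j] l(3)[of y' j] V(3) W(3) xy by (simp_all add: side_pair_def)
    moreover have "0 \<le> real_of_int (k j)" "0 \<le> real_of_int (l j)" using k(4) l(4) by simp_all
    ultimately have j0: "bary x' j = 0" "bary y' j = 0" "real_of_int (k j) = 0" "real_of_int (l j) = 0"
      using b[of j] by linarith+
    have s: "of_int (k i) + bary x' i + (of_int (l i) + bary y' i) = real m" if "i \<noteq> j" for i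
    proof -
      have "real m * (bary x i + bary y i) = real m" using xy that by (simp add: side_pair_def)
      then show ?thesis using k(3)[of x' i] l(3)[of y' i] V(3) W(3) by (simp add: distrib_left)
    qed
    obtain i i' where i: "i \<noteq> j" "i' \<noteq> j" "i \<noteq> i'" "\<And>h. h = j \<or> h = i \<or> h = i'" by (rule other_indices[of j]) blast
    have "bary x' i + bary y' i = of_int (int m - k i - l i)" using s[OF i(1)] by simp
    then have "bary x' i + bary y' i \<in> \<int>" by (metis Ints_of_int)
    from base_region_edge_pair[OF V(4) W(4) j0(1,2) i(1) this]
    have pair: "\<forall>h. h \<noteq> j \<longrightarrow> bary x' h + bary y' h = 1"
    proof
      assume "\<exists>h. h \<noteq> j \<and> x' = base_triangle h \<and> y' = base_triangle h"
      then obtain h where "x' = base_triangle h" "y' = base_triangle h" by blast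
      then show ?thesis using V(2) W(2) corner_neq[of h c] 1 by simp
    qed
    have kl: "k i + l i = int m - 1" if "i \<noteq> j" for i using s[OF that] pair that by (simp add: algebra_simps)
    have "k = exit_index c j \<and> l = exit_index (\<not> c) j"
      using exit_unique[OF k(1) l(1) _ _ kl] j0 V(1) W(1) k(2) l(2) 1 by simp
    then show ?thesis
      by (intro that[of x' y']) (use V W 1 k(2) l(2) j0 pair in \<open>auto simp: side_pair_def exit_cell_def\<close>)
  next
    case 2
    then show ?thesis using side_pair_up_down[OF xy] V W by auto
  next
    case 3
    then show ?thesis using side_pair_up_down[OF side_pair_sym[OF xy]] V W by auto
  next
    case 4
    obtain k where k: "\<And>x i. real m * bary (affine_map V x) i = of_int (k i) + 1 - bary x i" "\<And>i. 0 \<le> k i"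
      using V(1) 4 by (auto elim: down_cellE)
    obtain l where l: "\<And>x i. real m * bary (affine_map W x) i = of_int (l i) + 1 - bary x i" "\<And>i. 0 \<le> l i"
      using W(1) 4 by (auto elim: down_cellE)
    have "of_int (k j) + 1 - bary x' j = 0" "of_int (l j) + 1 - bary y' j = 0"
      using k(1)[of x' j] l(1)[of y' j] V(3) W(3) xy by (simp_all add: side_pair_def)
    moreover have "0 \<le> real_of_int (k j)" "0 \<le> real_of_int (l j)" using k(2) l(2) by simp_all
    ultimately have "bary x' j = 1" "bary y' j = 1" using b[of j] by linarith+
    then have "x' = base_triangle j" "y' = base_triangle j" using base_region_vertex V(4) W(4) by blast+
    then show ?thesis using V(2) W(2) corner_neq[of j c] 4 by simp
  qed
qed

text \<open>The pair recurs in the exit cells at every scale, and the map of the exit cell contracts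
  towards the exit point.\<close>

lemma side_pair_unique:
  assumes "side_pair c j x y"
  shows "x = exit_point c j"
proof (rule bary_eqI)
  fix i
  have "\<bar>bary x i - bary (exit_point c j) i\<bar> \<le> (1 / real m) ^ n" for n
    using assms
  proof (induction n arbitrary: x y)
    case 0
    then have "x \<in> base_region" using fractal_subset by (auto simp: side_pair_def)
    then have "0 \<le> bary x i" "bary x i \<le> 1" "0 \<le> bary (exit_point c j) i" "bary (exit_point c j) i \<le> 1"
      using exit_point_base_region base_region_le_1 by (auto simp: base_region_iff)
    then show ?case by simp
  next
    case (Suc n)
    obtain x' y' where xy': "side_pair c j x' y'" "x = affine_map (exit_cell c j) x'"
      using Suc.prems by (rule side_pair_step) blast
    have "bary x i - bary (exit_point c j) i = bary (affine_map (exit_cell c j) x') i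
        - bary (affine_map (exit_cell c j) (exit_point c j)) i" by (simp only: xy'(2) affine_map_exit_cell)
    also have "\<dots> = (bary x' i - bary (exit_point c j) i) / real m"
      unfolding exit_cell_def bary_up[OF exit_index_up m_ge_2] by (simp flip: diff_divide_distrib)
    finally show ?case using Suc.IH[OF xy'(1)] m_ge_2 by (simp add: abs_divide divide_right_mono)
  qed
  moreover have "(\<lambda>n. (1 / real m) ^ n) \<longlonglongrightarrow> 0" using m_ge_2 by (intro LIMSEQ_realpow_zero) auto
  ultimately have "\<bar>bary x i - bary (exit_point c j) i\<bar> \<le> 0" by (intro LIMSEQ_le_const) auto
  then show "bary x i = bary (exit_point c j) i" by simp
qed

text \<open>The integers \<open>k i - l i\<close> are -1, 0 or 1 and have sum 0. Unless all vanish,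
  1 and -1 both occur and make \<open>y\<close> and \<open>x\<close> two different vertices in the
  same fractal.\<close>

lemma contact_same_direction:
  assumes x: "x \<in> fractal S c" and y: "y \<in> fractal S c"
    and eq: "\<And>i. of_int (k i) + bary x i = of_int (l i) + bary y i"
  shows "k = l"
proof (rule ccontr)
  assume "k \<noteq> l"
  have b: "x \<in> base_region" "y \<in> base_region" using x y fractal_subset by auto
  have b': "0 \<le> bary x i" "bary x i \<le> 1" "0 \<le> bary y i" "bary y i \<le> 1" for i
    using b base_region_le_1 by (auto simp: base_region_iff)
  have d: "bary y i - bary x i = of_int (k i - l i)" for i using eq[of i] by simp
  have sum0: "(\<Sum>i\<in>UNIV. k i - l i) = 0"
  proof -
    have "real_of_int (\<Sum>i\<in>UNIV. k i - l i) = (\<Sum>i\<in>UNIV. bary y i - bary x i)"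
      by (simp only: d of_int_sum)
    also have "\<dots> = 0" by (simp add: sum_subtractf)
    finally show ?thesis by linarith
  qed
  have le: "k i - l i \<in> {-1, 0, 1}" for i
  proof -
    have "\<bar>real_of_int (k i - l i)\<bar> \<le> 1" using b'[of i] d[of i] by linarith
    then have "\<bar>k i - l i\<bar> \<le> 1" by linarith
    then show ?thesis by auto
  qed
  obtain i where i: "k i \<noteq> l i" using \<open>k \<noteq> l\<close> by auto
  obtain p q where pq: "k p - l p = 1" "k q - l q = -1"
  proof -
    obtain a b where ab: "a \<noteq> i" "b \<noteq> i" "a \<noteq> b" "\<And>h. h = i \<or> h = a \<or> h = b" by (rule other_indices[of i]) blast
    have s: "(k i - l i) + (k a - l a) + (k b - l b) = 0"
      using sum0 sum_distinct_3[OF ab(1-3), of "\<lambda>i. k i - l i"] by simp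
    show ?thesis using s i le[of i] le[of a] le[of b] that by auto
  qed
  have "bary y p = 1" "bary x q = 1" using d[of p] d[of q] pq b'[of p] b'[of q] by auto
  then have "y = base_triangle p" "x = base_triangle q" using base_region_vertex b by blast+
  then have "p = q" using corner_eq x y by blast
  then show False using pq by simp
qed

text \<open>The integers \<open>l i - k i + 1\<close> are 0, 1 or 2 and have sum 2. The value 2
  would put a common vertex into both fractals, so the values are 0 at one \<open>j\<close> and 1
  elsewhere: the cells share side \<open>j\<close>, and \<open>x\<close> and \<open>y\<close> form a
  side pair.\<close>

lemma contact_up_down:
  assumes V: "V \<in> pattern_part S c True" and W: "W \<in> pattern_part S c False"
    and x: "x \<in> fractal S c" and y: "y \<in> fractal S (\<not> c)" and eq: "affine_map V x = affine_map W y"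
  shows "\<exists>j. up_down_neighbours m j V W \<and> x = exit_point c j \<and> y = exit_point (\<not> c) j"
proof -
  obtain k where k: "k \<in> up_index m" "V = up_triangle m k"
    "\<And>x i. real m * bary (affine_map V x) i = of_int (k i) + bary x i" "\<And>i. 0 \<le> k i"
    using V by (rule up_cellE) blast
  obtain l where l: "l \<in> down_index m" "W = down_triangle m l"
    "\<And>x i. real m * bary (affine_map W x) i = of_int (l i) + 1 - bary x i" "\<And>i. 0 \<le> l i"
    using W by (rule down_cellE) blast
  have b: "x \<in> base_region" "y \<in> base_region" using x y fractal_subset by auto
  have b': "0 \<le> bary x i" "bary x i \<le> 1" "0 \<le> bary y i" "bary y i \<le> 1" for i
    using b base_region_le_1 by (auto simp: base_region_iff)
  have e: "bary x i + bary y i = of_int (l i - k i + 1)" for i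
    using k(3)[of x i] l(3)[of y i] eq by simp
  have range: "l i - k i + 1 \<in> {0, 1, 2}" for i
  proof -
    have "0 \<le> real_of_int (l i - k i + 1)" "real_of_int (l i - k i + 1) \<le> 2" using e[of i] b'[of i] by linarith+
    then have "0 \<le> l i - k i + 1" "l i - k i + 1 \<le> 2" by linarith+
    then show ?thesis by auto
  qed
  have no2: "l i - k i + 1 \<noteq> 2" for i
  proof
    assume "l i - k i + 1 = 2"
    then have "bary x i = 1" "bary y i = 1" using e[of i] b'[of i] by auto
    then have "x = base_triangle i" "y = base_triangle i" using base_region_vertex b by blast+
    then show False using corner_neq x y by blast
  qed
  obtain j where j: "l j - k j + 1 = 0"
  proof -
    have "(\<Sum>i\<in>UNIV. l i - k i + 1) = 2"
      using k(1) l(1) by (simp add: up_index_def down_index_def sum.distrib sum_subtractf)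
    then have "(l 1 - k 1 + 1) + (l 2 - k 2 + 1) + (l 3 - k 3 + 1) = 2" by (simp only: sum_3)
    then show ?thesis using that range[of 1] range[of 2] range[of 3] no2[of 1] no2[of 2] no2[of 3] by auto
  qed
  have oth: "l i - k i + 1 = 1" if "i \<noteq> j" for i
  proof -
    obtain a b' where ab: "a \<noteq> j" "b' \<noteq> j" "a \<noteq> b'" "\<And>h. h = j \<or> h = a \<or> h = b'" by (rule other_indices[of j]) blast
    have "(\<Sum>i\<in>UNIV. l i - k i + 1) = 2"
      using k(1) l(1) by (simp add: up_index_def down_index_def sum.distrib sum_subtractf)
    then have "(l j - k j + 1) + (l a - k a + 1) + (l b' - k b' + 1) = 2"
      using sum_distinct_3[OF ab(1-3), of "\<lambda>i. l i - k i + 1"] by simp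
    then show ?thesis using j ab(4)[of i] that range[of a] range[of b'] no2[of a] no2[of b'] by auto
  qed
  have j0: "bary x j = 0" "bary y j = 0" using e[of j] j b'[of j] by auto
  have "side_pair c j x y" unfolding side_pair_def
    using x y j0 e oth by simp
  then have "x = exit_point c j" "y = exit_point (\<not> c) j"
    using side_pair_unique side_pair_sym by blast+
  moreover have "up_down_neighbours m j V W" unfolding up_down_neighbours_def
    by (rule bexI[of _ k], rule bexI[of _ l]) (use k l j oth in auto)
  ultimately show ?thesis by blast
qed

lemma contact:
  assumes "V \<in> cells c" "W \<in> cells c" "V \<noteq> W" "x \<in> fractal S (child c V)" "y \<in> fractal S (child c W)"
    and eq: "affine_map V x = affine_map W y"
  shows "\<exists>j. neighbours m j V W \<and> x = exit_point (child c V) j \<and> y = exit_point (child c W) j"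
proof -
  obtain u w where V: "V \<in> pattern_part S c u" and W: "W \<in> pattern_part S c w"
    using assms(1,2) by (auto simp: cells_iff)
  have ch: "child c V = (c = u)" "child c W = (c = w)" using child_eq V W by auto
  consider "u" "w" | "u" "\<not> w" | "\<not> u" "w" | "\<not> u" "\<not> w" by blast
  then show ?thesis
  proof cases
    case 1
    obtain k where k: "V = up_triangle m k" "\<And>x i. real m * bary (affine_map V x) i = of_int (k i) + bary x i"
      using V 1 by (auto elim: up_cellE)
    obtain l where l: "W = up_triangle m l" "\<And>x i. real m * bary (affine_map W x) i = of_int (l i) + bary x i"
      using W 1 by (auto elim: up_cellE)
    have "of_int (k i) + bary x i = of_int (l i) + bary y i" for i
      using k(2)[of x i] l(2)[of y i] eq by simp
    then have "k = l" using assms(4,5) ch 1 by (intro contact_same_direction[of x c y]) auto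
    then show ?thesis using k l assms(3) by simp
  next
    case 4
    obtain k where k: "V = down_triangle m k" "\<And>x i. real m * bary (affine_map V x) i = of_int (k i) + 1 - bary x i"
      using V 4 by (auto elim: down_cellE)
    obtain l where l: "W = down_triangle m l" "\<And>x i. real m * bary (affine_map W x) i = of_int (l i) + 1 - bary x i"
      using W 4 by (auto elim: down_cellE)
    \<comment> \<open>Downward maps reverse the coordinates, so \<open>x\<close> and
      \<open>y\<close> change places.\<close>
    have "of_int (k i) + bary y i = of_int (l i) + bary x i" for i
      using k(2)[of x i] l(2)[of y i] eq by simp
    then have "k = l" using assms(4,5) ch 4 by (intro contact_same_direction[of y "\<not> c" x]) auto
    then show ?thesis using k l assms(3) by simp
  next
    case 2
    then show ?thesis using contact_up_down[of V c W x y] V W ch assms(4,5) eq by (auto simp: neighbours_def)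
  next
    case 3
    then show ?thesis using contact_up_down[of W c V y x] V W ch assms(4,5) eq by (auto simp: neighbours_def)
  qed
qed

lemma up_down_exit_point:
  assumes "up_down_neighbours m j V W"
  shows "affine_map V (exit_point c j) = affine_map W (exit_point (\<not> c) j)"
proof -
  obtain k l where k: "k \<in> up_index m" "l \<in> down_index m" "V = up_triangle m k" "W = down_triangle m l"
    "\<And>i. k i = l i + (if i = j then 1 else 0)" using assms by (rule up_down_neighboursE) blast
  show ?thesis
  proof (rule bary_eqI)
    fix i
    have "of_int (k i) + bary (exit_point c j) i = of_int (l i) + 1 - bary (exit_point (\<not> c) j) i"
      using k(5)[of i] exit_point_mirror[of i j c] by (cases "i = j") auto
    then show "bary (affine_map V (exit_point c j)) i = bary (affine_map W (exit_point (\<not> c) j)) i"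
      unfolding k(3,4) bary_up[OF k(1) m_ge_2] bary_down[OF k(2) m_ge_2] by simp
  qed
qed

lemma neighbours_exit_point:
  assumes "neighbours m j V W"
  shows "affine_map V (exit_point (child c V) j) = affine_map W (exit_point (child c W) j)"
  using assms up_down_exit_point[of j V W "child c V"] up_down_exit_point[of j W V "child c W"] neighbours_child[OF assms, of c]
  by (auto simp: neighbours_def)

end

section \<open>Arcs in the fractals\<close>

definition uniquely_arcwise :: "'a::topological_space set \<Rightarrow> bool" where
  "uniquely_arcwise L \<longleftrightarrow> (\<forall>x\<in>L. \<forall>y\<in>L. x \<noteq> y \<longrightarrow> (\<exists>!a. a \<subseteq> L \<and> arc_between a x y))"

text \<open>Degenerate segments for equal end points let unions along a route be formed without case
  distinctions.\<close>

definition arc_segment :: "'a::topological_space set \<Rightarrow> 'a \<Rightarrow> 'a \<Rightarrow> 'a set" where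
  "arc_segment L x y = (if x = y then {x} else THE a. a \<subseteq> L \<and> arc_between a x y)"

lemma arc_between_sym: "arc_between a x y \<Longrightarrow> arc_between a y x"
  unfolding arc_between_def
  by (metis arc_reversepath path_image_reversepath pathfinish_reversepath pathstart_reversepath)

lemma arc_segment_sym: "arc_segment L x y = arc_segment L y x"
proof -
  have "arc_between a x y = arc_between a y x" for a using arc_between_sym by blast
  then show ?thesis by (simp add: arc_segment_def)
qed

lemma arc_segment_same [simp]: "arc_segment L x x = {x}"
  by (simp add: arc_segment_def)

context
  fixes L :: "'a::euclidean_space set"
  assumes L: "uniquely_arcwise L"
begin

lemma arc_segment_arc:
  assumes "x \<in> L" "y \<in> L" "x \<noteq> y"
  shows "arc_segment L x y \<subseteq> L" "arc_between (arc_segment L x y) x y"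
proof -
  have "\<exists>!a. a \<subseteq> L \<and> arc_between a x y" using L assms by (auto simp: uniquely_arcwise_def)
  from theI'[OF this] show "arc_segment L x y \<subseteq> L" "arc_between (arc_segment L x y) x y"
    using assms(3) by (simp_all add: arc_segment_def)
qed

lemma arc_segment_unique:
  assumes "a \<subseteq> L" "arc_between a x y"
  shows "a = arc_segment L x y"
proof -
  obtain g where g: "arc g" "path_image g = a" "pathstart g = x" "pathfinish g = y"
    using assms(2) by (auto simp: arc_between_def)
  then have xy: "x \<in> L" "y \<in> L" "x \<noteq> y"
    using assms(1) arc_distinct_ends by (metis pathstart_in_path_image subsetD, metis pathfinish_in_path_image subsetD, metis)
  have "\<exists>!a. a \<subseteq> L \<and> arc_between a x y" using L xy by (simp add: uniquely_arcwise_def)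
  then show ?thesis using arc_segment_arc[OF xy] assms by blast
qed

lemma arc_segment_subset: "x \<in> L \<Longrightarrow> y \<in> L \<Longrightarrow> arc_segment L x y \<subseteq> L"
  using arc_segment_arc(1) by (cases "x = y") auto

lemma arc_segment_ends: "x \<in> L \<Longrightarrow> y \<in> L \<Longrightarrow> x \<in> arc_segment L x y \<and> y \<in> arc_segment L x y"
  using arc_segment_arc(2)[of x y] by (cases "x = y") (auto simp: arc_between_def)

lemma arc_segment_cases:
  assumes "x \<in> L" "y \<in> L"
  obtains "arc_segment L x y = {x}" | g where "arc g" "arc_segment L x y = path_image g"
  using arc_segment_arc(2)[OF assms] that unfolding arc_between_def by (cases "x = y") auto

lemma arc_segment_path_connected: "x \<in> L \<Longrightarrow> y \<in> L \<Longrightarrow> path_connected (arc_segment L x y)"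
  by (erule (1) arc_segment_cases) (simp_all add: path_connected_path_image arc_imp_path)

lemma arc_segment_compact: "x \<in> L \<Longrightarrow> y \<in> L \<Longrightarrow> compact (arc_segment L x y)"
  by (erule (1) arc_segment_cases) (simp_all add: compact_arc_image)

text \<open>A path-connected set contains an arc between any two of its points, and \<open>L\<close>
  has only one such arc.\<close>

lemma arc_segment_least:
  assumes "path_connected K" "K \<subseteq> L" "x \<in> K" "y \<in> K"
  shows "arc_segment L x y \<subseteq> K"
proof (cases "x = y")
  case False
  then obtain g where g: "arc g" "path_image g \<subseteq> K" "pathstart g = x" "pathfinish g = y"
    using assms(1,3,4) path_connected_arcwise by metis
  then have "path_image g = arc_segment L x y"
    using assms(2) by (intro arc_segment_unique) (auto simp: arc_between_def)
  then show ?thesis using g(2) by simp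
qed (use assms in simp)

lemma arc_segment_sub:
  assumes "x \<in> L" "y \<in> L" "p \<in> arc_segment L x y" "q \<in> arc_segment L x y"
  shows "arc_segment L p q \<subseteq> arc_segment L x y"
  by (rule arc_segment_least[OF arc_segment_path_connected arc_segment_subset]) (use assms in auto)

text \<open>The segment is connected and meets both closed sides, hence meets their
  intersection.\<close>

lemma arc_segment_cut:
  assumes "x \<in> L" "y \<in> L" "x \<in> A" "y \<in> B" "closed A" "closed B" "L \<subseteq> A \<union> B" "A \<inter> B \<subseteq> {p}"
  shows "p \<in> arc_segment L x y"
proof -
  let ?s = "arc_segment L x y"
  have con: "connected ?s" using assms arc_segment_path_connected path_connected_imp_connected by blast
  have "?s \<subseteq> A \<union> B" using arc_segment_subset assms by blast
  moreover have "A \<inter> ?s \<noteq> {}" "B \<inter> ?s \<noteq> {}" using arc_segment_ends assms by blast+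
  ultimately have "A \<inter> B \<inter> ?s \<noteq> {}" using con assms(5,6) unfolding connected_closed by blast
  then show ?thesis using assms(8) by blast
qed

end

context labyrinth
begin

section \<open>Gluing the pieces along the tree of cells\<close>

definition piece :: "bool \<Rightarrow> triangle \<Rightarrow> (real^2) set" where
  "piece c V = affine_map V ` fractal S (child c V)"

lemma fractal_pieces: "fractal S c = (\<Union>V\<in>cells c. piece c V)"
  unfolding piece_def by (rule fractal_self_similar)

lemma continuous_cell: "V \<in> cells c \<Longrightarrow> continuous_on A (affine_map V)"
proof -
  assume "V \<in> cells c"
  then have "(1 / real m)-lipschitz_on UNIV (affine_map V)"
    using cell_homothety by (intro lipschitz_onI) auto
  then show ?thesis using lipschitz_on_continuous_on continuous_on_subset by blast
qed

lemma compact_piece: "V \<in> cells c \<Longrightarrow> compact (piece c V)"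
  unfolding piece_def using continuous_cell compact_fractal by (rule compact_continuous_image)

text \<open>Pieces on opposite sides meet only if their cells are neighbours, and the bridge is the
  only edge across; so all contacts happen at the exit point of one label.\<close>

lemma bridge_contact:
  assumes AB: "A \<union> B = cells c" "A \<inter> B = {}" "u \<in> A" "w \<in> B" and uw: "neighbours m j u w"
    and cross: "\<And>a b. a \<in> A \<Longrightarrow> b \<in> B \<Longrightarrow> adjacent m a b \<Longrightarrow> a = u \<and> b = w"
  shows "(\<Union>V\<in>A. piece c V) \<inter> (\<Union>V\<in>B. piece c V) \<subseteq> {affine_map u (exit_point (child c u) j)}"
proof
  fix z assume "z \<in> (\<Union>V\<in>A. piece c V) \<inter> (\<Union>V\<in>B. piece c V)"
  then obtain V W x y where V: "V \<in> A" "x \<in> fractal S (child c V)" "z = affine_map V x"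
    and W: "W \<in> B" "y \<in> fractal S (child c W)" "z = affine_map W y"
    by (auto simp: piece_def)
  have "V \<noteq> W" using V W AB(2) by blast
  then obtain i where i: "neighbours m i V W" "x = exit_point (child c V) i"
    using contact[of V c W x y] V W AB(1) by blast
  then have "V = u" "W = w" using cross[of V W] V W by (auto simp: adjacent_def)
  then have "i = j" using neighbours_label i(1) uw by blast
  then show "z \<in> {affine_map u (exit_point (child c u) j)}" using i(2) V(3) \<open>V = u\<close> by simp
qed

lemma cells_path: "u \<in> cells c \<Longrightarrow> w \<in> cells c \<Longrightarrow> \<exists>p. graph_path (cells c) (adjacent m) u p w"
  using tree[of c] unfolding tree_graph_def by blast

lemma separation:
  assumes "u \<in> cells c" "w \<in> cells c" "u \<noteq> w"
  shows "\<exists>A B p. A \<union> B = cells c \<and> u \<in> A \<and> w \<in> B \<and> u \<notin> B \<and> w \<notin> A \<and>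
    (\<Union>V\<in>A. piece c V) \<inter> (\<Union>V\<in>B. piece c V) \<subseteq> {p}"
proof -
  obtain p where p: "graph_path (cells c) (adjacent m) u p w"
    using cells_path assms by blast
  then obtain v q where pq: "p = [] @ u # v # q"
    using assms(3) by (cases p; cases "tl p") (auto simp: graph_path_def)
  have "graph_path (cells c) (adjacent m) u ([] @ u # v # q) w" using p pq by simp
  from path_bridge[OF tree adjacent_sym adjacent_irrefl this] obtain A B
    where AB: "A \<union> B = cells c" "A \<inter> B = {}" "set ([] @ [u]) \<subseteq> A" "set (v # q) \<subseteq> B"
    and cross: "\<And>a b. a \<in> A \<Longrightarrow> b \<in> B \<Longrightarrow> adjacent m a b \<Longrightarrow> a = u \<and> b = v" by blast
  have "w \<in> set (v # q)" using p pq last_in_set[of "v # q"] by (auto simp: graph_path_def)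
  then have w: "w \<in> B" using AB(4) by blast
  have "adjacent m u v" using p pq by (auto simp: graph_path_def)
  then obtain j where "neighbours m j u v" by (auto simp: adjacent_def)
  then have "(\<Union>V\<in>A. piece c V) \<inter> (\<Union>V\<in>B. piece c V) \<subseteq> {affine_map u (exit_point (child c u) j)}"
    using bridge_contact[OF AB(1,2) _ _ _ cross] AB(3,4) by auto
  then show ?thesis
    by (rule_tac exI[of _ A], rule_tac exI[of _ B], rule_tac exI, intro conjI) (use AB w in auto)
qed

lemma no_loop:
  assumes "simple_path g" "pathfinish g = pathstart g"
  shows "\<not> path_image g \<subseteq> fractal S c"
proof -
  have "\<exists>h. \<forall>c. V \<in> cells c \<longrightarrow> continuous_on UNIV h \<and> (\<forall>x. h (affine_map V x) = x)" for V
    using affine_map_left_inverse[OF _ m_ge_2] cells_subset by (metis subsetD)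
  then obtain h where h: "\<And>V c. V \<in> cells c \<Longrightarrow> continuous_on UNIV (h V) \<and> (\<forall>x. h V (affine_map V x) = x)" by metis
  show ?thesis
  proof (rule self_similar_no_loop[where r = "1 / real m" and V = cells and f = affine_map and nxt = child and h = h])
    show "bounded (\<Union>c. fractal S c)"
      using fractal_subset compact_imp_bounded[OF compact_base_region] by (meson UN_least bounded_subset)
    show "fractal S c = (\<Union>v\<in>cells c. affine_map v ` fractal S (child c v))" for c
      by (rule fractal_self_similar)
    show "\<exists>A B p. A \<union> B = cells c \<and> u \<in> A \<and> w \<in> B \<and> u \<notin> B \<and> w \<notin> A \<and>
        (\<Union>v\<in>A. affine_map v ` fractal S (child c v)) \<inter> (\<Union>v\<in>B. affine_map v ` fractal S (child c v)) \<subseteq> {p}"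
      if "u \<in> cells c" "w \<in> cells c" "u \<noteq> w" for c u w
      using separation[OF that] by (simp only: piece_def)
  qed (use m_ge_2 in \<open>simp_all add: cell_homothety h compact_fractal finite_cells assms\<close>)
qed

lemma edge_exit_point:
  "adjacent m V W \<Longrightarrow> affine_map V (exit_point (child c V) (edge_label m V W)) =
     affine_map W (exit_point (child c W) (edge_label m V W))"
  using neighbours_exit_point edge_label_neighbours by blast

text \<open>Entry and exit points are in the local coordinates of each cell. At an edge both cells
  use the exit point of its label, each in the colour of its own copy; the images agree by
  \<open>edge_exit_point\<close>.\<close>

fun route :: "bool \<Rightarrow> triangle list \<Rightarrow> real^2 \<Rightarrow> real^2 \<Rightarrow> (triangle \<times> (real^2) \<times> (real^2)) list" where
  "route c [] a b = []"
| "route c [v] a b = [(v, a, b)]"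
| "route c (v # w # vs) a b = (v, a, exit_point (child c v) (edge_label m v w)) #
     route c (w # vs) (exit_point (child c w) (edge_label m v w)) b"

lemma route_chain:
  assumes "vs \<noteq> []" "set vs \<subseteq> cells c" "successively (adjacent m) vs"
    and "a \<in> fractal S (child c (hd vs))" "b \<in> fractal S (child c (last vs))"
  shows "chain_in affine_map (cells c) (\<lambda>V. fractal S (child c V)) (affine_map (hd vs) a) (affine_map (last vs) b) (route c vs a b)
    \<and> fst (hd (route c vs a b)) = hd vs"
  using assms
proof (induction c vs a b rule: route.induct)
  case (3 c v w vs a b)
  let ?l = "edge_label m v w"
  let ?r = "route c (w # vs) (exit_point (child c w) ?l) b"
  have IH: "chain_in affine_map (cells c) (\<lambda>V. fractal S (child c V))
     (affine_map w (exit_point (child c w) ?l)) (affine_map (last (w # vs)) b) ?r"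
    using 3 exit_point_in_fractal by simp
  obtain w' a' b' r' where r: "?r = (w', a', b') # r'"
    using IH by (cases ?r) (auto simp: chain_in_def)
  have "affine_map v (exit_point (child c v) ?l) = affine_map w (exit_point (child c w) ?l)"
    using 3(4) by (intro edge_exit_point) auto
  then show ?case using IH 3 exit_point_in_fractal by (auto simp: chain_in_def r)
qed (auto simp: chain_in_def)

lemma fractal_chain:
  assumes "x \<in> fractal S c" "y \<in> fractal S c"
  shows "\<exists>xs. chain_in affine_map (cells c) (\<lambda>V. fractal S (child c V)) x y xs"
proof -
  obtain V x' W y' where V: "V \<in> cells c" "x' \<in> fractal S (child c V)" "x = affine_map V x'"
    and W: "W \<in> cells c" "y' \<in> fractal S (child c W)" "y = affine_map W y'"
    using assms fractal_self_similar[of c] by blast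
  obtain p where p: "graph_path (cells c) (adjacent m) V p W"
    using cells_path V W by blast
  then show ?thesis using route_chain[of p c x' y'] V W by (auto simp: graph_path_def)
qed

lemma path_connected_fractal: "path_connected (fractal S c)"
proof (rule self_similar_path_connected[where r = "1 / real m" and V = cells and f = affine_map and nxt = child and T = base_region])
  show "bounded base_region" using compact_base_region by (rule compact_imp_bounded)
  show "closed (fractal S c)" for c using compact_fractal by (rule compact_imp_closed)
  show "affine_map v ` fractal S (child c v) \<subseteq> fractal S c" if "v \<in> cells c" for c v
    using fractal_self_similar[of c] that by blast
qed (use m_ge_2 cell_homothety fractal_subset cell_maps_base fractal_chain convex_base_region in auto)

lemma uniquely_arcwise_fractal: "uniquely_arcwise (fractal S c)"
  unfolding uniquely_arcwise_def
proof (intro ballI impI)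
  fix x y assume xy: "x \<in> fractal S c" "y \<in> fractal S c" "x \<noteq> y"
  obtain g where "arc g" "path_image g \<subseteq> fractal S c" "pathstart g = x" "pathfinish g = y"
    using path_connected_fractal xy path_connected_arcwise by metis
  then have "path_image g \<subseteq> fractal S c \<and> arc_between (path_image g) x y" by (auto simp: arc_between_def)
  moreover have "a = b" if "a \<subseteq> fractal S c \<and> arc_between a x y" "b \<subseteq> fractal S c \<and> arc_between b x y" for a b
    using arc_unique_of_no_loop[OF no_loop] that by metis
  ultimately show "\<exists>!a. a \<subseteq> fractal S c \<and> arc_between a x y" by blast
qed

abbreviation seg :: "bool \<Rightarrow> real^2 \<Rightarrow> real^2 \<Rightarrow> (real^2) set" where
  "seg c \<equiv> arc_segment (fractal S c)"

lemmas seg_subset = arc_segment_subset[OF uniquely_arcwise_fractal]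
lemmas seg_ends = arc_segment_ends[OF uniquely_arcwise_fractal]
lemmas seg_sub = arc_segment_sub[OF uniquely_arcwise_fractal]
lemmas seg_cut = arc_segment_cut[OF uniquely_arcwise_fractal]
lemmas seg_least = arc_segment_least[OF uniquely_arcwise_fractal]
lemmas seg_path_connected = arc_segment_path_connected[OF uniquely_arcwise_fractal]
lemmas seg_compact = arc_segment_compact[OF uniquely_arcwise_fractal]

lemma piece_subset: "V \<in> cells c \<Longrightarrow> piece c V \<subseteq> fractal S c"
  using fractal_pieces by blast

lemma affine_map_in_fractal: "V \<in> cells c \<Longrightarrow> x \<in> fractal S (child c V) \<Longrightarrow> affine_map V x \<in> fractal S c"
  using piece_subset by (auto simp: piece_def)

lemma seg_image:
  assumes V: "V \<in> cells c" and ab: "a \<in> fractal S (child c V)" "b \<in> fractal S (child c V)"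
  shows "affine_map V ` seg (child c V) a b = seg c (affine_map V a) (affine_map V b)"
proof (cases "a = b")
  case False
  obtain g where g: "arc g" "path_image g = seg (child c V) a b" "pathstart g = a" "pathfinish g = b"
    using arc_segment_arc(2)[OF uniquely_arcwise_fractal ab False] by (auto simp: arc_between_def)
  have "arc (affine_map V \<circ> g)" unfolding arc_def
  proof
    show "path (affine_map V \<circ> g)" using g(1) continuous_cell[OF V] by (intro path_continuous_image) (auto simp: arc_imp_path)
    show "inj_on (affine_map V \<circ> g) {0..1}"
      using g(1) cell_inj[OF V] by (auto simp: arc_def intro!: comp_inj_on intro: inj_on_subset)
  qed
  then have "arc_between (affine_map V ` seg (child c V) a b) (affine_map V a) (affine_map V b)"
    unfolding arc_between_def using g
    by (intro exI[of _ "affine_map V \<circ> g"]) (simp add: path_image_compose pathstart_compose pathfinish_compose)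
  moreover have "affine_map V ` seg (child c V) a b \<subseteq> fractal S c"
    using seg_subset[OF ab] piece_subset[OF V] by (auto simp: piece_def)
  ultimately show ?thesis by (intro arc_segment_unique[OF uniquely_arcwise_fractal])
qed simp

lemma route_members:
  assumes "(v, a, b) \<in> set (route c vs a0 b0)" "set vs \<subseteq> cells c"
    and "a0 \<in> fractal S (child c (hd vs))" "b0 \<in> fractal S (child c (last vs))"
  shows "v \<in> cells c \<and> a \<in> fractal S (child c v) \<and> b \<in> fractal S (child c v)"
  using assms by (induction c vs a0 b0 rule: route.induct) (auto simp: exit_point_in_fractal)

definition contact_point :: "bool \<Rightarrow> triangle list \<Rightarrow> real^2 \<Rightarrow> bool" where
  "contact_point c vs z \<longleftrightarrow> (\<exists>xs u w ys. vs = xs @ u # w # ys \<and>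
     z = affine_map u (exit_point (child c u) (edge_label m u w)))"

lemma route_points:
  assumes "(v, a, b) \<in> set (route c vs a0 b0)" "successively (adjacent m) vs"
  shows "(affine_map v a = affine_map (hd vs) a0 \<or> contact_point c vs (affine_map v a)) \<and>
    (affine_map v b = affine_map (last vs) b0 \<or> contact_point c vs (affine_map v b))"
  using assms
proof (induction c vs a0 b0 rule: route.induct)
  case (3 c v' w vs a0 b0)
  have ext: "contact_point c (v' # w # vs) z" if "contact_point c (w # vs) z" for z
    using that unfolding contact_point_def by (metis append_Cons)
  have first: "contact_point c (v' # w # vs) (affine_map v' (exit_point (child c v') (edge_label m v' w)))"
    unfolding contact_point_def by (metis append_Nil)
  have adj: "adjacent m v' w" using 3(3) by simp
  show ?case
  proof (cases "(v, a, b) = (v', a0, exit_point (child c v') (edge_label m v' w))")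
    case True
    then show ?thesis using first by simp
  next
    case False
    then have "(v, a, b) \<in> set (route c (w # vs) (exit_point (child c w) (edge_label m v' w)) b0)"
      using 3(2) by auto
    from 3(1)[OF this] have
      "(affine_map v a = affine_map w (exit_point (child c w) (edge_label m v' w)) \<or> contact_point c (w # vs) (affine_map v a))
      \<and> (affine_map v b = affine_map (last (w # vs)) b0 \<or> contact_point c (w # vs) (affine_map v b))" using 3(3) by simp
    then show ?thesis using ext first edge_exit_point[OF adj, of c] by (metis last.simps list.discI)
  qed
qed auto

lemma route_union_path_connected:
  assumes "vs \<noteq> []" "set vs \<subseteq> cells c" "successively (adjacent m) vs"
    and "a0 \<in> fractal S (child c (hd vs))" "b0 \<in> fractal S (child c (last vs))"
  shows "path_connected (\<Union>(v, a, b)\<in>set (route c vs a0 b0). affine_map v ` seg (child c v) a b) \<and>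
    affine_map (hd vs) a0 \<in> (\<Union>(v, a, b)\<in>set (route c vs a0 b0). affine_map v ` seg (child c v) a b) \<and>
    affine_map (last vs) b0 \<in> (\<Union>(v, a, b)\<in>set (route c vs a0 b0). affine_map v ` seg (child c v) a b)"
  using assms
proof (induction c vs a0 b0 rule: route.induct)
  case (2 c v a b)
  then show ?case using seg_path_connected seg_ends continuous_cell
    by (auto intro!: path_connected_continuous_image)
next
  case (3 c v w vs a0 b0)
  let ?l = "edge_label m v w"
  let ?e = "exit_point (child c v) ?l" and ?e' = "exit_point (child c w) ?l"
  let ?U = "\<Union>(v, a, b)\<in>set (route c (w # vs) ?e' b0). affine_map v ` seg (child c v) a b"
  have IH: "path_connected ?U" "affine_map w ?e' \<in> ?U" "affine_map (last (w # vs)) b0 \<in> ?U"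
    using 3(1) 3(3-) exit_point_in_fractal by auto
  have "affine_map v ?e = affine_map w ?e'" using 3(4) by (intro edge_exit_point) simp
  have v: "path_connected (affine_map v ` seg (child c v) a0 ?e)"
    using seg_path_connected continuous_cell 3 exit_point_in_fractal by (auto intro!: path_connected_continuous_image)
  have ends: "a0 \<in> seg (child c v) a0 ?e" "?e \<in> seg (child c v) a0 ?e" using seg_ends 3 exit_point_in_fractal by auto
  have "affine_map v ` seg (child c v) a0 ?e \<inter> ?U \<noteq> {}"
  proof -
    have "affine_map w ?e' \<in> affine_map v ` seg (child c v) a0 ?e"
      unfolding \<open>affine_map v ?e = affine_map w ?e'\<close>[symmetric] using ends(2) by (rule imageI)
    then show ?thesis using IH(2) by blast
  qed
  then have "path_connected (affine_map v ` seg (child c v) a0 ?e \<union> ?U)"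
    using v IH(1) by (intro path_connected_Un)
  then show ?case using IH(3) ends(1) by auto
qed simp

text \<open>The union is path-connected, hence contains the arc. Conversely each edge of the path is
  a bridge whose contact point separates the end points in the fractal and so lies on the arc; with
  its two ends, every part of the union does.\<close>

lemma seg_route:
  assumes p: "graph_path (cells c) (adjacent m) u vs w"
    and a0: "a0 \<in> fractal S (child c u)" and b0: "b0 \<in> fractal S (child c w)"
  shows "seg c (affine_map u a0) (affine_map w b0) =
    (\<Union>(v, a, b)\<in>set (route c vs a0 b0). affine_map v ` seg (child c v) a b)" (is "?s = ?U")
proof
  have vs: "vs \<noteq> []" "set vs \<subseteq> cells c" "successively (adjacent m) vs" "hd vs = u" "last vs = w"
    using p by (auto simp: graph_path_def)
  have uw: "u \<in> cells c" "w \<in> cells c" using vs by (metis hd_in_set subsetD, metis last_in_set subsetD)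
  have x: "affine_map u a0 \<in> fractal S c" "affine_map w b0 \<in> fractal S c"
    using affine_map_in_fractal uw a0 b0 by auto
  have mem: "v \<in> cells c \<and> a \<in> fractal S (child c v) \<and> b \<in> fractal S (child c v)" if "(v, a, b) \<in> set (route c vs a0 b0)" for v a b
    using route_members[OF that vs(2)] a0 b0 vs by simp
  have U: "path_connected ?U" "affine_map u a0 \<in> ?U" "affine_map w b0 \<in> ?U"
    using route_union_path_connected[OF vs(1-3), of a0 b0] vs(4,5) a0 b0 by auto
  have "?U \<subseteq> fractal S c"
  proof safe
    fix v a b z assume m: "(v, a, b) \<in> set (route c vs a0 b0)" and z: "z \<in> seg (child c v) a b"
    have "z \<in> fractal S (child c v)" using mem[OF m] seg_subset z by blast
    then show "affine_map v z \<in> fractal S c" using affine_map_in_fractal mem[OF m] by blast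
  qed
  then show "?s \<subseteq> ?U" using U by (intro seg_least)
  have cut: "affine_map u' (exit_point (child c u') (edge_label m u' w')) \<in> ?s" if vs': "vs = xs @ u' # w' # ys" for xs u' w' ys
  proof -
    have "graph_path (cells c) (adjacent m) u (xs @ u' # w' # ys) w" using p vs' by simp
    from path_bridge[OF tree adjacent_sym adjacent_irrefl this] obtain A B
      where AB: "A \<union> B = cells c" "A \<inter> B = {}" "set (xs @ [u']) \<subseteq> A" "set (w' # ys) \<subseteq> B"
      and cross: "\<And>a b. a \<in> A \<Longrightarrow> b \<in> B \<Longrightarrow> adjacent m a b \<Longrightarrow> a = u' \<and> b = w'" by blast
    have "adjacent m u' w'" using vs(3) vs' by (auto simp: successively_append_iff)
    then have nb: "neighbours m (edge_label m u' w') u' w'" by (rule edge_label_neighbours)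
    have int: "(\<Union>V\<in>A. piece c V) \<inter> (\<Union>V\<in>B. piece c V) \<subseteq> {affine_map u' (exit_point (child c u') (edge_label m u' w'))}"
      using bridge_contact[OF AB(1,2) _ _ nb cross] AB(3,4) by simp
    have "u \<in> A" using vs(4) vs' AB(3) by (cases xs) auto
    moreover have "w \<in> B" using vs(5) vs' AB(4) last_in_set[of "w' # ys"] by auto
    moreover have "finite A" "finite B" using AB(1) finite_cells[of c] finite_Un by metis+
    ultimately have fin: "finite A" "finite B" and mem: "u \<in> A" "w \<in> B" by auto
    show ?thesis
    proof (rule seg_cut[OF x _ _ _ _ _ int])
      show "affine_map u a0 \<in> (\<Union>V\<in>A. piece c V)" "affine_map w b0 \<in> (\<Union>V\<in>B. piece c V)"
        using mem a0 b0 by (auto simp: piece_def)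
      show "closed (\<Union>V\<in>A. piece c V)" "closed (\<Union>V\<in>B. piece c V)"
        using fin AB(1) compact_piece[of _ c] by (auto intro!: closed_UN compact_imp_closed)
      show "fractal S c \<subseteq> (\<Union>V\<in>A. piece c V) \<union> (\<Union>V\<in>B. piece c V)"
        using AB(1) fractal_pieces[of c] by auto
    qed
  qed
  have cut': "z \<in> ?s" if "contact_point c vs z" for z
    using that cut unfolding contact_point_def by blast
  show "?U \<subseteq> ?s"
  proof safe
    fix v a b z assume m: "(v, a, b) \<in> set (route c vs a0 b0)" and z: "z \<in> seg (child c v) a b"
    have "affine_map v a \<in> ?s" "affine_map v b \<in> ?s"
      using route_points[OF m vs(3)] vs(4,5) cut' seg_ends[OF x] by metis+
    then have "seg c (affine_map v a) (affine_map v b) \<subseteq> ?s" using x by (intro seg_sub)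
    then show "affine_map v z \<in> ?s" using seg_image mem[OF m] z by blast
  qed
qed

end

section \<open>Copies of exit arcs\<close>

context labyrinth
begin

lemma up_down_neighbours_target:
  assumes "up_down_neighbours m j U V"
  shows "up_down_neighbours m j U W \<Longrightarrow> V = W" "up_down_neighbours m j W V \<Longrightarrow> U = W"
proof -
  obtain k k' where k: "k \<in> up_index m" "k' \<in> down_index m" "U = up_triangle m k" "V = down_triangle m k'"
    "\<And>i. k i = k' i + (if i = j then 1 else 0)" using assms by (rule up_down_neighboursE) blast
  show "V = W" if UW: "up_down_neighbours m j U W"
  proof -
    obtain l l' where l: "l \<in> up_index m" "l' \<in> down_index m" "U = up_triangle m l" "W = down_triangle m l'"
      "\<And>i. l i = l' i + (if i = j then 1 else 0)" using UW by (rule up_down_neighboursE) blast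
    have "k = l" using up_triangle_inject k(1,3) l(1,3) m_ge_2 by metis
    then have "k' i = l' i" for i using k(5)[of i] l(5)[of i] by simp
    then have "k' = l'" by (rule ext)
    then show ?thesis using k l by simp
  qed
  show "U = W" if WV: "up_down_neighbours m j W V"
  proof -
    obtain l l' where l: "l \<in> up_index m" "l' \<in> down_index m" "W = up_triangle m l" "V = down_triangle m l'"
      "\<And>i. l i = l' i + (if i = j then 1 else 0)" using WV by (rule up_down_neighboursE) blast
    have "k' = l'" using down_triangle_inject k(2,4) l(2,4) m_ge_2 by metis
    then have "k i = l i" for i using k(5)[of i] l(5)[of i] by simp
    then have "k = l" by (rule ext)
    then show ?thesis using k l by simp
  qed
qed

lemma up_down_neighbours_exclusive: "up_down_neighbours m j U V \<Longrightarrow> \<not> up_down_neighbours m j' W U"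
  using up_down_disjoint[OF m_ge_2]
  by (auto simp: up_triangles_def down_triangles_def elim!: up_down_neighboursE)

lemma neighbours_target:
  assumes "neighbours m j U V" "neighbours m j U W"
  shows "V = W"
  using assms up_down_neighbours_exclusive[of j U _ j]
    up_down_neighbours_target(1)[of j U V W] up_down_neighbours_target(2)[of j V U W]
  unfolding neighbours_def by blast

text \<open>The exit cell has index 0 at \<open>j\<close>, and a neighbour across side
  \<open>j\<close> would have index -1 there.\<close>

lemma exit_cell_no_neighbour: "\<not> neighbours m j (exit_cell c j) V"
proof
  assume "neighbours m j (exit_cell c j) V"
  then show False unfolding neighbours_def
  proof
    assume "up_down_neighbours m j (exit_cell c j) V"
    then obtain k k' where k: "k \<in> up_index m" "k' \<in> down_index m" "exit_cell c j = up_triangle m k"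
      "\<And>i. k i = k' i + (if i = j then 1 else 0)" by (rule up_down_neighboursE) blast
    have "k = exit_index c j"
      using up_triangle_inject[OF k(1) exit_index_up m_ge_2] k(3) by (simp add: exit_cell_def)
    then show False using k(2) k(4)[of j] by (auto simp: down_index_def) (metis add_le_same_cancel2 not_one_le_zero exit_index_self add_nonneg_eq_0_iff zero_le_one zero_neq_one)
  next
    assume "up_down_neighbours m j V (exit_cell c j)"
    then obtain k k' where "k' \<in> down_index m" "exit_cell c j = down_triangle m k'" by (rule up_down_neighboursE) blast
    then show False using up_down_disjoint[OF m_ge_2] exit_index_up[of c j]
      by (auto simp: exit_cell_def up_triangles_def down_triangles_def)
  qed
qed

lemma exit_cell_cells: "exit_cell c j \<in> cells c"
  using exit_cell_in by (auto simp: cells_iff)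

lemma child_exit_cell [simp]: "child c' (exit_cell c j) = c'"
  using child_eq[OF exit_cell_in] by simp

lemma length_route [simp]: "length (route c vs a0 b0) = length vs"
  by (induction c vs a0 b0 rule: route.induct) auto

lemma route_nth:
  assumes "h < length vs"
  shows "route c vs a0 b0 ! h = (vs ! h,
    if h = 0 then a0 else exit_point (child c (vs ! h)) (edge_label m (vs ! (h - 1)) (vs ! h)),
    if Suc h = length vs then b0 else exit_point (child c (vs ! h)) (edge_label m (vs ! h) (vs ! Suc h)))"
  using assms
proof (induction c vs a0 b0 arbitrary: h rule: route.induct)
  case (3 c v w vs a0 b0)
  show ?case
  proof (cases h)
    case (Suc h')
    then show ?thesis using 3(1)[of h'] 3(2) by (cases h') auto
  qed simp
qed auto

text \<open>Each label belongs to at most one neighbour, so repeating a label would mean going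
  back.\<close>

lemma edge_labels_distinct:
  assumes "distinct vs" "successively (adjacent m) vs" "Suc (Suc h) < length vs"
  shows "edge_label m (vs ! h) (vs ! Suc h) \<noteq> edge_label m (vs ! Suc h) (vs ! Suc (Suc h))"
proof
  assume eq: "edge_label m (vs ! h) (vs ! Suc h) = edge_label m (vs ! Suc h) (vs ! Suc (Suc h))"
  have "adjacent m (vs ! h) (vs ! Suc h)" "adjacent m (vs ! Suc h) (vs ! Suc (Suc h))"
    using assms(2,3) by (auto simp: successively_conv_nth)
  then have "neighbours m (edge_label m (vs ! h) (vs ! Suc h)) (vs ! Suc h) (vs ! h)"
    "neighbours m (edge_label m (vs ! h) (vs ! Suc h)) (vs ! Suc h) (vs ! Suc (Suc h))"
    using edge_label_neighbours neighbours_sym eq by metis+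
  then have "vs ! h = vs ! Suc (Suc h)" by (rule neighbours_target)
  then show False using assms(1,3) by (simp add: nth_eq_iff_index_eq)
qed

lemma path_labels_nth:
  assumes "h \<le> length vs" "vs \<noteq> []"
  shows "path_labels m i j vs ! h = (if h = 0 then i else if h = length vs then j
    else edge_label m (vs ! (h - 1)) (vs ! h))"
proof (cases h)
  case (Suc h')
  then show ?thesis using assms by (auto simp: path_labels_def nth_append nth_tl)
qed (simp add: path_labels_def)

lemma route_labels:
  assumes "h < length vs"
  shows "route c vs (exit_point (child c (hd vs)) i) (exit_point (child c (last vs)) j) ! h =
    (vs ! h, exit_point (child c (vs ! h)) (path_labels m i j vs ! h), exit_point (child c (vs ! h)) (path_labels m i j vs ! Suc h))"
proof -
  have "vs \<noteq> []" using assms by auto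
  moreover have "length vs - Suc 0 = h" if "Suc h = length vs" using that by simp
  ultimately show ?thesis using assms
    by (auto simp: route_nth path_labels_nth hd_conv_nth last_conv_nth)
qed

text \<open>The labels \<open>i\<close> and \<open>j\<close> added at the ends belong to sides
  without a neighbour. So each cell of the path is crossed between two different exits, and its type
  is a genuine pair.\<close>

lemma path_labels_distinct:
  assumes p: "graph_path (cells c) (adjacent m) (exit_cell c i) vs (exit_cell c j)" and "i \<noteq> j" "h < length vs"
  shows "path_labels m i j vs ! h \<noteq> path_labels m i j vs ! Suc h"
proof -
  have vs: "vs \<noteq> []" "distinct vs" "successively (adjacent m) vs" "vs ! 0 = exit_cell c i" "vs ! (length vs - 1) = exit_cell c j"
    using p by (auto simp: graph_path_def hd_conv_nth last_conv_nth)
  have nb: "neighbours m (edge_label m (vs ! h) (vs ! Suc h)) (vs ! h) (vs ! Suc h)" if "Suc h < length vs" for h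
    using vs(3) that by (intro edge_label_neighbours) (auto simp: successively_conv_nth)
  have first: "edge_label m (vs ! 0) (vs ! Suc 0) \<noteq> i" if "1 < length vs"
    using nb[of 0] exit_cell_no_neighbour[of i c] vs(4) that by auto
  have last: "edge_label m (vs ! h) (vs ! Suc h) \<noteq> j" if "Suc (Suc h) = length vs" for h
  proof -
    have "vs ! Suc h = exit_cell c j" using vs(5) that by (metis diff_Suc_1)
    then show ?thesis using neighbours_sym[OF nb[of h]] exit_cell_no_neighbour[of j c] that by (metis lessI)
  qed
  show ?thesis
  proof (cases h)
    case 0
    have "path_labels m i j vs ! Suc 0 = (if 1 = length vs then j else edge_label m (vs ! 0) (vs ! Suc 0))"
      using path_labels_nth[of 1 vs i j] vs(1) assms(3) by auto
    moreover have "path_labels m i j vs ! 0 = i" by (simp add: path_labels_def)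
    moreover have "1 = length vs \<or> 1 < length vs" using assms(3) by linarith
    ultimately show ?thesis using assms(2) first 0 by auto
  next
    case (Suc h')
    then show ?thesis using assms(3) last[of h'] edge_labels_distinct[OF vs(2,3), of h']
      by (auto simp: path_labels_nth vs(1))
  qed
qed

section \<open>Copies of exit arcs inside arbitrary arcs\<close>

fun pieces :: "nat \<Rightarrow> bool \<Rightarrow> (real^2) set set" where
  "pieces 0 c = {seg c (exit_point c i) (exit_point c j) | i j. i \<noteq> j}"
| "pieces (Suc n) c = (\<Union>V\<in>cells c. (\<lambda>a. affine_map V ` a) ` pieces n (child c V))"

lemma finite_pieces: "finite (pieces n c)"
proof (induction n arbitrary: c)
  case 0
  have "pieces 0 c \<subseteq> (\<lambda>(i, j). seg c (exit_point c i) (exit_point c j)) ` UNIV" by auto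
  then show ?case by (rule finite_subset) simp
qed (auto simp: finite_cells)

lemma piece_step: "V \<in> cells c \<Longrightarrow> a \<in> pieces n (child c V) \<Longrightarrow> affine_map V ` a \<in> pieces (Suc n) c"
  by auto

lemma piece_1: "V \<in> cells c \<Longrightarrow> i \<noteq> j \<Longrightarrow>
    affine_map V ` seg (child c V) (exit_point (child c V) i) (exit_point (child c V) j) \<in> pieces 1 c"
  unfolding One_nat_def by (rule piece_step) auto

definition diam :: real where "diam = diameter base_region"

lemma dist_le_diam: "x \<in> base_region \<Longrightarrow> y \<in> base_region \<Longrightarrow> dist x y \<le> diam"
  unfolding diam_def using compact_base_region compact_imp_bounded diameter_bounded_bound by blast

lemma diam_nonneg: "0 \<le> diam"
  unfolding diam_def using compact_base_region compact_imp_bounded diameter_ge_0 by blast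

lemma dist_fractal: "x \<in> fractal S c \<Longrightarrow> y \<in> fractal S c \<Longrightarrow> dist x y \<le> diam"
  using dist_le_diam fractal_subset by blast

lemma fractal_route:
  assumes "x \<in> fractal S c" "y \<in> fractal S c"
  obtains V x' W y' vs where "x' \<in> fractal S (child c V)" "x = affine_map V x'" "y' \<in> fractal S (child c W)" "y = affine_map W y'"
    "graph_path (cells c) (adjacent m) V vs W"
proof -
  obtain V x' W y' where V: "V \<in> cells c" "x' \<in> fractal S (child c V)" "x = affine_map V x'"
    and W: "W \<in> cells c" "y' \<in> fractal S (child c W)" "y = affine_map W y'"
    using assms fractal_self_similar[of c] by blast
  obtain p where "graph_path (cells c) (adjacent m) V p W" using cells_path V W by blast
  then show thesis using that V W by blast
qed

lemma dist_cell: "V \<in> cells c \<Longrightarrow> dist a b = real m * dist (affine_map V a) (affine_map V b)"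
  using cell_homothety m_ge_2 by simp

text \<open>A route through three or more cells crosses a middle cell from exit to exit. With one or
  two cells, some part of the arc has end points at least \<open>m/2\<close> times as far apart in
  local coordinates, until the distance would exceed \<open>diam\<close>.\<close>

lemma contains_piece_aux:
  assumes "x \<in> fractal S c" "y \<in> fractal S c" "diam * (2 / real m) ^ n < dist x y"
  shows "\<exists>k. \<exists>a\<in>pieces k c. a \<subseteq> seg c x y"
  using assms
proof (induction n arbitrary: c x y)
  case 0
  then show ?case using dist_fractal[of x c y] by simp
next
  case (Suc n)
  obtain V x' W y' vs where VW: "x' \<in> fractal S (child c V)" "x = affine_map V x'" "y' \<in> fractal S (child c W)" "y = affine_map W y'"
    and p: "graph_path (cells c) (adjacent m) V vs W" using Suc.prems(1,2) by (rule fractal_route)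
  have vs: "vs \<noteq> []" "hd vs = V" "last vs = W" "set vs \<subseteq> cells c" "distinct vs" "successively (adjacent m) vs"
    using p by (auto simp: graph_path_def)
  let ?R = "route c vs x' y'"
  have seg: "seg c x y = (\<Union>(v, a, b)\<in>set ?R. affine_map v ` seg (child c v) a b)"
    using seg_route[OF p VW(1,3)] VW(2,4) by simp
  have sub: "affine_map v ` seg (child c v) a b \<subseteq> seg c x y" if "(v, a, b) \<in> set ?R" for v a b
    unfolding seg using that by blast
  \<comment> \<open>Half of the rescaled distance is enough, because a route of two cells splits the
    distance at the contact point.\<close>
  have step: ?case if m1: "(v, a, b) \<in> set ?R" and m2: "real m * (diam * (2 / real m) ^ Suc n) / 2 < dist a b" for v a b
  proof -
    have mem: "v \<in> cells c" "a \<in> fractal S (child c v)" "b \<in> fractal S (child c v)"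
      using route_members[OF m1 vs(4)] VW vs by auto
    have "real m * (diam * (2 / real m) ^ Suc n) / 2 = diam * (2 / real m) ^ n" using m_ge_2 by simp
    then obtain k a' where "a' \<in> pieces k (child c v)" "a' \<subseteq> seg (child c v) a b"
      using Suc.IH[OF mem(2,3)] m2 by auto
    then have "affine_map v ` a' \<in> pieces (Suc k) c" "affine_map v ` a' \<subseteq> seg c x y"
      using piece_step[OF mem(1)] sub[OF m1] by blast+
    then show ?thesis by blast
  qed
  have D: "0 \<le> real m * (diam * (2 / real m) ^ Suc n) / 2" using diam_nonneg by simp
  consider "vs = [V]" "W = V" | "vs = [V, W]" | v w vs' where "vs = V # v # w # vs'"
  proof -
    obtain r where r: "vs = V # r" using vs(1,2) by (cases vs) auto
    show thesis
    proof (cases r)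
      case Nil
      then show ?thesis using that(1) r vs(3) by simp
    next
      case (Cons v r')
      then show ?thesis using that(2,3) r vs(3) by (cases r') auto
    qed
  qed
  then show ?case
  proof cases
    case 1
    have "V \<in> cells c" using vs(4) 1 by simp
    then have "dist x' y' = real m * dist x y" using dist_cell[of V c x' y'] VW(2,4) 1 by simp
    moreover have "real m * (diam * (2 / real m) ^ Suc n) < real m * dist x y"
      using Suc.prems(3) m_ge_2 by (intro mult_strict_left_mono) auto
    ultimately have "real m * (diam * (2 / real m) ^ Suc n) < dist x' y'" by (simp only:)
    then show ?thesis using step[of V x' y'] D 1 by simp
  next
    case 2
    let ?l = "edge_label m V W"
    let ?e = "exit_point (child c V) ?l" and ?e' = "exit_point (child c W) ?l"
    have e: "affine_map V ?e = affine_map W ?e'" using vs(6) 2 by (intro edge_exit_point) simp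
    have VWc: "V \<in> cells c" "W \<in> cells c" using vs(4) 2 by auto
    have "dist x y \<le> dist x (affine_map V ?e) + dist (affine_map W ?e') y" using dist_triangle e by metis
    then have "real m * dist x y \<le> real m * (dist x (affine_map V ?e) + dist (affine_map W ?e') y)"
      by (intro mult_left_mono) auto
    also have "\<dots> = dist x' ?e + dist ?e' y'"
      using dist_cell[OF VWc(1), of x' ?e] dist_cell[OF VWc(2), of ?e' y'] VW by (simp add: distrib_left)
    finally have le: "real m * dist x y \<le> dist x' ?e + dist ?e' y'" .
    have "real m * (diam * (2 / real m) ^ Suc n) < real m * dist x y"
      using Suc.prems(3) m_ge_2 by (intro mult_strict_left_mono) auto
    then have "real m * (diam * (2 / real m) ^ Suc n) / 2 < dist x' ?e \<or> real m * (diam * (2 / real m) ^ Suc n) / 2 < dist ?e' y'"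
      using le by linarith
    then show ?thesis using step[of V x' ?e] step[of W ?e' y'] 2 by auto
  next
    case 3
    let ?l = "edge_label m V v" and ?l' = "edge_label m v w"
    have m1: "(v, exit_point (child c v) ?l, exit_point (child c v) ?l') \<in> set ?R" using 3 by simp
    have "?l \<noteq> ?l'" using edge_labels_distinct[OF vs(5,6), of 0] 3 by simp
    moreover have "v \<in> cells c" using vs(4) 3 by simp
    ultimately show ?thesis using piece_1[of v c ?l ?l'] sub[OF m1] by blast
  qed
qed

lemma corner_index_pattern:
  assumes "up_triangle m (\<lambda>j. if j = i then int m - 1 else 0) \<in> pattern_part S c True"
  shows "base_triangle i \<in> fractal S c"
proof (rule fixed_point_in_fractal[OF assms])
  let ?k = "\<lambda>j. if j = i then int m - 1 else 0"
  have k: "?k \<in> up_index m" using m_ge_2 exhaust_3[of i] by (auto simp: up_index_def sum_3)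
  show "affine_map (up_triangle m ?k) (base_triangle i) = base_triangle i"
    by (rule bary_eqI) (use m_ge_2 in \<open>auto simp: bary_up[OF k] bary_base simp del: affine_map_vertex\<close>)
qed simp

lemma index_corner:
  assumes "k \<in> up_index m" "k i = 0" "k j = 0" "i \<noteq> j" "l \<noteq> i" "l \<noteq> j"
  shows "k = (\<lambda>h. if h = l then int m - 1 else 0)"
proof -
  have "k j + k i + k l = int m - 1" using sum_distinct_3[of i j l k] assms by (simp add: up_index_def)
  moreover have "h = j \<or> h = i \<or> h = l" for h using exhaust_3[of h] exhaust_3[of i] exhaust_3[of j] exhaust_3[of l] assms(4-6) by auto
  ultimately show ?thesis using assms by (intro ext) (metis add.left_neutral add_0)
qed

text \<open>Two vanishing indices leave all of \<open>m - 1\<close> to the third one: the exit cell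
  is a corner cell, and its vertex belongs to the fractal.\<close>

lemma exit_index_not_corner:
  assumes "exit_index c i j = 0" "i \<noteq> j"
  shows "\<exists>l. l \<noteq> i \<and> l \<noteq> j \<and> base_triangle l \<in> fractal S c"
proof -
  obtain a b where ab: "a \<noteq> i" "b \<noteq> i" "a \<noteq> b" "\<And>h. h = i \<or> h = a \<or> h = b" by (rule other_indices[of i]) blast
  obtain l where l: "l \<noteq> i" "l \<noteq> j" using ab assms(2) by metis
  have "exit_index c i = (\<lambda>h. if h = l then int m - 1 else 0)"
    using index_corner[of "exit_index c i" i j l] exit_index_up assms l by auto
  then have "up_triangle m (\<lambda>h. if h = l then int m - 1 else 0) \<in> pattern_part S c True"
    using exit_cell_in[of c i] by (simp add: exit_cell_def)
  then show ?thesis using corner_index_pattern l by blast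
qed

text \<open>Coinciding exits on two sides form the corner cell at the third vertex. By mirroring,
  the exits of the other colour on these sides are the corner cells at the two remaining vertices,
  so its fractal would have two corners.\<close>

lemma exit_cells_distinct:
  assumes "i \<noteq> j" shows "exit_cell c i \<noteq> exit_cell c j"
proof
  assume "exit_cell c i = exit_cell c j"
  then have eq: "exit_index c i = exit_index c j"
    using up_triangle_inject[OF exit_index_up exit_index_up m_ge_2] by (simp add: exit_cell_def)
  have "exit_index c i j = 0" using eq by simp
  then have ki: "exit_index c i j = 0" "exit_index c j i = 0" using eq by (metis exit_index_self)+
  obtain a b where ab: "a \<noteq> i" "b \<noteq> i" "a \<noteq> b" "\<And>h. h = i \<or> h = a \<or> h = b" by (rule other_indices[of i]) blast
  obtain l where l: "l \<noteq> i" "l \<noteq> j" using ab assms by metis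
  have "exit_index c i = (\<lambda>h. if h = l then int m - 1 else 0)"
    using index_corner[of "exit_index c i" i j l] exit_index_up ki assms l by auto
  then have "exit_index c i l = int m - 1" "exit_index c j l = int m - 1" using eq by auto
  then have "exit_index (\<not> c) i l = 0" "exit_index (\<not> c) j l = 0"
    using exit_index_mirror[of l i c] exit_index_mirror[of l j c] l by auto
  then obtain a b where "a \<noteq> i" "a \<noteq> l" "base_triangle a \<in> fractal S (\<not> c)" "b \<noteq> j" "b \<noteq> l" "base_triangle b \<in> fractal S (\<not> c)"
    using exit_index_not_corner l by metis
  then show False using corner_eq[of a "\<not> c" b] l assms exhaust_3[of a] exhaust_3[of i] exhaust_3[of j] exhaust_3[of l] by auto
qed

text \<open>For \<open>m = 2\<close> every exit cell is a corner cell. By the corners property all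
  white exits sit at one vertex \<open>l\<close>, but the exit on side \<open>l\<close> cannot. The
  bound makes the factor \<open>m/2\<close> in the search for pieces exceed 1.\<close>

lemma m_ge_3: "3 \<le> m"
proof (rule ccontr)
  assume "\<not> 3 \<le> m"
  then have m2: "m = 2" using m_ge_2 by simp
  have corner: "\<exists>l. l \<noteq> j \<and> base_triangle l \<in> fractal S True \<and> exit_index True j l = 1" for j
  proof -
    obtain a b where ab: "a \<noteq> j" "b \<noteq> j" "a \<noteq> b" "\<And>h. h = j \<or> h = a \<or> h = b" by (rule other_indices[of j]) blast
    have "exit_index True j j + exit_index True j a + exit_index True j b = int m - 1"
      "0 \<le> exit_index True j a" "0 \<le> exit_index True j b"
      using sum_distinct_3[OF ab(1-3), of "exit_index True j"] exit_index_up[of True j] by (simp_all add: up_index_def)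
    then have "exit_index True j a + exit_index True j b = 1" "0 \<le> exit_index True j a" "0 \<le> exit_index True j b"
      using m2 exit_index_self[of True j] by linarith+
    then have "exit_index True j a = 0 \<and> exit_index True j b = 1 \<or> exit_index True j a = 1 \<and> exit_index True j b = 0" by auto
    then show ?thesis
    proof (elim disjE conjE)
      assume e: "exit_index True j a = 0" "exit_index True j b = 1"
      then obtain l where "l \<noteq> j" "l \<noteq> a" "base_triangle l \<in> fractal S True"
        using exit_index_not_corner[of True j a] ab(1) by blast
      then show ?thesis using ab(4)[of l] e by auto
    next
      assume e: "exit_index True j a = 1" "exit_index True j b = 0"
      then obtain l where "l \<noteq> j" "l \<noteq> b" "base_triangle l \<in> fractal S True"
        using exit_index_not_corner[of True j b] ab(2) by blast
      then show ?thesis using ab(4)[of l] e by auto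
    qed
  qed
  obtain l where l: "base_triangle l \<in> fractal S True" using corner by blast
  then show False using corner[of l] corner_eq by blast
qed

lemma contains_piece:
  assumes "x \<in> fractal S c" "y \<in> fractal S c" "x \<noteq> y"
  shows "\<exists>k. \<exists>a\<in>pieces k c. a \<subseteq> seg c x y"
proof -
  have "(\<lambda>n. diam * (2 / real m) ^ n) \<longlonglongrightarrow> diam * 0"
    using m_ge_3 by (intro tendsto_mult tendsto_const LIMSEQ_realpow_zero) auto
  then have "\<forall>\<^sub>F n in sequentially. diam * (2 / real m) ^ n < dist x y"
    using assms(3) by (intro order_tendstoD) auto
  then obtain n where "diam * (2 / real m) ^ n < dist x y" using eventually_happens'[OF sequentially_bot] by blast
  then show ?thesis using contains_piece_aux assms(1,2) by blast
qed

lemma eventually_small: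
  assumes "x \<noteq> (y :: real^2)"
  obtains n where "diam * (1 / real m) ^ n < dist x y"
proof -
  have "(\<lambda>n. diam * (1 / real m) ^ n) \<longlonglongrightarrow> diam * 0"
    using m_ge_3 by (intro tendsto_mult tendsto_const LIMSEQ_realpow_zero) auto
  then have "\<forall>\<^sub>F n in sequentially. diam * (1 / real m) ^ n < dist x y"
    using assms by (intro order_tendstoD) auto
  then show thesis using that eventually_happens'[OF sequentially_bot] by blast
qed

lemma scale_diam: "real m * (diam * (1 / real m) ^ Suc n) = diam * (1 / real m) ^ n"
  using m_ge_2 by simp

text \<open>All cells of the route except the first are crossed from exit to exit. If
  \<open>z\<close> is in the first cell, its distance from \<open>x\<close> grows by the factor
  \<open>m\<close> in local coordinates, which can happen only finitely often.\<close>

lemma in_piece_exit_aux: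
  assumes "x \<in> fractal S c" "z \<in> seg c x (exit_point c j)" "diam * (1 / real m) ^ n < dist z x"
  shows "\<exists>k. \<exists>a\<in>pieces k c. z \<in> a"
  using assms
proof (induction n arbitrary: c x j z)
  case 0
  have "z \<in> fractal S c" using seg_subset 0(1,2) exit_point_in_fractal by blast
  then show ?case using dist_fractal[of z c x] 0 by simp
next
  case (Suc n)
  obtain V x' where V: "V \<in> cells c" "x' \<in> fractal S (child c V)" "x = affine_map V x'"
    using Suc.prems(1) fractal_self_similar[of c] by blast
  obtain vs where p: "graph_path (cells c) (adjacent m) V vs (exit_cell c j)"
    using cells_path V(1) exit_cell_cells by blast
  have vs: "vs \<noteq> []" "hd vs = V" "last vs = exit_cell c j" "set vs \<subseteq> cells c" "distinct vs" "successively (adjacent m) vs"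
    using p by (auto simp: graph_path_def)
  let ?R = "route c vs x' (exit_point c j)"
  have "z \<in> (\<Union>(v, a, b)\<in>set ?R. affine_map v ` seg (child c v) a b)"
    using seg_route[OF p V(2), of "exit_point c j"] V(3) Suc.prems(2) exit_point_in_fractal[of c j]
    by (simp add: affine_map_exit_cell)
  then obtain v a b z' where z': "(v, a, b) \<in> set ?R" "z = affine_map v z'" "z' \<in> seg (child c v) a b" by blast
  obtain h where h: "h < length vs" "?R ! h = (v, a, b)" using z'(1) by (metis in_set_conv_nth length_route)
  have v: "v = vs ! h" "v \<in> cells c" using route_nth[OF h(1)] h(2) vs(4) h(1) by auto
  have lastv: "child c v = c" if "Suc h = length vs"
  proof -
    have "length vs - 1 = h" using that by simp
    then have "v = exit_cell c j" using vs(1,3) v(1) by (simp add: last_conv_nth)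
    then show ?thesis by simp
  qed
  let ?l = "if Suc h = length vs then j else edge_label m (vs ! h) (vs ! Suc h)"
  have b: "b = exit_point (child c v) ?l" using route_nth[OF h(1), of c x' "exit_point c j"] h(2) v(1) lastv by auto
  show ?case
  proof (cases "h = 0")
    case True
    then have a: "a = x'" "v = V" using route_nth[OF h(1)] h(2) vs(1,2) by (auto simp: hd_conv_nth)
    have "dist z' x' = real m * dist z x" using dist_cell[OF v(2), of z' x'] z'(2) V(3) a by simp
    moreover have "real m * (diam * (1 / real m) ^ Suc n) < real m * dist z x"
      using Suc.prems(3) m_ge_2 by (intro mult_strict_left_mono) auto
    ultimately have "diam * (1 / real m) ^ n < dist z' x'" by (simp only: scale_diam)
    then obtain k a' where "a' \<in> pieces k (child c v)" "z' \<in> a'"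
      using Suc.IH[of x' "child c v" z' ?l] V(2) a z'(3) b by blast
    then show ?thesis using piece_step[OF v(2)] z'(2) by blast
  next
    case False
    then obtain h' where h': "h = Suc h'" by (cases h) auto
    have a: "a = exit_point (child c v) (edge_label m (vs ! h') (vs ! h))"
      using route_nth[OF h(1)] h(2) False h' v(1) by simp
    have "edge_label m (vs ! h') (vs ! h) \<noteq> ?l"
    proof (cases "Suc h = length vs")
      case True
      have "adjacent m (vs ! h') (vs ! h)" using vs(6) h(1) h' by (auto simp: successively_conv_nth)
      then have "neighbours m (edge_label m (vs ! h') (vs ! h)) (vs ! h) (vs ! h')"
        using edge_label_neighbours neighbours_sym by blast
      moreover have "length vs - 1 = h" using True by simp
      then have "vs ! h = exit_cell c j" using vs(1,3) by (simp add: last_conv_nth)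
      ultimately show ?thesis using exit_cell_no_neighbour True by metis
    next
      case False
      then show ?thesis using edge_labels_distinct[OF vs(5,6), of h'] h(1) h' by auto
    qed
    from piece_1[OF v(2) this] show ?thesis using a b z'(2,3) by blast
  qed
qed

lemma in_piece_exit:
  assumes "x \<in> fractal S c" "z \<in> seg c x (exit_point c j)" "z \<noteq> x"
  shows "\<exists>k. \<exists>a\<in>pieces k c. z \<in> a"
  using in_piece_exit_aux[OF assms(1,2)] eventually_small[OF assms(3)] by metis

text \<open>Both end cells of the route may be incomplete, but if they differ, each has an exit at
  one end and falls under \<open>in_piece_exit\<close>. Only a route of a single cell needs the
  induction.\<close>

lemma in_piece_aux:
  assumes "x \<in> fractal S c" "y \<in> fractal S c" "z \<in> seg c x y" "z \<noteq> x" "z \<noteq> y" "diam * (1 / real m) ^ n < dist z x"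
  shows "\<exists>k. \<exists>a\<in>pieces k c. z \<in> a"
  using assms
proof (induction n arbitrary: c x y z)
  case 0
  have "z \<in> fractal S c" using seg_subset 0 by blast
  then show ?case using dist_fractal[of z c x] 0 by simp
next
  case (Suc n)
  obtain V x' W y' vs where VW: "x' \<in> fractal S (child c V)" "x = affine_map V x'" "y' \<in> fractal S (child c W)" "y = affine_map W y'"
    and p: "graph_path (cells c) (adjacent m) V vs W" using Suc.prems(1,2) by (rule fractal_route)
  have vs: "vs \<noteq> []" "hd vs = V" "last vs = W" "set vs \<subseteq> cells c" "distinct vs" "successively (adjacent m) vs"
    using p by (auto simp: graph_path_def)
  let ?R = "route c vs x' y'"
  have "z \<in> (\<Union>(v, a, b)\<in>set ?R. affine_map v ` seg (child c v) a b)"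
    using seg_route[OF p VW(1,3)] VW(2,4) Suc.prems(3) by simp
  then obtain v a b z' where z': "(v, a, b) \<in> set ?R" "z = affine_map v z'" "z' \<in> seg (child c v) a b" by blast
  obtain h where h: "h < length vs" "?R ! h = (v, a, b)" using z'(1) by (metis in_set_conv_nth length_route)
  have v: "v = vs ! h" "v \<in> cells c" using route_nth[OF h(1)] h(2) vs(4) h(1) by auto
  have first: "a = x'" "v = V" if "h = 0" using route_nth[OF h(1)] h(2) vs(1,2) that by (auto simp: hd_conv_nth)
  have last: "b = y'" "v = W" if "Suc h = length vs"
  proof -
    have e: "length vs - 1 = h" using that by simp
    then have "vs ! h = W" using vs(1,3) by (simp add: last_conv_nth)
    then show "b = y'" "v = W" using route_nth[OF h(1)] h(2) that by auto
  qed
  have nfirst: "a = exit_point (child c v) (edge_label m (vs ! (h - 1)) (vs ! h))" if "h \<noteq> 0"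
    using route_nth[OF h(1)] h(2) that v(1) by simp
  have nlast: "b = exit_point (child c v) (edge_label m (vs ! h) (vs ! Suc h))" if "Suc h \<noteq> length vs"
    using route_nth[OF h(1)] h(2) that v(1) by simp
  have lift: ?case if "\<exists>k. \<exists>a\<in>pieces k (child c v). z' \<in> a"
    using that piece_step[OF v(2)] z'(2) by blast
  consider "h = 0" "Suc h = length vs" | "h = 0" "Suc h \<noteq> length vs" | "h \<noteq> 0" "Suc h = length vs" | "h \<noteq> 0" "Suc h \<noteq> length vs"
    by blast
  then show ?case
  proof cases
    case 1
    have "dist z' x' = real m * dist z x" using dist_cell[OF v(2), of z' x'] z'(2) VW(2) first 1 by simp
    moreover have "real m * (diam * (1 / real m) ^ Suc n) < real m * dist z x"
      using Suc.prems(6) m_ge_2 by (intro mult_strict_left_mono) auto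
    ultimately have "diam * (1 / real m) ^ n < dist z' x'" by (simp only: scale_diam)
    moreover have "x' \<in> fractal S (child c v)" "y' \<in> fractal S (child c v)" "z' \<in> seg (child c v) x' y'" "z' \<noteq> x'" "z' \<noteq> y'"
      using VW first last 1 z' Suc.prems(4,5) by auto
    ultimately show ?thesis by (intro lift Suc.IH[of x' "child c v" y' z'])
  next
    case 2
    have "x' \<in> fractal S (child c v)" "z' \<noteq> x'" using VW first 2 z' Suc.prems(4) by auto
    then show ?thesis using lift in_piece_exit[of x' "child c v" z'] nlast 2 first z'(3) by blast
  next
    case 3
    have "y' \<in> fractal S (child c v)" "z' \<noteq> y'" using VW last 3 z' Suc.prems(5) by auto
    moreover have "z' \<in> seg (child c v) b a" using z'(3) by (simp only: arc_segment_sym[of _ a b])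
    ultimately show ?thesis using lift in_piece_exit[of y' "child c v" z'] nfirst 3 last by blast
  next
    case 4
    then obtain h' where h': "h = Suc h'" by (cases h) auto
    have "edge_label m (vs ! (h - 1)) (vs ! h) \<noteq> edge_label m (vs ! h) (vs ! Suc h)"
      using edge_labels_distinct[OF vs(5,6), of h'] h(1) h' 4 by auto
    from piece_1[OF v(2) this] show ?thesis using nfirst nlast 4 z'(2,3) by blast
  qed
qed

lemma in_piece:
  assumes "x \<in> fractal S c" "y \<in> fractal S c" "z \<in> seg c x y" "z \<noteq> x" "z \<noteq> y"
  shows "\<exists>k. \<exists>a\<in>pieces k c. z \<in> a"
  using in_piece_aux[OF assms] eventually_small[OF assms(4)] by metis

end

section \<open>Graph-directed constructions\<close>

text \<open>Walks of length \<open>n\<close> from the vertex \<open>t\<close> of a directed graph;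
  an edge \<open>(v, t')\<close> in \<open>D t\<close> leads to \<open>t'\<close> and carries the
  map with label \<open>v\<close>.\<close>

fun words :: "('t \<Rightarrow> ('v \<times> 't) set) \<Rightarrow> nat \<Rightarrow> 't \<Rightarrow> ('v \<times> 't) list set" where
  "words D 0 t = {[]}"
| "words D (Suc n) t = (\<Union>(v, t')\<in>D t. (#) (v, t') ` words D n t')"

fun end_type :: "'t \<Rightarrow> ('v \<times> 't) list \<Rightarrow> 't" where
  "end_type t [] = t"
| "end_type t ((v, t') # w) = end_type t' w"

fun word_map :: "('v \<Rightarrow> 'a \<Rightarrow> 'a) \<Rightarrow> ('v \<times> 't) list \<Rightarrow> 'a \<Rightarrow> 'a" where
  "word_map f [] x = x"
| "word_map f ((v, t') # w) x = f v (word_map f w x)"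

lemma words_Suc_iff:
  "w \<in> words D (Suc n) t \<longleftrightarrow> (\<exists>v t' w'. w = (v, t') # w' \<and> (v, t') \<in> D t \<and> w' \<in> words D n t')"
  by auto

lemma end_type_Cons: "end_type t (p # w) = end_type (snd p) w"
  by (cases p) simp

lemma words_length: "w \<in> words D n t \<Longrightarrow> length w = n"
  by (induction n arbitrary: t w) auto

lemma words_take_drop:
  "w \<in> words D (n + k) t \<Longrightarrow> take n w \<in> words D n t \<and> drop n w \<in> words D k (end_type t (take n w))"
proof (induction n arbitrary: t w)
  case (Suc n)
  then show ?case unfolding add_Suc words_Suc_iff by fastforce
qed simp

lemma words_append:
  "v \<in> words D n t \<Longrightarrow> w \<in> words D k (end_type t v) \<Longrightarrow> v @ w \<in> words D (n + k) t"
proof (induction n arbitrary: t v)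
  case (Suc n)
  then show ?case unfolding add_Suc words_Suc_iff by fastforce
qed simp

lemma end_type_append: "end_type t (v @ w) = end_type (end_type t v) w"
  by (induction t v rule: end_type.induct) auto

lemma word_map_append: "word_map f (v @ w) x = word_map f v (word_map f w x)"
  by (induction f v x rule: word_map.induct) auto

lemma sum_le_cover:
  fixes g :: "'b \<Rightarrow> real"
  assumes "finite I" "A \<subseteq> (\<Union>i\<in>I. W i)" "\<And>i. i \<in> I \<Longrightarrow> finite (W i)" "\<And>i w. i \<in> I \<Longrightarrow> w \<in> W i \<Longrightarrow> 0 \<le> g w"
  shows "sum g A \<le> (\<Sum>i\<in>I. sum g (W i))"
  using assms
proof (induction I arbitrary: A rule: finite_induct)
  case (insert i I)
  have "finite A" using insert.prems(1,2) insert.hyps(1) by (meson finite_UN_I finite_insert finite_subset)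
  then have "sum g A = sum g (A \<inter> W i) + sum g (A - W i)" by (rule sum.Int_Diff)
  also have "sum g (A \<inter> W i) \<le> sum g (W i)" using insert.prems by (intro sum_mono2) auto
  also have "sum g (A - W i) \<le> (\<Sum>i\<in>I. sum g (W i))" using insert.prems by (intro insert.IH) auto
  finally show ?case using insert.hyps by simp
qed simp

text \<open>\<open>X\<close> is a positive eigenvector of the incidence matrix and serves as mass.
  Copies may touch, so \<open>sep\<close> takes the place of disjointness: a set of diameter at most
  \<open>1 / M ^ n\<close> meets boundedly many copies of level \<open>n\<close>.\<close>

locale graph_directed =
  fixes K :: "'t \<Rightarrow> 'a::euclidean_space set" and T :: "'t set" and D :: "'t \<Rightarrow> ('v \<times> 't) set"
    and f :: "'v \<Rightarrow> 'a \<Rightarrow> 'a" and X :: "'t \<Rightarrow> real" and \<theta> M :: real and C :: nat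
  assumes fin: "finite T" "\<And>t. t \<in> T \<Longrightarrow> finite (D t)" "\<And>t v t'. t \<in> T \<Longrightarrow> (v, t') \<in> D t \<Longrightarrow> t' \<in> T"
    and decomp: "\<And>t. t \<in> T \<Longrightarrow> K t = (\<Union>(v, t')\<in>D t. f v ` K t')"
    and K: "\<And>t. t \<in> T \<Longrightarrow> compact (K t)" "\<And>t. t \<in> T \<Longrightarrow> K t \<noteq> {}"
    and X: "\<And>t. t \<in> T \<Longrightarrow> 0 < X t" "\<And>t. t \<in> T \<Longrightarrow> (\<Sum>(v, t')\<in>D t. X t') = \<theta> * X t"
    and \<theta>: "0 < \<theta>" and M: "1 < M"
    and hom: "\<And>t v t' x y. t \<in> T \<Longrightarrow> (v, t') \<in> D t \<Longrightarrow> dist (f v x) (f v y) = dist x y / M"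
    and sep: "\<And>t n U. t \<in> T \<Longrightarrow> (\<forall>x\<in>U. \<forall>y\<in>U. dist x y \<le> 1 / M ^ n) \<Longrightarrow>
       card {w \<in> words D n t. word_map f w ` K (end_type t w) \<inter> U \<noteq> {}} \<le> C"
begin

lemma finite_words: "t \<in> T \<Longrightarrow> finite (words D n t)"
  by (induction n arbitrary: t) (auto simp: fin)

lemma end_type_in: "t \<in> T \<Longrightarrow> w \<in> words D n t \<Longrightarrow> end_type t w \<in> T"
  by (induction n arbitrary: t w) (auto simp: fin)

lemma words_mass: "t \<in> T \<Longrightarrow> (\<Sum>w\<in>words D n t. X (end_type t w)) = \<theta> ^ n * X t"
proof (induction n arbitrary: t)
  case (Suc n)
  have "(\<Sum>w\<in>words D (Suc n) t. X (end_type t w)) =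
     (\<Sum>p\<in>D t. \<Sum>w\<in>(#) p ` words D n (snd p). X (end_type t w))"
    unfolding words.simps case_prod_unfold
    by (subst sum.UNION_disjoint) (use Suc.prems fin finite_words in auto)
  also have "\<dots> = (\<Sum>p\<in>D t. \<Sum>w\<in>words D n (snd p). X (end_type (snd p) w))"
    by (simp add: sum.reindex end_type_Cons)
  also have "\<dots> = (\<Sum>p\<in>D t. \<theta> ^ n * X (snd p))"
    using Suc fin(3) by (intro sum.cong refl Suc.IH) (metis prod.collapse)
  also have "\<dots> = \<theta> ^ Suc n * X t"
    using X(2)[OF Suc.prems] by (simp add: case_prod_unfold flip: sum_distrib_left)
  finally show ?case .
qed simp

lemma words_decomp: "t \<in> T \<Longrightarrow> K t = (\<Union>w\<in>words D n t. word_map f w ` K (end_type t w))"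
proof (induction n arbitrary: t)
  case (Suc n)
  show ?case
  proof (intro subset_antisym subsetI)
    fix x assume "x \<in> K t"
    then obtain v t' y where y: "(v, t') \<in> D t" "y \<in> K t'" "x = f v y" using decomp[OF Suc.prems] by blast
    then obtain w z where "w \<in> words D n t'" "z \<in> K (end_type t' w)" "y = word_map f w z"
      using Suc.IH[OF fin(3)[OF Suc.prems y(1)]] by blast
    then have "(v, t') # w \<in> words D (Suc n) t" "z \<in> K (end_type t ((v, t') # w))" "x = word_map f ((v, t') # w) z"
      using y unfolding words_Suc_iff by auto
    then show "x \<in> (\<Union>w\<in>words D (Suc n) t. word_map f w ` K (end_type t w))" by blast
  next
    fix x assume "x \<in> (\<Union>w\<in>words D (Suc n) t. word_map f w ` K (end_type t w))"
    then obtain v t' w z where w: "(v, t') \<in> D t" "w \<in> words D n t'" "z \<in> K (end_type t' w)" "x = f v (word_map f w z)"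
      unfolding words_Suc_iff by fastforce
    then have "word_map f w z \<in> K t'" using Suc.IH[OF fin(3)[OF Suc.prems w(1)]] by blast
    then show "x \<in> K t" using w(1,4) decomp[OF Suc.prems] by blast
  qed
qed simp

lemma word_map_hom: "t \<in> T \<Longrightarrow> w \<in> words D n t \<Longrightarrow> dist (word_map f w x) (word_map f w y) = dist x y / M ^ n"
proof (induction n arbitrary: t w)
  case (Suc n)
  then obtain v t' w' where w: "w = (v, t') # w'" "(v, t') \<in> D t" "w' \<in> words D n t'" by auto
  then show ?case using Suc.IH[of t' w'] hom[OF Suc.prems(1) w(2)] fin(3)[OF Suc.prems(1) w(2)] by simp
qed simp

lemma words_extension_mass:
  assumes "t \<in> T" "v \<in> words D n t"
  shows "(\<Sum>w\<in>{w \<in> words D (n + k) t. take n w = v}. X (end_type t w)) = \<theta> ^ k * X (end_type t v)"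
proof -
  have "{w \<in> words D (n + k) t. take n w = v} = (@) v ` words D k (end_type t v)"
  proof (intro subset_antisym subsetI)
    fix w assume w: "w \<in> {w \<in> words D (n + k) t. take n w = v}"
    then have "drop n w \<in> words D k (end_type t v)" using words_take_drop[of w D n k t] by auto
    moreover have "w = v @ drop n w" using w append_take_drop_id[of n w] by auto
    ultimately show "w \<in> (@) v ` words D k (end_type t v)" by blast
  next
    fix w assume "w \<in> (@) v ` words D k (end_type t v)"
    then show "w \<in> {w \<in> words D (n + k) t. take n w = v}"
      using assms(2) words_append words_length by fastforce
  qed
  then show ?thesis using words_mass[OF end_type_in[OF assms]]
    by (simp add: sum.reindex inj_on_def end_type_append)
qed

lemma X_bounds:
  obtains a b where "0 < a" "0 < b" "\<And>t. t \<in> T \<Longrightarrow> a \<le> X t" "\<And>t. t \<in> T \<Longrightarrow> X t \<le> b"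
proof
  have f: "finite (insert 1 (X ` T))" using fin(1) by simp
  show "0 < Min (insert 1 (X ` T))" using X(1) f by (subst Min_gr_iff) auto
  show "0 < Max (insert 1 (X ` T))" using f by (subst Max_gr_iff) auto
  show "Min (insert 1 (X ` T)) \<le> X t" if "t \<in> T" for t using f that by (intro Min_le) auto
  show "X t \<le> Max (insert 1 (X ` T))" if "t \<in> T" for t using f that by (intro Max_ge) auto
qed

lemma diameter_bound:
  obtains d where "0 \<le> d" "\<And>t x y. t \<in> T \<Longrightarrow> x \<in> K t \<Longrightarrow> y \<in> K t \<Longrightarrow> dist x y \<le> d"
proof
  have "compact (\<Union>t\<in>T. K t)" using fin(1) K(1) by (intro compact_UN) auto
  then have b: "bounded (\<Union>t\<in>T. K t)" by (rule compact_imp_bounded)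
  show "0 \<le> diameter (\<Union>t\<in>T. K t)" using b by (rule diameter_ge_0)
  show "dist x y \<le> diameter (\<Union>t\<in>T. K t)" if "t \<in> T" "x \<in> K t" "y \<in> K t" for t x y
    using that by (intro diameter_bounded_bound[OF b]) auto
qed

text \<open>The masses of level \<open>n\<close> add up to \<open>\<theta> ^ n * X t\<close> and are
  bounded below, so there are at most a constant times \<open>\<theta> ^ n\<close> copies, of
  diameter at most a constant times \<open>1 / M ^ n\<close>.\<close>

lemma hausdorff_null:
  assumes t: "t \<in> T" and s: "0 < s" "\<theta> < M powr s"
  shows "hausdorff_measure s (K t) = 0"
proof -
  obtain a where a: "0 < a" "\<And>t. t \<in> T \<Longrightarrow> a \<le> X t" using X_bounds by metis
  obtain d where d: "0 \<le> d" "\<And>t x y. t \<in> T \<Longrightarrow> x \<in> K t \<Longrightarrow> y \<in> K t \<Longrightarrow> dist x y \<le> d" using diameter_bound by metis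
  show ?thesis
  proof (rule hausdorff_null_of_finite_covers[OF M s(1) \<theta> s(2)])
    show "0 \<le> X t / a" "0 \<le> d" using a(1) X(1)[OF t] d(1) by auto
    fix n
    let ?F = "(\<lambda>w. word_map f w ` K (end_type t w)) ` words D n t"
    have "real (card (words D n t)) * a \<le> (\<Sum>w\<in>words D n t. X (end_type t w))"
      using a(2) end_type_in[OF t] by (simp add: sum_bounded_below)
    then have "real (card (words D n t)) \<le> X t / a * \<theta> ^ n" using a(1) words_mass[OF t] by (simp add: field_simps)
    moreover have "real (card ?F) \<le> real (card (words D n t))" using finite_words[OF t] by (simp add: card_image_le)
    ultimately have "real (card ?F) \<le> X t / a * \<theta> ^ n" by linarith
    moreover have "dist x y \<le> d / M ^ n"
      if w: "w \<in> words D n t" and xy: "x \<in> word_map f w ` K (end_type t w)" "y \<in> word_map f w ` K (end_type t w)" for w x y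
    proof -
      obtain x' y' where "x' \<in> K (end_type t w)" "x = word_map f w x'" "y' \<in> K (end_type t w)" "y = word_map f w y'" using xy by blast
      then show ?thesis using word_map_hom[OF t w, of x' y'] d(2)[OF end_type_in[OF t w]] M by (simp add: divide_right_mono)
    qed
    ultimately show "\<exists>F. finite F \<and> K t \<subseteq> \<Union>F \<and> real (card F) \<le> X t / a * \<theta> ^ n \<and>
       (\<forall>U\<in>F. \<forall>x\<in>U. \<forall>y\<in>U. dist x y \<le> d / M ^ n)"
      using words_decomp[OF t, of n] finite_words[OF t]
      by (intro exI[of _ ?F] conjI) auto
  qed
qed

text \<open>A mass distribution argument without a limit measure: for a finite cover all masses are
  compared at one level \<open>N\<close> that is at least as fine as every covering set.\<close>

lemma hausdorff_pos:
  assumes t: "t \<in> T" and s: "0 < s" "M powr s = \<theta>"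
  shows "hausdorff_measure s (K t) \<noteq> 0"
proof -
  obtain b where b: "0 < b" "\<And>t. t \<in> T \<Longrightarrow> X t \<le> b" using X_bounds by metis
  \<comment> \<open>\<open>C\<close> bounds the number of copies met by a covering set,
    \<open>b\<close> their masses, and \<theta> pays for rounding its diameter to a power of
    \<open>M\<close>; \<open>Suc C\<close> keeps \<open>B\<close> positive.\<close>
  define B where "B = real (Suc C) * b * \<theta>"
  have B: "0 < B" using b \<theta> by (simp add: B_def)
  show ?thesis
  proof (rule hausdorff_measure_pos_of_covers[OF K(1)[OF t] s(1)])
    show "0 < X t / B" using X(1)[OF t] B by simp
    fix I :: "nat set" and U d
    assume I: "finite I" "K t \<subseteq> (\<Union>i\<in>I. U i)"
      and d: "\<And>i. i \<in> I \<Longrightarrow> 0 < d i \<and> d i < 1 \<and> (\<forall>x\<in>U i. \<forall>y\<in>U i. dist x y \<le> d i)"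
    have "\<exists>n. 1 / M ^ Suc n \<le> d i \<and> d i \<le> 1 / M ^ n" if "i \<in> I" for i
    proof -
      have "(\<lambda>n. (1 / M) ^ n) \<longlonglongrightarrow> 0" using M by (intro LIMSEQ_realpow_zero) auto
      then have "\<forall>\<^sub>F n in sequentially. (1 / M) ^ n < d i" using d[OF that] by (intro order_tendstoD) auto
      then obtain k where k: "(1 / M) ^ k < d i" using eventually_happens'[OF sequentially_bot] by blast
      define n where "n = (LEAST n. 1 / M ^ Suc n \<le> d i)"
      have "1 / M ^ Suc k \<le> 1 / M ^ k" using M by (intro divide_left_mono power_increasing) auto
      then have "1 / M ^ Suc k \<le> d i" using k by (simp add: power_divide)
      then have n1: "1 / M ^ Suc n \<le> d i" unfolding n_def by (rule LeastI)
      have "d i \<le> 1 / M ^ n"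
      proof (cases n)
        case (Suc n')
        then have "\<not> 1 / M ^ Suc n' \<le> d i" unfolding n_def by (metis lessI not_less_Least)
        then show ?thesis using Suc by simp
      qed (use d[OF that] in simp)
      then show ?thesis using n1 by blast
    qed
    then obtain n where n: "\<And>i. i \<in> I \<Longrightarrow> 1 / M ^ Suc (n i) \<le> d i" "\<And>i. i \<in> I \<Longrightarrow> d i \<le> 1 / M ^ n i" by metis
    define N where "N = Max (insert 0 (n ` I))"
    have nN: "n i \<le> N" if "i \<in> I" for i unfolding N_def using I(1) that by (intro Max_ge) auto
    let ?meet = "\<lambda>i v. word_map f v ` K (end_type t v) \<inter> U i \<noteq> {}"
    let ?W = "\<lambda>i. {w \<in> words D N t. ?meet i (take (n i) w)}"
    \<comment> \<open>A point of the copy \<open>w\<close> lies in some \<open>U i\<close>, and then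
      the copy of level \<open>n i\<close> that contains \<open>w\<close> meets
      \<open>U i\<close>.\<close>
    have cov: "words D N t \<subseteq> (\<Union>i\<in>I. ?W i)"
    proof
      fix w assume w: "w \<in> words D N t"
      obtain x where x: "x \<in> K (end_type t w)" using K(2)[OF end_type_in[OF t w]] by blast
      have "word_map f w x \<in> K t" using words_decomp[OF t, of N] w x by blast
      then obtain i where i: "i \<in> I" "word_map f w x \<in> U i" using I(2) by blast
      have "w \<in> words D (n i + (N - n i)) t" using w nN[OF i(1)] by simp
      note td = words_take_drop[OF this]
      have e: "end_type t w = end_type (end_type t (take (n i) w)) (drop (n i) w)"
        using end_type_append[of t "take (n i) w" "drop (n i) w"] by simp
      have "word_map f (drop (n i) w) x \<in> K (end_type t (take (n i) w))"
      proof (subst words_decomp[OF end_type_in[OF t conjunct1[OF td]], of "N - n i"])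
        show "word_map f (drop (n i) w) x \<in> (\<Union>w'\<in>words D (N - n i) (end_type t (take (n i) w)).
            word_map f w' ` K (end_type (end_type t (take (n i) w)) w'))"
          using td x[unfolded e] by blast
      qed
      moreover have "word_map f w x = word_map f (take (n i) w) (word_map f (drop (n i) w) x)"
        using word_map_append[of f "take (n i) w" "drop (n i) w" x] by simp
      ultimately have "?meet i (take (n i) w)" using i(2) by (metis IntI empty_iff imageI)
      then show "w \<in> (\<Union>i\<in>I. ?W i)" using w i(1) by blast
    qed
    have part: "(\<Sum>w\<in>?W i. X (end_type t w)) \<le> real (Suc C) * b * \<theta> ^ (N - n i)" if i: "i \<in> I" for i
    proof -
      let ?V = "{v \<in> words D (n i) t. ?meet i v}"
      have W: "?W i = (\<Union>v\<in>?V. {w \<in> words D (n i + (N - n i)) t. take (n i) w = v})"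
        using nN[OF i] words_take_drop[of _ D "n i" "N - n i" t] by auto
      have "card ?V \<le> C" using d[OF i] n(2)[OF i] by (intro sep[OF t]) (meson order_trans)
      have "(\<Sum>w\<in>?W i. X (end_type t w)) = (\<Sum>v\<in>?V. \<Sum>w\<in>{w \<in> words D (n i + (N - n i)) t. take (n i) w = v}. X (end_type t w))"
        unfolding W by (rule sum.UNION_disjoint) (use finite_words[OF t] in auto)
      also have "\<dots> = (\<Sum>v\<in>?V. \<theta> ^ (N - n i) * X (end_type t v))"
        by (rule sum.cong[OF refl], rule words_extension_mass[OF t]) simp
      also have "\<dots> \<le> (\<Sum>v\<in>?V. \<theta> ^ (N - n i) * b)"
        using b(2) end_type_in[OF t] \<theta> by (intro sum_mono mult_left_mono) auto
      also have "\<dots> = real (card ?V) * b * \<theta> ^ (N - n i)" by simp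
      also have "\<dots> \<le> real (Suc C) * b * \<theta> ^ (N - n i)"
        using \<open>card ?V \<le> C\<close> b \<theta> by (intro mult_right_mono) auto
      finally show ?thesis .
    qed
    have "\<theta> ^ N * X t = (\<Sum>w\<in>words D N t. X (end_type t w))" using words_mass[OF t] by simp
    also have "\<dots> \<le> (\<Sum>i\<in>I. \<Sum>w\<in>?W i. X (end_type t w))"
      using I(1) cov finite_words[OF t] end_type_in[OF t] X(1)
      by (intro sum_le_cover[where W = ?W]) (auto intro: less_imp_le)
    also have "\<dots> \<le> (\<Sum>i\<in>I. real (Suc C) * b * \<theta> ^ (N - n i))" by (intro sum_mono part)
    also have "\<dots> \<le> (\<Sum>i\<in>I. \<theta> ^ N * (B * d i powr s))"
    proof (rule sum_mono)
      fix i assume i: "i \<in> I"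
      have "1 / \<theta> ^ Suc (n i) = (1 / M ^ Suc (n i)) powr s"
      proof -
        have "(M ^ Suc (n i)) powr s = (M powr s) ^ Suc (n i)"
          using M by (simp add: powr_powr powr_realpow[symmetric] mult.commute del: power_Suc)
        then show ?thesis using M s(2) by (simp add: powr_divide del: power_Suc)
      qed
      also have "\<dots> \<le> d i powr s" using n(1)[OF i] M s(1) by (intro powr_mono2) auto
      finally have "1 / \<theta> ^ Suc (n i) \<le> d i powr s" .
      then have "\<theta> ^ N * \<theta> * (1 / \<theta> ^ Suc (n i)) \<le> \<theta> ^ N * \<theta> * d i powr s"
        using \<theta> by (intro mult_left_mono) auto
      moreover have "\<theta> ^ N * \<theta> * (1 / \<theta> ^ Suc (n i)) = \<theta> ^ (N - n i)"
        using \<theta> nN[OF i] by (simp add: power_diff)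
      ultimately have "real (Suc C) * b * \<theta> ^ (N - n i) \<le> real (Suc C) * b * (\<theta> ^ N * \<theta> * d i powr s)"
        using b by (intro mult_left_mono) auto
      then show "real (Suc C) * b * \<theta> ^ (N - n i) \<le> \<theta> ^ N * (B * d i powr s)" by (simp add: B_def mult_ac)
    qed
    also have "\<dots> = \<theta> ^ N * (B * (\<Sum>i\<in>I. d i powr s))" by (simp add: sum_distrib_left)
    finally have "X t \<le> B * (\<Sum>i\<in>I. d i powr s)" using \<theta> by simp
    then show "X t / B \<le> (\<Sum>i\<in>I. d i powr s)" using B by (simp add: divide_le_eq mult.commute)
  qed
qed

lemma word_at:
  assumes "t \<in> T" "x \<in> K t"
  obtains w y where "w \<in> words D n t" "y \<in> K (end_type t w)" "x = word_map f w y"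
  using words_decomp[OF assms(1), of n] assms(2) by blast

end

section \<open>Counting types along paths\<close>

text \<open>The third index. For \<open>x = y\<close> the complement is no singleton and the value
  is unspecified.\<close>

definition missing :: "3 \<Rightarrow> 3 \<Rightarrow> 3" where
  "missing x y = the_elem (- {x, y})"

lemma missing_iff:
  assumes "x \<noteq> y"
  shows "missing x y = k \<longleftrightarrow> k \<noteq> x \<and> k \<noteq> y"
proof -
  obtain a b where ab: "a \<noteq> x" "b \<noteq> x" "a \<noteq> b" "\<And>h. h = x \<or> h = a \<or> h = b" by (rule other_indices[of x]) blast
  then obtain l where l: "l \<noteq> x" "l \<noteq> y" "\<And>h. h = x \<or> h = y \<or> h = l" using assms by metis
  then have "- {x, y} = {l}" by auto
  then have "missing x y = l" by (simp add: missing_def)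
  then show ?thesis using l by metis
qed

lemma missing_commute: "missing x y = missing y x"
  by (simp add: missing_def insert_commute)

lemma pair_eq_missing: "x \<noteq> y \<Longrightarrow> {x, y} = - {k} \<longleftrightarrow> k = missing x y"
proof -
  assume xy: "x \<noteq> y"
  have "{x, y} = - {k} \<longleftrightarrow> k \<noteq> x \<and> k \<noteq> y"
  proof
    assume "k \<noteq> x \<and> k \<noteq> y"
    moreover have "h = x \<or> h = y \<or> h = k" if "k \<noteq> x" "k \<noteq> y" for h
      using xy that exhaust_3[of h] exhaust_3[of x] exhaust_3[of y] exhaust_3[of k] by auto
    ultimately show "{x, y} = - {k}" by blast
  qed blast
  then show ?thesis using missing_iff[OF xy, of k] by auto
qed

fun typed :: "nat \<Rightarrow> 3 \<Rightarrow> 3 \<Rightarrow> triangle list \<Rightarrow> (triangle \<times> 3 \<times> 3) list" where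
  "typed m a b [] = []"
| "typed m a b [v] = [(v, a, b)]"
| "typed m a b (v # w # vs) = (v, a, edge_label m v w) # typed m (edge_label m v w) b (w # vs)"

lemma length_typed [simp]: "length (typed m a b vs) = length vs"
  by (induction m a b vs rule: typed.induct) auto

lemma typed_nth: "h < length vs \<Longrightarrow> typed m a b vs ! h = (vs ! h, path_labels m a b vs ! h, path_labels m a b vs ! Suc h)"
proof (induction m a b vs arbitrary: h rule: typed.induct)
  case (3 m a b v w vs)
  then show ?case by (cases h) (auto simp: path_labels_def)
qed (auto simp: path_labels_def)

lemma type_count_typed:
  "type_count m a b vs X \<gamma> = length (filter (\<lambda>(v, x, y). v \<in> X \<and> {x, y} = \<gamma>) (typed m a b vs))"
  unfolding type_count_def type_in_path_def length_filter_conv_card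
  by (rule arg_cong[where f = card]) (auto simp: typed_nth)

lemma typed_append:
  "set (typed m a b (xs @ B # ys)) =
    (if xs = [] then {} else set (typed m a (edge_label m (last xs) B) xs)) \<union>
    {(B, if xs = [] then a else edge_label m (last xs) B, if ys = [] then b else edge_label m B (hd ys))} \<union>
    (if ys = [] then {} else set (typed m (edge_label m B (hd ys)) b ys))"
proof (induction m a b xs rule: typed.induct)
  case (1 m a b)
  then show ?case by (cases ys) auto
next
  case (2 m a b v)
  then show ?case by (cases ys) auto
qed auto

lemma edge_label_sym: "edge_label m V W = edge_label m W V"
proof -
  have "neighbours m j V W = neighbours m j W V" for j using neighbours_sym by blast
  then show ?thesis by (simp add: edge_label_def)
qed

lemma set_typed_rev: "set (typed m b a (rev vs)) = (\<lambda>(v, x, y). (v, y, x)) ` set (typed m a b vs)"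
proof (induction m a b vs rule: typed.induct)
  case (3 m a b v w vs)
  have "set (typed m b a (rev (v # w # vs))) = set (typed m b a (rev (w # vs) @ v # []))" by simp
  also have "\<dots> = set (typed m b (edge_label m v w) (rev (w # vs))) \<union> {(v, edge_label m v w, a)}"
    unfolding typed_append by (simp add: edge_label_sym)
  also have "\<dots> = (\<lambda>(v, x, y). (v, y, x)) ` set (typed m a b (v # w # vs))" using 3 by auto
  finally show ?case .
qed auto

text \<open>A path type \<open>{i, j}\<close> is encoded by the third index.\<close>

definition canon :: "3 \<Rightarrow> 3 \<times> 3" where
  "canon k = (if k = 3 then (1, 2) else if k = 2 then (1, 3) else (2, 3))"

lemma canon_distinct: "fst (canon k) \<noteq> snd (canon k)"
  by (simp add: canon_def)

lemma canon_missing: "missing (fst (canon k)) (snd (canon k)) = k"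
  using exhaust_3[of k] by (subst missing_iff[OF canon_distinct]) (auto simp: canon_def)

lemma canon_pair: "i \<noteq> j \<Longrightarrow> canon (missing i j) = (i, j) \<or> canon (missing i j) = (j, i)"
proof -
  assume ij: "i \<noteq> j"
  let ?k = "missing i j"
  have "?k \<noteq> i" "?k \<noteq> j" using missing_iff[OF ij, of ?k] by auto
  moreover have "fst (canon ?k) \<noteq> ?k" "snd (canon ?k) \<noteq> ?k"
    using missing_iff[OF canon_distinct, of ?k ?k] canon_missing by auto
  ultimately show ?thesis using ij canon_distinct[of ?k] exhaust_3[of i] exhaust_3[of j] exhaust_3[of ?k]
      exhaust_3[of "fst (canon ?k)"] exhaust_3[of "snd (canon ?k)"] by (cases "canon ?k") auto
qed

lemma alternating_sum:
  "(\<Sum>h<r. (-1) ^ h * (g h + g (Suc h) :: real)) = g 0 - (-1) ^ r * g r"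
  by (induction r) (auto simp: algebra_simps)

lemma alternating_one: "odd r \<Longrightarrow> (\<Sum>h<r. (-1) ^ h) = (1::real)"
proof -
  have "(\<Sum>h<r. (-1) ^ h) = (if odd r then 1 else 0::real)" by (induction r) auto
  then show "odd r \<Longrightarrow> ?thesis" by simp
qed

lemma sum_even: "2 * (\<Sum>h<r. if even h then 1 else 0) = real r + (if odd r then 1 else 0)"
  by (induction r) auto

lemma unit_steps_bound:
  fixes g :: "nat \<Rightarrow> int"
  assumes "\<And>t. t < n \<Longrightarrow> g (Suc t) \<le> g t + 1"
  shows "g n \<le> g 0 + int n" "t0 < n \<Longrightarrow> g (Suc t0) \<le> g t0 \<Longrightarrow> g n \<le> g 0 + int n - 1"
proof -
  have *: "g k \<le> g 0 + int k" if "k \<le> n" for k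
    using that
  proof (induction k)
    case (Suc k)
    then show ?case using assms[of k] by simp
  qed simp
  then show "g n \<le> g 0 + int n" by simp
  show "g n \<le> g 0 + int n - 1" if t0: "t0 < n" "g (Suc t0) \<le> g t0"
  proof -
    have "g k \<le> g 0 + int k - 1" if "Suc t0 \<le> k" "k \<le> n" for k
      using that
    proof (induction k rule: dec_induct)
      case base
      then show ?case using *[of t0] t0 by simp
    next
      case (step k)
      then show ?case using assms[of k] by simp
    qed
    then show ?thesis using t0 by simp
  qed
qed

context labyrinth
begin

section \<open>Exit paths and the types of their cells\<close>

definition exit_path :: "bool \<Rightarrow> 3 \<Rightarrow> 3 \<Rightarrow> triangle list" where
  "exit_path c i j = (THE p. graph_path (cells c) (adjacent m) (exit_cell c i) p (exit_cell c j))"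

lemma path_unique: "graph_path (cells c) (adjacent m) x p y \<Longrightarrow> graph_path (cells c) (adjacent m) x q y \<Longrightarrow> p = q"
  by (rule tree_path_unique[OF tree adjacent_sym adjacent_irrefl])

lemma exit_path: "graph_path (cells c) (adjacent m) (exit_cell c i) (exit_path c i j) (exit_cell c j)"
proof -
  obtain p where p: "graph_path (cells c) (adjacent m) (exit_cell c i) p (exit_cell c j)"
    using cells_path exit_cell_cells by blast
  show ?thesis unfolding exit_path_def by (rule theI[where P = "\<lambda>p. graph_path (cells c) (adjacent m) (exit_cell c i) p (exit_cell c j)", OF p])
      (rule path_unique[OF _ p])
qed

lemma white_path_eq: "white_path m S = exit_path True"
  by (intro ext) (simp add: white_path_def exit_path_def white_exit_eq cells_def pattern_part_def)

lemma yellow_path_eq: "yellow_path m S = exit_path False"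
  by (intro ext) (simp add: yellow_path_def exit_path_def yellow_exit_eq cells_def pattern_part_def)

lemma graph_path_rev:
  assumes "graph_path (cells c) (adjacent m) x p y"
  shows "graph_path (cells c) (adjacent m) y (rev p) x"
proof -
  have "successively (adjacent m) p" using assms by (simp add: graph_path_def)
  then have "successively (\<lambda>a b. adjacent m b a) p" by (rule successively_mono) (rule adjacent_sym)
  then show ?thesis using assms by (simp add: graph_path_def hd_rev last_rev)
qed

lemma exit_path_rev: "exit_path c j i = rev (exit_path c i j)"
  using path_unique exit_path graph_path_rev by metis

context
  fixes c :: bool and i j :: 3
  assumes ij: "i \<noteq> j"
begin

abbreviation (input) "ep \<equiv> exit_path c i j"
abbreviation (input) "lab \<equiv> path_labels m i j (exit_path c i j)"

lemma exit_path_facts: "ep \<noteq> []" "set ep \<subseteq> cells c" "distinct ep" "successively (adjacent m) ep"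
    "ep ! 0 = exit_cell c i" "ep ! (length ep - 1) = exit_cell c j"
  using exit_path[of c i j] by (auto simp: graph_path_def hd_conv_nth last_conv_nth)

lemma lab_distinct: "h < length ep \<Longrightarrow> lab ! h \<noteq> lab ! Suc h"
  using path_labels_distinct[OF exit_path ij] .

lemma lab_ends: "lab ! 0 = i" "lab ! length ep = j"
  using exit_path_facts(1) path_labels_nth[of "length ep" ep i j] by (auto simp: path_labels_def)

lemma exit_path_neighbours: "Suc h < length ep \<Longrightarrow> neighbours m (lab ! Suc h) (ep ! h) (ep ! Suc h)"
  using exit_path_facts(1,4) path_labels_nth[of "Suc h" ep i j]
  by (auto simp: successively_conv_nth intro!: edge_label_neighbours)

lemma exit_path_parity: "h < length ep \<Longrightarrow> ep ! h \<in> pattern_part S c (even h)"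
proof -
  have "ep ! h \<in> up_triangles m \<longleftrightarrow> even h" if "h < length ep" for h
    using that
  proof (induction h)
    case 0
    then show ?case using exit_path_facts(5) exit_index_up by (auto simp: exit_cell_def up_triangles_def)
  next
    case (Suc h)
    then show ?case using neighbours_child[OF exit_path_neighbours[OF Suc.prems], of True] by (auto simp: child_def)
  qed
  moreover assume "h < length ep"
  ultimately have e: "ep ! h \<in> up_triangles m \<longleftrightarrow> even h" by blast
  have "ep ! h \<in> cells c" using exit_path_facts(2) \<open>h < length ep\<close> by auto
  then show ?thesis using e pattern_part_subset[of c] up_down_disjoint[OF m_ge_2] by (cases "even h") (auto simp: cells_def)
qed

lemma exit_path_odd: "odd (length ep)"
proof -
  have "length ep - 1 < length ep" using exit_path_facts(1) by simp
  from exit_path_parity[OF this] have "exit_cell c j \<in> pattern_part S c (even (length ep - 1))" using exit_path_facts(6) by simp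
  then have "even (length ep - 1)"
    using exit_cell_in[of c j] pattern_part_subset[of c] up_down_disjoint[OF m_ge_2] by (cases "even (length ep - 1)") auto
  then show ?thesis using exit_path_facts(1) by (cases ep) auto
qed

lemma exit_path_long: "3 \<le> length ep"
proof -
  have "length ep \<noteq> 1" using exit_path_facts(5,6) exit_cells_distinct[OF ij] by auto
  then show ?thesis using exit_path_odd exit_path_facts(1) by (cases ep; cases "tl ep"; cases "tl (tl ep)") auto
qed

end

text \<open>An entry of a block of the path matrix, where \<open>k\<close> and \<open>k'\<close>
  stand for the complementary pairs, \<open>c\<close> is the colour of the path and \<open>u\<close>
  the direction of the cells.\<close>

definition count :: "bool \<Rightarrow> bool \<Rightarrow> 3 \<Rightarrow> 3 \<Rightarrow> nat" where
  "count c u k k' = (case canon k of (i, j) \<Rightarrow> type_count m i j (exit_path c i j) (pattern_part S c u) (- {k'}))"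

lemma pattern_part_exclusive: "V \<in> pattern_part S c u \<Longrightarrow> V \<in> pattern_part S c u' \<longleftrightarrow> u = u'"
  using pattern_part_subset[of c] up_down_disjoint[OF m_ge_2] by (cases u; cases u') auto

lemma count_eq:
  assumes "canon k = (i, j)"
  shows "count c u k k' = card {h. h < length (exit_path c i j) \<and> even h = u \<and>
     missing (path_labels m i j (exit_path c i j) ! h) (path_labels m i j (exit_path c i j) ! Suc h) = k'}"
proof -
  have ij: "i \<noteq> j" using canon_distinct[of k] assms by simp
  have "h < length (exit_path c i j) \<Longrightarrow>
     (exit_path c i j ! h \<in> pattern_part S c u \<and> type_in_path m i j (exit_path c i j) h = - {k'}) \<longleftrightarrow>
     (even h = u \<and> missing (path_labels m i j (exit_path c i j) ! h) (path_labels m i j (exit_path c i j) ! Suc h) = k')" for h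
    using pattern_part_exclusive[OF exit_path_parity[OF ij]] pair_eq_missing[OF lab_distinct[OF ij]]
    by (auto simp: type_in_path_def)
  then show ?thesis unfolding count_def type_count_def assms prod.case by (metis (no_types, lifting))
qed

lemma count_sum:
  assumes "canon k = (i, j)"
  shows "(\<Sum>h<length (exit_path c i j). if even h = u \<and> missing (path_labels m i j (exit_path c i j) ! h)
      (path_labels m i j (exit_path c i j) ! Suc h) = k' then 1 else 0) = real (count c u k k')"
  unfolding count_eq[OF assms]
  by (subst sum.If_cases) (auto intro!: arg_cong[where f = card])

text \<open>Directions alternate along a path of odd length, and a cell has type
  \<open>- {k'}\<close> iff neither of its labels is \<open>k'\<close>. In the alternating sum the
  inner labels cancel, and the end labels \<open>i\<close> and \<open>j\<close> remain.\<close>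

lemma count_telescope: "real (count c True k k') - real (count c False k k') = (if k = k' then 1 else 0)"
proof -
  obtain i j where c: "canon k = (i, j)" by (cases "canon k")
  have ij: "i \<noteq> j" using canon_distinct[of k] c by simp
  let ?L = "path_labels m i j (exit_path c i j)" and ?r = "length (exit_path c i j)"
  let ?g = "\<lambda>h. if ?L ! h = k' then 1 else 0 :: real"
  have "real (count c True k k') - real (count c False k k') =
     (\<Sum>h<?r. (-1) ^ h * (if missing (?L ! h) (?L ! Suc h) = k' then 1 else 0))"
    unfolding count_sum[OF c, symmetric] sum_subtractf[symmetric] by (rule sum.cong) auto
  also have "\<dots> = (\<Sum>h<?r. (-1) ^ h - (-1) ^ h * (?g h + ?g (Suc h)))"
  proof (rule sum.cong[OF refl])
    fix h assume "h \<in> {..<?r}"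
    then have "?L ! h \<noteq> ?L ! Suc h" using lab_distinct[OF ij] by simp
    then show "(-1) ^ h * (if missing (?L ! h) (?L ! Suc h) = k' then 1 else 0) = (-1) ^ h - (-1) ^ h * (?g h + ?g (Suc h))"
      by (auto simp: missing_iff)
  qed
  also have "\<dots> = 1 - (?g 0 + ?g ?r)"
    using alternating_sum[of ?g ?r] alternating_one[OF exit_path_odd[OF ij, of c]] exit_path_odd[OF ij, of c]
    by (simp add: sum_subtractf)
  also have "\<dots> = (if k = k' then 1 else 0)"
    using lab_ends[OF ij, of c] missing_iff[OF ij, of k'] canon_missing[of k] c ij by auto
  finally show ?thesis .
qed

lemma count_total: "canon k = (i, j) \<Longrightarrow> 2 * (\<Sum>k'\<in>UNIV. real (count c True k k')) = real (length (exit_path c i j)) + 1"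
proof -
  assume c: "canon k = (i, j)"
  have ij: "i \<noteq> j" using canon_distinct[of k] c by simp
  let ?L = "path_labels m i j (exit_path c i j)" and ?r = "length (exit_path c i j)"
  have "(\<Sum>k'\<in>UNIV. real (count c True k k')) =
     (\<Sum>h<?r. \<Sum>k'\<in>UNIV. if even h = True \<and> missing (?L ! h) (?L ! Suc h) = k' then 1 else 0)"
    unfolding count_sum[OF c, symmetric] by (rule sum.swap)
  also have "\<dots> = (\<Sum>h<?r. if even h then 1 else 0)"
    by (intro sum.cong refl) (auto simp: sum.delta')
  also have "2 * \<dots> = real ?r + (if odd ?r then 1 else 0)" by (rule sum_even)
  finally show ?thesis using exit_path_odd[OF ij] by simp
qed

end

section \<open>A positive eigenvector of the path matrix\<close>

lemma common_prefix_split: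
  assumes "p \<noteq> []" "q \<noteq> []" "hd p = hd q"
  obtains w B p' q' where "p = w @ B # p'" "q = w @ B # q'" "p' = [] \<or> q' = [] \<or> hd p' \<noteq> hd q'"
  using assms
proof (induction p arbitrary: q thesis)
  case (Cons x p1)
  obtain q1 where q: "q = x # q1" using Cons.prems by (cases q) auto
  show ?case
  proof (cases "p1 = [] \<or> q1 = [] \<or> hd p1 \<noteq> hd q1")
    case True
    then show ?thesis using Cons.prems(1)[of "[]" x p1 q1] q by simp
  next
    case False
    then obtain w B p' q' where "p1 = w @ B # p'" "q1 = w @ B # q'" "p' = [] \<or> q' = [] \<or> hd p' \<noteq> hd q'"
      using Cons.IH[of q1] by blast
    then show ?thesis using Cons.prems(1)[of "x # w" B p' q'] q by simp
  qed
qed simp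

text \<open>The nonnegative vectors \<open>u\<close> with \<open>N u \<ge> \<rho> u\<close> form a cone that is invariant under \<open>N\<close>; a Brouwer
  fixed point in it is an eigenvector for an eigenvalue that is at least \<open>\<rho>\<close>.\<close>

lemma perron_3:
  fixes N :: "3 \<Rightarrow> 3 \<Rightarrow> real"
  assumes nonneg: "\<And>i j. 0 \<le> N i j" and \<rho>: "0 < \<rho>" and row: "\<And>i. \<rho> \<le> (\<Sum>j\<in>UNIV. N i j)"
    and off: "\<And>i. \<exists>j. j \<noteq> i \<and> 0 < N i j"
    and isolated: "\<And>i. (\<And>j. j \<noteq> i \<Longrightarrow> N j i = 0) \<Longrightarrow> N i i < \<rho>"
  obtains \<mu> s where "\<rho> \<le> \<mu>" "\<And>i. 0 < s i" "\<And>i. (\<Sum>j\<in>UNIV. N i j * s j) = \<mu> * s i"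
proof -
  define F :: "real^3 \<Rightarrow> real^3" where "F u = (\<chi> i. \<Sum>j\<in>UNIV. N i j * u $ j)" for u
  define \<sigma> :: "real^3 \<Rightarrow> real" where "\<sigma> u = (\<Sum>i\<in>UNIV. u $ i)" for u
  \<comment> \<open>A compact slice of the cone. The last condition keeps the coordinate sum of
    \<open>F u\<close> at least \<rho>, so that \<open>G\<close> can normalise.\<close>
  define K where "K = {u. (\<forall>i. 0 \<le> u $ i) \<and> \<sigma> u = 1 \<and> (\<forall>i. \<rho> * u $ i \<le> F u $ i)}"
  have linF: "F (a *\<^sub>R u + b *\<^sub>R v) = a *\<^sub>R F u + b *\<^sub>R F v" for a b u v
    by (simp add: F_def Finite_Cartesian_Product.vec_eq_iff sum_distrib_left sum.distrib algebra_simps)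
  have lin\<sigma>: "\<sigma> (a *\<^sub>R u + b *\<^sub>R v) = a * \<sigma> u + b * \<sigma> v" for a b u v
    by (simp add: \<sigma>_def sum.distrib sum_distrib_left)
  have F0: "F (a *\<^sub>R u) = a *\<^sub>R F u" for a u using linF[of a u 0 0] by simp
  have \<sigma>0: "\<sigma> (a *\<^sub>R u) = a * \<sigma> u" for a u using lin\<sigma>[of a u 0 0] by simp
  have contF: "continuous_on A F" for A unfolding F_def by (intro continuous_intros)
  have cont\<sigma>: "continuous_on A \<sigma>" for A unfolding \<sigma>_def by (intro continuous_intros)
  have monoF: "F u $ i \<le> F v $ i" if "\<And>i. u $ i \<le> v $ i" for u v :: "real^3" and i
    unfolding F_def using that nonneg by (auto intro!: sum_mono mult_left_mono)
  have F_nonneg: "0 \<le> F u $ i" if "\<And>i. 0 \<le> u $ i" for u :: "real^3" and i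
    unfolding F_def using that nonneg by (auto intro!: sum_nonneg)
  have conv: "convex K"
  proof (rule convexI)
    fix u v :: "real^3" and a b :: real
    assume uv: "u \<in> K" "v \<in> K" and ab: "0 \<le> a" "0 \<le> b" "a + b = 1"
    have "\<rho> * (a * u $ i + b * v $ i) \<le> a * F u $ i + b * F v $ i" for i
    proof -
      have "a * (\<rho> * u $ i) \<le> a * F u $ i" "b * (\<rho> * v $ i) \<le> b * F v $ i"
        using uv ab by (auto simp: K_def intro!: mult_left_mono)
      then show ?thesis by (simp add: algebra_simps)
    qed
    then show "a *\<^sub>R u + b *\<^sub>R v \<in> K"
      using uv ab by (auto simp: K_def linF lin\<sigma>)
  qed
  have comp: "compact K"
  proof -
    have "closed K" unfolding K_def
      by (intro closed_Collect_conj closed_Collect_all closed_Collect_le closed_Collect_eq continuous_intros contF cont\<sigma>)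
    moreover have "bounded K"
    proof -
      have "norm u \<le> 1" if "u \<in> K" for u
        using norm_le_l1_cart[of u] that by (simp add: K_def \<sigma>_def)
      then show ?thesis by (auto simp: bounded_iff)
    qed
    ultimately show ?thesis by (simp add: compact_eq_bounded_closed)
  qed
  have ne: "K \<noteq> {}"
  proof -
    have "(\<chi> i. 1/3) \<in> K"
      using row by (auto simp: K_def \<sigma>_def F_def simp flip: sum_divide_distrib intro!: divide_right_mono)
    then show ?thesis by blast
  qed
  have \<sigma>F: "\<rho> \<le> \<sigma> (F u)" if "u \<in> K" for u
  proof -
    have "\<rho> * \<sigma> u \<le> \<sigma> (F u)" unfolding \<sigma>_def sum_distrib_left using that by (intro sum_mono) (simp add: K_def)
    then show ?thesis using that by (simp add: K_def)
  qed
  define G where "G u = (1 / \<sigma> (F u)) *\<^sub>R F u" for u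
  have "continuous_on K G" unfolding G_def
  proof (intro continuous_intros contF)
    show "continuous_on K (\<lambda>x. \<sigma> (F x))"
      using continuous_on_compose[OF contF cont\<sigma>] by (simp add: o_def)
    show "\<forall>x\<in>K. \<sigma> (F x) \<noteq> 0" using \<sigma>F \<rho> by fastforce
  qed
  moreover have "G \<in> K \<rightarrow> K"
  proof
    fix u assume u: "u \<in> K"
    have pos: "0 < \<sigma> (F u)" using \<sigma>F[OF u] \<rho> by simp
    have "\<rho> * F u $ i \<le> F (F u) $ i" for i
    proof -
      have "F (\<rho> *\<^sub>R u) $ i \<le> F (F u) $ i" using u by (intro monoF) (simp add: K_def)
      then show ?thesis by (simp add: F0)
    qed
    then have "\<rho> * (1 / \<sigma> (F u) * F u $ i) \<le> 1 / \<sigma> (F u) * F (F u) $ i" for i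
      using pos by (simp add: field_simps)
    then show "G u \<in> K"
      using u pos F_nonneg by (auto simp: K_def G_def F0 \<sigma>0)
  qed
  ultimately obtain u where u: "u \<in> K" "G u = u" using brouwer[OF comp conv ne] by blast
  define \<mu> where "\<mu> = \<sigma> (F u)"
  have \<mu>: "\<rho> \<le> \<mu>" "0 < \<mu>" using \<sigma>F[OF u(1)] \<rho> by (auto simp: \<mu>_def)
  have "F u = \<mu> *\<^sub>R G u" using \<mu>(2) by (simp add: G_def \<mu>_def)
  then have "F u $ i = \<mu> * u $ i" for i using u(2) by simp
  then have eig: "(\<Sum>j\<in>UNIV. N i j * u $ j) = \<mu> * u $ i" for i by (simp add: F_def)
  have u0: "0 \<le> u $ i" for i using u(1) by (simp add: K_def)
  have zero: "N i j = 0" if "u $ i = 0" "u $ j \<noteq> 0" for i j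
  proof -
    have "(\<Sum>j\<in>UNIV. N i j * u $ j) = 0" using eig[of i] that by simp
    then have "N i j * u $ j = 0" using nonneg u0 by (subst (asm) sum_nonneg_eq_0_iff) auto
    then show ?thesis using that by simp
  qed
  have pos: "0 < u $ i" for i
  proof (rule ccontr)
    \<comment> \<open>A zero at \<open>i\<close> spreads to some \<open>j\<close>, so all weight
      sits on the third index \<open>l\<close>. Then column \<open>l\<close> vanishes off the
      diagonal, and \<open>isolated\<close> makes the eigenvalue \<open>N l l\<close> smaller than
      \<rho>.\<close>
    assume "\<not> 0 < u $ i"
    then have i: "u $ i = 0" using u0[of i] by simp
    obtain j where j: "j \<noteq> i" "0 < N i j" using off by blast
    then have uj: "u $ j = 0" using zero[OF i, of j] by auto
    obtain a b where ab: "a \<noteq> i" "b \<noteq> i" "a \<noteq> b" "\<And>h. h = i \<or> h = a \<or> h = b" by (rule other_indices[of i]) blast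
    then obtain l where l: "l \<noteq> i" "l \<noteq> j" "\<And>h. h = i \<or> h = j \<or> h = l" using j(1) by metis
    have "u $ j + u $ i + u $ l = 1"
      using sum_distinct_3[of i j l "\<lambda>h. u $ h"] j l u(1) by (auto simp: K_def \<sigma>_def)
    then have ul: "u $ l = 1" using i uj by simp
    have "N h l = 0" if "h \<noteq> l" for h using zero[of h l] l(3)[of h] i uj ul that by auto
    then have "N l l < \<rho>" by (rule isolated)
    moreover have "(\<Sum>h\<in>UNIV. N l h * u $ h) = N l l"
      using sum_distinct_3[of i j l "\<lambda>h. N l h * u $ h"] j l i uj ul by auto
    ultimately show False using eig[of l] ul \<mu> by simp
  qed
  show thesis by (rule that[of \<mu> "\<lambda>i. u $ i"]) (use \<mu> pos eig in auto)
qed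

context labyrinth
begin

section \<open>Lengths of exit paths and blocking\<close>

lemma exit_path_indices:
  assumes ij: "i \<noteq> j"
  obtains idx where
    "\<And>h. h < length (exit_path c i j) \<Longrightarrow> even h \<Longrightarrow> idx h \<in> up_index m \<and> exit_path c i j ! h = up_triangle m (idx h)"
    "\<And>h. h < length (exit_path c i j) \<Longrightarrow> odd h \<Longrightarrow> idx h \<in> down_index m \<and> exit_path c i j ! h = down_triangle m (idx h)"
    "\<And>h l. Suc h < length (exit_path c i j) \<Longrightarrow> idx (Suc h) l = idx h l +
       (if path_labels m i j (exit_path c i j) ! Suc h = l then (if even h then -1 else 1) else 0)"
    "idx 0 = exit_index c i" "idx (length (exit_path c i j) - 1) = exit_index c j"
proof -
  let ?p = "exit_path c i j" and ?L = "path_labels m i j (exit_path c i j)"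
  have "\<exists>k. (even h \<longrightarrow> k \<in> up_index m \<and> ?p ! h = up_triangle m k) \<and> (odd h \<longrightarrow> k \<in> down_index m \<and> ?p ! h = down_triangle m k)"
    if "h < length ?p" for h
    using exit_path_parity[OF ij that] pattern_part_subset[of c]
    by (cases "even h") (auto simp: up_triangles_def down_triangles_def)
  then obtain idx where idx: "\<And>h. h < length ?p \<Longrightarrow>
    (even h \<longrightarrow> idx h \<in> up_index m \<and> ?p ! h = up_triangle m (idx h)) \<and> (odd h \<longrightarrow> idx h \<in> down_index m \<and> ?p ! h = down_triangle m (idx h))"
    by metis
  have step: "idx (Suc h) l = idx h l + (if ?L ! Suc h = l then (if even h then -1 else 1) else 0)" if h: "Suc h < length ?p" for h l
  proof -
    have nb: "neighbours m (?L ! Suc h) (?p ! h) (?p ! Suc h)" using exit_path_neighbours[OF ij h] .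
    show ?thesis
    proof (cases "even h")
      case True
      then have e: "idx h \<in> up_index m" "?p ! h = up_triangle m (idx h)" "idx (Suc h) \<in> down_index m" "?p ! Suc h = down_triangle m (idx (Suc h))"
        using idx[of h] idx[of "Suc h"] h by auto
      have "\<not> up_down_neighbours m (?L ! Suc h) (?p ! Suc h) (?p ! h)"
        using e up_down_disjoint[OF m_ge_2] by (auto simp: up_triangles_def down_triangles_def elim!: up_down_neighboursE)
      then have "up_down_neighbours m (?L ! Suc h) (?p ! h) (?p ! Suc h)" using nb by (auto simp: neighbours_def)
      then obtain k k' where k: "k \<in> up_index m" "k' \<in> down_index m" "?p ! h = up_triangle m k" "?p ! Suc h = down_triangle m k'"
        "\<And>l. k l = k' l + (if l = ?L ! Suc h then 1 else 0)" by (rule up_down_neighboursE) blast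
      have "k = idx h" "k' = idx (Suc h)" using up_triangle_inject down_triangle_inject k e m_ge_2 by metis+
      then show ?thesis using k(5)[of l] True by auto
    next
      case False
      then have e: "idx h \<in> down_index m" "?p ! h = down_triangle m (idx h)" "idx (Suc h) \<in> up_index m" "?p ! Suc h = up_triangle m (idx (Suc h))"
        using idx[of h] idx[of "Suc h"] h by auto
      have "\<not> up_down_neighbours m (?L ! Suc h) (?p ! h) (?p ! Suc h)"
        using e up_down_disjoint[OF m_ge_2] by (auto simp: up_triangles_def down_triangles_def elim!: up_down_neighboursE)
      then have "up_down_neighbours m (?L ! Suc h) (?p ! Suc h) (?p ! h)" using nb by (auto simp: neighbours_def)
      then obtain k k' where k: "k \<in> up_index m" "k' \<in> down_index m" "?p ! Suc h = up_triangle m k" "?p ! h = down_triangle m k'"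
        "\<And>l. k l = k' l + (if l = ?L ! Suc h then 1 else 0)" by (rule up_down_neighboursE) blast
      have "k = idx (Suc h)" "k' = idx h" using up_triangle_inject down_triangle_inject k e m_ge_2 by metis+
      then show ?thesis using k(5)[of l] False by auto
    qed
  qed
  have len: "0 < length ?p" "length ?p - 1 < length ?p" "even (length ?p - 1)"
    using exit_path_facts(1)[OF ij, of c] exit_path_odd[OF ij, of c] by auto
  have "idx 0 = exit_index c i" "idx (length ?p - 1) = exit_index c j"
    using idx[OF len(1)] idx[OF len(2)] len(3) exit_path_facts(5,6)[OF ij, of c]
      up_triangle_inject[OF _ exit_index_up m_ge_2] by (auto simp: exit_cell_def)
  then show thesis using that[of idx] idx step by blast
qed

text \<open>Leaving an upward cell lowers one index and leaving a downward cell raises one, so two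
  steps raise index \<open>i\<close> by at most 1 and lower index \<open>j\<close> by at most 1. A
  label \<open>missing i j\<close> is a step lost for one of these.\<close>

lemma exit_path_bounds:
  assumes ij: "i \<noteq> j" and n: "length (exit_path c i j) = 2 * n + 1"
  shows "exit_index c j i \<le> int n" "exit_index c i j \<le> int n"
    and "0 < q \<Longrightarrow> q < length (exit_path c i j) \<Longrightarrow> path_labels m i j (exit_path c i j) ! q = missing i j \<Longrightarrow>
      exit_index c j i \<le> int n - 1 \<or> exit_index c i j \<le> int n - 1"
proof -
  let ?p = "exit_path c i j" and ?L = "path_labels m i j (exit_path c i j)"
  obtain idx where step: "\<And>h l. Suc h < length ?p \<Longrightarrow> idx (Suc h) l = idx h l +
       (if ?L ! Suc h = l then (if even h then -1 else 1) else 0)"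
    and ends: "idx 0 = exit_index c i" "idx (length ?p - 1) = exit_index c j"
    using exit_path_indices[OF ij, of c] by metis
  define g where "g t = idx (2 * t) i" for t
  define g' where "g' t = - idx (2 * t) j" for t
  have sum: "idx (Suc (Suc (2 * t))) l = idx (2 * t) l - (if ?L ! Suc (2 * t) = l then 1 else 0)
      + (if ?L ! Suc (Suc (2 * t)) = l then 1 else 0)" if "t < n" for t l
    using step[of "2 * t" l] step[of "Suc (2 * t)" l] that n by simp
  have g: "g (Suc t) = g t - (if ?L ! Suc (2 * t) = i then 1 else 0) + (if ?L ! Suc (Suc (2 * t)) = i then 1 else 0)"
    and g': "g' (Suc t) = g' t + (if ?L ! Suc (2 * t) = j then 1 else 0) - (if ?L ! Suc (Suc (2 * t)) = j then 1 else 0)"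
    if "t < n" for t
    using sum[OF that, of i] sum[OF that, of j] by (simp_all add: g_def g'_def)
  have le: "g (Suc t) \<le> g t + 1" "g' (Suc t) \<le> g' t + 1" if "t < n" for t using g[OF that] g'[OF that] by auto
  have e: "g 0 = 0" "g n = exit_index c j i" "g' 0 = - exit_index c i j" "g' n = 0"
    using ends n by (auto simp: g_def g'_def)
  show "exit_index c j i \<le> int n" "exit_index c i j \<le> int n"
    using unit_steps_bound(1)[of n g] unit_steps_bound(1)[of n g'] le e by auto
  assume q: "0 < q" "q < length ?p" "?L ! q = missing i j"
  have miss: "missing i j \<noteq> i" "missing i j \<noteq> j" using missing_iff[OF ij, of "missing i j"] by auto
  show "exit_index c j i \<le> int n - 1 \<or> exit_index c i j \<le> int n - 1"
  proof (cases "even q")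
    case True
    then obtain b where b: "q = 2 * b" by (elim evenE)
    then obtain t where "b = Suc t" using q(1) by (cases b) auto
    then have t: "q = Suc (Suc (2 * t))" using b by simp
    then have tn: "t < n" using q(2) n by simp
    have "g (Suc t) \<le> g t" using g[OF tn] q(3) t miss by auto
    then show ?thesis using unit_steps_bound(2)[of n g t] le tn e by auto
  next
    case False
    then obtain t where t: "q = Suc (2 * t)" by (elim oddE) simp
    then have tn: "t < n" using q(2) n by simp
    have "g' (Suc t) \<le> g' t" using g'[OF tn] q(3) t miss by auto
    then show ?thesis using unit_steps_bound(2)[of n g' t] le tn e by auto
  qed
qed

text \<open>The index \<open>missing i j\<close> changes only across an edge with this label;
  without such an edge all cells lie in one strip.\<close>

lemma blocked_label:
  assumes ij: "i \<noteq> j" and bl: "blocked_path m i j (exit_path c i j)"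
  shows "\<exists>q. 0 < q \<and> q < length (exit_path c i j) \<and> path_labels m i j (exit_path c i j) ! q = missing i j"
proof (rule ccontr)
  let ?p = "exit_path c i j" and ?L = "path_labels m i j (exit_path c i j)"
  assume no: "\<not> ?thesis"
  let ?k = "missing i j"
  obtain idx where idx: "\<And>h. h < length ?p \<Longrightarrow> even h \<Longrightarrow> idx h \<in> up_index m \<and> ?p ! h = up_triangle m (idx h)"
    "\<And>h. h < length ?p \<Longrightarrow> odd h \<Longrightarrow> idx h \<in> down_index m \<and> ?p ! h = down_triangle m (idx h)"
    and step: "\<And>h l. Suc h < length ?p \<Longrightarrow> idx (Suc h) l = idx h l +
       (if ?L ! Suc h = l then (if even h then -1 else 1) else 0)"
    and ends: "idx 0 = exit_index c i"
    using exit_path_indices[OF ij, of c] by metis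
  have const: "idx h ?k = exit_index c i ?k" if "h < length ?p" for h
    using that
  proof (induction h)
    case (Suc h)
    have "?L ! Suc h \<noteq> ?k" using no Suc.prems by blast
    then show ?case using Suc step[of h ?k] by simp
  qed (simp add: ends)
  have K: "exit_index c i ?k \<in> {0..int m - 1}"
  proof -
    have "exit_index c i ?k \<le> (\<Sum>h\<in>UNIV. exit_index c i h)" using exit_index_up[of c i]
      by (intro member_le_sum) (auto simp: up_index_def)
    then show ?thesis using exit_index_up[of c i] by (auto simp: up_index_def)
  qed
  have strip: "U \<in> strip m ?k (exit_index c i ?k)" if U: "U \<in> set ?p" for U
  proof -
    obtain h where h: "h < length ?p" "U = ?p ! h" using U by (metis in_set_conv_nth)
    then show ?thesis using idx(1)[of h] idx(2)[of h] const[of h] by (cases "even h") (auto simp: strip_def)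
  qed
  obtain k U V where "{k} = UNIV - {i, j}" "U \<in> set ?p" "V \<in> set ?p"
    "\<not> (\<exists>K\<in>{0..int m - 1}. U \<in> strip m k K \<and> V \<in> strip m k K)" using bl by (auto simp: blocked_path_def)
  moreover have "k = ?k" using calculation(1) missing_iff[OF ij, of k] by auto
  ultimately show False using strip K by blast
qed

text \<open>The path between two exits runs along the paths from the third exit to these exits and turns
  around where the latter two separate.\<close>

lemma tripod:
  assumes ij: "i \<noteq> j" and k: "k = missing i j" and none: "\<And>k'. k' \<noteq> k \<Longrightarrow> count c True k' k = 0"
  shows "\<exists>B. \<forall>(v, x, y)\<in>set (typed m i j (exit_path c i j)). missing x y = k \<longrightarrow> v = B"
proof -
  have ki: "k \<noteq> i" "k \<noteq> j" using missing_iff[OF ij, of k] k by auto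
  \<comment> \<open>The hypothesis speaks of upward cells in the paths of the two other types; off
    the diagonal the counts of downward cells agree with theirs. So no cell of a path from exit
    \<open>k\<close> has type \<open>- {k}\<close>.\<close>
  have no_type: "missing x y \<noteq> k" if v: "(v, x, y) \<in> set (typed m a b (exit_path c a b))" and ab: "a \<noteq> b" "missing a b \<noteq> k" for v x y a b
  proof -
    have canonical: "missing x y \<noteq> k" if v: "(v, x, y) \<in> set (typed m a b (exit_path c a b))" and cn: "canon k' = (a, b)" "k' \<noteq> k" for v x y a b k'
    proof
      assume e: "missing x y = k"
      have ab: "a \<noteq> b" using canon_distinct[of k'] cn by simp
      have c0: "count c u k' k = 0" for u
        using none[OF cn(2)] count_telescope[of c k' k] cn(2) by (cases u) auto
      obtain h where h: "h < length (exit_path c a b)" "typed m a b (exit_path c a b) ! h = (v, x, y)"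
        using v by (metis in_set_conv_nth length_typed)
      then have xy: "x \<noteq> y" "v = exit_path c a b ! h" using lab_distinct[OF ab h(1)] typed_nth[OF h(1)] by auto
      have "v \<in> pattern_part S c (even h)" using exit_path_parity[OF ab h(1)] xy by simp
      moreover have "\<not> (v \<in> pattern_part S c (even h) \<and> {x, y} = - {k})"
        using c0[of "even h"] v cn by (auto simp: count_def type_count_typed filter_empty_conv)
      ultimately show False using e pair_eq_missing[OF xy(1), of k] by simp
    qed
    show ?thesis
    proof (cases "canon (missing a b) = (a, b)")
      case True
      then show ?thesis using canonical v ab by blast
    next
      case False
      then have cn: "canon (missing a b) = (b, a)" using canon_pair ab by blast
      have "(v, y, x) \<in> set (typed m b a (exit_path c b a))"
        using v set_typed_rev[of m b a "exit_path c a b"] exit_path_rev[of c b a] by force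
      from canonical[OF this cn ab(2)] show ?thesis by (subst missing_commute)
    qed
  qed
  let ?E = "adjacent m"
  let ?p = "exit_path c k i" and ?q = "exit_path c k j"
  have p: "graph_path (cells c) ?E (exit_cell c k) ?p (exit_cell c i)" and q: "graph_path (cells c) ?E (exit_cell c k) ?q (exit_cell c j)"
    by (rule exit_path)+
  have "?p \<noteq> []" "?q \<noteq> []" "hd ?p = hd ?q" using p q by (simp_all add: graph_path_def)
  then obtain w B p' q' where s: "?p = w @ B # p'" "?q = w @ B # q'" "p' = [] \<or> q' = [] \<or> hd p' \<noteq> hd q'"
    by (rule common_prefix_split)
  have pp: "successively ?E (B # p')" "distinct (B # p')" "set (B # p') \<subseteq> cells c" "last (B # p') = exit_cell c i"
    using p unfolding s graph_path_def by (auto simp: successively_append_iff)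
  have qq: "successively ?E (B # q')" "distinct (B # q')" "set (B # q') \<subseteq> cells c" "last (B # q') = exit_cell c j"
    using q unfolding s graph_path_def by (auto simp: successively_append_iff)
  have prefix: "graph_path (cells c) ?E B (B # r1 @ [z]) z"
    if "successively ?E (B # r)" "distinct (B # r)" "set (B # r) \<subseteq> cells c" "r = r1 @ z # r2" for r r1 z r2
  proof -
    have "successively ?E ((B # r1 @ [z]) @ r2)" using that(1,4) by simp
    then have "successively ?E (B # r1 @ [z])" unfolding successively_append_iff by blast
    then show ?thesis using that by (auto simp: graph_path_def)
  qed
  \<comment> \<open>A further common cell beyond \<open>B\<close> would be reached from
    \<open>B\<close> by two different paths.\<close>
  have disj: "set p' \<inter> set q' = {}"
  proof (rule ccontr)
    assume "set p' \<inter> set q' \<noteq> {}"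
    then obtain z where z: "z \<in> set p'" "z \<in> set q'" by blast
    obtain p1 p2 q1 q2 where d: "p' = p1 @ z # p2" "q' = q1 @ z # q2" using z by (meson split_list)
    have "B # p1 @ [z] = B # q1 @ [z]"
      using path_unique prefix[OF pp(1-3) d(1)] prefix[OF qq(1-3) d(2)] by blast
    then have "hd p' = hd q'" using d by (cases p1) auto
    then show False using s(3) z by auto
  qed
  have "graph_path (cells c) ?E (exit_cell c i) (rev p' @ B # q') (exit_cell c j)"
  proof -
    have gp: "graph_path (cells c) ?E B (B # p') (exit_cell c i)" using pp by (auto simp: graph_path_def)
    have gr: "graph_path (cells c) ?E (exit_cell c i) (rev p' @ [B]) B" using graph_path_rev[OF gp] by simp
    have "successively ?E (rev p' @ B # q')"
      using gr qq(1) by (auto simp: graph_path_def successively_append_iff)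
    moreover have "hd (rev p' @ B # q') = exit_cell c i" using gr by (cases "rev p'") (auto simp: graph_path_def)
    ultimately show ?thesis using pp qq disj by (auto simp: graph_path_def)
  qed
  then have ep: "exit_path c i j = rev p' @ B # q'" using path_unique exit_path by blast
  have "v = B" if v: "(v, x, y) \<in> set (typed m i j (exit_path c i j))" and e: "missing x y = k" for v x y
  proof (rule ccontr)
    assume "v \<noteq> B"
    then consider "p' \<noteq> []" "(v, x, y) \<in> set (typed m i (edge_label m (last (rev p')) B) (rev p'))"
      | "q' \<noteq> []" "(v, x, y) \<in> set (typed m (edge_label m B (hd q')) j q')"
      using v unfolding ep typed_append by (auto split: if_splits)
    then show False
    proof cases
      case 1
      then have "(v, y, x) \<in> set (typed m (edge_label m B (hd p')) i p')"
        using set_typed_rev[of m i "edge_label m (last (rev p')) B" p'] by (force simp: last_rev edge_label_sym[of m B])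
      then have "(v, y, x) \<in> set (typed m k i ?p)" using 1(1) unfolding s(1) typed_append by auto
      moreover have "missing k i \<noteq> k" using missing_iff[OF ki(1), of k] by simp
      ultimately show False using no_type[of v y x k i] ki e by (simp add: missing_commute)
    next
      case 2
      then have "(v, x, y) \<in> set (typed m k j ?q)" unfolding s(2) typed_append by auto
      moreover have "missing k j \<noteq> k" using missing_iff[OF ki(2), of k] by simp
      ultimately show False using no_type[of v x y k j] ki e by simp
    qed
  qed
  then show ?thesis by blast
qed

text \<open>By \<open>tripod\<close> only the branching cell can have this type, and the path visits
  it once.\<close>

lemma count_isolated:
  assumes "\<And>k'. k' \<noteq> k \<Longrightarrow> count c True k' k = 0"
  shows "count c True k k \<le> 1"
proof -
  obtain i j where cn: "canon k = (i, j)" by (cases "canon k")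
  have ij: "i \<noteq> j" using canon_distinct[of k] cn by simp
  have "k = missing i j" using canon_missing[of k] cn by simp
  then obtain B where B: "\<forall>(v, x, y)\<in>set (typed m i j (exit_path c i j)). missing x y = k \<longrightarrow> v = B"
    using tripod[OF ij _ assms] by blast
  let ?p = "exit_path c i j" and ?L = "path_labels m i j (exit_path c i j)"
  let ?H = "{h. h < length ?p \<and> even h = True \<and> missing (?L ! h) (?L ! Suc h) = k}"
  have "?p ! h = B" if "h \<in> ?H" for h
  proof -
    have "(?p ! h, ?L ! h, ?L ! Suc h) \<in> set (typed m i j ?p)"
      using that typed_nth[of h ?p m i j] nth_mem[of h "typed m i j ?p"] by auto
    then show ?thesis using B that by blast
  qed
  then have "h = h'" if "h \<in> ?H" "h' \<in> ?H" for h h'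
    using that exit_path_facts(3)[OF ij, of c] nth_eq_iff_index_eq[of ?p h h'] by (metis (mono_tags, lifting) mem_Collect_eq)
  then have "card ?H \<le> Suc 0" by (subst card_le_Suc0_iff_eq) auto
  then show ?thesis unfolding count_eq[OF cn] by simp
qed

section \<open>The eigenvalue problem of size 3\<close>

definition pair_matrix :: "3 \<Rightarrow> 3 \<Rightarrow> real" where
  "pair_matrix k k' = real (count True True k k') + real (count False True k k') - (if k = k' then 1 else 0)"

lemma count_diag: "1 \<le> count c True k k"
  using count_telescope[of c k k] by simp

lemma pair_matrix_nonneg: "0 \<le> pair_matrix k k'"
  using count_diag[of True k] by (auto simp: pair_matrix_def)

lemma pair_matrix_isolated:
  assumes "\<And>k'. k' \<noteq> k \<Longrightarrow> pair_matrix k' k = 0"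
  shows "pair_matrix k k < real m + 1"
proof -
  have "count c True k' k = 0" if "k' \<noteq> k" for c k' using assms[OF that] that by (cases c) (auto simp: pair_matrix_def)
  then have "count True True k k \<le> 1" "count False True k k \<le> 1" by (blast intro: count_isolated)+
  then show ?thesis using m_ge_2 by (simp add: pair_matrix_def)
qed

context
  assumes blocked: "globally_blocked m S"
begin

lemma blocked_exit_path:
  assumes "i \<noteq> j"
  obtains c where "blocked_path m i j (exit_path c i j)"
  using blocked assms that[of True] that[of False]
  by (auto simp: globally_blocked_def blocked_def white_path_eq yellow_path_eq)

text \<open>A blocked path has an edge labelled \<open>k\<close>, and a cell at this edge has a type
  other than \<open>- {k}\<close>.\<close>

lemma pair_matrix_offdiag: "\<exists>k'. k' \<noteq> k \<and> 0 < pair_matrix k k'"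
proof -
  obtain i j where cn: "canon k = (i, j)" by (cases "canon k")
  have ij: "i \<noteq> j" using canon_distinct[of k] cn by simp
  have k: "k = missing i j" using canon_missing[of k] cn by simp
  obtain c where "blocked_path m i j (exit_path c i j)" using blocked_exit_path[OF ij] by blast
  then obtain q where q: "0 < q" "q < length (exit_path c i j)" "path_labels m i j (exit_path c i j) ! q = k"
    using blocked_label[OF ij] k by metis
  let ?L = "path_labels m i j (exit_path c i j)"
  let ?k' = "missing (?L ! q) (?L ! Suc q)"
  have ne: "?k' \<noteq> k" using missing_iff[OF lab_distinct[OF ij q(2)], of ?k'] q(3) by auto
  have "0 < count c (even q) k ?k'" unfolding count_eq[OF cn]
    using q(2) by (subst card_gt_0_iff) auto
  then have "0 < count c True k ?k'" using count_telescope[of c k ?k'] ne by (cases "even q") auto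
  then have "0 < pair_matrix k ?k'" using ne by (cases c) (auto simp: pair_matrix_def)
  then show ?thesis using ne by blast
qed

text \<open>For paths of length \<open>2 * n c + 1\<close> the row sum is
  \<open>n True + n False + 1\<close>. The mirrored exit indices add up to \<open>m - 1\<close>,
  which \<open>n True + n False\<close> cannot be less than, and the step lost on a blocked path
  adds one more.\<close>

lemma pair_matrix_row_sum: "real m + 1 \<le> (\<Sum>k'\<in>UNIV. pair_matrix k k')"
proof -
  obtain i j where cn: "canon k = (i, j)" by (cases "canon k")
  have ij: "i \<noteq> j" using canon_distinct[of k] cn by simp
  have "\<exists>n. length (exit_path c i j) = 2 * n + 1" for c using exit_path_odd[OF ij, of c] by (elim oddE) auto
  then obtain n where n: "\<And>c. length (exit_path c i j) = 2 * n c + 1" by metis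
  have total: "(\<Sum>k'\<in>UNIV. real (count c True k k')) = real (n c) + 1" for c
    using count_total[OF cn, of c] n[of c] by simp
  have rs: "(\<Sum>k'\<in>UNIV. pair_matrix k k') = real (n True) + real (n False) + 1"
    using total[of True] total[of False] by (simp add: pair_matrix_def sum_subtractf sum.distrib)
  obtain c where "blocked_path m i j (exit_path c i j)" using blocked_exit_path[OF ij] by blast
  then obtain q where q: "0 < q" "q < length (exit_path c i j)" "path_labels m i j (exit_path c i j) ! q = missing i j"
    using blocked_label[OF ij] by metis
  have "exit_index c j i + exit_index (\<not> c) j i = int m - 1" "exit_index c i j + exit_index (\<not> c) i j = int m - 1"
    using exit_index_mirror ij by auto
  then have "int m \<le> int (n c) + int (n (\<not> c))"
    using exit_path_bounds(1,2)[OF ij n, of c] exit_path_bounds(1,2)[OF ij n, of "\<not> c"] exit_path_bounds(3)[OF ij n q] by auto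
  then have "m \<le> n True + n False" by (cases c) auto
  then show ?thesis unfolding rs by linarith
qed

lemma pair_matrix_perron:
  obtains \<mu> s where "real m + 1 \<le> \<mu>" "\<And>k. 0 < s k" "\<And>k. (\<Sum>k'\<in>UNIV. pair_matrix k k' * s k') = \<mu> * s k"
  by (rule perron_3[OF pair_matrix_nonneg _ pair_matrix_row_sum pair_matrix_offdiag pair_matrix_isolated]) auto

end

end

text \<open>The row of the global path matrix: white before yellow, and within a colour the pairs
  12, 13, 23, which are encoded by 3, 2, 1.\<close>

definition pair_position :: "bool \<times> 3 \<Rightarrow> nat" where
  "pair_position = (\<lambda>(c, k). (if c then 0 else 3) + (if k = 3 then 0 else if k = 2 then 1 else 2))"

lemma UNIV_bool_3: "(UNIV :: (bool \<times> 3) set) = {(True, 3), (True, 2), (True, 1), (False, 3), (False, 2), (False, 1)}"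
  using exhaust_3 by (auto simp: UNIV_3)

lemma bij_pair_position: "bij_betw pair_position UNIV {0..<6}"
proof -
  have "pair_position ` UNIV = {0, 1, 2, 3, 4, 5}" unfolding UNIV_bool_3 by (simp add: pair_position_def)
  also have "\<dots> = {0..<6}" by auto
  finally have im: "pair_position ` UNIV = {0..<6}" .
  moreover have "card (UNIV :: (bool \<times> 3) set) = 6" by (simp add: card_cartesian_product flip: UNIV_Times_UNIV)
  ultimately have "inj_on pair_position UNIV" by (intro eq_card_imp_inj_on) auto
  then show ?thesis using im by (simp add: bij_betw_def)
qed

lemma type_pair_canon: "pair_position (True, k) < 3" "type_pair (pair_position (True, k)) = canon k"
  using exhaust_3[of k] by (auto simp: pair_position_def type_pair_def canon_def)

lemma canon_compl: "canon k = (i, j) \<Longrightarrow> {i, j} = - {k}"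
proof -
  assume c: "canon k = (i, j)"
  then have "i \<noteq> j" "k = missing i j" using canon_distinct[of k] canon_missing[of k] by auto
  then show "{i, j} = - {k}" using pair_eq_missing by blast
qed

context labyrinth
begin

lemma path_matrix_entry:
  "path_matrix m (exit_path c) (pattern_part S c u) $$ (pair_position (True, k), pair_position (True, k')) = real (count c u k k')"
proof -
  obtain i j where ij: "canon k = (i, j)" by (cases "canon k")
  obtain i' j' where ij': "canon k' = (i', j')" by (cases "canon k'")
  show ?thesis
    using type_pair_canon[of k] type_pair_canon[of k'] ij ij' canon_compl[OF ij']
    by (simp add: path_matrix_def count_def)
qed

lemma global_path_matrix_dim: "global_path_matrix m S \<in> carrier_mat 6 6"
proof -
  have "path_matrix m q Y \<in> carrier_mat 3 3" for q Y unfolding path_matrix_def by (rule mat_carrier)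
  then have "global_path_matrix m S \<in> carrier_mat (3 + 3) (3 + 3)"
    unfolding global_path_matrix_def by (intro four_block_carrier_mat)
  then show ?thesis by simp
qed

lemma global_path_matrix_entry:
  "global_path_matrix m S $$ (pair_position (c, k), pair_position (c', k')) = real (count c (c = c') k k')"
proof -
  have pos: "pair_position (False, k) = 3 + pair_position (True, k)" for k by (simp add: pair_position_def)
  have "global_path_matrix m S = four_block_mat
     (path_matrix m (exit_path True) (pattern_part S True True)) (path_matrix m (exit_path True) (pattern_part S True False))
     (path_matrix m (exit_path False) (pattern_part S False False)) (path_matrix m (exit_path False) (pattern_part S False True))"
    by (simp add: global_path_matrix_def white_path_eq yellow_path_eq pattern_part_def)
  moreover have "dim_row (path_matrix m q Y) = 3" "dim_col (path_matrix m q Y) = 3" for q Y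
    by (simp_all add: path_matrix_def)
  ultimately show ?thesis
    using type_pair_canon(1)[of k] type_pair_canon(1)[of k'] path_matrix_entry[of _ _ k k']
    by (cases c; cases c') (simp_all add: pos index_mat_four_block)
qed

lemma global_path_matrix_mult:
  assumes y: "y \<in> carrier_vec 6"
  shows "vec_index (global_path_matrix m S *\<^sub>v y) (pair_position (c, k)) =
    (\<Sum>k'\<in>UNIV. real (count c True k k') * (vec_index y (pair_position (c, k'))) + real (count c False k k') * (vec_index y (pair_position (\<not> c, k'))))"
proof -
  let ?M = "global_path_matrix m S"
  have lt: "pair_position p < 6" for p using bij_pair_position by (auto simp: bij_betw_def)
  have "vec_index (?M *\<^sub>v y) (pair_position (c, k)) = (\<Sum>j\<in>{0..<6}. ?M $$ (pair_position (c, k), j) * (vec_index y j))"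
    using global_path_matrix_dim y lt[of "(c, k)"] by (auto simp: scalar_prod_def intro!: sum.cong)
  also have "\<dots> = (\<Sum>p\<in>UNIV. ?M $$ (pair_position (c, k), pair_position p) * (vec_index y (pair_position p)))"
    by (rule sum.reindex_bij_betw[OF bij_pair_position, symmetric])
  also have "\<dots> = (\<Sum>c'\<in>UNIV. \<Sum>k'\<in>UNIV. ?M $$ (pair_position (c, k), pair_position (c', k')) * (vec_index y (pair_position (c', k'))))"
    by (simp only: sum.cartesian_product UNIV_Times_UNIV[symmetric]) (simp add: case_prod_unfold)
  also have "\<dots> = (\<Sum>c'\<in>UNIV. \<Sum>k'\<in>UNIV. real (count c (c = c') k k') * (vec_index y (pair_position (c', k'))))"
    by (simp only: global_path_matrix_entry)
  also have "\<dots> = (\<Sum>k'\<in>UNIV. real (count c True k k') * (vec_index y (pair_position (c, k'))) + real (count c False k k') * (vec_index y (pair_position (\<not> c, k'))))"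
    by (cases c) (simp_all add: UNIV_bool sum.distrib add.commute)
  finally show ?thesis .
qed

context
  assumes blocked: "globally_blocked m S"
begin

lemma count_down_pos: "\<exists>k'. 0 < count c False k k'"
proof -
  obtain i j where cn: "canon k = (i, j)" by (cases "canon k")
  have ij: "i \<noteq> j" using canon_distinct[of k] cn by simp
  let ?L = "path_labels m i j (exit_path c i j)"
  have "0 < count c False k (missing (?L ! 1) (?L ! Suc 1))"
    unfolding count_eq[OF cn] using exit_path_long[OF ij, of c] by (subst card_gt_0_iff) (auto intro!: exI[of _ 1])
  then show ?thesis by blast
qed

text \<open>With upward counts written as downward counts plus the identity, the equation for
  \<open>w\<close> reads \<open>(\<mu> - 1) * w c = D c * s\<close>, where \<open>D c\<close> holds
  the downward counts and \<open>s\<close> is the sum over both colours. Adding the colours gives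
  the eigenvector equation of \<open>pair_matrix\<close> for \<open>s\<close>.\<close>

lemma path_weights_exist:
  obtains \<mu> w where "real m + 1 \<le> \<mu>" "\<And>c k. 0 < w c k"
    "\<And>c k. (\<Sum>k'\<in>UNIV. real (count c True k k') * w c k' + real (count c False k k') * w (\<not> c) k') = \<mu> * w c k"
proof -
  obtain \<mu> s where \<mu>: "real m + 1 \<le> \<mu>" and s: "\<And>k. 0 < s k" "\<And>k. (\<Sum>k'\<in>UNIV. pair_matrix k k' * s k') = \<mu> * s k"
    using pair_matrix_perron[OF blocked] by metis
  have \<mu>1: "1 < \<mu>" using \<mu> m_ge_2 by simp
  have up: "real (count c True k k') = real (count c False k k') + (if k = k' then 1 else 0)" for c k k'
    using count_telescope[of c k k'] by simp
  define w where "w c k = (\<Sum>k'\<in>UNIV. real (count c False k k') * s k') / (\<mu> - 1)" for c k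
  have delta: "(\<Sum>k'\<in>UNIV. (if k = k' then 1 else 0) * f k') = (f k :: real)" for f and k :: 3
  proof -
    have "(\<Sum>k'\<in>UNIV. (if k = k' then 1 else 0) * f k') = (\<Sum>k'\<in>UNIV. if k = k' then f k' else 0)"
      by (intro sum.cong) auto
    then show ?thesis by simp
  qed
  have ws: "w c k + w (\<not> c) k = s k" for c k
  proof -
    have "(\<Sum>k'\<in>UNIV. pair_matrix k k' * s k') =
        (\<Sum>k'\<in>UNIV. real (count True False k k') * s k') + (\<Sum>k'\<in>UNIV. real (count False False k k') * s k') + s k"
      using delta[of k s] unfolding pair_matrix_def up
      by (simp only: distrib_right left_diff_distrib sum.distrib sum_subtractf)
    then have "w True k + w False k = s k"
      using s(2)[of k] \<mu>1 by (simp add: w_def add_divide_distrib[symmetric] divide_eq_eq algebra_simps)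
    then show ?thesis by (cases c) auto
  qed
  show thesis
  proof (rule that[OF \<mu>, of w])
    fix c k
    obtain k' where k': "0 < count c False k k'" using count_down_pos by blast
    have "0 < (\<Sum>k'\<in>UNIV. real (count c False k k') * s k')"
      using k' s(1) by (intro sum_pos2[of _ k']) (auto intro!: mult_nonneg_nonneg intro: less_imp_le)
    then show "0 < w c k" using \<mu>1 by (simp add: w_def)
    have "(\<Sum>k'\<in>UNIV. real (count c True k k') * w c k' + real (count c False k k') * w (\<not> c) k')
       = (\<Sum>k'\<in>UNIV. real (count c False k k') * (w c k' + w (\<not> c) k') + (if k = k' then 1 else 0) * w c k')"
      unfolding up by (intro sum.cong) (auto simp: algebra_simps)
    also have "\<dots> = (\<Sum>k'\<in>UNIV. real (count c False k k') * s k') + w c k"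
      by (simp only: sum.distrib ws delta)
    also have "\<dots> = (\<mu> - 1) * w c k + w c k" using \<mu>1 by (simp add: w_def)
    also have "\<dots> = \<mu> * w c k" by (simp add: algebra_simps)
    finally show "(\<Sum>k'\<in>UNIV. real (count c True k k') * w c k' + real (count c False k k') * w (\<not> c) k') = \<mu> * w c k" .
  qed
qed

lemma path_weights:
  assumes ev: "eigenvalue (global_path_matrix m S) \<theta>"
    and max: "\<And>\<mu>. eigenvalue (global_path_matrix m S) \<mu> \<Longrightarrow> \<mu> \<le> \<theta>"
  obtains w where "real m + 1 \<le> \<theta>" "\<And>c k. 0 < w c k"
    "\<And>c k. (\<Sum>k'\<in>UNIV. real (count c True k k') * w c k' + real (count c False k k') * w (\<not> c) k') = \<theta> * w c k"
proof -
  let ?M = "global_path_matrix m S"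
  obtain \<mu> w where \<mu>: "real m + 1 \<le> \<mu>" and w: "\<And>c k. 0 < w c k"
    "\<And>c k. (\<Sum>k'\<in>UNIV. real (count c True k k') * w c k' + real (count c False k k') * w (\<not> c) k') = \<mu> * w c k"
    by (rule path_weights_exist) blast
  have dim: "dim_row ?M = 6" "dim_col ?M = 6" using global_path_matrix_dim by auto
  have lt: "pair_position p < 6" for p using bij_pair_position by (auto simp: bij_betw_def)
  have all_positions: "P j" if "\<And>c k. P (pair_position (c, k))" "j < 6" for P and j :: nat
  proof -
    have "j \<in> pair_position ` UNIV" using bij_pair_position that(2) by (simp add: bij_betw_def)
    then show ?thesis using that(1) by auto
  qed
  have inj: "inv_into UNIV pair_position (pair_position p) = p" for p
    using bij_pair_position by (simp add: bij_betw_def)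
  have "eigenvalue ?M \<mu>"
  proof -
    define y where "y = vec 6 (\<lambda>j. case inv_into UNIV pair_position j of (c, k) \<Rightarrow> w c k)"
    have y: "y \<in> carrier_vec 6" by (simp add: y_def)
    have yp: "vec_index y (pair_position (c, k)) = w c k" for c k using lt[of "(c, k)"] by (simp add: y_def inj)
    have "?M *\<^sub>v y = \<mu> \<cdot>\<^sub>v y"
    proof (rule eq_vecI)
      fix j assume "j < dim_vec (\<mu> \<cdot>\<^sub>v y)"
      then have "j < 6" using y by simp
      moreover have "vec_index (?M *\<^sub>v y) (pair_position (c, k)) = vec_index (\<mu> \<cdot>\<^sub>v y) (pair_position (c, k))" for c k
        using global_path_matrix_mult[OF y, of c k] w(2)[of c k] y lt[of "(c, k)"] by (simp add: yp)
      ultimately show "vec_index (?M *\<^sub>v y) j = vec_index (\<mu> \<cdot>\<^sub>v y) j"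
        using all_positions[of "\<lambda>j. vec_index (?M *\<^sub>v y) j = vec_index (\<mu> \<cdot>\<^sub>v y) j" j] by blast
    qed (use y dim in simp)
    moreover have "y \<noteq> 0\<^sub>v 6"
    proof
      assume "y = 0\<^sub>v 6"
      then have "vec_index y (pair_position (True, 1)) = 0" using lt by simp
      then show False using yp[of True 1] w(1)[of True 1] by simp
    qed
    ultimately show ?thesis using y dim by (auto simp: eigenvalue_def eigenvector_def)
  qed
  then have "\<mu> \<le> \<theta>" by (rule max)
  \<comment> \<open>An eigenvector for \<theta> is compared with the positive one at a position
    where the ratio \<open>R\<close> is largest; nonnegativity of the matrix gives the
    bound.\<close>
  moreover have "\<bar>\<theta>\<bar> \<le> \<mu>"
  proof -
    obtain y where y: "y \<in> carrier_vec 6" "y \<noteq> 0\<^sub>v 6" "?M *\<^sub>v y = \<theta> \<cdot>\<^sub>v y"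
      using ev dim by (auto simp: eigenvalue_def eigenvector_def)
    define Y where "Y c k = vec_index y (pair_position (c, k))" for c k
    have eq: "\<theta> * Y c k = (\<Sum>k'\<in>UNIV. real (count c True k k') * Y c k' + real (count c False k k') * Y (\<not> c) k')" for c k
      using global_path_matrix_mult[OF y(1), of c k] y(1,3) lt[of "(c, k)"] by (simp add: Y_def)
    define R where "R p = \<bar>Y (fst p) (snd p)\<bar> / w (fst p) (snd p)" for p
    have "finite (range R)" by simp
    then obtain c k where ck: "R (c, k) = Max (range R)" by (metis Max_in UNIV_I empty_is_image emptyE imageE surj_pair)
    define t where "t = R (c, k)"
    have bound: "\<bar>Y c' k'\<bar> \<le> t * w c' k'" for c' k'
    proof -
      have "R (c', k') \<le> t" unfolding t_def ck by (intro Max_ge) auto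
      then show ?thesis using w(1)[of c' k'] by (simp add: R_def divide_le_eq)
    qed
    have eqt: "\<bar>Y c k\<bar> = t * w c k" using w(1)[of c k] by (simp add: t_def R_def)
    have "0 < t"
    proof (rule ccontr)
      assume "\<not> 0 < t"
      have "Y c' k' = 0" for c' k'
      proof -
        have "t * w c' k' \<le> 0" using \<open>\<not> 0 < t\<close> w(1)[of c' k'] by (intro mult_nonpos_nonneg) auto
        then show ?thesis using bound[of c' k'] by simp
      qed
      then have "vec_index y j = 0" if "j < 6" for j
        using all_positions[of "\<lambda>j. vec_index y j = 0" j] that by (simp add: Y_def)
      then have "y = 0\<^sub>v 6" using y(1) by (intro eq_vecI) auto
      then show False using y(2) by simp
    qed
    have "\<bar>\<theta>\<bar> * (t * w c k) = \<bar>\<theta> * Y c k\<bar>" by (simp add: abs_mult eqt)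
    also have "\<dots> \<le> (\<Sum>k'\<in>UNIV. \<bar>real (count c True k k') * Y c k' + real (count c False k k') * Y (\<not> c) k'\<bar>)"
      unfolding eq by (rule sum_abs)
    also have "\<dots> \<le> (\<Sum>k'\<in>UNIV. real (count c True k k') * (t * w c k') + real (count c False k k') * (t * w (\<not> c) k'))"
    proof (rule sum_mono)
      fix k'
      have "\<bar>real (count c True k k') * Y c k'\<bar> \<le> real (count c True k k') * (t * w c k')"
        "\<bar>real (count c False k k') * Y (\<not> c) k'\<bar> \<le> real (count c False k k') * (t * w (\<not> c) k')"
        using bound by (auto simp: abs_mult intro!: mult_left_mono)
      then show "\<bar>real (count c True k k') * Y c k' + real (count c False k k') * Y (\<not> c) k'\<bar>
        \<le> real (count c True k k') * (t * w c k') + real (count c False k k') * (t * w (\<not> c) k')" by linarith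
    qed
    also have "\<dots> = t * (\<Sum>k'\<in>UNIV. real (count c True k k') * w c k' + real (count c False k k') * w (\<not> c) k')"
      by (simp add: sum_distrib_left algebra_simps)
    also have "\<dots> = \<mu> * (t * w c k)" by (simp add: w(2))
    finally show ?thesis using \<open>0 < t\<close> w(1)[of c k] by simp
  qed
  ultimately have eq: "\<theta> = \<mu>" by linarith
  show thesis unfolding eq by (rule that[unfolded eq, OF \<mu> w])
qed

end

end

section \<open>Directions in plane sets\<close>

lemma hausdorff_null_homothety_iff:
  fixes g :: "'a::real_normed_vector \<Rightarrow> 'a"
  assumes s: "0 < s" and r: "0 < r" and g: "\<And>x y. dist (g x) (g y) = r * dist x y"
  shows "hausdorff_measure s (g ` A) = 0 \<longleftrightarrow> hausdorff_measure s A = 0"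
proof
  assume "hausdorff_measure s A = 0"
  then show "hausdorff_measure s (g ` A) = 0"
    using s r g by (intro hausdorff_null_lipschitz_image[where C = r]) auto
next
  assume null: "hausdorff_measure s (g ` A) = 0"
  have "inj g" using g r by (intro injI) (metis dist_eq_0_iff mult_eq_0_iff less_irrefl)
  define h where "h = inv_into UNIV g"
  have h: "h (g x) = x" for x using \<open>inj g\<close> by (simp add: h_def)
  have "hausdorff_measure s (h ` g ` A) = 0"
  proof (rule hausdorff_null_lipschitz_image[OF s _ _ null, where C = "1 / r"])
    show "dist (h x) (h y) \<le> 1 / r * dist x y" if xy: "x \<in> g ` A" "y \<in> g ` A" for x y
    proof -
      obtain a b where "x = g a" "y = g b" using xy by blast
      then show ?thesis using g[of a b] r by (simp add: h)
    qed
  qed (use r in simp)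
  then show "hausdorff_measure s A = 0" by (simp add: image_image h)
qed

text \<open>The determinant of two plane vectors. For a unit vector \<open>v\<close>, the modulus of
  \<open>cross v (x - p)\<close> is the distance of \<open>x\<close> from the line through
  \<open>p\<close> with direction \<open>v\<close>.\<close>

definition cross :: "real^2 \<Rightarrow> real^2 \<Rightarrow> real" where
  "cross u v = vec_nth u 1 * vec_nth v 2 - vec_nth u 2 * vec_nth v 1"

lemma inner_2: "(u :: real^2) \<bullet> v = vec_nth u 1 * vec_nth v 1 + vec_nth u 2 * vec_nth v 2"
  by (simp add: inner_vec_def sum_2)

text \<open>Lagrange's identity; for the angle between the vectors, the squares of sine and cosine
  add up to 1.\<close>

lemma cross_inner: "(cross u v)\<^sup>2 + (u \<bullet> v)\<^sup>2 = (norm u)\<^sup>2 * (norm v)\<^sup>2"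
  unfolding power2_norm_eq_inner inner_2 cross_def by (simp add: power2_eq_square algebra_simps)

lemma cross_zero_parallel:
  assumes "cross v w = 0"
  shows "(v \<bullet> v) *\<^sub>R w = (w \<bullet> v) *\<^sub>R v"
proof -
  have *: "(p * p + q * q) * r = (r * p + t * q) * p \<and> (p * p + q * q) * t = (r * p + t * q) * q"
    if "p * t = q * r" for p q r t :: real
  proof -
    have "(p * p + q * q) * r = r * p * p + q * (q * r)" "(p * p + q * q) * t = p * (p * t) + t * q * q"
      by (simp_all only: algebra_simps)
    then show ?thesis using that by (simp only:) (simp add: algebra_simps)
  qed
  have "vec_nth v 1 * vec_nth w 2 = vec_nth v 2 * vec_nth w 1" using assms by (simp add: cross_def)
  from *[OF this] show ?thesis
    unfolding Finite_Cartesian_Product.vec_eq_iff forall_2 inner_2 vector_scaleR_component real_scaleR_def by simp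
qed

lemma cross_diff: "cross v (a - b) = cross v a - cross v b"
  by (simp add: cross_def algebra_simps)

text \<open>Cramer's rule in the plane.\<close>

lemma cross_expand: "cross b c *\<^sub>R v = cross v c *\<^sub>R b - cross v b *\<^sub>R c"
  unfolding Finite_Cartesian_Product.vec_eq_iff forall_2 by (simp add: cross_def algebra_simps)

lemma line_angle_scale: "a \<noteq> 0 \<Longrightarrow> line_angle v (a *\<^sub>R u) = line_angle v u"
  by (simp add: line_angle_def abs_mult)

text \<open>Three points that are not collinear cannot all be closer than \<eta> to one line. A
  point at least this far from the line and at most \<open>d\<close> from \<open>p\<close> is seen
  from \<open>p\<close> under an angle to the line whose sine is at least
  \<open>\<eta> / d\<close>.\<close>

lemma directions_spread:
  fixes K :: "(real^2) set"
  assumes "bounded K" and abc: "a \<in> K" "b \<in> K" "c \<in> K" "cross (b - a) (c - a) \<noteq> 0"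
  shows "\<exists>\<phi>>0. \<forall>p\<in>K. \<forall>v. v \<noteq> 0 \<longrightarrow> (\<exists>x\<in>K. x \<noteq> p \<and> \<phi> < line_angle v (x - p))"
proof -
  define d where "d = diameter K + 1"
  have d: "0 < d" "\<And>x y. x \<in> K \<Longrightarrow> y \<in> K \<Longrightarrow> norm (x - y) \<le> d"
    using diameter_ge_0[OF assms(1)] diameter_bounded_bound[OF assms(1)]
    by (auto simp: d_def dist_norm intro: order_trans[of _ "diameter K"])
  define D where "D = \<bar>cross (b - a) (c - a)\<bar>"
  have D: "0 < D" using abc by (simp add: D_def)
  \<comment> \<open>With this value the two terms that bound \<open>D\<close> below would add up to
    less than \<open>4 * \<eta> * d = D\<close>.\<close>
  define \<eta> where "\<eta> = D / (4 * d)"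
  have \<eta>: "0 < \<eta>" using D d by (simp add: \<eta>_def)
  have far: "\<exists>x\<in>K. \<eta> \<le> \<bar>cross v (x - p)\<bar>" if v: "norm v = 1" for v p
  proof (rule ccontr)
    assume "\<not> ?thesis"
    then have small: "\<bar>cross v (x - p)\<bar> < \<eta>" if "x \<in> K" for x using that by force
    have diff: "cross v (x - y) = cross v (x - p) - cross v (y - p)" for x y by (simp add: cross_diff)
    have "\<bar>cross v (b - a)\<bar> < 2 * \<eta>" "\<bar>cross v (c - a)\<bar> < 2 * \<eta>"
      unfolding diff[of b a] diff[of c a] using small[OF abc(1)] small[OF abc(2)] small[OF abc(3)] by linarith+
    then have "\<bar>cross v (c - a)\<bar> * norm (b - a) + \<bar>cross v (b - a)\<bar> * norm (c - a) < 2 * \<eta> * d + 2 * \<eta> * d"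
      using d abc \<eta> by (intro add_less_le_mono mult_less_le_imp_less mult_mono) (auto simp: cross_def)
    moreover have "D = norm (cross (b - a) (c - a) *\<^sub>R v)" using v by (simp add: D_def)
    then have "D = norm (cross v (c - a) *\<^sub>R (b - a) - cross v (b - a) *\<^sub>R (c - a))"
      by (simp only: cross_expand[of "b - a" "c - a" v])
    then have "D \<le> norm (cross v (c - a) *\<^sub>R (b - a)) + norm (cross v (b - a) *\<^sub>R (c - a))"
      by (simp only: norm_triangle_ineq4)
    then have "D \<le> \<bar>cross v (c - a)\<bar> * norm (b - a) + \<bar>cross v (b - a)\<bar> * norm (c - a)"
      by (simp only: norm_scaleR)
    ultimately show False using d by (simp add: \<eta>_def)
  qed
  define q where "q = sqrt (1 - (\<eta> / d)\<^sup>2)"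
  have q1: "q < 1" using \<eta> d by (simp add: q_def real_sqrt_lt_1_iff)
  \<comment> \<open>The half makes the inequality strict; the maximum with 0 keeps the argument of
    \<open>arccos\<close> in its range.\<close>
  show ?thesis
  proof (intro exI[of _ "arccos (max 0 q) / 2"] conjI ballI allI impI)
    have mq: "0 \<le> max 0 q" "max 0 q < 1" using q1 by auto
    have ac: "0 < arccos (max 0 q)" using arccos_less_mono[of 1 "max 0 q"] mq by simp
    then show "0 < arccos (max 0 q) / 2" by simp
    fix p v assume p: "p \<in> K" and v: "v \<noteq> (0 :: real^2)"
    define u where "u = (1 / norm v) *\<^sub>R v"
    have u: "norm u = 1" using v by (simp add: u_def)
    obtain x where x: "x \<in> K" "\<eta> \<le> \<bar>cross u (x - p)\<bar>" using far[OF u] by blast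
    let ?w = "x - p"
    have w0: "x \<noteq> p" using x(2) \<eta> by (auto simp: cross_def)
    then have nw: "0 < norm ?w" "norm ?w \<le> d" using d x p by auto
    have "(\<eta> / d)\<^sup>2 \<le> (\<bar>cross u ?w\<bar> / norm ?w)\<^sup>2"
      using x(2) nw \<eta> d by (intro power_mono frac_le) auto
    moreover have "(\<bar>cross u ?w\<bar> / norm ?w)\<^sup>2 + (\<bar>u \<bullet> ?w\<bar> / norm ?w)\<^sup>2 = 1"
      using cross_inner[of u ?w] nw u by (simp add: power_divide flip: add_divide_distrib)
    ultimately have "(\<bar>u \<bullet> ?w\<bar> / norm ?w)\<^sup>2 \<le> 1 - (\<eta> / d)\<^sup>2" by linarith
    then have le: "\<bar>u \<bullet> ?w\<bar> / norm ?w \<le> q" unfolding q_def by (rule real_le_rsqrt)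
    have "\<bar>v \<bullet> ?w\<bar> / (norm v * norm ?w) = \<bar>u \<bullet> ?w\<bar> / norm ?w"
      using v by (simp add: u_def abs_mult)
    then have "line_angle v ?w = arccos (\<bar>u \<bullet> ?w\<bar> / norm ?w)" by (simp add: line_angle_def)
    also have "\<dots> \<ge> arccos (max 0 q)"
      using le mq nw by (intro arccos_le_arccos) (auto intro: order_trans[of _ 0])
    finally have "arccos (max 0 q) / 2 < line_angle v ?w" using ac by simp
    then show "\<exists>x\<in>K. x \<noteq> p \<and> arccos (max 0 q) / 2 < line_angle v (x - p)" using x w0 by blast
  qed
qed

lemma noncollinear_of_hausdorff:
  fixes K :: "(real^2) set"
  assumes "bounded K" "1 < s" "hausdorff_measure s K \<noteq> 0"
  shows "\<exists>a\<in>K. \<exists>b\<in>K. \<exists>c\<in>K. cross (b - a) (c - a) \<noteq> 0"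
proof (rule ccontr)
  assume no: "\<not> ?thesis"
  have single: "hausdorff_measure s {x} = 0" for x :: "real^2" using assms(2) by (intro hausdorff_null_singleton) simp
  have "K \<noteq> {}" using assms(3) single hausdorff_null_subset by (metis empty_subsetI)
  then obtain a where a: "a \<in> K" by blast
  have "K \<noteq> {a}" using assms(3) single by auto
  then obtain b where b: "b \<in> K" "b \<noteq> a" using a by blast
  have "c \<in> range (\<lambda>t. a + t *\<^sub>R (b - a))" if "c \<in> K" for c
  proof -
    let ?v = "b - a"
    have "cross ?v (c - a) = 0" using no a b that by blast
    then have eq: "(?v \<bullet> ?v) *\<^sub>R (c - a) = ((c - a) \<bullet> ?v) *\<^sub>R ?v" by (rule cross_zero_parallel)
    have "?v \<bullet> ?v \<noteq> 0" using b(2) by simp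
    then have "c - a = (1 / (?v \<bullet> ?v)) *\<^sub>R ((?v \<bullet> ?v) *\<^sub>R (c - a))" by (simp del: inner_eq_zero_iff)
    then have "c - a = ((c - a) \<bullet> ?v / (?v \<bullet> ?v)) *\<^sub>R ?v" by (simp only: eq scaleR_scaleR times_divide_eq_left mult_1)
    then have "\<exists>t. c - a = t *\<^sub>R ?v" by (rule exI)
    then obtain t where t: "c - a = t *\<^sub>R ?v" by (elim exE)
    have "c = a + t *\<^sub>R ?v" unfolding t[symmetric] by simp
    then show ?thesis by blast
  qed
  then have "hausdorff_measure s K = 0"
    using b(2) assms(1,2) by (intro hausdorff_null_of_subset_line[of s K a "b - a"]) auto
  then show False using assms(3) by simp
qed

lemma bary_lipschitz: "\<bar>bary x i - bary y i\<bar> \<le> 4 * dist x y"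
proof -
  have c: "\<bar>vec_nth x 1 - vec_nth y 1\<bar> \<le> dist x y" "\<bar>vec_nth x 2 - vec_nth y 2\<bar> \<le> dist x y"
    using component_le_norm_cart[of "x - y" 1] component_le_norm_cart[of "x - y" 2] by (simp_all add: dist_norm)
  have "1 \<le> sqrt 3" by simp
  then have "\<bar>vec_nth x 2 - vec_nth y 2\<bar> / sqrt 3 \<le> \<bar>vec_nth x 2 - vec_nth y 2\<bar> / 1"
    by (intro divide_left_mono) auto
  then have "\<bar>vec_nth x 2 / sqrt 3 - vec_nth y 2 / sqrt 3\<bar> \<le> dist x y"
    using c(2) by (simp flip: diff_divide_distrib add: abs_divide)
  then show ?thesis using c(1) exhaust_3[of i] zero_le_dist[of x y] by (auto simp: bary_def)
qed

section \<open>Exit arcs as a graph-directed construction\<close>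

context labyrinth
begin

definition arc_types :: "(bool \<times> 3 \<times> 3) set" where
  "arc_types = {(c, i, j). i \<noteq> j}"

definition exit_arc :: "bool \<times> 3 \<times> 3 \<Rightarrow> (real^2) set" where
  "exit_arc = (\<lambda>(c, i, j). seg c (exit_point c i) (exit_point c j))"

text \<open>Both orders of the exits use the path in canonical order, the one recorded by the path
  matrix; the arc is the same.\<close>

definition arc_parts :: "bool \<times> 3 \<times> 3 \<Rightarrow> (triangle \<times> bool \<times> 3 \<times> 3) set" where
  "arc_parts = (\<lambda>(c, i, j). case canon (missing i j) of (a, b) \<Rightarrow>
     (\<lambda>(v, x, y). (v, child c v, x, y)) ` set (typed m a b (exit_path c a b)))"

lemma arc_partsE:
  assumes "(c, i, j) \<in> arc_types" "(v, t') \<in> arc_parts (c, i, j)"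
  obtains a b h where "canon (missing i j) = (a, b)" "a \<noteq> b" "h < length (exit_path c a b)" "v = exit_path c a b ! h"
    "t' = (child c v, path_labels m a b (exit_path c a b) ! h, path_labels m a b (exit_path c a b) ! Suc h)"
proof -
  obtain a b where ab: "canon (missing i j) = (a, b)" by (cases "canon (missing i j)")
  then have "a \<noteq> b" using canon_distinct[of "missing i j"] by simp
  obtain x y where xy: "(v, x, y) \<in> set (typed m a b (exit_path c a b))" "t' = (child c v, x, y)"
    using assms(2) ab by (auto simp: arc_parts_def)
  then obtain h where "h < length (exit_path c a b)" "typed m a b (exit_path c a b) ! h = (v, x, y)"
    by (metis in_set_conv_nth length_typed)
  then show thesis using that[OF ab \<open>a \<noteq> b\<close>, of h] typed_nth[of h "exit_path c a b" m a b] xy(2) by auto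
qed

lemma arc_parts_in:
  assumes "(c, i, j) \<in> arc_types" "(v, t') \<in> arc_parts (c, i, j)"
  shows "v \<in> cells c \<and> t' \<in> arc_types \<and> fst t' = child c v"
proof -
  obtain a b h where ab: "a \<noteq> b" "h < length (exit_path c a b)" "v = exit_path c a b ! h"
    "t' = (child c v, path_labels m a b (exit_path c a b) ! h, path_labels m a b (exit_path c a b) ! Suc h)"
    using assms by (rule arc_partsE)
  then show ?thesis using lab_distinct[OF ab(1,2)] exit_path_facts(2)[OF ab(1), of c] nth_mem[OF ab(2)]
    by (auto simp: arc_types_def)
qed

text \<open>A path visits each cell once. Hence the cells along a word determine its types, and
  words can be told apart by their centroids.\<close>

lemma arc_parts_unique:
  assumes "t \<in> arc_types" "(v, t') \<in> arc_parts t" "(v, t'') \<in> arc_parts t"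
  shows "t' = t''"
proof -
  obtain c i j where t: "t = (c, i, j)" by (cases t)
  obtain a b h where 1: "canon (missing i j) = (a, b)" "a \<noteq> b" "h < length (exit_path c a b)" "v = exit_path c a b ! h"
    "t' = (child c v, path_labels m a b (exit_path c a b) ! h, path_labels m a b (exit_path c a b) ! Suc h)"
    using assms(1,2) unfolding t by (rule arc_partsE)
  obtain a' b' h' where 2: "canon (missing i j) = (a', b')" "h' < length (exit_path c a' b')" "v = exit_path c a' b' ! h'"
    "t'' = (child c v, path_labels m a' b' (exit_path c a' b') ! h', path_labels m a' b' (exit_path c a' b') ! Suc h')"
    using assms(1,3) unfolding t by (rule arc_partsE)
  have "a' = a" "b' = b" using 1(1) 2(1) by auto
  then have "h = h'" using 1 2 exit_path_facts(3)[OF 1(2), of c] by (simp add: nth_eq_iff_index_eq)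
  then show ?thesis using 1(5) 2(4) \<open>a' = a\<close> \<open>b' = b\<close> by simp
qed

lemma exit_arc_canon:
  assumes "i \<noteq> j" "canon (missing i j) = (a, b)"
  shows "exit_arc (c, i, j) = seg c (exit_point c a) (exit_point c b)"
  using canon_pair[OF assms(1)] assms(2) arc_segment_sym by (auto simp: exit_arc_def)

lemma exit_arc_decomp:
  assumes "t \<in> arc_types"
  shows "exit_arc t = (\<Union>(v, t')\<in>arc_parts t. affine_map v ` exit_arc t')"
proof -
  obtain c i j where t: "t = (c, i, j)" by (cases t)
  have ij: "i \<noteq> j" using assms t by (simp add: arc_types_def)
  obtain a b where ab: "canon (missing i j) = (a, b)" by (cases "canon (missing i j)")
  have a_b: "a \<noteq> b" using canon_distinct[of "missing i j"] ab by simp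
  let ?p = "exit_path c a b"
  have p: "hd ?p = exit_cell c a" "last ?p = exit_cell c b" using exit_path[of c a b] by (auto simp: graph_path_def)
  have "exit_arc t = seg c (affine_map (exit_cell c a) (exit_point c a)) (affine_map (exit_cell c b) (exit_point c b))"
    unfolding t exit_arc_canon[OF ij ab] by (simp add: affine_map_exit_cell)
  also have "\<dots> = (\<Union>(v, x, y)\<in>set (route c ?p (exit_point c a) (exit_point c b)). affine_map v ` seg (child c v) x y)"
    by (rule seg_route[OF exit_path]) (simp_all add: exit_point_in_fractal)
  also have "route c ?p (exit_point c a) (exit_point c b) =
      map (\<lambda>(v, x, y). (v, exit_point (child c v) x, exit_point (child c v) y)) (typed m a b ?p)"
  proof (rule nth_equalityI)
    fix h assume "h < length (route c ?p (exit_point c a) (exit_point c b))"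
    then show "route c ?p (exit_point c a) (exit_point c b) ! h =
        map (\<lambda>(v, x, y). (v, exit_point (child c v) x, exit_point (child c v) y)) (typed m a b ?p) ! h"
      using route_labels[of h ?p c a b] p by (simp add: typed_nth)
  qed simp
  also have "(\<Union>(v, x, y)\<in>set (map (\<lambda>(v, x, y). (v, exit_point (child c v) x, exit_point (child c v) y)) (typed m a b ?p)).
      affine_map v ` seg (child c v) x y) = (\<Union>(v, t')\<in>arc_parts t. affine_map v ` exit_arc t')"
    by (auto simp: t arc_parts_def ab exit_arc_def split: prod.splits)
  finally show ?thesis .
qed

lemma compact_exit_arc: "compact (exit_arc t)"
  by (cases t) (simp add: exit_arc_def seg_compact exit_point_in_fractal)

lemma exit_arc_nonempty: "exit_arc t \<noteq> {}"
proof -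
  obtain c i j where t: "t = (c, i, j)" by (cases t)
  have "exit_point c i \<in> exit_arc t"
    using seg_ends[OF exit_point_in_fractal exit_point_in_fractal] by (simp add: t exit_arc_def)
  then show ?thesis by blast
qed

lemma exit_arc_base_region: "exit_arc t \<subseteq> base_region"
  using seg_subset exit_point_in_fractal fractal_subset by (cases t) (fastforce simp: exit_arc_def)

text \<open>The eigenvector equation with the count of each type resolved into a sum over the cells
  of the path.\<close>

lemma weight_sum:
  assumes w: "\<And>c k. (\<Sum>k'\<in>UNIV. real (count c True k k') * w c k' + real (count c False k k') * w (\<not> c) k') = \<theta> * w c k"
    and t: "(c, i, j) \<in> arc_types"
  shows "(\<Sum>(v, c', x, y)\<in>arc_parts (c, i, j). w c' (missing x y)) = \<theta> * w c (missing i j)"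
proof -
  let ?k = "missing i j"
  obtain a b where ab: "canon ?k = (a, b)" by (cases "canon ?k")
  have a_b: "a \<noteq> b" using canon_distinct[of ?k] ab by simp
  let ?p = "exit_path c a b" and ?L = "path_labels m a b (exit_path c a b)"
  let ?f = "\<lambda>h. (?p ! h, child c (?p ! h), ?L ! h, ?L ! Suc h)"
  have parts: "arc_parts (c, i, j) = ?f ` {..<length ?p}"
  proof -
    have "set (typed m a b ?p) = (\<lambda>h. (?p ! h, ?L ! h, ?L ! Suc h)) ` {..<length ?p}"
    proof -
      have "typed m a b ?p = map (\<lambda>h. (?p ! h, ?L ! h, ?L ! Suc h)) [0..<length ?p]"
        by (rule nth_equalityI) (simp_all add: typed_nth)
      then show ?thesis by (simp add: atLeast0LessThan)
    qed
    then show ?thesis by (simp add: arc_parts_def ab image_image)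
  qed
  have inj: "inj_on ?f {..<length ?p}"
    using exit_path_facts(3)[OF a_b, of c] by (auto simp: inj_on_def nth_eq_iff_index_eq)
  have ch: "child c (?p ! h) = (c = even h)" if "h < length ?p" for h
    using child_eq[OF exit_path_parity[OF a_b that]] .
  have "(\<Sum>(v, c', x, y)\<in>arc_parts (c, i, j). w c' (missing x y)) =
      (\<Sum>h<length ?p. w (child c (?p ! h)) (missing (?L ! h) (?L ! Suc h)))"
    unfolding parts by (subst sum.reindex[OF inj]) simp
  also have "\<dots> = (\<Sum>h<length ?p. \<Sum>k'\<in>UNIV.
      (if even h = True \<and> missing (?L ! h) (?L ! Suc h) = k' then 1 else 0) * w c k' +
      (if even h = False \<and> missing (?L ! h) (?L ! Suc h) = k' then 1 else 0) * w (\<not> c) k')"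
  proof (rule sum.cong[OF refl])
    fix h assume "h \<in> {..<length ?p}"
    then have c: "child c (?p ! h) = (c = even h)" using ch by simp
    have delta: "(\<Sum>k'\<in>UNIV. (if l = k' then 1 else 0) * g k') = (g l :: real)" for g and l :: 3
    proof -
      have "(\<Sum>k'\<in>UNIV. (if l = k' then 1 else 0) * g k') = (\<Sum>k'\<in>UNIV. if l = k' then g k' else 0)"
        by (intro sum.cong) auto
      then show ?thesis by simp
    qed
    show "w (child c (?p ! h)) (missing (?L ! h) (?L ! Suc h)) = (\<Sum>k'\<in>UNIV.
      (if even h = True \<and> missing (?L ! h) (?L ! Suc h) = k' then 1 else 0) * w c k' +
      (if even h = False \<and> missing (?L ! h) (?L ! Suc h) = k' then 1 else 0) * w (\<not> c) k')"
      unfolding c using delta by (cases "even h"; cases c) simp_all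
  qed
  also have "\<dots> = (\<Sum>k'\<in>UNIV. real (count c True ?k k') * w c k' + real (count c False ?k k') * w (\<not> c) k')"
    unfolding count_sum[OF ab, symmetric] sum_distrib_right
    by (subst sum.swap) (simp only: sum.distrib)
  finally show ?thesis using w by simp
qed

section \<open>Separation of copies by centroids\<close>

definition centroid :: "real^2" where
  "centroid = (\<Sum>i\<in>UNIV. (1/3) *\<^sub>R base_triangle i)"

lemma bary_centroid: "bary centroid i = 1/3"
  unfolding centroid_def by (rule bary_combination) (simp add: sum_3)

lemma centroid_base_region: "centroid \<in> base_region"
  by (simp add: base_region_iff bary_centroid)

lemma cell_bary:
  assumes "V \<in> cells c"
  obtains k :: "3 \<Rightarrow> int" where "\<And>x i. real m * bary (affine_map V x) i = of_int (k i) + bary x i" "\<And>i. 0 \<le> k i"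
    | k :: "3 \<Rightarrow> int" where "\<And>x i. real m * bary (affine_map V x) i = of_int (k i) + 1 - bary x i" "\<And>i. 0 \<le> k i"
  using assms unfolding cells_def by (metis UnE up_cellE down_cellE)

lemma bary_interior_less_1: "(\<And>i. 0 < bary x i) \<Longrightarrow> bary x i < 1"
proof -
  assume pos: "\<And>i. 0 < bary x i"
  obtain a b where ab: "a \<noteq> i" "b \<noteq> i" "a \<noteq> b" by (rule other_indices[of i]) blast
  show ?thesis using sum_distinct_3[OF ab, of "bary x"] pos[of a] pos[of b] by simp
qed

text \<open>For coordinates strictly between 0 and 1 the equations determine the index triples. For
  opposite directions the three sums of corresponding coordinates would all be 1, but their total is
  2.\<close>

lemma interior_disjoint:
  assumes V: "V \<in> cells c" and W: "W \<in> cells c" and x: "\<And>i. 0 < bary x i" and y: "\<And>i. 0 < bary y i"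
    and eq: "affine_map V x = affine_map W y"
  shows "V = W"
proof -
  have b: "0 < bary x i" "bary x i < 1" "0 < bary y i" "bary y i < 1" for i
    using x y bary_interior_less_1 by auto
  have mixed: False if U: "U \<in> pattern_part S c True" "U' \<in> pattern_part S c False" "affine_map U z = affine_map U' z'"
    "\<And>i. 0 < bary z i \<and> bary z i < 1" "\<And>i. 0 < bary z' i \<and> bary z' i < 1" for U U' z z'
  proof -
    obtain k where k: "\<And>x i. real m * bary (affine_map U x) i = of_int (k i) + bary x i" using U(1) by (rule up_cellE) blast
    obtain l where l: "\<And>x i. real m * bary (affine_map U' x) i = of_int (l i) + 1 - bary x i" using U(2) by (rule down_cellE) blast
    have "bary z i + bary z' i = 1" for i
    proof -
      have e: "bary z i + bary z' i = of_int (l i - k i + 1)" using k[of z i] l[of z' i] U(3) by simp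
      then have "0 < real_of_int (l i - k i + 1)" "real_of_int (l i - k i + 1) < 2" using U(4)[of i] U(5)[of i] e by linarith+
      then have "l i - k i + 1 = 1" by linarith
      then show ?thesis using e by simp
    qed
    then have "(\<Sum>i\<in>UNIV. bary z i + bary z' i) = 3" by (simp add: sum_3)
    then show False by (simp add: sum.distrib)
  qed
  consider "V \<in> pattern_part S c True" "W \<in> pattern_part S c True" | "V \<in> pattern_part S c False" "W \<in> pattern_part S c False"
    | "V \<in> pattern_part S c True" "W \<in> pattern_part S c False" | "V \<in> pattern_part S c False" "W \<in> pattern_part S c True"
    using V W by (auto simp: cells_def)
  then show ?thesis
  proof cases
    case 1
    obtain k where k: "V = up_triangle m k" "\<And>x i. real m * bary (affine_map V x) i = of_int (k i) + bary x i" using 1(1) by (rule up_cellE) blast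
    obtain l where l: "W = up_triangle m l" "\<And>x i. real m * bary (affine_map W x) i = of_int (l i) + bary x i" using 1(2) by (rule up_cellE) blast
    have "k i = l i" for i
    proof -
      have "of_int (k i) + bary x i = of_int (l i) + bary y i" using k(2)[of x i] l(2)[of y i] eq by simp
      then show ?thesis using b[of i] by linarith
    qed
    then have "k = l" by (rule ext)
    then show ?thesis using k(1) l(1) by simp
  next
    case 2
    obtain k where k: "V = down_triangle m k" "\<And>x i. real m * bary (affine_map V x) i = of_int (k i) + 1 - bary x i" using 2(1) by (rule down_cellE) blast
    obtain l where l: "W = down_triangle m l" "\<And>x i. real m * bary (affine_map W x) i = of_int (l i) + 1 - bary x i" using 2(2) by (rule down_cellE) blast
    have "k i = l i" for i
    proof -
      have "of_int (k i) + 1 - bary x i = of_int (l i) + 1 - bary y i" using k(2)[of x i] l(2)[of y i] eq by simp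
      then show ?thesis using b[of i] by linarith
    qed
    then have "k = l" by (rule ext)
    then show ?thesis using k(1) l(1) by simp
  next
    case 3
    then show ?thesis using mixed[of V W x y] b eq by auto
  next
    case 4
    then show ?thesis using mixed[of W V y x] b eq by auto
  qed
qed

lemma arc_words_Suc:
  assumes "t \<in> arc_types" "w \<in> words arc_parts (Suc n) t"
  obtains v t' w' where "w = (v, t') # w'" "(v, t') \<in> arc_parts t" "w' \<in> words arc_parts n t'" "v \<in> cells (fst t)"
    "t' \<in> arc_types" "fst t' = child (fst t) v"
proof -
  obtain v t' w' where w: "w = (v, t') # w'" "(v, t') \<in> arc_parts t" "w' \<in> words arc_parts n t'"
    using assms(2) unfolding words_Suc_iff by blast
  obtain c i j where t: "t = (c, i, j)" by (cases t)
  then show thesis using that[OF w] arc_parts_in[of c i j v t'] w(2) assms(1) by auto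
qed

text \<open>The coordinates of the centroids of the cells of level \<open>n\<close> are multiples of \<open>1 / (3 * m ^ n)\<close>, so a set of
  diameter \<open>m ^ -n\<close> is close to a bounded number of them only.\<close>

lemma centroid_word:
  assumes "t \<in> arc_types" "w \<in> words arc_parts n t"
  shows "0 < bary (word_map affine_map w centroid) i \<and> (\<exists>q::int. 3 * real m ^ n * bary (word_map affine_map w centroid) i = of_int q)"
  using assms
proof (induction n arbitrary: t w i)
  case 0
  then show ?case by (auto simp: bary_centroid intro: exI[of _ 1])
next
  case (Suc n)
  obtain v t' w' where w: "w = (v, t') # w'" "w' \<in> words arc_parts n t'" "v \<in> cells (fst t)" "t' \<in> arc_types"
    using Suc.prems by (rule arc_words_Suc) blast
  let ?z = "word_map affine_map w' centroid"
  have pos: "0 < bary ?z i" for i using Suc.IH[OF w(4,2)] by blast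
  have lt: "bary ?z i < 1" using bary_interior_less_1[OF pos] .
  obtain q :: int where q: "3 * real m ^ n * bary ?z i = of_int q" using Suc.IH[OF w(4,2)] by blast
  have e: "word_map affine_map w centroid = affine_map v ?z" by (simp add: w(1))
  have s: "3 * real m ^ Suc n * bary (affine_map v ?z) i = 3 * real m ^ n * (real m * bary (affine_map v ?z) i)" by simp
  have m0: "0 < real m" using m_ge_2 by simp
  from w(3) show ?case
  proof (cases rule: cell_bary)
    case (1 k)
    have "0 < real m * bary (affine_map v ?z) i" unfolding 1(1) using 1(2)[of i] pos[of i] by (simp add: add_nonneg_pos)
    then have "0 < bary (affine_map v ?z) i" using m0 by (simp add: zero_less_mult_iff)
    moreover have "3 * real m ^ Suc n * bary (affine_map v ?z) i = of_int (3 * int m ^ n * k i + q)"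
      unfolding s 1(1) distrib_left q by simp
    ultimately show ?thesis unfolding e by blast
  next
    case (2 k)
    have "0 < real m * bary (affine_map v ?z) i" unfolding 2(1) using 2(2)[of i] lt by (simp add: add_nonneg_pos)
    then have "0 < bary (affine_map v ?z) i" using m0 by (simp add: zero_less_mult_iff)
    moreover have "3 * real m ^ Suc n * bary (affine_map v ?z) i = of_int (3 * int m ^ n * k i + 3 * int m ^ n - q)"
      unfolding s 2(1) distrib_left right_diff_distrib q by simp
    ultimately show ?thesis unfolding e by blast
  qed
qed

lemma centroid_word_inj:
  assumes "t \<in> arc_types" "w \<in> words arc_parts n t" "w' \<in> words arc_parts n t"
    "word_map affine_map w centroid = word_map affine_map w' centroid"
  shows "w = w'"
  using assms
proof (induction n arbitrary: t w w')
  case (Suc n)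
  obtain v t1 w1 where w: "w = (v, t1) # w1" "(v, t1) \<in> arc_parts t" "w1 \<in> words arc_parts n t1" "v \<in> cells (fst t)" "t1 \<in> arc_types"
    using Suc.prems(1,2) by (rule arc_words_Suc) blast
  obtain v' t2 w2 where w': "w' = (v', t2) # w2" "(v', t2) \<in> arc_parts t" "w2 \<in> words arc_parts n t2" "v' \<in> cells (fst t)" "t2 \<in> arc_types"
    using Suc.prems(1,3) by (rule arc_words_Suc) blast
  have eq: "affine_map v (word_map affine_map w1 centroid) = affine_map v' (word_map affine_map w2 centroid)"
    using Suc.prems(4) by (simp add: w(1) w'(1))
  have "v = v'" using interior_disjoint[OF w(4) w'(4) _ _ eq] centroid_word[OF w(5,3)] centroid_word[OF w'(5,3)] by blast
  then have "t1 = t2" using arc_parts_unique[OF Suc.prems(1)] w(2) w'(2) by blast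
  moreover have "word_map affine_map w1 centroid = word_map affine_map w2 centroid"
    using eq \<open>v = v'\<close> cell_inj[OF w(4)] by (auto dest: injD)
  ultimately show ?case using Suc.IH[OF w(5,3)] w w' \<open>v = v'\<close> by simp
qed simp

text \<open>A cell map involves no rotation except possibly a half turn, so copies preserve the
  directions of lines.\<close>

lemma cell_difference:
  assumes "V \<in> cells c"
  shows "\<exists>\<rho>. \<bar>\<rho>\<bar> = 1 / real m \<and> (\<forall>x y. affine_map V x - affine_map V y = \<rho> *\<^sub>R (x - y))"
proof -
  have "V \<in> up_triangles m \<union> down_triangles m" using assms cells_subset by blast
  then consider k where "V = up_triangle m k" | k where "V = down_triangle m k"
    by (auto simp: up_triangles_def down_triangles_def)
  then show ?thesis
  proof cases
    case (1 k)
    show ?thesis by (rule exI[of _ "1 / real m"]) (simp add: 1 affine_map_up flip: scaleR_diff_right)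
  next
    case (2 k)
    show ?thesis by (rule exI[of _ "- (1 / real m)"]) (simp add: 2 affine_map_down flip: scaleR_diff_right scaleR_minus_right)
  qed
qed

lemma word_map_difference:
  assumes "t \<in> arc_types" "w \<in> words arc_parts n t"
  shows "\<exists>\<rho>. \<bar>\<rho>\<bar> = 1 / real m ^ n \<and> (\<forall>x y. word_map affine_map w x - word_map affine_map w y = \<rho> *\<^sub>R (x - y))"
  using assms
proof (induction n arbitrary: t w)
  case 0
  then show ?case by (intro exI[of _ 1]) simp
next
  case (Suc n)
  obtain v t' w' where w: "w = (v, t') # w'" "w' \<in> words arc_parts n t'" "v \<in> cells (fst t)" "t' \<in> arc_types"
    using Suc.prems by (rule arc_words_Suc) blast
  obtain \<rho> where \<rho>: "\<bar>\<rho>\<bar> = 1 / real m ^ n" "\<And>x y. word_map affine_map w' x - word_map affine_map w' y = \<rho> *\<^sub>R (x - y)"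
    using Suc.IH[OF w(4,2)] by blast
  obtain \<sigma> where \<sigma>: "\<bar>\<sigma>\<bar> = 1 / real m" "\<And>x y. affine_map v x - affine_map v y = \<sigma> *\<^sub>R (x - y)"
    using cell_difference[OF w(3)] by blast
  show ?case
    by (rule exI[of _ "\<sigma> * \<rho>"]) (use \<rho> \<sigma> in \<open>simp add: w(1) abs_mult\<close>)
qed

end

section \<open>Dimension and tangents of arcs\<close>

context labyrinth
begin

text \<open>In units of \<open>1 / (3 * m ^ n)\<close>: the points compared are at most
  \<open>(diam + 1) / m ^ n\<close> apart, coordinates differ by at most 4 times the distance, and
  the last 1 absorbs rounding.\<close>

definition sep_bound :: int where
  "sep_bound = \<lceil>12 * (diam + 1)\<rceil> + 1"

lemma words_near:
  assumes t: "t \<in> arc_types" and U: "\<forall>x\<in>U. \<forall>y\<in>U. dist x y \<le> 1 / real m ^ n"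
  shows "card {w \<in> words arc_parts n t. word_map affine_map w ` exit_arc (end_type t w) \<inter> U \<noteq> {}}
    \<le> nat (2 * sep_bound + 1) ^ 2" (is "card ?W \<le> _")
proof (cases "?W = {}")
  case False
  then obtain x0 where x0: "x0 \<in> U" by blast
  define P where "P = 3 * real m ^ n"
  have P: "0 < P" using m_ge_2 by (simp add: P_def)
  \<comment> \<open>Two coordinates determine the third, and after scaling by \<open>P\<close> they
    are integers for a centroid, so rounding down loses nothing.\<close>
  define \<phi> where "\<phi> w = (\<lfloor>P * bary (word_map affine_map w centroid) 1\<rfloor>, \<lfloor>P * bary (word_map affine_map w centroid) 2\<rfloor>)" for w :: "(triangle \<times> bool \<times> 3 \<times> 3) list"
  define A where "A i = {\<lfloor>P * bary x0 i\<rfloor> - sep_bound .. \<lfloor>P * bary x0 i\<rfloor> + sep_bound}" for i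
  have near: "\<lfloor>P * bary (word_map affine_map w centroid) i\<rfloor> \<in> A i" if w: "w \<in> ?W" for w i
  proof -
    let ?z = "word_map affine_map w centroid"
    obtain y where y: "y \<in> exit_arc (end_type t w)" "word_map affine_map w y \<in> U" using w by blast
    obtain \<rho> where \<rho>: "\<bar>\<rho>\<bar> = 1 / real m ^ n" "\<And>x y. word_map affine_map w x - word_map affine_map w y = \<rho> *\<^sub>R (x - y)"
      using word_map_difference[OF t] w by blast
    have "dist centroid y \<le> diam" using dist_le_diam centroid_base_region exit_arc_base_region y(1) by blast
    then have "dist ?z (word_map affine_map w y) \<le> 1 / real m ^ n * diam"
      unfolding dist_norm \<rho>(2) norm_scaleR \<rho>(1) by (intro mult_left_mono) auto
    moreover have "dist (word_map affine_map w y) x0 \<le> 1 / real m ^ n" using U y(2) x0 by blast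
    ultimately have "dist ?z x0 \<le> 1 / real m ^ n * diam + 1 / real m ^ n" using dist_triangle[of ?z x0 "word_map affine_map w y"] by linarith
    then have "4 * dist ?z x0 \<le> 4 * (1 / real m ^ n * (diam + 1))" by (simp add: distrib_left add_divide_distrib)
    then have "\<bar>bary ?z i - bary x0 i\<bar> \<le> 4 * (1 / real m ^ n * (diam + 1))"
      using bary_lipschitz[of ?z i x0] by linarith
    then have "P * \<bar>bary ?z i - bary x0 i\<bar> \<le> P * (4 * (1 / real m ^ n * (diam + 1)))"
      using P by (intro mult_left_mono) auto
    also have "\<dots> = 12 * (diam + 1)" using m_ge_2 by (simp add: P_def)
    finally have "\<bar>P * bary ?z i - P * bary x0 i\<bar> \<le> 12 * (diam + 1)"
      using P by (simp add: abs_mult flip: right_diff_distrib)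
    then show ?thesis unfolding A_def sep_bound_def atLeastAtMost_iff by linarith
  qed
  have "inj_on \<phi> ?W"
  proof (rule inj_onI)
    fix w w' assume w: "w \<in> ?W" and w': "w' \<in> ?W" and eq: "\<phi> w = \<phi> w'"
    let ?z = "word_map affine_map w centroid" and ?z' = "word_map affine_map w' centroid"
    have fl: "\<lfloor>P * bary ?z i\<rfloor> = \<lfloor>P * bary ?z' i\<rfloor> \<Longrightarrow> bary ?z i = bary ?z' i" for i
    proof -
      obtain q q' :: int where "P * bary ?z i = of_int q" "P * bary ?z' i = of_int q'"
        using centroid_word[OF t, of w n i] centroid_word[OF t, of w' n i] w w' unfolding P_def by blast
      then show "\<lfloor>P * bary ?z i\<rfloor> = \<lfloor>P * bary ?z' i\<rfloor> \<Longrightarrow> bary ?z i = bary ?z' i"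
        using P by (metis floor_of_int mult_left_cancel less_irrefl)
    qed
    have e: "bary ?z 1 = bary ?z' 1" "bary ?z 2 = bary ?z' 2" using eq fl by (auto simp: \<phi>_def)
    then have "bary ?z 3 = bary ?z' 3" using bary_sum3[of ?z] bary_sum3[of ?z'] by linarith
    then have "bary ?z i = bary ?z' i" for i using e exhaust_3[of i] by auto
    then have "?z = ?z'" by (rule bary_eqI)
    then show "w = w'" using centroid_word_inj[OF t] w w' by blast
  qed
  then have "card ?W = card (\<phi> ` ?W)" by (simp add: card_image)
  also have "\<dots> \<le> card (A 1 \<times> A 2)"
  proof (rule card_mono)
    show "finite (A 1 \<times> A 2)" by (simp add: A_def)
    show "\<phi> ` ?W \<subseteq> A 1 \<times> A 2"
    proof (rule image_subsetI)
      fix w assume "w \<in> ?W"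
      from near[OF this, of 1] near[OF this, of 2] show "\<phi> w \<in> A 1 \<times> A 2" by (simp add: \<phi>_def)
    qed
  qed
  also have "\<dots> = nat (2 * sep_bound + 1) ^ 2"
    by (simp add: A_def card_cartesian_product power2_eq_square algebra_simps)
  finally show ?thesis .
next
  case True
  show ?thesis unfolding True by simp
qed

lemma finite_arc_types: "finite arc_types"
  by (rule finite_subset[OF subset_UNIV]) simp

lemma pieces_copy:
  assumes "a \<in> pieces n c"
  shows "\<exists>g \<rho> t. t \<in> arc_types \<and> a = g ` exit_arc t \<and> \<bar>\<rho>\<bar> = 1 / real m ^ n \<and> (\<forall>x y. g x - g y = \<rho> *\<^sub>R (x - y))"
  using assms
proof (induction n arbitrary: c a)
  case 0
  then obtain i j where "i \<noteq> j" "a = seg c (exit_point c i) (exit_point c j)" by auto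
  then have "(c, i, j) \<in> arc_types" "a = id ` exit_arc (c, i, j)" by (auto simp: arc_types_def exit_arc_def)
  then show ?case by (intro exI[of _ id] exI[of _ 1] exI[of _ "(c, i, j)"]) simp
next
  case (Suc n)
  then obtain V b where V: "V \<in> cells c" "b \<in> pieces n (child c V)" "a = affine_map V ` b" by auto
  obtain g \<rho> t where g: "t \<in> arc_types" "b = g ` exit_arc t" "\<bar>\<rho>\<bar> = 1 / real m ^ n" "\<And>x y. g x - g y = \<rho> *\<^sub>R (x - y)"
    using Suc.IH[OF V(2)] by blast
  obtain \<sigma> where \<sigma>: "\<bar>\<sigma>\<bar> = 1 / real m" "\<And>x y. affine_map V x - affine_map V y = \<sigma> *\<^sub>R (x - y)"
    using cell_difference[OF V(1)] by blast
  have "a = (affine_map V \<circ> g) ` exit_arc t" using V(3) g(2) by (simp add: image_comp)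
  moreover have "\<bar>\<sigma> * \<rho>\<bar> = 1 / real m ^ Suc n" using g(3) \<sigma>(1) by (simp add: abs_mult)
  moreover have "(affine_map V \<circ> g) x - (affine_map V \<circ> g) y = (\<sigma> * \<rho>) *\<^sub>R (x - y)" for x y
    using g(4) \<sigma>(2) by simp
  ultimately show ?case using g(1) by blast
qed

context
  fixes \<theta> :: real and w :: "bool \<Rightarrow> 3 \<Rightarrow> real"
  assumes \<theta>: "real m + 1 \<le> \<theta>" and w_pos: "\<And>c k. 0 < w c k"
    and w_eig: "\<And>c k. (\<Sum>k'\<in>UNIV. real (count c True k k') * w c k' + real (count c False k k') * w (\<not> c) k') = \<theta> * w c k"
begin

abbreviation (input) "hdim \<equiv> ln \<theta> / ln (real m)"

lemma arcs_graph_directed: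
  "graph_directed exit_arc arc_types arc_parts affine_map (\<lambda>(c, i, j). w c (missing i j)) \<theta> (real m) (nat (2 * sep_bound + 1) ^ 2)"
proof
  fix t assume t: "t \<in> arc_types"
  obtain c i j where ct: "t = (c, i, j)" by (cases t)
  show "finite (arc_parts t)" by (simp add: ct arc_parts_def split: prod.split)
  show "exit_arc t = (\<Union>(v, t')\<in>arc_parts t. affine_map v ` exit_arc t')" using t by (rule exit_arc_decomp)
  show "compact (exit_arc t)" "exit_arc t \<noteq> {}" by (rule compact_exit_arc exit_arc_nonempty)+
  show "0 < (case t of (c, i, j) \<Rightarrow> w c (missing i j))" by (simp add: ct w_pos)
  show "(\<Sum>(v, t')\<in>arc_parts t. case t' of (c, i, j) \<Rightarrow> w c (missing i j)) = \<theta> * (case t of (c, i, j) \<Rightarrow> w c (missing i j))"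
    using weight_sum[OF w_eig, of c i j] t by (simp add: ct)
  show "t' \<in> arc_types" if "(v, t') \<in> arc_parts t" for v t' using arc_parts_in[of c i j v t'] t that ct by simp
  show "dist (affine_map v x) (affine_map v y) = dist x y / real m" if "(v, t') \<in> arc_parts t" for v t' x y
    using arc_parts_in[of c i j v t'] t that ct cell_homothety[of v c x y] by simp
  show "card {w \<in> words arc_parts n t. word_map affine_map w ` exit_arc (end_type t w) \<inter> U \<noteq> {}} \<le> nat (2 * sep_bound + 1) ^ 2"
    if "\<forall>x\<in>U. \<forall>y\<in>U. dist x y \<le> 1 / real m ^ n" for n U using words_near[OF t that] .
qed (use finite_arc_types \<theta> m_ge_2 in auto)

lemma dimension_gt_1: "1 < hdim"
  using \<theta> m_ge_2 by (simp add: less_divide_eq)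

lemma powr_dimension: "real m powr hdim = \<theta>"
  using \<theta> m_ge_2 by (simp add: powr_def)

lemma powr_gt: "hdim < s \<Longrightarrow> \<theta> < real m powr s"
  using powr_less_mono[of hdim s "real m"] powr_dimension m_ge_2 by simp

lemma exit_arc_pos: "t \<in> arc_types \<Longrightarrow> hausdorff_measure hdim (exit_arc t) \<noteq> 0"
  using graph_directed.hausdorff_pos[OF arcs_graph_directed] powr_dimension dimension_gt_1 by simp

lemma exit_arc_null: "t \<in> arc_types \<Longrightarrow> hdim < s \<Longrightarrow> hausdorff_measure s (exit_arc t) = 0"
  using graph_directed.hausdorff_null[OF arcs_graph_directed] powr_gt dimension_gt_1 by simp

lemma pieces_measure:
  assumes "a \<in> pieces n c"
  shows "hausdorff_measure hdim a \<noteq> 0" "hdim < s \<Longrightarrow> hausdorff_measure s a = 0"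
proof -
  obtain g \<rho> t where g: "t \<in> arc_types" "a = g ` exit_arc t" "\<bar>\<rho>\<bar> = 1 / real m ^ n" "\<And>x y. g x - g y = \<rho> *\<^sub>R (x - y)"
    using pieces_copy[OF assms] by blast
  have \<rho>: "0 < \<bar>\<rho>\<bar>" unfolding g(3) using m_ge_2 by simp
  have d: "dist (g x) (g y) = \<bar>\<rho>\<bar> * dist x y" for x y by (simp add: dist_norm g(4))
  show "hausdorff_measure hdim a \<noteq> 0"
    unfolding g(2) using hausdorff_null_homothety_iff[OF _ \<rho> d, of hdim] dimension_gt_1 exit_arc_pos[OF g(1)] by simp
  show "hausdorff_measure s a = 0" if "hdim < s"
    unfolding g(2) using hausdorff_null_homothety_iff[OF _ \<rho> d, of s] dimension_gt_1 exit_arc_null[OF g(1) that] that by simp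
qed

lemma seg_pos:
  assumes "x \<in> fractal S c" "y \<in> fractal S c" "x \<noteq> y"
  shows "hausdorff_measure hdim (seg c x y) \<noteq> 0"
  using contains_piece[OF assms] pieces_measure(1) hausdorff_null_subset by metis

lemma seg_null:
  assumes "x \<in> fractal S c" "y \<in> fractal S c" and s: "hdim < s"
  shows "hausdorff_measure s (seg c x y) = 0"
proof -
  have s0: "0 < s" using s dimension_gt_1 by simp
  define F where "F = insert {x} (insert {y} (\<Union>n. pieces n c))"
  have "countable F" unfolding F_def by (intro countable_insert countable_UN) (auto intro: countable_finite finite_pieces)
  moreover have "hausdorff_measure s a = 0" if "a \<in> F" for a
    using that pieces_measure(2)[OF _ s] hausdorff_null_singleton[OF s0] by (auto simp: F_def)
  ultimately have "hausdorff_measure s (\<Union>a\<in>F. a) = 0" by (rule hausdorff_null_countable_UN)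
  moreover have "seg c x y \<subseteq> (\<Union>a\<in>F. a)"
    using in_piece[OF assms(1,2)] by (fastforce simp: F_def)
  ultimately show ?thesis by (rule hausdorff_null_subset)
qed

section \<open>Points without a tangent\<close>

lemma uniform_spread:
  obtains \<phi> where "0 < \<phi>" "\<And>t p v. t \<in> arc_types \<Longrightarrow> p \<in> exit_arc t \<Longrightarrow> v \<noteq> 0 \<Longrightarrow>
    \<exists>x\<in>exit_arc t. x \<noteq> p \<and> \<phi> < line_angle v (x - p)"
proof -
  have "\<exists>\<phi>>0. \<forall>p\<in>exit_arc t. \<forall>v. v \<noteq> 0 \<longrightarrow> (\<exists>x\<in>exit_arc t. x \<noteq> p \<and> \<phi> < line_angle v (x - p))"
    if t: "t \<in> arc_types" for t
  proof -
    have b: "bounded (exit_arc t)" using compact_exit_arc by (rule compact_imp_bounded)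
    obtain a b c where "a \<in> exit_arc t" "b \<in> exit_arc t" "c \<in> exit_arc t" "cross (b - a) (c - a) \<noteq> 0"
      using noncollinear_of_hausdorff[OF b dimension_gt_1 exit_arc_pos[OF t]] by blast
    then show ?thesis using directions_spread[OF b] by blast
  qed
  then obtain \<phi> where \<phi>: "\<And>t. t \<in> arc_types \<Longrightarrow> 0 < \<phi> t" "\<And>t p v. t \<in> arc_types \<Longrightarrow> p \<in> exit_arc t \<Longrightarrow> v \<noteq> 0 \<Longrightarrow>
    \<exists>x\<in>exit_arc t. x \<noteq> p \<and> \<phi> t < line_angle v (x - p)" by metis
  define \<phi>0 where "\<phi>0 = Min (insert 1 (\<phi> ` arc_types))"
  have fin: "finite (insert 1 (\<phi> ` arc_types))" using finite_arc_types by simp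
  have "0 < \<phi>0" unfolding \<phi>0_def using fin \<phi>(1) by (subst Min_gr_iff) auto
  moreover have "\<phi>0 \<le> \<phi> t" if "t \<in> arc_types" for t unfolding \<phi>0_def using fin that by (intro Min_le) auto
  ultimately show thesis using that[of \<phi>0] \<phi>(2) by (meson le_less_trans)
qed

text \<open>\<open>z\<close> lies in copies of exit arcs inside every neighbourhood. Their maps
  preserve directions of lines, so each copy has a point seen from \<open>z\<close> at an angle
  above \<phi> to any given line. This excludes a tangent to every set that contains the
  piece.\<close>

lemma no_tangent_on_piece:
  assumes a: "a \<in> pieces n c" "a \<subseteq> A" and z: "z \<in> a"
  shows "\<not> has_tangent_at A z"
proof
  obtain \<phi> where \<phi>: "0 < \<phi>" "\<And>t p v. t \<in> arc_types \<Longrightarrow> p \<in> exit_arc t \<Longrightarrow> v \<noteq> 0 \<Longrightarrow>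
    \<exists>x\<in>exit_arc t. x \<noteq> p \<and> \<phi> < line_angle v (x - p)" by (rule uniform_spread) blast
  assume "has_tangent_at A z"
  then obtain v where v: "v \<noteq> 0" "\<forall>\<phi>>0. \<exists>\<epsilon>>0. \<forall>x\<in>A. x \<noteq> z \<and> dist z x < \<epsilon> \<longrightarrow> line_angle v (x - z) \<le> \<phi>"
    unfolding has_tangent_at_def by blast
  then obtain \<epsilon> where \<epsilon>: "0 < \<epsilon>" "\<And>x. x \<in> A \<Longrightarrow> x \<noteq> z \<Longrightarrow> dist z x < \<epsilon> \<Longrightarrow> line_angle v (x - z) \<le> \<phi>"
    using \<phi>(1) by blast
  obtain g \<rho> t where g: "t \<in> arc_types" "a = g ` exit_arc t" "\<bar>\<rho>\<bar> = 1 / real m ^ n" "\<And>x y. g x - g y = \<rho> *\<^sub>R (x - y)"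
    using pieces_copy[OF a(1)] by blast
  obtain p where p: "p \<in> exit_arc t" "z = g p" using z g(2) by blast
  have "(\<lambda>N. diam * (1 / real m) ^ N) \<longlonglongrightarrow> diam * 0"
    using m_ge_2 by (intro tendsto_mult tendsto_const LIMSEQ_realpow_zero) auto
  then have "\<forall>\<^sub>F N in sequentially. diam * (1 / real m) ^ N < \<epsilon>" using \<epsilon>(1) by (intro order_tendstoD) auto
  then obtain N where N: "diam * (1 / real m) ^ N < \<epsilon>" using eventually_happens'[OF sequentially_bot] by blast
  obtain u p' where u: "u \<in> words arc_parts N t" "p' \<in> exit_arc (end_type t u)" "p = word_map affine_map u p'"
    using graph_directed.word_at[OF arcs_graph_directed g(1) p(1)] by metis
  have et: "end_type t u \<in> arc_types" using graph_directed.end_type_in[OF arcs_graph_directed g(1) u(1)] .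
  obtain \<sigma> where \<sigma>: "\<bar>\<sigma>\<bar> = 1 / real m ^ N" "\<And>x y. word_map affine_map u x - word_map affine_map u y = \<sigma> *\<^sub>R (x - y)"
    using word_map_difference[OF g(1) u(1)] by blast
  obtain x where x: "x \<in> exit_arc (end_type t u)" "x \<noteq> p'" "\<phi> < line_angle v (x - p')"
    using \<phi>(2)[OF et u(2) v(1)] by blast
  define y where "y = g (word_map affine_map u x)"
  have "word_map affine_map u x \<in> exit_arc t"
    using graph_directed.words_decomp[OF arcs_graph_directed g(1), of N] u(1) x(1) by blast
  then have "y \<in> A" using a(2) g(2) by (auto simp: y_def)
  have diff: "y - z = (\<rho> * \<sigma>) *\<^sub>R (x - p')" by (simp add: y_def p(2) u(3) g(4) \<sigma>(2))
  have "0 < \<bar>\<rho>\<bar>" "0 < \<bar>\<sigma>\<bar>" unfolding g(3) \<sigma>(1) using m_ge_2 by simp_all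
  then have nz: "\<rho> * \<sigma> \<noteq> 0" by simp
  then have "y \<noteq> z" using diff x(2) by auto
  have "norm (x - p') \<le> diam"
    using dist_le_diam exit_arc_base_region x(1) u(2) by (metis dist_norm subsetD)
  have "\<bar>\<rho>\<bar> \<le> 1" unfolding g(3) using m_ge_2 by simp
  have "dist z y = \<bar>\<rho>\<bar> * (\<bar>\<sigma>\<bar> * norm (x - p'))" using diff by (simp add: dist_norm norm_minus_commute abs_mult)
  also have "\<dots> \<le> 1 * (\<bar>\<sigma>\<bar> * diam)"
    using \<open>\<bar>\<rho>\<bar> \<le> 1\<close> \<open>norm (x - p') \<le> diam\<close> by (intro mult_mono mult_left_mono) auto
  also have "\<dots> < \<epsilon>" using N unfolding \<sigma>(1) by (simp add: power_divide)
  finally have "line_angle v (y - z) \<le> \<phi>" using \<epsilon>(2) \<open>y \<in> A\<close> \<open>y \<noteq> z\<close> by blast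
  then show False using x(3) by (simp add: diff line_angle_scale[OF nz])
qed

lemma small_subarc:
  assumes xy: "x \<in> fractal S c" "y \<in> fractal S c" "x \<noteq> y" and z: "z \<in> seg c x y" and e: "0 < e"
  obtains z' where "z' \<in> seg c x y" "z' \<noteq> z" "seg c z z' \<subseteq> ball z e"
proof -
  obtain g where g: "arc g" "path_image g = seg c x y"
    using arc_segment_arc(2)[OF uniquely_arcwise_fractal xy] by (auto simp: arc_between_def)
  have "z \<in> g ` {0..1}" using z g(2) by (simp add: path_image_def)
  then obtain t where t: "t \<in> {0..1}" "z = g t" by blast
  have cont: "continuous_on {0..1} g" and inj: "inj_on g {0..1}" using g(1) by (auto simp: arc_def path_def)
  obtain d where d: "0 < d" "\<And>u. u \<in> {0..1} \<Longrightarrow> dist u t < d \<Longrightarrow> dist (g u) (g t) < e"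
    using cont[unfolded continuous_on_iff, rule_format, OF t(1) e] by blast
  \<comment> \<open>Moves from \<open>t\<close> towards the more distant end of the unit interval,
    so that \<open>u\<close> stays inside.\<close>
  define u where "u = (if t \<le> 1/2 then t + min (d/2) (1/2) else t - min (d/2) (1/2))"
  have u: "u \<in> {0..1}" "u \<noteq> t" "\<bar>u - t\<bar> < d" using t(1) d(1) by (auto simp: u_def min_def)
  let ?I = "{min t u..max t u}"
  have I: "?I \<subseteq> {0..1}" "\<And>s. s \<in> ?I \<Longrightarrow> dist s t < d" using t(1) u by (auto simp: dist_real_def)
  have pc: "path_connected (g ` ?I)"
    using continuous_on_subset[OF cont I(1)] by (intro path_connected_continuous_image convex_imp_path_connected) auto
  have sub: "g ` ?I \<subseteq> seg c x y" unfolding g(2)[symmetric] path_image_def using I(1) by (rule image_mono)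
  then have "g ` ?I \<subseteq> fractal S c" using seg_subset[OF xy(1,2)] by blast
  then have "seg c z (g u) \<subseteq> g ` ?I" using t(2) by (intro seg_least[OF pc]) auto
  moreover have "g ` ?I \<subseteq> ball z e"
  proof (rule image_subsetI)
    fix s assume "s \<in> ?I"
    then show "g s \<in> ball z e" using d(2)[of s] I t(2) by (simp only: mem_ball dist_commute) blast
  qed
  ultimately have "seg c z (g u) \<subseteq> ball z e" by blast
  moreover have "g u \<in> seg c x y" using sub by auto
  moreover have "g u \<noteq> z" using inj u(1,2) t by (auto dest: inj_onD)
  ultimately show thesis using that by blast
qed

text \<open>Near every point there is a subarc, which contains a piece, and no point of a piece has
  a tangent to the whole arc.\<close>

lemma no_tangent_dense:
  assumes xy: "x \<in> fractal S c" "y \<in> fractal S c" "x \<noteq> y"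
  shows "seg c x y \<subseteq> closure {z \<in> seg c x y. \<not> has_tangent_at (seg c x y) z}"
proof
  fix z assume z: "z \<in> seg c x y"
  show "z \<in> closure {z \<in> seg c x y. \<not> has_tangent_at (seg c x y) z}"
    unfolding closure_approachable
  proof (intro allI impI)
    fix e :: real assume e: "0 < e"
    obtain z' where z': "z' \<in> seg c x y" "z' \<noteq> z" "seg c z z' \<subseteq> ball z e" using small_subarc[OF xy z e] by blast
    have "z \<in> fractal S c" "z' \<in> fractal S c" using seg_subset[OF xy(1,2)] z z' by auto
    then obtain k a where a: "a \<in> pieces k c" "a \<subseteq> seg c z z'" using contains_piece z'(2) by metis
    have sub: "a \<subseteq> seg c x y" using a(2) seg_sub[OF xy(1,2) z z'(1)] by blast
    have "a \<noteq> {}" using pieces_copy[OF a(1)] exit_arc_nonempty by auto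
    then obtain p where p: "p \<in> a" by blast
    then have "\<not> has_tangent_at (seg c x y) p" using no_tangent_on_piece[OF a(1) sub] by blast
    then show "\<exists>p\<in>{z \<in> seg c x y. \<not> has_tangent_at (seg c x y) z}. dist p z < e"
      using p sub a(2) z'(3) by (intro bexI[of _ p]) (auto simp: dist_commute)
  qed
qed

end

end

theorem theorem9p7:
  fixes m :: nat and S :: patterns and \<theta> :: real
  assumes "labyrinth_patterns_system m S"
    and "globally_blocked m S"
    and "eigenvalue (global_path_matrix m S) \<theta>"
    and "\<And>\<mu>. eigenvalue (global_path_matrix m S) \<mu> \<Longrightarrow> \<mu> \<le> \<theta>"
  shows "\<forall>L \<in> {white_fractal S, yellow_fractal S}. \<forall>x\<in>L. \<forall>y\<in>L. x \<noteq> y \<longrightarrow>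
    (\<exists>!a. a \<subseteq> L \<and> arc_between a x y) \<and>
    (\<forall>a. a \<subseteq> L \<and> arc_between a x y \<longrightarrow>
      arc_length a = \<infinity> \<and>
      hausdorff_dim a = ereal (ln \<theta> / ln (real m)) \<and> ln \<theta> / ln (real m) > 1 \<and>
      a \<subseteq> closure {z \<in> a. \<not> has_tangent_at a z})"
proof (intro ballI impI)
  interpret labyrinth m S using assms(1) by unfold_locales
  fix L x y assume L: "L \<in> {white_fractal S, yellow_fractal S}" and xy: "x \<in> L" "y \<in> L" "x \<noteq> y"
  have "L = fractal S True \<or> L = fractal S False" using L by (simp add: fractal_def)
  then obtain c where c: "L = fractal S c" by blast
  obtain w where w: "real m + 1 \<le> \<theta>" "\<And>c k. 0 < w c k"
    "\<And>c k. (\<Sum>k'\<in>UNIV. real (count c True k k') * w c k' + real (count c False k k') * w (\<not> c) k') = \<theta> * w c k"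
    using path_weights[OF assms(2-4)] by blast
  let ?d = "ln \<theta> / ln (real m)"
  have d: "1 < ?d" using dimension_gt_1[OF w] .
  have "arc_length a = \<infinity> \<and> hausdorff_dim a = ereal ?d \<and> ?d > 1 \<and> a \<subseteq> closure {z \<in> a. \<not> has_tangent_at a z}"
    if "a \<subseteq> L" "arc_between a x y" for a
  proof -
    have a: "a = seg c x y" using arc_segment_unique[OF uniquely_arcwise_fractal] that c by blast
    have pos: "hausdorff_measure ?d a \<noteq> 0" using seg_pos[OF w] xy a c by simp
    have "arc_length a = \<infinity>" using d pos by (rule arc_length_infinite)
    moreover have "hausdorff_dim a = ereal ?d"
      using d pos seg_null[OF w] xy a c by (intro hausdorff_dim_eqI) auto
    moreover have "a \<subseteq> closure {z \<in> a. \<not> has_tangent_at a z}"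
      using no_tangent_dense[OF w] xy a c by simp
    ultimately show ?thesis using d by blast
  qed
  moreover have "\<exists>!a. a \<subseteq> L \<and> arc_between a x y"
    using uniquely_arcwise_fractal[of c] xy c by (simp add: uniquely_arcwise_def)
  ultimately show "(\<exists>!a. a \<subseteq> L \<and> arc_between a x y) \<and>
    (\<forall>a. a \<subseteq> L \<and> arc_between a x y \<longrightarrow>
      arc_length a = \<infinity> \<and> hausdorff_dim a = ereal ?d \<and> ?d > 1 \<and> a \<subseteq> closure {z \<in> a. \<not> has_tangent_at a z})"
    by blast
qed

end
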